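(* Let $H$ be a non-cosemisimple coquasi-Hopf algebra over $\Bbbk$ with the dual Chevalley property, let $\mathcal{S}=\{C_i\mid i\in I\}$ be the set of its simple subcoalgebras, and let $\mathrm{Q}(H)=(\mathcal{S},\mathcal{P})$ be its link quiver. Write $|{}^{\mathcal{C}_i}\mathcal{P}^{\mathcal{C}_j}|$ for the number of arrows from $C_j$ to $C_i$ in $\mathrm{Q}(H)$ and $|{}^{1}\mathcal{P}^{\mathcal{C}_k}|$ for the number of arrows from $C_k$ to $\Bbbk1$. Suppose ${}^1\mathcal{S}=\{C_k\mid k\in J\}$, where $J\subseteq I$. Then for any $i,j\in I$, $$|{}^{\mathcal{C}_i}\mathcal{P}^{\mathcal{C}_j}|=\sum_{k\in J}|{}^1\mathcal{P}^{\mathcal{C}_k}|\,\alpha_{ik}^j=\sum_{k\in J}|{}^1\mathcal{P}^{\mathcal{C}_k}|\,\alpha_{ki}^j.$$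
   Context: $\Bbbk$ is an algebraically closed field; all spaces are over $\Bbbk$; Sweedler notation $\Delta(a)=a_1\otimes a_2$. A coquasi-bialgebra is a coalgebra $(H,\Delta,\varepsilon)$ with coalgebra maps $H\otimes H\to H$, $a\otimes b\mapsto ab$, and $\Bbbk\to H$, $\lambda\mapsto\lambda 1_H$, and a convolution-invertible linear map $\Phi:H^{\otimes 3}\to\Bbbk$ such that for all $a,b,c,d\in H$: $a_1(b_1c_1)\Phi(a_2,b_2,c_2)=\Phi(a_1,b_1,c_1)(a_2b_2)c_2$; $1_Ha=a=a1_H$; $\Phi(a_1,b_1,c_1d_1)\Phi(a_2b_2,c_2,d_2)=\Phi(b_1,c_1,d_1)\Phi(a_1,b_2c_2,d_2)\Phi(a_2,b_3,c_3)$; $\Phi(a,1_H,b)=\varepsilon(a)\varepsilon(b)$. It is a coquasi-Hopf algebra if there are a coalgebra antimorphism $S:H\to H$ and linear maps $\alpha,\beta:H\to\Bbbk$ with $S(a_1)\alpha(a_2)a_3=\alpha(a)1_H$, $a_1\beta(a_2)S(a_3)=\beta(a)1_H$, $\Phi(a_1,S(a_3),a_5)\beta(a_2)\alpha(a_4)=\Phi^{-1}(S(a_1),a_3,S(a_5))\alpha(a_2)\beta(a_4)=\varepsilon(a)$. $H$ has the dual Chevalley property if its coradical $H_0$ is a coquasi-Hopf subalgebra. Link quiver: its vertex set is $\mathcal{S}$, and for $C,D\in\mathcal{S}$ with $\dim C=r^2$, $\dim D=s^2$ there are exactly $\frac1{rs}\dim((C\wedge D)/(C+D))$ arrows from $D$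 to $C$, where $C\wedge D=\Delta^{-1}(C\otimes H+H\otimes D)$. ${}^1\mathcal{S}:=\{C\in\mathcal{S}\mid\Bbbk1+C\ne\Bbbk1\wedge C\}$. The coefficients $\alpha_{ij}^t\in\mathbb{Z}_+$: if $V_i$ is the simple right $H$-comodule with coefficient coalgebra $C_i$, then $V_i\otimes V_j\cong\bigoplus_{t\in I}V_t^{\oplus\alpha_{ij}^t}$; equivalently $C_i\cdot C_j=\sum_t\alpha_{ij}^tC_t$ in the ring $\mathbb{Z}\mathcal{S}\cong\operatorname{Gr}(\mathscr{M}^{H_0})$. *)

theory Defs
  imports
    "HOL-Computational_Algebra.Polynomial"
    "HOL-Library.Function_Algebras"
    "HOL-Library.Set_Algebras"
    "HOL-Library.Equipollence"
    "Graph_Theory.Digraph"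
begin

section \<open>Linear algebra\<close>

definition pointwise_scale :: "('k \<Rightarrow> 'u \<Rightarrow> 'u) \<Rightarrow> 'k \<Rightarrow> ('x \<Rightarrow> 'u) \<Rightarrow> 'x \<Rightarrow> 'u" where
  "pointwise_scale s c f = (\<lambda>x. s c (f x))"

definition linear_on ::
  "('k \<Rightarrow> 'v::ab_group_add \<Rightarrow> 'v) \<Rightarrow> ('k \<Rightarrow> 'w::ab_group_add \<Rightarrow> 'w) \<Rightarrow> 'v set \<Rightarrow> ('v \<Rightarrow> 'w) \<Rightarrow> bool" where
  "linear_on sV sW V f \<longleftrightarrow>
     (\<forall>x\<in>V. \<forall>y\<in>V. f (x + y) = f x + f y) \<and> (\<forall>c. \<forall>x\<in>V. f (sV c x) = sW c (f x))"

definition bilinear_map ::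
  "('k::field \<Rightarrow> 'v::ab_group_add \<Rightarrow> 'v) \<Rightarrow> ('k \<Rightarrow> 'w::ab_group_add \<Rightarrow> 'w) \<Rightarrow>
   ('k \<Rightarrow> 'u::ab_group_add \<Rightarrow> 'u) \<Rightarrow> ('v \<Rightarrow> 'w \<Rightarrow> 'u) \<Rightarrow> bool" where
  "bilinear_map sV sW sU f \<longleftrightarrow>
     (\<forall>v. Vector_Spaces.linear sW sU (f v)) \<and> (\<forall>w. Vector_Spaces.linear sV sU (\<lambda>v. f v w))"

definition trilinear_form ::
  "('k::field \<Rightarrow> 'v::ab_group_add \<Rightarrow> 'v) \<Rightarrow> ('v \<Rightarrow> 'v \<Rightarrow> 'v \<Rightarrow> 'k) \<Rightarrow> bool" where
  "trilinear_form s f \<longleftrightarrow>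
     (\<forall>x y. Vector_Spaces.linear s (*) (\<lambda>z. f x y z)) \<and>
     (\<forall>x z. Vector_Spaces.linear s (*) (\<lambda>y. f x y z)) \<and>
     (\<forall>y z. Vector_Spaces.linear s (*) (\<lambda>x. f x y z))"

text \<open>
  For a subspace \<open>W\<close> of \<open>U\<close>, the residue classes of the elements of \<open>B\<close> are pairwise distinct and
  form a basis of \<open>U/W\<close>, so that \<open>dim (U/W)\<close> is the cardinality of \<open>B\<close>.
\<close>
definition (in vector_space) basis_mod :: "'b set \<Rightarrow> 'b set \<Rightarrow> 'b set \<Rightarrow> bool" where
  "basis_mod U W B \<longleftrightarrow> B \<subseteq> U \<and> span (W \<union> B) = U \<and> (\<forall>b\<in>B. b \<notin> span (W \<union> (B - {b})))"


section \<open>Tensor products\<close>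

text \<open>
  Over a field, \<open>V \<otimes> W\<close> embeds into the dual of the space of bilinear forms on \<open>V \<times> W\<close> by letting
  \<open>v \<otimes> w\<close> act as evaluation at \<open>(v, w)\<close>. The tensor product is taken to be the image of this
  embedding. Functionals are set to \<open>0\<close> off the bilinear forms to make them unique.
  Since bilinear forms on subspaces extend, for subspaces \<open>V\<close>, \<open>W\<close> of the ambient
  spaces the set \<open>tensor_space sV sW V W\<close> is \<open>V \<otimes> W\<close>.
\<close>
type_synonym ('v, 'w, 'k) tensor = "('v \<Rightarrow> 'w \<Rightarrow> 'k) \<Rightarrow> 'k"

abbreviation tscale :: "'k::field \<Rightarrow> ('v, 'w, 'k) tensor \<Rightarrow> ('v, 'w, 'k) tensor" where
  "tscale \<equiv> pointwise_scale (*)"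

definition tensor ::
  "('k::field \<Rightarrow> 'v::ab_group_add \<Rightarrow> 'v) \<Rightarrow> ('k \<Rightarrow> 'w::ab_group_add \<Rightarrow> 'w) \<Rightarrow>
   'v \<Rightarrow> 'w \<Rightarrow> ('v, 'w, 'k) tensor" where
  "tensor sV sW v w = (\<lambda>b. if bilinear_map sV sW (*) b then b v w else 0)"

definition tensor_space ::
  "('k::field \<Rightarrow> 'v::ab_group_add \<Rightarrow> 'v) \<Rightarrow> ('k \<Rightarrow> 'w::ab_group_add \<Rightarrow> 'w) \<Rightarrow>
   'v set \<Rightarrow> 'w set \<Rightarrow> ('v, 'w, 'k) tensor set" where
  "tensor_space sV sW V W = module.span tscale {tensor sV sW v w | v w. v \<in> V \<and> w \<in> W}"

text \<open>
  A list of pairs \<open>(v\<^sub>n, w\<^sub>n)\<close> in \<open>V \<times> W\<close> with \<open>t = \<Sum>\<^sub>n v\<^sub>n \<otimes> w\<^sub>n\<close>, for \<open>t\<close> in \<open>V \<otimes> W\<close>. It is only used in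
  sums \<open>\<Sum>(v, w)\<leftarrow>tensor_rep sV sW V W t. f v w\<close> with \<open>f\<close> bilinear on \<open>V \<times> W\<close>, whose value is that of the
  linear map induced by \<open>f\<close> at \<open>t\<close> and does not depend on the choice.
\<close>
definition tensor_rep ::
  "('k::field \<Rightarrow> 'v::ab_group_add \<Rightarrow> 'v) \<Rightarrow> ('k \<Rightarrow> 'w::ab_group_add \<Rightarrow> 'w) \<Rightarrow>
   'v set \<Rightarrow> 'w set \<Rightarrow> ('v, 'w, 'k) tensor \<Rightarrow> ('v \<times> 'w) list" where
  "tensor_rep sV sW V W t =
     (SOME xs. set xs \<subseteq> V \<times> W \<and> t = (\<Sum>(v, w)\<leftarrow>xs. tensor sV sW v w))"


section \<open>Coalgebras\<close>

text \<open>
  Sweedler notation: \<open>\<Sum>(a1, a2)\<leftarrow>sweedler a. f a1 a2\<close> is \<open>f(a\<^sub>1, a\<^sub>2)\<close>.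
\<close>
locale precoalgebra = vector_space scale
  for scale :: "'k::field \<Rightarrow> 'h::ab_group_add \<Rightarrow> 'h" (infixr \<open>*s\<close> 75) +
  fixes \<Delta> :: "'h \<Rightarrow> ('h, 'h, 'k) tensor"
    and \<epsilon> :: "'h \<Rightarrow> 'k"
begin

abbreviation pure_tensor (infixr \<open>\<otimes>\<close> 70) where
  "a \<otimes> b \<equiv> tensor scale scale a b"

definition sweedler :: "'h \<Rightarrow> ('h \<times> 'h) list" where
  "sweedler a = tensor_rep scale scale UNIV UNIV (\<Delta> a)"

definition sweedler3 :: "'h \<Rightarrow> ('h \<times> 'h \<times> 'h) list" where
  "sweedler3 a = [(a1, a2, a3). (a1, x) \<leftarrow> sweedler a, (a2, a3) \<leftarrow> sweedler x]"

definition sweedler5 :: "'h \<Rightarrow> ('h \<times> 'h \<times> 'h \<times> 'h \<times> 'h) list" where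
  "sweedler5 a = [(a1, a2, a3, a4, a5). (a1, a2, x) \<leftarrow> sweedler3 a, (a3, a4, a5) \<leftarrow> sweedler3 x]"

end

text \<open>
  Both sides of \<open>coassoc\<close> live in \<open>H \<otimes> (H \<otimes> H)\<close>, the left one being the image of \<open>(\<Delta> \<otimes> id) (\<Delta> a)\<close>
  under the associativity isomorphism.
\<close>
locale coalgebra = precoalgebra +
  assumes \<Delta>_linear: "Vector_Spaces.linear scale tscale \<Delta>"
    and \<Delta>_tensor: "\<Delta> a \<in> tensor_space scale scale UNIV UNIV"
    and \<epsilon>_linear: "Vector_Spaces.linear scale (*) \<epsilon>"
    and coassoc:
      "(\<Sum>(x, a3)\<leftarrow>sweedler a. \<Sum>(a1, a2)\<leftarrow>sweedler x. tensor scale tscale a1 (a2 \<otimes> a3)) =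
       (\<Sum>(a1, x)\<leftarrow>sweedler a. tensor scale tscale a1 (\<Delta> x))"
    and counit_left: "(\<Sum>(a1, a2)\<leftarrow>sweedler a. \<epsilon> a1 *s a2) = a"
    and counit_right: "(\<Sum>(a1, a2)\<leftarrow>sweedler a. \<epsilon> a2 *s a1) = a"

context precoalgebra
begin

definition subcoalgebra :: "'h set \<Rightarrow> bool" where
  "subcoalgebra C \<longleftrightarrow> subspace C \<and> (\<forall>c\<in>C. \<Delta> c \<in> tensor_space scale scale C C)"

definition simple_subcoalgebra :: "'h set \<Rightarrow> bool" where
  "simple_subcoalgebra C \<longleftrightarrow>
     subcoalgebra C \<and> C \<noteq> {0} \<and> (\<forall>D. subcoalgebra D \<and> D \<subseteq> C \<longrightarrow> D = {0} \<or> D = C)"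

definition simple_subcoalgebras :: "'h set set" where
  "simple_subcoalgebras = {C. simple_subcoalgebra C}"

definition coradical :: "'h set" where
  "coradical = span (\<Union>simple_subcoalgebras)"

definition cosemisimple :: bool where
  "cosemisimple \<longleftrightarrow> coradical = UNIV"

definition wedge :: "'h set \<Rightarrow> 'h set \<Rightarrow> 'h set" (infixr \<open>\<and>\<^sub>c\<close> 70) where
  "C \<and>\<^sub>c D = {x. \<Delta> x \<in> tensor_space scale scale C UNIV + tensor_space scale scale UNIV D}"

text \<open>The convolution inverse of a trilinear form, that is, of a linear form on \<open>H \<otimes> H \<otimes> H\<close>.\<close>
definition is_convolution_inverse3 ::
  "('h \<Rightarrow> 'h \<Rightarrow> 'h \<Rightarrow> 'k) \<Rightarrow> ('h \<Rightarrow> 'h \<Rightarrow> 'h \<Rightarrow> 'k) \<Rightarrow> bool" where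
  "is_convolution_inverse3 \<phi> \<psi> \<longleftrightarrow> trilinear_form scale \<psi> \<and>
     (\<forall>a b c.
       (\<Sum>(a1, a2)\<leftarrow>sweedler a. \<Sum>(b1, b2)\<leftarrow>sweedler b. \<Sum>(c1, c2)\<leftarrow>sweedler c.
          \<phi> a1 b1 c1 * \<psi> a2 b2 c2) = \<epsilon> a * \<epsilon> b * \<epsilon> c \<and>
       (\<Sum>(a1, a2)\<leftarrow>sweedler a. \<Sum>(b1, b2)\<leftarrow>sweedler b. \<Sum>(c1, c2)\<leftarrow>sweedler c.
          \<psi> a1 b1 c1 * \<phi> a2 b2 c2) = \<epsilon> a * \<epsilon> b * \<epsilon> c)"

definition convolution_inverse3 :: "('h \<Rightarrow> 'h \<Rightarrow> 'h \<Rightarrow> 'k) \<Rightarrow> 'h \<Rightarrow> 'h \<Rightarrow> 'h \<Rightarrow> 'k" where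
  "convolution_inverse3 \<phi> = (THE \<psi>. is_convolution_inverse3 \<phi> \<psi>)"

end


section \<open>Coquasi-Hopf algebras\<close>

locale coquasi_bialgebra = coalgebra scale \<Delta> \<epsilon>
  for scale :: "'k::field \<Rightarrow> 'h::ab_group_add \<Rightarrow> 'h" (infixr \<open>*s\<close> 75) and \<Delta> \<epsilon> +
  fixes mult :: "'h \<Rightarrow> 'h \<Rightarrow> 'h" (infixl \<open>\<cdot>\<close> 72)
    and one :: 'h (\<open>\<one>\<close>)
    and \<Phi> :: "'h \<Rightarrow> 'h \<Rightarrow> 'h \<Rightarrow> 'k"
  assumes mult_bilinear: "bilinear_map scale scale scale (\<cdot>)"
    and \<Delta>_mult: "\<Delta> (a \<cdot> b) = (\<Sum>(a1, a2)\<leftarrow>sweedler a. \<Sum>(b1, b2)\<leftarrow>sweedler b. (a1 \<cdot> b1) \<otimes> (a2 \<cdot> b2))"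
    and \<epsilon>_mult: "\<epsilon> (a \<cdot> b) = \<epsilon> a * \<epsilon> b"
    and \<Delta>_one: "\<Delta> \<one> = \<one> \<otimes> \<one>"
    and \<epsilon>_one: "\<epsilon> \<one> = 1"
    and \<Phi>_trilinear: "trilinear_form scale \<Phi>"
    and \<Phi>_invertible: "\<exists>\<Psi>. is_convolution_inverse3 \<Phi> \<Psi>"
    and quasi_assoc:
      "(\<Sum>(a1, a2)\<leftarrow>sweedler a. \<Sum>(b1, b2)\<leftarrow>sweedler b. \<Sum>(c1, c2)\<leftarrow>sweedler c.
          \<Phi> a2 b2 c2 *s (a1 \<cdot> (b1 \<cdot> c1))) =
       (\<Sum>(a1, a2)\<leftarrow>sweedler a. \<Sum>(b1, b2)\<leftarrow>sweedler b. \<Sum>(c1, c2)\<leftarrow>sweedler c.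
          \<Phi> a1 b1 c1 *s ((a2 \<cdot> b2) \<cdot> c2))"
    and mult_one_left: "\<one> \<cdot> a = a"
    and mult_one_right: "a \<cdot> \<one> = a"
    and \<Phi>_cocycle:
      "(\<Sum>(a1, a2)\<leftarrow>sweedler a. \<Sum>(b1, b2)\<leftarrow>sweedler b.
        \<Sum>(c1, c2)\<leftarrow>sweedler c. \<Sum>(d1, d2)\<leftarrow>sweedler d.
          \<Phi> a1 b1 (c1 \<cdot> d1) * \<Phi> (a2 \<cdot> b2) c2 d2) =
       (\<Sum>(a1, a2)\<leftarrow>sweedler a. \<Sum>(b1, b2, b3)\<leftarrow>sweedler3 b.
        \<Sum>(c1, c2, c3)\<leftarrow>sweedler3 c. \<Sum>(d1, d2)\<leftarrow>sweedler d.
          \<Phi> b1 c1 d1 * \<Phi> a1 (b2 \<cdot> c2) d2 * \<Phi> a2 b3 c3)"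
    and \<Phi>_one: "\<Phi> a \<one> b = \<epsilon> a * \<epsilon> b"

locale coquasi_hopf_algebra = coquasi_bialgebra scale \<Delta> \<epsilon> mult one \<Phi>
  for scale :: "'k::field \<Rightarrow> 'h::ab_group_add \<Rightarrow> 'h" (infixr \<open>*s\<close> 75) and \<Delta> \<epsilon>
    and mult (infixl \<open>\<cdot>\<close> 72) and one (\<open>\<one>\<close>) and \<Phi> +
  fixes S :: "'h \<Rightarrow> 'h"
    and \<alpha> :: "'h \<Rightarrow> 'k"
    and \<beta> :: "'h \<Rightarrow> 'k"
  assumes S_linear: "Vector_Spaces.linear scale scale S"
    and \<Delta>_S: "\<Delta> (S a) = (\<Sum>(a1, a2)\<leftarrow>sweedler a. S a2 \<otimes> S a1)"
    and \<epsilon>_S: "\<epsilon> (S a) = \<epsilon> a"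
    and \<alpha>_linear: "Vector_Spaces.linear scale (*) \<alpha>"
    and \<beta>_linear: "Vector_Spaces.linear scale (*) \<beta>"
    and S_\<alpha>: "(\<Sum>(a1, a2, a3)\<leftarrow>sweedler3 a. \<alpha> a2 *s (S a1 \<cdot> a3)) = \<alpha> a *s \<one>"
    and S_\<beta>: "(\<Sum>(a1, a2, a3)\<leftarrow>sweedler3 a. \<beta> a2 *s (a1 \<cdot> S a3)) = \<beta> a *s \<one>"
    and \<Phi>_S: "(\<Sum>(a1, a2, a3, a4, a5)\<leftarrow>sweedler5 a. \<Phi> a1 (S a3) a5 * \<beta> a2 * \<alpha> a4) = \<epsilon> a"
    and \<Phi>_inverse_S:
      "(\<Sum>(a1, a2, a3, a4, a5)\<leftarrow>sweedler5 a.
          convolution_inverse3 \<Phi> (S a1) a3 (S a5) * \<alpha> a2 * \<beta> a4) = \<epsilon> a"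
begin

text \<open>
  The identities in the definition of a coquasi-Hopf algebra hold for the restrictions of
  \<open>\<Phi>\<close>, \<open>S\<close>, \<open>\<alpha>\<close>, \<open>\<beta>\<close> to any subcoalgebra closed under the operations, so closure is all that is required.
\<close>
definition coquasi_hopf_subalgebra :: "'h set \<Rightarrow> bool" where
  "coquasi_hopf_subalgebra A \<longleftrightarrow>
     subcoalgebra A \<and> \<one> \<in> A \<and> (\<forall>a\<in>A. \<forall>b\<in>A. a \<cdot> b \<in> A) \<and> (\<forall>a\<in>A. S a \<in> A)"

definition dual_Chevalley :: bool where
  "dual_Chevalley \<longleftrightarrow> coquasi_hopf_subalgebra coradical"

end


section \<open>Right comodules\<close>

text \<open>
  A right comodule is a subspace \<open>V\<close> of an ambient vector space (with scalar multiplication \<open>sV\<close>) together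
  with a coaction \<open>\<rho>\<close>, of which only the values on \<open>V\<close> matter.
\<close>
context precoalgebra
begin

text \<open>\<open>\<Sum>(v0, h)\<leftarrow>coact sV V \<rho> v. f v0 h\<close> is \<open>f(v\<^sub>0, v\<^sub>1)\<close> for \<open>\<rho>(v) = v\<^sub>0 \<otimes> v\<^sub>1\<close>.\<close>
definition coact ::
  "('k \<Rightarrow> 'v::ab_group_add \<Rightarrow> 'v) \<Rightarrow> 'v set \<Rightarrow> ('v \<Rightarrow> ('v, 'h, 'k) tensor) \<Rightarrow> 'v \<Rightarrow> ('v \<times> 'h) list" where
  "coact sV V \<rho> v = tensor_rep sV scale V UNIV (\<rho> v)"

definition right_comodule ::
  "('k \<Rightarrow> 'v::ab_group_add \<Rightarrow> 'v) \<Rightarrow> 'v set \<Rightarrow> ('v \<Rightarrow> ('v, 'h, 'k) tensor) \<Rightarrow> bool" where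
  "right_comodule sV V \<rho> \<longleftrightarrow>
     vector_space sV \<and> module.subspace sV V \<and> linear_on sV tscale V \<rho> \<and>
     (\<forall>v\<in>V. \<rho> v \<in> tensor_space sV scale V UNIV \<and>
        (\<Sum>(x, h2)\<leftarrow>coact sV V \<rho> v. \<Sum>(v0, h1)\<leftarrow>coact sV V \<rho> x. tensor sV tscale v0 (h1 \<otimes> h2)) =
          (\<Sum>(v0, h)\<leftarrow>coact sV V \<rho> v. tensor sV tscale v0 (\<Delta> h)) \<and>
        (\<Sum>(v0, h)\<leftarrow>coact sV V \<rho> v. sV (\<epsilon> h) v0) = v)"

definition simple_right_comodule ::
  "('k \<Rightarrow> 'v::ab_group_add \<Rightarrow> 'v) \<Rightarrow> 'v set \<Rightarrow> ('v \<Rightarrow> ('v, 'h, 'k) tensor) \<Rightarrow> bool" where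
  "simple_right_comodule sV V \<rho> \<longleftrightarrow>
     right_comodule sV V \<rho> \<and> V \<noteq> {0} \<and>
     (\<forall>W. W \<subseteq> V \<and> right_comodule sV W \<rho> \<longrightarrow> W = {0} \<or> W = V)"

text \<open>
  The span of the matrix coefficients \<open>f(v\<^sub>0) v\<^sub>1\<close>, with \<open>f\<close> a linear form. Linear forms on \<open>V\<close> are the
  restrictions of linear forms on the ambient space.
\<close>
definition coefficient_coalgebra ::
  "('k \<Rightarrow> 'v::ab_group_add \<Rightarrow> 'v) \<Rightarrow> 'v set \<Rightarrow> ('v \<Rightarrow> ('v, 'h, 'k) tensor) \<Rightarrow> 'h set" where
  "coefficient_coalgebra sV V \<rho> =
     span {\<Sum>(v0, h)\<leftarrow>coact sV V \<rho> v. f v0 *s h | f v. Vector_Spaces.linear sV (*) f \<and> v \<in> V}"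

definition comodule_isomorphic ::
  "('k \<Rightarrow> 'v::ab_group_add \<Rightarrow> 'v) \<Rightarrow> 'v set \<Rightarrow> ('v \<Rightarrow> ('v, 'h, 'k) tensor) \<Rightarrow>
   ('k \<Rightarrow> 'w::ab_group_add \<Rightarrow> 'w) \<Rightarrow> 'w set \<Rightarrow> ('w \<Rightarrow> ('w, 'h, 'k) tensor) \<Rightarrow> bool" where
  "comodule_isomorphic sV V \<rho> sW W \<sigma> \<longleftrightarrow>
     (\<exists>f. linear_on sV sW V f \<and> bij_betw f V W \<and>
        (\<forall>v\<in>V. \<sigma> (f v) = (\<Sum>(v0, h)\<leftarrow>coact sV V \<rho> v. tensor sW scale (f v0) h)))"

text \<open>
  The direct sum of the comodules \<open>(V p, \<rho> p)\<close> for \<open>p \<in> P\<close>, as finitely supported families; its scalar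
  multiplication is \<open>pointwise_scale sV\<close>.
\<close>
definition direct_sum :: "'p set \<Rightarrow> ('p \<Rightarrow> 'v::ab_group_add set) \<Rightarrow> ('p \<Rightarrow> 'v) set" where
  "direct_sum P V = {x. finite {p. x p \<noteq> 0} \<and> (\<forall>p\<in>P. x p \<in> V p) \<and> (\<forall>p. p \<notin> P \<longrightarrow> x p = 0)}"

definition direct_sum_coaction ::
  "('k \<Rightarrow> 'v::ab_group_add \<Rightarrow> 'v) \<Rightarrow> ('p \<Rightarrow> 'v set) \<Rightarrow> ('p \<Rightarrow> 'v \<Rightarrow> ('v, 'h, 'k) tensor) \<Rightarrow>
   ('p \<Rightarrow> 'v) \<Rightarrow> ('p \<Rightarrow> 'v, 'h, 'k) tensor" where
  "direct_sum_coaction sV V \<rho> x =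
     (\<Sum>p | x p \<noteq> 0. \<Sum>(v0, h)\<leftarrow>coact sV (V p) (\<rho> p) (x p).
        tensor (pointwise_scale sV) scale (0(p := v0)) h)"

end

text \<open>The coaction \<open>v \<otimes> w \<mapsto> (v\<^sub>0 \<otimes> w\<^sub>0) \<otimes> v\<^sub>1w\<^sub>1\<close> on \<open>V \<otimes> W\<close>.\<close>
definition (in coquasi_bialgebra) tensor_coaction ::
  "('k \<Rightarrow> 'v::ab_group_add \<Rightarrow> 'v) \<Rightarrow> 'v set \<Rightarrow> ('v \<Rightarrow> ('v, 'h, 'k) tensor) \<Rightarrow>
   ('k \<Rightarrow> 'w::ab_group_add \<Rightarrow> 'w) \<Rightarrow> 'w set \<Rightarrow> ('w \<Rightarrow> ('w, 'h, 'k) tensor) \<Rightarrow>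
   ('v, 'w, 'k) tensor \<Rightarrow> (('v, 'w, 'k) tensor, 'h, 'k) tensor" where
  "tensor_coaction sV V \<rho> sW W \<sigma> t =
     (\<Sum>(v, w)\<leftarrow>tensor_rep sV sW V W t. \<Sum>(v0, g)\<leftarrow>coact sV V \<rho> v. \<Sum>(w0, h)\<leftarrow>coact sW W \<sigma> w.
        tensor tscale scale (tensor sV sW v0 w0) (g \<cdot> h))"

text \<open>
  For simple comodules \<open>(V i, \<rho> i)\<close>, \<open>i \<in> I\<close>: \<open>V i \<otimes> V j\<close> is isomorphic to the direct sum over \<open>t \<in> I\<close> of
  \<open>N i j t\<close> copies of \<open>V t\<close>.
\<close>
definition (in coquasi_bialgebra) fusion_coefficients ::
  "('k \<Rightarrow> 'v::ab_group_add \<Rightarrow> 'v) \<Rightarrow> 'i set \<Rightarrow> ('i \<Rightarrow> 'v set) \<Rightarrow>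
   ('i \<Rightarrow> 'v \<Rightarrow> ('v, 'h, 'k) tensor) \<Rightarrow> ('i \<Rightarrow> 'i \<Rightarrow> 'i \<Rightarrow> nat) \<Rightarrow> bool" where
  "fusion_coefficients sV I V \<rho> N \<longleftrightarrow>
     (\<forall>i\<in>I. \<forall>j\<in>I. comodule_isomorphic
        tscale (tensor_space sV sV (V i) (V j)) (tensor_coaction sV (V i) (\<rho> i) sV (V j) (\<rho> j))
        (pointwise_scale sV) (direct_sum (SIGMA t:I. {..<N i j t}) (V \<circ> fst))
        (direct_sum_coaction sV (V \<circ> fst) (\<rho> \<circ> fst)))"


section \<open>Link quivers\<close>

definition arrows :: "('a, 'e) pre_digraph \<Rightarrow> 'a \<Rightarrow> 'a \<Rightarrow> 'e set" where
  "arrows Q x y = {e \<in> arcs Q. tail Q e = x \<and> head Q e = y}"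

text \<open>
  The dimension of \<open>(C \<and> D)/(C + D)\<close> may be infinite, so the number of arrows from \<open>D\<close> to \<open>C\<close> is a cardinal
  \<open>n\<close>. That it equals \<open>dim ((C \<and> D)/(C + D)) / (r s)\<close> is expressed as \<open>n \<cdot> (r s) = dim ((C \<and> D)/(C + D))\<close>.
\<close>
definition (in precoalgebra) link_quiver :: "('h set, 'e) pre_digraph \<Rightarrow> bool" where
  "link_quiver Q \<longleftrightarrow>
     wf_digraph Q \<and> verts Q = simple_subcoalgebras \<and>
     (\<forall>C\<in>verts Q. \<forall>D\<in>verts Q. \<forall>r s. dim C = r\<^sup>2 \<longrightarrow> dim D = s\<^sup>2 \<longrightarrow>
        (\<exists>B. basis_mod (C \<and>\<^sub>c D) (C + D) B \<and> arrows Q D C \<times> {..<r * s} \<approx> B))"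

text \<open>The set of simple subcoalgebras written \<open>\<^sup>1\<S>\<close>.\<close>
definition (in coquasi_bialgebra) linked_to_one :: "'h set set" where
  "linked_to_one = {C \<in> simple_subcoalgebras. span {\<one>} + C \<noteq> span {\<one>} \<and>\<^sub>c C}"

end

theory Submission
 imports Defs "Jordan_Normal_Form.Char_Poly"
begin

text \<open>
 Extensions of simple comodules are counted in coordinates. A basis of a simple comodule turns its
 coaction into a square matrix \<open>A\<close> over \<open>H\<close> with \<open>\<Delta>(A\<^sub>i\<^sub>j) = \<Sum>\<^sub>k A\<^sub>i\<^sub>k \<otimes> A\<^sub>k\<^sub>j\<close>, a comatrix, whose entries are a
 basis of its coefficient coalgebra (\<open>irreducible_entries_independent\<close>; this uses Schur's lemma over an
 algebraically closed field). For two simple comodules with comatrices \<open>C\<close>, \<open>D\<close> of sizes \<open>r\<close>, \<open>s\<close>, an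
 extension is a matrix \<open>X\<close> over \<open>H\<close> for which the block matrix with diagonal \<open>C\<close>, \<open>D\<close> and corner \<open>X\<close> is a
 comatrix, and it splits iff \<open>X = CM - MD\<close> with a scalar matrix \<open>M\<close>. Together with the two simple
 subcoalgebras the entries of such matrices \<open>X\<close> span their wedge, and \<open>wedge_basis\<close> shows that the dimension of the
 wedge modulo the sum is \<open>rs\<close> times \<open>dim Ext(D, C)\<close>. Hence the number of arrows from \<open>D\<close> to \<open>C\<close> is
 \<open>dim Ext(D, C)\<close>, a possibly infinite cardinal.

 The theorem is then a statement about the tensor category of comodules. If \<open>U\<close> is a left dual of \<open>V\<close>, then
 tensoring with \<open>U\<close> is left adjoint to tensoring with \<open>V\<close>; both functors are exact, so that
 \<open>Ext(X, V) = Ext(U \<otimes> X, 1)\<close> (\<open>ext_dual\<close>, by the mutually inverse maps \<open>push\<close> and \<open>pull\<close>) and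
 \<open>Hom(U \<otimes> X, Y) = Hom(X, V \<otimes> Y)\<close> (\<open>hom_adjunction\<close> is one embedding; since \<open>V\<close> is also a left dual of
 \<open>U\<close> for simple \<open>V\<close>, comparing dimensions both ways gives equality). For \<open>V = V\<^sub>i\<close>, \<open>X = V\<^sub>j\<close> the product \<open>U \<otimes> X\<close> is
 semisimple and contains \<open>V\<^sub>k\<close> with multiplicity \<open>dim Hom(U \<otimes> V\<^sub>j, V\<^sub>k) = dim Hom(V\<^sub>j, V\<^sub>i \<otimes> V\<^sub>k)\<close>, which is
 the fusion coefficient of \<open>V\<^sub>j\<close> in \<open>V\<^sub>i \<otimes> V\<^sub>k\<close>. So \<open>dim Ext(V\<^sub>j, V\<^sub>i)\<close> is the sum over \<open>k\<close> of
 \<open>dim Ext(V\<^sub>k, 1)\<close> times this coefficient (\<open>ext_count\<close>), and only the \<open>k\<close> in \<open>J\<close> contribute.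

 The antipode provides a left dual of \<open>V\<^sub>i\<close>. That it is isomorphic to one of the \<open>V\<^sub>t\<close>, and that \<open>V\<^sub>i\<close> is in
 turn a left dual of \<open>V\<^sub>t\<close>, is \<open>simple_duals\<close>; here the dual Chevalley property is used, since it puts the
 coefficients of the dual into the coradical. As all associators of the category are scalar
 matrices obtained by evaluating \<open>\<Phi>\<close> at entries of comatrices, the pentagon and triangle identities
 become matrix identities. The second formula is the first one for the opposite multiplication, which is again
 quasi-associative, with associator \<open>\<Phi>\<^sup>-\<^sup>1(c, b, a)\<close> (\<open>opposite\<close>).
\<close>

section \<open>Linear maps\<close>

abbreviation lin where "lin \<equiv> Vector_Spaces.linear"

lemma vector_space_mult: "vector_space ((*) :: 'k::field \<Rightarrow> 'k \<Rightarrow> 'k)"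
 by standard (auto simp: algebra_simps)

lemma vector_space_pointwise:
 assumes "vector_space s" shows "vector_space (pointwise_scale s)"
proof -
 interpret vector_space s by fact
 show ?thesis
  by standard (auto simp: pointwise_scale_def fun_eq_iff scale_right_distrib scale_left_distrib)
qed

lemma lin_vs: "lin s s' f \<Longrightarrow> vector_space s" "lin s s' f \<Longrightarrow> vector_space s'"
 by (auto simp: Vector_Spaces.linear_iff)

lemma lin_add: "lin s s' f \<Longrightarrow> f (x + y) = f x + f y"
 and lin_scale: "lin s s' f \<Longrightarrow> f (s c x) = s' c (f x)"
 by (auto simp: Vector_Spaces.linear_iff)

lemma lin_module_hom: "lin s s' f \<Longrightarrow> module_hom s s' f"
 by (simp add: module_hom_eq_linear)

lemma lin_zero: "lin s s' f \<Longrightarrow> f 0 = 0"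
 and lin_diff: "lin s s' f \<Longrightarrow> f (x - y) = f x - f y"
 by (auto dest!: lin_module_hom simp: module_hom.zero module_hom.diff)

lemma lin_sum: "lin s s' f \<Longrightarrow> f (SUM x:A. g x) = (SUM x:A. f (g x))"
 by (auto dest!: lin_module_hom simp: module_hom.sum)

lemma lin_sum_list: "lin s s' f \<Longrightarrow> f (SUM x<-xs. g x) = (SUM x<-xs. f (g x))"
 by (induction xs) (auto simp: lin_zero lin_add)

lemma linI:
 assumes "vector_space s" "vector_space s'"
  and "\<And>x y. f (x + y) = f x + f y" and "\<And>c x. f (s c x) = s' c (f x)"
 shows "lin s s' f"
 using assms by (auto simp: Vector_Spaces.linear_iff)

lemma vs_simps:
 assumes "vector_space s"
 shows "s c (x + y) = s c x + s c y" "s (a + b) x = s a x + s b x" "s a (s b x) = s (a * b) x"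
  "s 1 x = x" "s 0 x = 0" "s c 0 = 0" "s c (x - y) = s c x - s c y" "s (a - b) x = s a x - s b x"
  "s (- a) x = - s a x"
proof -
 interpret vector_space s by fact
 show "s c (x + y) = s c x + s c y" "s (a + b) x = s a x + s b x" "s a (s b x) = s (a * b) x"
  "s 1 x = x" "s 0 x = 0" "s c 0 = 0" "s c (x - y) = s c x - s c y" "s (a - b) x = s a x - s b x"
  "s (- a) x = - s a x"
  by (simp_all add: scale_right_distrib scale_left_distrib scale_right_diff_distrib scale_left_diff_distrib)
qed

lemma scale_sum: "vector_space s \<Longrightarrow> s c (SUM x:A. g x) = (SUM x:A. s c (g x))"
 and scale_sum_left: "vector_space s \<Longrightarrow> s (SUM x:A. h x) v = (SUM x:A. s (h x) v)"
 and scale_sum_list: "vector_space s \<Longrightarrow> s c (SUM x<-xs. g x) = (SUM x<-xs. s c (g x))"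
proof -
 assume "vector_space s"
 then interpret vector_space s .
 show "s c (SUM x:A. g x) = (SUM x:A. s c (g x))" by (rule scale_sum_right)
 show "s (SUM x:A. h x) v = (SUM x:A. s (h x) v)" by (rule scale_sum_left)
 show "s c (SUM x<-xs. g x) = (SUM x<-xs. s c (g x))"
  by (induction xs) (auto simp: scale_right_distrib)
qed

lemma lin_id: "vector_space s \<Longrightarrow> lin s s (\<lambda>x. x)"
 by (rule linI) auto

lemma lin_const_0: "vector_space s \<Longrightarrow> vector_space s' \<Longrightarrow> lin s s' (\<lambda>x. 0)"
 by (rule linI) (auto simp: vs_simps)

lemma lin_comp: "lin s s' f \<Longrightarrow> lin s' s'' g \<Longrightarrow> lin s s'' (\<lambda>x. g (f x))"
 by (auto simp: Vector_Spaces.linear_iff)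

lemma lin_plus: "lin s s' f \<Longrightarrow> lin s s' g \<Longrightarrow> lin s s' (\<lambda>x. f x + g x)"
 and lin_minus: "lin s s' f \<Longrightarrow> lin s s' g \<Longrightarrow> lin s s' (\<lambda>x. f x - g x)"
 by (auto simp: Vector_Spaces.linear_iff vs_simps)

lemma lin_mult_left: "lin s (*) f \<Longrightarrow> lin s (*) (\<lambda>x. c * f x)"
 and lin_mult_right: "lin s (*) f \<Longrightarrow> lin s (*) (\<lambda>x. f x * c)"
 for f :: "'a::ab_group_add \<Rightarrow> 'k::field"
 by (auto simp: Vector_Spaces.linear_iff algebra_simps)

lemma lin_scale_const: "lin s s' f \<Longrightarrow> lin s s' (\<lambda>x. s' c (f x))"
 by (auto simp: Vector_Spaces.linear_iff vs_simps mult.commute)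

lemma lin_scale_fun: "lin s (*) f \<Longrightarrow> vector_space s' \<Longrightarrow> lin s s' (\<lambda>x. s' (f x) y)"
 by (auto simp: Vector_Spaces.linear_iff vs_simps)

lemma lin_sum_fun:
 assumes "vector_space s" "vector_space s'" "\<And>i. i \<in> I \<Longrightarrow> lin s s' (f i)"
 shows "lin s s' (\<lambda>x. SUM i:I. f i x)"
proof (rule linI[OF assms(1,2)])
 show "(SUM i:I. f i (x + y)) = (SUM i:I. f i x) + (SUM i:I. f i y)" for x y
  unfolding sum.distrib[symmetric] by (rule sum.cong) (auto dest!: assms(3) simp: Vector_Spaces.linear_iff)
 show "(SUM i:I. f i (s c x)) = s' c (SUM i:I. f i x)" for c x
  unfolding scale_sum[OF assms(2)] by (rule sum.cong) (auto dest!: assms(3) simp: Vector_Spaces.linear_iff)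
qed

lemma lin_sum_list_fun:
 assumes "vector_space s" "vector_space s'" "\<And>i. i \<in> set xs \<Longrightarrow> lin s s' (f i)"
 shows "lin s s' (\<lambda>x. SUM i<-xs. f i x)"
 using assms(3)
 by (induction xs) (auto intro!: lin_const_0 lin_plus assms(1,2))

lemma bilinear_mapI:
 "(\<And>v. lin sW sU (f v)) \<Longrightarrow> (\<And>w. lin sV sU (\<lambda>v. f v w)) \<Longrightarrow> bilinear_map sV sW sU f"
 by (auto simp: bilinear_map_def)

lemma bilinear_right: "bilinear_map sV sW sU f \<Longrightarrow> lin sW sU (f v)"
 and bilinear_left: "bilinear_map sV sW sU f \<Longrightarrow> lin sV sU (\<lambda>v. f v w)"
 by (auto simp: bilinear_map_def)

lemma bilinear_form_functionals:
 "lin sV (*) f \<Longrightarrow> lin sW (*) g \<Longrightarrow> bilinear_map sV sW (*) (\<lambda>x y. f x * g y)"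
 by (intro bilinear_mapI lin_mult_left lin_mult_right)

lemma lin_extend_independent:
 assumes "vector_space s" "vector_space s'" "\<not> module.dependent s B"
 obtains g where "lin s s' g" "\<And>x. x \<in> B \<Longrightarrow> g x = f x"
proof -
 interpret vector_space_pair s s' using assms by (simp add: vector_space_pair_def)
 show ?thesis using linear_independent_extend[OF assms(3), of f] that by auto
qed

lemma dual_basis_exists:
 assumes "vector_space (s :: 'k::field \<Rightarrow> _)" "\<not> module.dependent s B"
 obtains d where "\<And>b. lin s (*) (d b)" "\<And>a b. a \<in> B \<Longrightarrow> d b a = (if a = b then 1 else 0)"
proof -
 have "\<exists>g. lin s (*) g \<and> (\<forall>x\<in>B. g x = (if x = b then 1 else 0))" for b
  by (rule lin_extend_independent[OF assms(1) vector_space_mult assms(2), where f="\<lambda>x. if x = b then 1 else 0"]) auto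
 then obtain d where "\<forall>b. lin s (*) (d b) \<and> (\<forall>x\<in>B. d b x = (if x = b then 1 else 0))" by metis
 then show ?thesis using that by blast
qed

text \<open>A basis of the subspace together with \<open>x\<close> is linearly independent.\<close>
lemma functional_separates_subspace:
 assumes "vector_space (s :: 'k::field \<Rightarrow> _)" "module.subspace s W" "x \<notin> W"
 obtains f where "lin s (*) f" "\<And>w. w \<in> W \<Longrightarrow> f w = 0" "f x = 1"
proof -
 interpret vector_space s by fact
 interpret vector_space_pair s "(*)" using assms vector_space_mult by (simp add: vector_space_pair_def)
 obtain B where B: "B \<subseteq> W" "independent B" "W \<subseteq> span B" by (rule maximal_independent_subset)
 have "span B = W" using B assms(2) by (meson span_subspace)
 then have "independent (insert x B)" using B assms(3) by (intro independent_insertI) auto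
 then obtain f where f: "lin s (*) f" "\<And>y. y \<in> insert x B \<Longrightarrow> f y = (if y = x then 1 else 0)"
  by (rule lin_extend_independent[OF assms(1) vector_space_mult, where f="\<lambda>y. if y = x then 1 else 0"]) blast
 have "f w = 0" if "w \<in> W" for w
 proof (rule linear_eq_0_on_span[OF f(1), where b=B])
  show "f y = 0" if "y \<in> B" for y using f(2)[of y] that B assms(3) by auto
  show "w \<in> span B" using that B by auto
 qed
 then show ?thesis using that f by auto
qed

lemma functionals_separate:
 assumes "vector_space (s :: 'k::field \<Rightarrow> _)" "\<And>f. lin s (*) f \<Longrightarrow> f x = f y"
 shows "x = y"
proof (rule ccontr)
 interpret vector_space s by fact
 assume "x \<noteq> y"
 then have "x - y \<notin> {0}" by auto
 then obtain f where "lin s (*) f" "f (x - y) = 1"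
  using functional_separates_subspace[OF assms(1) subspace_single_0] by metis
 then show False using assms(2)[of f] by (simp add: lin_diff)
qed

lemma projection_exists:
 assumes "vector_space s" "module.subspace s V"
 obtains p where "lin s s p" "\<And>x. p x \<in> V" "\<And>v. v \<in> V \<Longrightarrow> p v = v"
proof -
 interpret vector_space_pair s s using assms by (simp add: vector_space_pair_def)
 obtain g where "range g \<subseteq> V" "lin s s g" "\<forall>v\<in>V. g v = v"
  using linear_exists_left_inverse_on[OF lin_id[OF assms(1)] assms(2)] by (auto simp: inj_on_def)
 then show ?thesis using that by blast
qed

section \<open>Tensors as functionals on bilinear forms\<close>

lemma sum_list_apply: "(SUM x<-xs. f x) b = (SUM x<-xs. f x b)"
 by (induction xs) auto

lemma sum_apply: "(SUM x:A. f x) b = (SUM x:A. f x b)"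
 by (induction A rule: infinite_finite_induct) auto

lemma sum_list_pair_cong:
 "(\<And>x y. (x, y) \<in> set xs \<Longrightarrow> f x y = g x y) \<Longrightarrow> (SUM (x, y)<-xs. f x y) = (SUM (x, y)<-xs. g x y)"
 by (rule arg_cong[where f=sum_list], rule map_cong) auto

lemma tensor_apply: "bilinear_map sV sW (*) b \<Longrightarrow> tensor sV sW v w b = b v w"
 by (simp add: tensor_def)

lemma tensor_off: "\<not> bilinear_map sV sW (*) b \<Longrightarrow> tensor sV sW v w b = 0"
 by (simp add: tensor_def)

lemma tensor_bilinear:
 assumes "vector_space sV" "vector_space (sW :: 'k::field \<Rightarrow> _)"
 shows "bilinear_map sV sW tscale (tensor sV sW)"
 by (intro bilinear_mapI linI assms vector_space_pointwise vector_space_mult)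
  (auto simp: tensor_def fun_eq_iff pointwise_scale_def bilinear_map_def Vector_Spaces.linear_iff)

lemma tensor_space_repr:
 assumes "vector_space sV" "vector_space (sW :: 'k::field \<Rightarrow> _)"
  and "module.subspace sV V" and "t \<in> tensor_space sV sW V W"
 shows "\<exists>xs. set xs \<subseteq> V \<times> W \<and> t = (SUM (v, w)<-xs. tensor sV sW v w)"
proof -
 interpret T: vector_space "tscale :: 'k \<Rightarrow> _"
  by (intro vector_space_pointwise vector_space_mult)
 interpret V: vector_space sV by fact
 from assms(4) show ?thesis unfolding tensor_space_def
 proof (induction rule: T.span_induct_alt)
  case base
  show ?case by (rule exI[of _ "[]"]) auto
 next
  case (step c x y)
  then obtain v w xs where "x = tensor sV sW v w" "v \<in> V" "w \<in> W"
   "set xs \<subseteq> V \<times> W" "y = (SUM (v, w)<-xs. tensor sV sW v w)" by blast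
  then show ?case
   by (intro exI[of _ "(sV c v, w) # xs"])
    (auto simp: V.subspace_scale[OF assms(3)]
     lin_scale[OF bilinear_left[OF tensor_bilinear[OF assms(1,2)]]])
 qed
qed

lemma tensor_rep:
 assumes "vector_space sV" "vector_space (sW :: 'k::field \<Rightarrow> _)"
  and "module.subspace sV V" and "t \<in> tensor_space sV sW V W"
 shows "set (tensor_rep sV sW V W t) \<subseteq> V \<times> W"
  and "t = (SUM (v, w)<-tensor_rep sV sW V W t. tensor sV sW v w)"
 using someI_ex[OF tensor_space_repr[OF assms]] unfolding tensor_rep_def by auto

lemma tensor_in_space:
 "v \<in> V \<Longrightarrow> w \<in> W \<Longrightarrow> tensor sV (sW :: 'k::field \<Rightarrow> _) v w \<in> tensor_space sV sW V W"
proof -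
 interpret T: vector_space "tscale :: 'k \<Rightarrow> _"
  by (intro vector_space_pointwise vector_space_mult)
 assume "v \<in> V" "w \<in> W"
 then show ?thesis unfolding tensor_space_def by (intro T.span_base) auto
qed

lemma subspace_tensor_space: "module.subspace tscale (tensor_space sV (sW :: 'k::field \<Rightarrow> _) V W)"
proof -
 interpret T: vector_space "tscale :: 'k \<Rightarrow> _"
  by (intro vector_space_pointwise vector_space_mult)
 show ?thesis unfolding tensor_space_def by simp
qed

lemma sum_tensor_in_space:
 assumes "\<And>i. i \<in> I \<Longrightarrow> x i \<in> V" "\<And>i. i \<in> I \<Longrightarrow> y i \<in> W"
 shows "(SUM i:I. tensor sV (sW :: 'k::field \<Rightarrow> _) (x i) (y i)) \<in> tensor_space sV sW V W"
proof -
 interpret T: vector_space "tscale :: 'k \<Rightarrow> _"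
  by (intro vector_space_pointwise vector_space_mult)
 show ?thesis using assms by (intro T.subspace_sum subspace_tensor_space tensor_in_space)
qed

lemma tensor_space_off:
 assumes "t \<in> tensor_space sV (sW :: 'k::field \<Rightarrow> _) V W" "\<not> bilinear_map sV sW (*) b"
 shows "t b = 0"
proof -
 interpret T: vector_space "tscale :: 'k \<Rightarrow> _"
  by (intro vector_space_pointwise vector_space_mult)
 show ?thesis using assms(1) unfolding tensor_space_def
  by (induction rule: T.span_induct_alt) (auto simp: pointwise_scale_def tensor_off assms(2))
qed

lemma tensor_eqI:
 assumes "t \<in> tensor_space sV (sW :: 'k::field \<Rightarrow> _) V W" "t' \<in> tensor_space sV sW V' W'"
  and "\<And>b. bilinear_map sV sW (*) b \<Longrightarrow> t b = t' b"
 shows "t = t'"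
 using assms(3) tensor_space_off[OF assms(1)] tensor_space_off[OF assms(2)] by (metis ext)

definition bilinear_on where
 "bilinear_on sV sW sU V W B \<longleftrightarrow>
   (\<forall>v\<in>V. linear_on sW sU W (B v)) \<and> (\<forall>w\<in>W. linear_on sV sU V (\<lambda>v. B v w))"

lemma bilinear_on_if_bilinear_map: "bilinear_map sV sW sU B \<Longrightarrow> bilinear_on sV sW sU V W B"
 by (auto simp: bilinear_on_def linear_on_def bilinear_map_def Vector_Spaces.linear_iff)

text \<open>The universal property of the tensor product: a bilinear map takes equal values on two
 expressions of the same tensor. Testing against linear forms on the codomain reduces this to
 bilinear forms, at which both expressions evaluate to the same scalar by definition.\<close>
lemma tensor_universal_list:
 assumes V: "vector_space sV" "module.subspace sV V"
  and W: "vector_space (sW :: 'k::field \<Rightarrow> _)" "module.subspace sW W"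
  and U: "vector_space sU" and B: "bilinear_on sV sW sU V W B"
  and xs: "set xs \<subseteq> V \<times> W" and ys: "set ys \<subseteq> V \<times> W"
  and eq: "(SUM (v, w)<-xs. tensor sV sW v w) = (SUM (v, w)<-ys. tensor sV sW v w)"
 shows "(SUM (v, w)<-xs. B v w) = (SUM (v, w)<-ys. B v w)"
proof (rule functionals_separate[OF U])
 fix g assume g: "lin sU (*) g"
 obtain p where p: "lin sV sV p" "\<And>x. p x \<in> V" "\<And>v. v \<in> V \<Longrightarrow> p v = v"
  by (rule projection_exists[OF V]) blast
 obtain q where q: "lin sW sW q" "\<And>x. q x \<in> W" "\<And>v. v \<in> W \<Longrightarrow> q v = v"
  by (rule projection_exists[OF W]) blast
 let ?b = "\<lambda>v w. g (B (p v) (q w))"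
 have b: "bilinear_map sV sW (*) ?b"
  using B p(2) q(2) by (intro bilinear_mapI linI V W vector_space_mult)
   (auto simp: lin_add[OF p(1)] lin_add[OF q(1)] lin_scale[OF p(1)] lin_scale[OF q(1)]
    bilinear_on_def linear_on_def lin_add[OF g] lin_scale[OF g])
 have "g (SUM (v, w)<-zs. B v w) = (SUM (v, w)<-zs. tensor sV sW v w) ?b" if "set zs \<subseteq> V \<times> W" for zs
  using that by (induction zs) (auto simp: lin_zero[OF g] lin_add[OF g] tensor_apply[OF b] p q)
 then show "g (SUM (v, w)<-xs. B v w) = g (SUM (v, w)<-ys. B v w)" using xs ys eq by metis
qed

lemma tensor_rep_sum_list:
 assumes V: "vector_space sV" "module.subspace sV V"
  and W: "vector_space (sW :: 'k::field \<Rightarrow> _)" "module.subspace sW W"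
  and U: "vector_space sU" and B: "bilinear_on sV sW sU V W B"
  and ys: "set ys \<subseteq> V \<times> W"
  and eq: "t = (SUM (v, w)<-ys. tensor sV sW v w)"
 shows "(SUM (v, w)<-tensor_rep sV sW V W t. B v w) = (SUM (v, w)<-ys. B v w)"
proof (rule tensor_universal_list[OF V W U B _ ys])
 have "t \<in> tensor_space sV sW V W"
 proof -
  interpret T: vector_space "tscale :: 'k \<Rightarrow> _"
   by (intro vector_space_pointwise vector_space_mult)
  show ?thesis unfolding eq using ys
   by (induction ys) (auto intro!: T.subspace_0 T.subspace_add subspace_tensor_space tensor_in_space)
 qed
 from tensor_rep[OF V(1) W(1) V(2) this]
 show "set (tensor_rep sV sW V W t) \<subseteq> V \<times> W"
  "(SUM (v, w)<-tensor_rep sV sW V W t. tensor sV sW v w) = (SUM (v, w)<-ys. tensor sV sW v w)"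
  using eq by simp_all
qed

lemma sum_list_pairs_eq_sum:
 "distinct il \<Longrightarrow> (SUM (v, w)<-map (\<lambda>i. (x i, y i)) il. F v w) = (SUM i:set il. F (x i) (y i))"
 by (simp add: sum_list_distinct_conv_sum_set comp_def)

lemma tensor_rep_sum:
 assumes V: "vector_space sV" "module.subspace sV V"
  and W: "vector_space (sW :: 'k::field \<Rightarrow> _)" "module.subspace sW W"
  and U: "vector_space sU" and B: "bilinear_on sV sW sU V W B"
  and xy: "\<And>i. i \<in> I \<Longrightarrow> x i \<in> V" "\<And>i. i \<in> I \<Longrightarrow> y i \<in> W"
  and eq: "t = (SUM i:I. tensor sV sW (x i) (y i))"
 shows "(SUM (v, w)<-tensor_rep sV sW V W t. B v w) = (SUM i:I. B (x i) (y i))"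
proof (cases "finite I")
 case True
 then obtain il where il: "set il = I" "distinct il" using finite_distinct_list by blast
 have "(SUM (v, w)<-tensor_rep sV sW V W t. B v w) = (SUM (v, w)<-map (\<lambda>i. (x i, y i)) il. B v w)"
  by (rule tensor_rep_sum_list[OF V W U B]) (use il xy in \<open>auto simp: sum_list_pairs_eq_sum[OF il(2)] eq simp del: map_map\<close>)
 then show ?thesis by (simp only: sum_list_pairs_eq_sum[OF il(2)] il(1))
next
 case False
 have "(SUM (v, w)<-tensor_rep sV sW V W t. B v w) = (SUM (v, w)<-[]. B v w)"
  by (rule tensor_rep_sum_list[OF V W U B]) (use False eq in auto)
 then show ?thesis using False by simp
qed

lemma tensor_rep_form:
 assumes V: "vector_space sV" and W: "vector_space (sW :: 'k::field \<Rightarrow> _)"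
  and "module.subspace sV V" "t \<in> tensor_space sV sW V W" "bilinear_map sV sW (*) b"
 shows "(SUM (v, w)<-tensor_rep sV sW V W t. b v w) = t b"
proof -
 have "t b = (SUM (v, w)<-tensor_rep sV sW V W t. tensor sV sW v w) b"
  using tensor_rep(2)[OF V W assms(3,4)] by simp
 also have "\<dots> = (SUM (v, w)<-tensor_rep sV sW V W t. tensor sV sW v w b)"
  by (simp add: sum_list_apply split_def)
 also have "\<dots> = (SUM (v, w)<-tensor_rep sV sW V W t. b v w)" by (simp add: tensor_apply[OF assms(5)])
 finally show ?thesis ..
qed

text \<open>The second components of any representation are expanded in a basis of their
 span.\<close>
lemma tensor_independent_repr:
 assumes V: "vector_space sV" "module.subspace sV V" and W: "vector_space (sW :: 'k::field \<Rightarrow> _)"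
  and t: "t \<in> tensor_space sV sW V UNIV"
 obtains B x where "finite B" "\<not> module.dependent sW B" "\<And>h. x h \<in> V" "t = (SUM h:B. tensor sV sW (x h) h)"
proof -
 interpret V: vector_space sV by fact
 interpret W: vector_space sW by fact
 obtain xs where xs: "set xs \<subseteq> V \<times> UNIV" "t = (SUM (v, w)<-xs. tensor sV sW v w)"
  using tensor_space_repr[OF V(1) W V(2) t] by blast
 obtain B where B: "B \<subseteq> snd ` set xs" "W.independent B" "snd ` set xs \<subseteq> W.span B"
  by (rule W.maximal_independent_subset) blast
 have fin: "finite B" using B by (meson finite_imageI finite_set finite_subset)
 let ?x = "\<lambda>h. SUM (v, w)<-xs. sV (W.representation B w h) v"
 note bil = tensor_bilinear[OF V(1) W]
 have "tensor sV sW v w = (SUM h:B. tensor sV sW (sV (W.representation B w h) v) h)" if "(v, w) \<in> set xs" for v w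
 proof -
  have "w \<in> W.span B" using that B by force
  then have "w = (SUM h:B. sW (W.representation B w h) h)"
   using W.sum_representation_eq[OF B(2) _ fin order_refl] by simp
  then have "tensor sV sW v w = tensor sV sW v (SUM h:B. sW (W.representation B w h) h)" by simp
  also have "\<dots> = (SUM h:B. tensor sV sW (sV (W.representation B w h) v) h)"
   by (simp add: lin_sum[OF bilinear_right[OF bil]] lin_scale[OF bilinear_right[OF bil]] lin_scale[OF bilinear_left[OF bil]])
  finally show ?thesis .
 qed
 then have "t = (SUM (v, w)<-xs. SUM h:B. tensor sV sW (sV (W.representation B w h) v) h)"
  unfolding xs(2) by (rule sum_list_pair_cong)
 also have "\<dots> = (SUM h:B. tensor sV sW (?x h) h)"
 proof (induction xs)
  case Nil
  have "tensor sV sW 0 h = 0" for h by (rule lin_zero[OF bilinear_left[OF bil]])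
  then show ?case by simp
 next
  case (Cons p xs)
  obtain v w where p: "p = (v, w)" by fastforce
  have add: "tensor sV sW (a + b) h = tensor sV sW a h + tensor sV sW b h" for a b h
   by (rule lin_add[OF bilinear_left[OF bil]])
  show ?case unfolding p list.map sum_list.Cons prod.case add sum.distrib Cons.IH ..
 qed
 finally have "t = (SUM h:B. tensor sV sW (?x h) h)" .
 moreover have "?x h \<in> V" for h
  using xs(1)
 proof (induction xs)
  case Nil
  show ?case using V.subspace_0[OF V(2)] by simp
 next
  case (Cons p xs)
  obtain v w where p: "p = (v, w)" by fastforce
  have "v \<in> V" and "set xs \<subseteq> V \<times> UNIV" using Cons.prems by (simp_all add: p)
  from V.subspace_add[OF V(2) V.subspace_scale[OF V(2) this(1)] Cons.IH[OF this(2)]]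
  show ?case unfolding p list.map sum_list.Cons prod.case .
 qed
 ultimately show ?thesis using that[of B ?x] fin B(2) by simp
qed

text \<open>Products of linear forms separate tensors: write the difference with linearly independent
 second components and use forms dual to these.\<close>
lemma tensor_eq_if_functionals:
 assumes V: "vector_space sV" and W: "vector_space (sW :: 'k::field \<Rightarrow> _)"
  and t: "t \<in> tensor_space sV sW UNIV UNIV" and t': "t' \<in> tensor_space sV sW UNIV UNIV"
  and eq: "\<And>f g. lin sV (*) f \<Longrightarrow> lin sW (*) g \<Longrightarrow> t (\<lambda>x y. f x * g y) = t' (\<lambda>x y. f x * g y)"
 shows "t = t'"
proof -
 interpret V: vector_space sV by fact
 interpret T: vector_space "tscale :: 'k \<Rightarrow> _"
  by (intro vector_space_pointwise vector_space_mult)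
 have "t - t' \<in> tensor_space sV sW UNIV UNIV" by (intro T.subspace_diff subspace_tensor_space t t')
 from tensor_independent_repr[OF V V.subspace_UNIV W this] obtain B x where
  B: "finite B" "\<not> module.dependent sW B" and x: "t - t' = (SUM h:B. tensor sV sW (x h) h)" by metis
 obtain d where d: "\<And>b. lin sW (*) (d b)" "\<And>a b. a \<in> B \<Longrightarrow> d b a = (if a = b then 1 else 0)"
  by (rule dual_basis_exists[OF W B(2)]) blast
 have "x h = 0" if "h \<in> B" for h
 proof (rule functionals_separate[OF V])
  fix f assume f: "lin sV (*) f"
  have "0 = (t - t') (\<lambda>x y. f x * d h y)" using eq[OF f d(1)] by simp
  also have "\<dots> = (SUM h':B. f (x h') * d h h')"
   unfolding x by (simp add: sum_apply tensor_apply[OF bilinear_form_functionals[OF f d(1)]])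
  also have "\<dots> = f (x h)" using that B by (simp add: d(2) if_distrib cong: if_cong)
  finally show "f (x h) = f 0" by (simp add: lin_zero[OF f])
 qed
 then have "t - t' = 0" unfolding x
  by (intro sum.neutral ballI) (simp add: lin_zero[OF bilinear_left[OF tensor_bilinear[OF V W]]])
 then show ?thesis by simp
qed

lemma tensor_form_plus:
 assumes "t \<in> tensor_space sV (sW :: 'k::field \<Rightarrow> _) V W"
  and "bilinear_map sV sW (*) b" "bilinear_map sV sW (*) b'"
 shows "t (\<lambda>x y. b x y + b' x y) = t b + t b'"
  and "t (\<lambda>x y. c * b x y) = c * t b"
proof -
 interpret T: vector_space "tscale :: 'k \<Rightarrow> _"
  by (intro vector_space_pointwise vector_space_mult)
 have b: "bilinear_map sV sW (*) (\<lambda>x y. b x y + b' x y)" "bilinear_map sV sW (*) (\<lambda>x y. c * b x y)"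
  using assms(2,3) by (auto intro!: bilinear_mapI lin_plus lin_mult_left simp: bilinear_map_def)
 show "t (\<lambda>x y. b x y + b' x y) = t b + t b'"
  using assms(1) unfolding tensor_space_def
  by (induction rule: T.span_induct_alt)
   (auto simp: pointwise_scale_def tensor_apply assms b algebra_simps)
 show "t (\<lambda>x y. c * b x y) = c * t b"
  using assms(1) unfolding tensor_space_def
  by (induction rule: T.span_induct_alt)
   (auto simp: pointwise_scale_def tensor_apply assms b algebra_simps)
qed

lemma vector_space_tscale: "vector_space (tscale :: 'k::field \<Rightarrow> ('v, 'w, 'k) tensor \<Rightarrow> _)"
 by (intro vector_space_pointwise vector_space_mult)

lemma sum_list_sum_swap: "(SUM x<-xs. SUM a:A. f x a) = (SUM a:A. SUM x<-xs. f x a)"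
 by (induction xs) (simp_all add: sum.distrib)

section \<open>Comodules in coordinates\<close>

context coalgebra
begin

lemma vs: "vector_space scale" by (rule vector_space_axioms)

lemma sweedler_form: "bilinear_map scale scale (*) b \<Longrightarrow> (SUM (x, y)<-sweedler a. b x y) = \<Delta> a b"
 unfolding sweedler_def by (rule tensor_rep_form[OF vs vs subspace_UNIV \<Delta>_tensor])

lemma sweedler_eq:
 assumes "vector_space sU" "bilinear_map scale scale sU B" "\<Delta> a = (SUM i:I. x i \<otimes> y i)"
 shows "(SUM (a1, a2)<-sweedler a. B a1 a2) = (SUM i:I. B (x i) (y i))"
 unfolding sweedler_def
 by (rule tensor_rep_sum[OF vs subspace_UNIV vs subspace_UNIV assms(1)
    bilinear_on_if_bilinear_map[OF assms(2)] _ _ assms(3)]) auto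

lemma lin_sweedler:
 assumes "vector_space sU" "bilinear_map scale scale sU B"
 shows "lin scale sU (\<lambda>a. SUM (a1, a2)<-sweedler a. B a1 a2)"
proof (rule linI[OF vs assms(1)])
 have g: "g (SUM (a1, a2)<-sweedler a. B a1 a2) = \<Delta> a (\<lambda>x y. g (B x y))" if "lin sU (*) g" for g a
 proof -
  have "bilinear_map scale scale (*) (\<lambda>x y. g (B x y))"
   using assms(2) by (intro bilinear_mapI lin_comp[OF _ that]) (auto simp: bilinear_map_def)
  then show ?thesis by (simp flip: sweedler_form add: lin_sum_list[OF that] split_def)
 qed
 show "(SUM (a1, a2)<-sweedler (x + y). B a1 a2) =
  (SUM (a1, a2)<-sweedler x. B a1 a2) + (SUM (a1, a2)<-sweedler y. B a1 a2)" for x y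
  by (rule functionals_separate[OF assms(1)]) (simp add: g lin_add lin_add[OF \<Delta>_linear])
 show "(SUM (a1, a2)<-sweedler (c *s x). B a1 a2) = sU c (SUM (a1, a2)<-sweedler x. B a1 a2)" for c x
  by (rule functionals_separate[OF assms(1)])
   (simp add: g lin_scale lin_scale[OF \<Delta>_linear] pointwise_scale_def)
qed

lemma \<Delta>_eqI:
 assumes "\<And>b. bilinear_map scale scale (*) b \<Longrightarrow> \<Delta> a b = (SUM i:I. b (x i) (y i))"
 shows "\<Delta> a = (SUM i:I. x i \<otimes> y i)"
 by (rule tensor_eqI[OF \<Delta>_tensor sum_tensor_in_space[where V=UNIV and W=UNIV]])
  (auto simp: assms sum_apply tensor_apply)

lemma right_comodule_self: "right_comodule scale UNIV \<Delta>"
 using vs subspace_UNIV \<Delta>_linear \<Delta>_tensor coassoc counit_right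
 unfolding right_comodule_def coact_def sweedler_def
 by (auto simp: linear_on_def lin_add lin_scale)

lemma comoduleD:
 assumes "right_comodule sV V \<rho>"
 shows "vector_space sV" "module.subspace sV V" "linear_on sV tscale V \<rho>"
  "\<And>v. v \<in> V \<Longrightarrow> \<rho> v \<in> tensor_space sV scale V UNIV"
  "\<And>v. v \<in> V \<Longrightarrow> (SUM (v0, h)<-coact sV V \<rho> v. sV (\<epsilon> h) v0) = v"
 using assms unfolding right_comodule_def by auto

lemma coact_subset:
 assumes "right_comodule sV V \<rho>" "v \<in> V"
 shows "set (coact sV V \<rho> v) \<subseteq> V \<times> UNIV"
 unfolding coact_def
 by (rule tensor_rep(1)[OF comoduleD(1)[OF assms(1)] vs comoduleD(2)[OF assms(1)] comoduleD(4)[OF assms]])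

lemma coact_tensor:
 assumes "right_comodule sV V \<rho>" "v \<in> V"
 shows "\<rho> v = (SUM (v0, h)<-coact sV V \<rho> v. tensor sV scale v0 h)"
 unfolding coact_def
 by (rule tensor_rep(2)[OF comoduleD(1)[OF assms(1)] vs comoduleD(2)[OF assms(1)] comoduleD(4)[OF assms]])

lemma coact_eq:
 assumes "right_comodule sV V \<rho>" "v \<in> V" "vector_space sU" "bilinear_on sV scale sU V UNIV B"
  and "\<And>i. i \<in> I \<Longrightarrow> x i \<in> V" "\<rho> v = (SUM i:I. tensor sV scale (x i) (y i))"
 shows "(SUM (v0, h)<-coact sV V \<rho> v. B v0 h) = (SUM i:I. B (x i) (y i))"
 unfolding coact_def
 by (rule tensor_rep_sum[OF comoduleD(1,2)[OF assms(1)] vs subspace_UNIV assms(3,4)])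
  (use assms in auto)

lemma coact_form:
 assumes "right_comodule sV V \<rho>" "v \<in> V" "bilinear_map sV scale (*) b"
 shows "(SUM (v0, h)<-coact sV V \<rho> v. b v0 h) = \<rho> v b"
 unfolding coact_def
 by (rule tensor_rep_form[OF comoduleD(1)[OF assms(1)] vs comoduleD(2)[OF assms(1)]
   comoduleD(4)[OF assms(1,2)] assms(3)])

text \<open>The sums over \<open>coact\<close> may be evaluated at any representation of
 \<open>\<rho> v\<close>.\<close>
lemma coact_eq_list:
 assumes "right_comodule sV V \<rho>" "v \<in> V" "vector_space sU" "bilinear_on sV scale sU V UNIV B"
  and "set ys \<subseteq> V \<times> UNIV" "\<rho> v = (SUM (v0, h)<-ys. tensor sV scale v0 h)"
 shows "(SUM (v0, h)<-coact sV V \<rho> v. B v0 h) = (SUM (v0, h)<-ys. B v0 h)"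
 unfolding coact_def
 by (rule tensor_rep_sum_list[OF comoduleD(1,2)[OF assms(1)] vs subspace_UNIV assms(3,4)])
  (use assms in auto)

lemma coact_linear_on:
 assumes \<rho>: "right_comodule sV V \<rho>" and U: "vector_space sU" and B: "bilinear_on sV scale sU V UNIV B"
 shows "linear_on sV sU V (\<lambda>v. SUM (v0, h)<-coact sV V \<rho> v. B v0 h)"
proof -
 note V = comoduleD[OF \<rho>]
 interpret V: vector_space sV by fact
 show ?thesis unfolding linear_on_def
 proof (intro conjI ballI allI)
  fix v w assume vw: "v \<in> V" "w \<in> V"
  have "\<rho> (v + w) = \<rho> v + \<rho> w" using V(3) vw by (simp add: linear_on_def)
  then have eq: "\<rho> (v + w) = (SUM (v0, h)<-coact sV V \<rho> v @ coact sV V \<rho> w. tensor sV scale v0 h)"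
   using vw by (simp flip: coact_tensor[OF \<rho>])
  show "(SUM (v0, h)<-coact sV V \<rho> (v + w). B v0 h) =
   (SUM (v0, h)<-coact sV V \<rho> v. B v0 h) + (SUM (v0, h)<-coact sV V \<rho> w. B v0 h)"
   by (subst coact_eq_list[OF \<rho> _ U B _ eq])
    (use vw V(2) coact_subset[OF \<rho>] in \<open>auto intro: V.subspace_add\<close>)
 next
  fix c v assume v: "v \<in> V"
  note bil = tensor_bilinear[OF V(1) vs]
  let ?ys = "map (\<lambda>(v0, h). (sV c v0, h)) (coact sV V \<rho> v)"
  have "\<rho> (sV c v) = tscale c (\<rho> v)" using V(3) v by (simp add: linear_on_def)
  also have "\<dots> = tscale c (SUM (v0, h)<-coact sV V \<rho> v. tensor sV scale v0 h)"
   using coact_tensor[OF \<rho> v] by simp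
  also have "\<dots> = (SUM (v0, h)<-?ys. tensor sV scale v0 h)"
   by (simp add: scale_sum_list[OF vector_space_tscale] comp_def split_def lin_scale[OF bilinear_left[OF bil]])
  finally have eq: "\<rho> (sV c v) = (SUM (v0, h)<-?ys. tensor sV scale v0 h)" .
  have sub: "set ?ys \<subseteq> V \<times> UNIV"
   using coact_subset[OF \<rho> v] by (auto intro!: V.subspace_scale[OF V(2)])
  have "(SUM (v0, h)<-coact sV V \<rho> (sV c v). B v0 h) = (SUM (v0, h)<-?ys. B v0 h)"
   by (rule coact_eq_list[OF \<rho> _ U B sub eq]) (use v in \<open>auto intro!: V.subspace_scale[OF V(2)]\<close>)
  also have "\<dots> = (SUM (v0, h)<-coact sV V \<rho> v. sU c (B v0 h))"
   unfolding map_map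
   by (rule arg_cong[where f=sum_list], rule map_cong)
    (use coact_subset[OF \<rho> v] B in \<open>auto simp: bilinear_on_def linear_on_def\<close>)
  also have "\<dots> = sU c (SUM (v0, h)<-coact sV V \<rho> v. B v0 h)"
   by (simp add: scale_sum_list[OF U] split_def)
  finally show "(SUM (v0, h)<-coact sV V \<rho> (sV c v). B v0 h) = sU c (SUM (v0, h)<-coact sV V \<rho> v. B v0 h)" .
 qed
qed

text \<open>Coassociativity of a coaction, tested on trilinear forms. A projection of the ambient space
 of all functionals onto the tensors turns a trilinear form into a bilinear form on
 \<open>V \<times> (H \<otimes> H)\<close>.\<close>
lemma coassoc_form:
 assumes \<rho>: "right_comodule sV V \<rho>" and v: "v \<in> V"
  and \<phi>: "\<And>v. bilinear_map scale scale (*) (\<phi> v)" "\<And>g h. lin sV (*) (\<lambda>v. \<phi> v g h)"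
 shows "(SUM (x, h2)<-coact sV V \<rho> v. SUM (v0, h1)<-coact sV V \<rho> x. \<phi> v0 h1 h2) =
  (SUM (v0, h)<-coact sV V \<rho> v. \<Delta> h (\<phi> v0))"
proof -
 note V = comoduleD[OF \<rho>]
 let ?T = "tensor_space scale scale UNIV UNIV"
 obtain p where p: "lin tscale tscale p" "\<And>x. p x \<in> ?T" "\<And>t. t \<in> ?T \<Longrightarrow> p t = t"
  by (rule projection_exists[OF vector_space_tscale subspace_tensor_space]) blast
 let ?b = "\<lambda>v t. p t (\<phi> v)"
 have b: "bilinear_map sV tscale (*) ?b"
 proof (intro bilinear_mapI linI vector_space_tscale V vector_space_mult)
  fix v v' w c
  show "?b v (w + w') = ?b v w + ?b v w'" for w' by (simp add: lin_add[OF p(1)])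
  show "?b v (tscale c w) = c * ?b v w" by (simp only: lin_scale[OF p(1)]) (simp add: pointwise_scale_def)
  have "\<phi> (v + v') = (\<lambda>x y. \<phi> v x y + \<phi> v' x y)" by (intro ext) (rule lin_add[OF \<phi>(2)])
  then show "?b (v + v') w = ?b v w + ?b v' w"
   using tensor_form_plus(1)[OF p(2) \<phi>(1,1)] by simp
  have "\<phi> (sV c v) = (\<lambda>x y. c * \<phi> v x y)" by (intro ext) (rule lin_scale[OF \<phi>(2)])
  then show "?b (sV c v) w = c * ?b v w"
   using tensor_form_plus(2)[OF p(2) \<phi>(1,1)] by simp
 qed
 have "(SUM (x, h2)<-coact sV V \<rho> v. SUM (v0, h1)<-coact sV V \<rho> x. tensor sV tscale v0 (h1 \<otimes> h2)) =
     (SUM (v0, h)<-coact sV V \<rho> v. tensor sV tscale v0 (\<Delta> h))"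
  using \<rho> v unfolding right_comodule_def by blast
 from fun_cong[OF this, of ?b]
 have "(SUM (x, h2)<-coact sV V \<rho> v. SUM (v0, h1)<-coact sV V \<rho> x. ?b v0 (h1 \<otimes> h2)) =
     (SUM (v0, h)<-coact sV V \<rho> v. ?b v0 (\<Delta> h))"
  by (simp add: sum_list_apply split_def tensor_apply[OF b])
 then show ?thesis
  by (simp add: p(3) tensor_in_space \<Delta>_tensor tensor_apply[OF \<phi>(1)])
qed

text \<open>The representative of \<open>\<rho> w\<close> chosen in \<open>coact\<close> depends on
 the subspace, but sums of bilinear expressions over it do not.\<close>
lemma subcomodule:
 assumes \<rho>: "right_comodule sV V \<rho>" and W: "module.subspace sV W" "W \<subseteq> V"
  and \<rho>W: "\<And>w. w \<in> W \<Longrightarrow> \<rho> w \<in> tensor_space sV scale W UNIV"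
 shows "right_comodule sV W \<rho>"
proof -
 note V = comoduleD[OF \<rho>]
 have sub: "set (coact sV W \<rho> w) \<subseteq> W \<times> UNIV"
  and ten: "\<rho> w = (SUM (v, w)<-coact sV W \<rho> w. tensor sV scale v w)" if "w \<in> W" for w
  unfolding coact_def using tensor_rep[OF V(1) vs W(1) \<rho>W[OF that]] by auto
 have eq: "(SUM (v0, h)<-coact sV W \<rho> w. B v0 h) = (SUM (v0, h)<-coact sV V \<rho> w. B v0 h)"
  if "w \<in> W" "vector_space sU" "bilinear_on sV scale sU V UNIV B" for w sU and B :: "_ \<Rightarrow> _ \<Rightarrow> 'z::ab_group_add"
  by (rule coact_eq_list[OF \<rho> _ that(2,3) _ ten[OF that(1)], symmetric])
   (use that W sub in auto)
 have B1: "bilinear_on sV scale tscale V UNIV (\<lambda>v0 h1. tensor sV tscale v0 (h1 \<otimes> h2))" for h2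
  using tensor_bilinear[OF V(1) vector_space_tscale] tensor_bilinear[OF vs vs]
  by (intro bilinear_on_if_bilinear_map bilinear_mapI)
   (auto simp: bilinear_map_def intro: lin_comp[where f="\<lambda>h1. h1 \<otimes> h2"])
 have B2: "bilinear_on sV scale tscale V UNIV
  (\<lambda>x h2. SUM (v0, h1)<-coact sV V \<rho> x. tensor sV tscale v0 (h1 \<otimes> h2))"
  unfolding bilinear_on_def
 proof (intro conjI ballI)
  fix x
  have "lin scale tscale (\<lambda>h2. SUM (v0, h1)<-coact sV V \<rho> x. tensor sV tscale v0 (h1 \<otimes> h2))"
   unfolding split_def
   by (intro lin_sum_list_fun vs vector_space_tscale
     lin_comp[OF bilinear_right[OF tensor_bilinear[OF vs vs]] bilinear_right[OF tensor_bilinear[OF V(1) vector_space_tscale]]])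
  then show "linear_on scale tscale UNIV (\<lambda>h2. SUM (v0, h1)<-coact sV V \<rho> x. tensor sV tscale v0 (h1 \<otimes> h2))"
   by (auto simp: linear_on_def Vector_Spaces.linear_iff)
 next
  show "linear_on sV tscale V (\<lambda>x. SUM (v0, h1)<-coact sV V \<rho> x. tensor sV tscale v0 (h1 \<otimes> h2))" for h2
   by (rule coact_linear_on[OF \<rho> vector_space_tscale B1])
 qed
 have B3: "bilinear_on sV scale tscale V UNIV (\<lambda>v0 h. tensor sV tscale v0 (\<Delta> h))"
  by (intro bilinear_on_if_bilinear_map bilinear_mapI
    lin_comp[OF \<Delta>_linear bilinear_right[OF tensor_bilinear[OF V(1) vector_space_tscale]]]
    bilinear_left[OF tensor_bilinear[OF V(1) vector_space_tscale]])
 have B4: "bilinear_on sV scale sV V UNIV (\<lambda>v0 h. sV (\<epsilon> h) v0)"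
  by (intro bilinear_on_if_bilinear_map bilinear_mapI lin_scale_fun[OF \<epsilon>_linear V(1)] lin_scale_const lin_id V(1))
 show ?thesis unfolding right_comodule_def
 proof (intro conjI ballI V(1) W(1))
  show "linear_on sV tscale W \<rho>" using V(3) W(2) unfolding linear_on_def by blast
 next
  fix w assume w: "w \<in> W"
  then have wV: "w \<in> V" using W by auto
  show "\<rho> w \<in> tensor_space sV scale W UNIV" by (rule \<rho>W[OF w])
  have "(SUM (x, h2)<-coact sV W \<rho> w. SUM (v0, h1)<-coact sV W \<rho> x. tensor sV tscale v0 (h1 \<otimes> h2)) =
   (SUM (x, h2)<-coact sV W \<rho> w. SUM (v0, h1)<-coact sV V \<rho> x. tensor sV tscale v0 (h1 \<otimes> h2))"
   by (rule sum_list_pair_cong, rule eq[OF _ vector_space_tscale B1]) (use sub[OF w] in auto)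
  also have "\<dots> = (SUM (x, h2)<-coact sV V \<rho> w. SUM (v0, h1)<-coact sV V \<rho> x. tensor sV tscale v0 (h1 \<otimes> h2))"
   by (rule eq[OF w vector_space_tscale B2])
  also have "\<dots> = (SUM (v0, h)<-coact sV V \<rho> w. tensor sV tscale v0 (\<Delta> h))"
   using \<rho> wV unfolding right_comodule_def by blast
  also have "\<dots> = (SUM (v0, h)<-coact sV W \<rho> w. tensor sV tscale v0 (\<Delta> h))"
   by (rule eq[OF w vector_space_tscale B3, symmetric])
  finally show "(SUM (x, h2)<-coact sV W \<rho> w. SUM (v0, h1)<-coact sV W \<rho> x. tensor sV tscale v0 (h1 \<otimes> h2)) =
   (SUM (v0, h)<-coact sV W \<rho> w. tensor sV tscale v0 (\<Delta> h))" .
  show "(SUM (v0, h)<-coact sV W \<rho> w. sV (\<epsilon> h) v0) = w"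
   using eq[OF w V(1) B4] V(5)[OF wV] by simp
 qed
qed


text \<open>A square matrix over \<open>H\<close> on the index set \<open>R\<close> with \<open>\<Delta>(A\<^sub>i\<^sub>j) = \<Sum>\<^sub>k A\<^sub>i\<^sub>k \<otimes> A\<^sub>k\<^sub>j\<close> and \<open>\<epsilon>(A\<^sub>i\<^sub>j) = \<delta>\<^sub>i\<^sub>j\<close>
 is the same as a right comodule with a basis indexed by \<open>R\<close>.\<close>
definition comatrix :: "'r set \<Rightarrow> ('r \<Rightarrow> 'r \<Rightarrow> 'b) \<Rightarrow> bool" where
 "comatrix R A \<longleftrightarrow> finite R \<and>
   (\<forall>i\<in>R. \<forall>j\<in>R. \<Delta> (A i j) = (SUM k:R. A i k \<otimes> A k j) \<and> \<epsilon> (A i j) = (if i = j then 1 else 0))"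

text \<open>Linear forms act on coordinate vectors by the matrices of their values; the comodule is simple
 if every nonzero vector is cyclic for this action.\<close>
definition irreducible_comatrix :: "'r set \<Rightarrow> ('r \<Rightarrow> 'r \<Rightarrow> 'b) \<Rightarrow> bool" where
 "irreducible_comatrix R A \<longleftrightarrow> comatrix R A \<and> R \<noteq> {} \<and>
   (\<forall>x y. (\<exists>j\<in>R. x j \<noteq> 0) \<longrightarrow>
    (\<exists>f. lin scale (*) f \<and> (\<forall>i\<in>R. y i = (SUM j:R. f (A i j) * x j))))"

lemma comatrixD:
 assumes "comatrix R A"
 shows "finite R"
  and "\<And>i j. i \<in> R \<Longrightarrow> j \<in> R \<Longrightarrow> \<Delta> (A i j) = (SUM k:R. A i k \<otimes> A k j)"
  and "\<And>i j. i \<in> R \<Longrightarrow> j \<in> R \<Longrightarrow> \<epsilon> (A i j) = (if i = j then 1 else 0)"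
 using assms unfolding comatrix_def by blast+

lemma finite_basis_dual:
 assumes "vector_space (sV :: 'a \<Rightarrow> _)" "finite E" "\<not> module.dependent sV E" "V = module.span sV E"
 obtains d where "\<And>a. lin sV (*) (d a)" "\<And>a b. a \<in> E \<Longrightarrow> b \<in> E \<Longrightarrow> d a b = (if a = b then 1 else 0)"
  "\<And>v. v \<in> V \<Longrightarrow> v = (SUM a:E. sV (d a v) a)"
proof -
 interpret V: vector_space sV by fact
 obtain d where d: "\<And>b. lin sV (*) (d b)" "\<And>a b. a \<in> E \<Longrightarrow> d b a = (if a = b then 1 else 0)"
  by (rule dual_basis_exists[OF assms(1,3)]) blast
 have "v = (SUM a:E. sV (d a v) a)" if "v \<in> V" for v
  using that unfolding assms(4)
 proof (induction rule: V.span_induct_alt)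
  case base
  show ?case by (simp add: lin_zero[OF d(1)])
 next
  case (step c x y)
  have "(SUM a:E. sV (d a x) a) = (SUM a:E. if a = x then sV 1 a else 0)"
   by (rule sum.cong) (use step d(2) in auto)
  also have "\<dots> = x" using step assms(2) by simp
  finally have x: "(SUM a:E. sV (d a x) a) = x" .
  have "(SUM a:E. sV (d a (sV c x + y)) a) = sV c (SUM a:E. sV (d a x) a) + (SUM a:E. sV (d a y) a)"
   by (simp add: lin_add[OF d(1)] lin_scale[OF d(1)] V.scale_left_distrib sum.distrib V.scale_sum_right)
  then show ?case using step x by simp
 qed
 then show ?thesis using that[of d] d by auto
qed

text \<open>The coaction in terms of a finite basis.\<close>
lemma comodule_comatrix:
 assumes \<rho>: "right_comodule sV V \<rho>"
  and E: "finite E" "\<not> module.dependent sV E" "V = module.span sV E"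
 obtains A where "comatrix E A" "\<And>b. b \<in> E \<Longrightarrow> \<rho> b = (SUM a:E. tensor sV scale a (A a b))"
proof -
 note V = comoduleD[OF \<rho>]
 interpret V: vector_space sV by (rule V)
 obtain d where d: "\<And>a. lin sV (*) (d a)"
  "\<And>a b. a \<in> E \<Longrightarrow> b \<in> E \<Longrightarrow> d a b = (if a = b then 1 else 0)"
  "\<And>v. v \<in> V \<Longrightarrow> v = (SUM a:E. sV (d a v) a)"
  by (rule finite_basis_dual[OF V(1) E]) blast
 define A where "A a b = (SUM (v0, h)<-coact sV V \<rho> b. d a v0 *s h)" for a b
 have EV: "a \<in> V" if "a \<in> E" for a using that E(3) V.span_base by auto
 note bil = tensor_bilinear[OF V(1) vs]
 have \<rho>A: "\<rho> b = (SUM a:E. tensor sV scale a (A a b))" if b: "b \<in> E" for b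
 proof -
  have "\<rho> b = (SUM (v0, h)<-coact sV V \<rho> b. tensor sV scale v0 h)" by (rule coact_tensor[OF \<rho> EV[OF b]])
  also have "\<dots> = (SUM (v0, h)<-coact sV V \<rho> b. SUM a:E. tensor sV scale a (d a v0 *s h))"
  proof (rule sum_list_pair_cong)
   fix v0 h assume "(v0, h) \<in> set (coact sV V \<rho> b)"
   then have "v0 \<in> V" using coact_subset[OF \<rho> EV[OF b]] by auto
   then have "tensor sV scale v0 h = tensor sV scale (SUM a:E. sV (d a v0) a) h" using d(3) by simp
   then show "tensor sV scale v0 h = (SUM a:E. tensor sV scale a (d a v0 *s h))"
    by (simp only: lin_sum[OF bilinear_left[OF bil]] lin_scale[OF bilinear_left[OF bil]]
      lin_scale[OF bilinear_right[OF bil]])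
  qed
  also have "\<dots> = (SUM a:E. SUM (v0, h)<-coact sV V \<rho> b. tensor sV scale a (d a v0 *s h))"
   by (simp add: split_def sum_list_sum_swap)
  also have "\<dots> = (SUM a:E. tensor sV scale a (A a b))"
   unfolding A_def by (simp add: lin_sum_list[OF bilinear_right[OF bil]] split_def)
  finally show ?thesis .
 qed
 have coact_b: "(SUM (v0, h)<-coact sV V \<rho> b. B v0 h) = (SUM a:E. B a (A a b))"
  if "b \<in> E" "vector_space sU" "bilinear_on sV scale sU V UNIV B" for b sU and B :: "_ \<Rightarrow> _ \<Rightarrow> 'z::ab_group_add"
  by (rule coact_eq[OF \<rho> EV[OF that(1)] that(2,3) _ \<rho>A[OF that(1)]]) (rule EV)
 have "comatrix E A" unfolding comatrix_def
 proof (intro conjI ballI E(1))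
  fix a b assume ab: "a \<in> E" "b \<in> E"
  show "\<Delta> (A a b) = (SUM k:E. A a k \<otimes> A k b)"
  proof (rule \<Delta>_eqI)
   fix \<beta> assume \<beta>: "bilinear_map scale scale (*) \<beta>"
   let ?\<phi> = "\<lambda>v g h. d a v * \<beta> g h"
   have \<phi>: "bilinear_map scale scale (*) (?\<phi> v)" "lin sV (*) (\<lambda>v. ?\<phi> v g h)" for v g h
    using \<beta> d(1) by (auto simp: bilinear_map_def intro: lin_mult_left lin_mult_right)
   have b1: "bilinear_on sV scale (*) V UNIV (\<lambda>v0 h1. d a v0 * \<beta> h1 h2)" for h2
    using \<beta> d(1) by (intro bilinear_on_if_bilinear_map bilinear_mapI lin_mult_left lin_mult_right)
     (auto simp: bilinear_map_def)
   have b2: "bilinear_on sV scale (*) V UNIV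
     (\<lambda>x h2. SUM (v0, h1)<-coact sV V \<rho> x. d a v0 * \<beta> h1 h2)"
    unfolding bilinear_on_def
   proof (intro conjI ballI)
    fix x
    have "lin scale (*) (\<lambda>h2. SUM (v0, h1)<-coact sV V \<rho> x. d a v0 * \<beta> h1 h2)"
     unfolding split_def using \<beta>
     by (intro lin_sum_list_fun vs vector_space_mult lin_mult_left) (auto simp: bilinear_map_def)
    then show "linear_on scale (*) UNIV (\<lambda>h2. SUM (v0, h1)<-coact sV V \<rho> x. d a v0 * \<beta> h1 h2)"
     by (auto simp: linear_on_def Vector_Spaces.linear_iff)
   qed (rule coact_linear_on[OF \<rho> vector_space_mult b1])
   have b3: "bilinear_on sV scale (*) V UNIV (\<lambda>v0 h. \<Delta> h (?\<phi> v0))"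
   proof -
    have "\<Delta> h (?\<phi> v0) = d a v0 * \<Delta> h \<beta>" for v0 h
     by (rule tensor_form_plus(2)[OF \<Delta>_tensor \<beta> \<beta>])
    moreover have "lin scale (*) (\<lambda>h. \<Delta> h \<beta>)"
     using \<Delta>_linear by (auto simp: Vector_Spaces.linear_iff pointwise_scale_def vector_space_mult)
    ultimately show ?thesis using d(1)
     by (auto intro!: bilinear_on_if_bilinear_map bilinear_mapI lin_mult_left lin_mult_right)
   qed
   have "\<Delta> (A a b) \<beta> = (SUM c:E. \<Delta> (A c b) (?\<phi> c))"
   proof -
    have "(SUM c:E. \<Delta> (A c b) (?\<phi> c)) = (SUM c:E. d a c * \<Delta> (A c b) \<beta>)"
     by (rule sum.cong[OF refl], rule tensor_form_plus(2)[OF \<Delta>_tensor \<beta> \<beta>])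
    also have "\<dots> = (SUM c:E. if c = a then \<Delta> (A c b) \<beta> else 0)"
     by (intro sum.cong refl) (simp add: d(2)[OF ab(1)])
    finally have "(SUM c:E. \<Delta> (A c b) (?\<phi> c)) = (SUM c:E. if c = a then \<Delta> (A c b) \<beta> else 0)" .
    then show ?thesis using ab E by simp
   qed
   also have "\<dots> = (SUM (v0, h)<-coact sV V \<rho> b. \<Delta> h (?\<phi> v0))"
    by (rule coact_b[OF ab(2) vector_space_mult b3, symmetric])
   also have "\<dots> = (SUM (x, h2)<-coact sV V \<rho> b. SUM (v0, h1)<-coact sV V \<rho> x. ?\<phi> v0 h1 h2)"
    by (rule coassoc_form[OF \<rho> EV[OF ab(2)] \<phi>, symmetric])
   also have "\<dots> = (SUM c:E. SUM (v0, h1)<-coact sV V \<rho> c. ?\<phi> v0 h1 (A c b))"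
    by (rule coact_b[OF ab(2) vector_space_mult b2])
   also have "\<dots> = (SUM c:E. SUM e:E. d a e * \<beta> (A e c) (A c b))"
    by (intro sum.cong refl coact_b[OF _ vector_space_mult b1])
   also have "\<dots> = (SUM c:E. SUM e:E. if e = a then \<beta> (A e c) (A c b) else 0)"
    using d(2)[OF ab(1)] by (intro sum.cong) auto
   also have "\<dots> = (SUM c:E. \<beta> (A a c) (A c b))" using E(1) ab by simp
   finally show "\<Delta> (A a b) \<beta> = (SUM c:E. \<beta> (A a c) (A c b))" .
  qed
  have "bilinear_on sV scale sV V UNIV (\<lambda>v0 h. sV (\<epsilon> h) v0)"
   by (intro bilinear_on_if_bilinear_map bilinear_mapI lin_scale_fun[OF \<epsilon>_linear V(1)] lin_scale_const lin_id V(1))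
  from coact_b[OF ab(2) V(1) this] have "b = (SUM c:E. sV (\<epsilon> (A c b)) c)"
   using V(5)[OF EV[OF ab(2)]] by simp
  then have "d a b = d a (SUM c:E. sV (\<epsilon> (A c b)) c)" by (rule arg_cong)
  also have "\<dots> = (SUM c:E. \<epsilon> (A c b) * d a c)"
   unfolding lin_sum[OF d(1)] lin_scale[OF d(1)] ..
  also have "\<dots> = (SUM c:E. if c = a then \<epsilon> (A c b) else 0)"
   using d(2)[OF ab(1)] by (intro sum.cong) auto
  finally show "\<epsilon> (A a b) = (if a = b then 1 else 0)" using ab E d(2) by simp
 qed
 from this \<rho>A show ?thesis by (rule that)
qed

text \<open>The finiteness theorem for comodules: writing \<open>\<rho>(v) = \<Sum>\<^sub>h x\<^sub>h \<otimes> h\<close> with linearly independent \<open>h\<close>,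
 coassociativity shows that the span of the \<open>x\<^sub>h\<close> is a subcomodule; it contains \<open>v\<close> by the counit axiom.\<close>
lemma cyclic_subcomodule:
 assumes \<rho>: "right_comodule sV V \<rho>" and v: "v \<in> V"
 obtains W X where "right_comodule sV W \<rho>" "W \<subseteq> V" "v \<in> W" "finite X" "W = module.span sV X"
  "\<And>w. w \<in> W \<Longrightarrow> \<exists>f. lin scale (*) f \<and> w = (SUM (v0, h)<-coact sV V \<rho> v. sV (f h) v0)"
proof -
 note V = comoduleD[OF \<rho>]
 interpret V: vector_space sV by (rule V)
 obtain B x where B: "finite B" "independent B" and x: "\<And>h. x h \<in> V" "\<rho> v = (SUM h:B. tensor sV scale (x h) h)"
  by (rule tensor_independent_repr[OF V(1,2) vs V(4)[OF v]], rule that)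
 obtain d where d: "\<And>b. lin scale (*) (d b)" "\<And>a b. a \<in> B \<Longrightarrow> d b a = (if a = b then 1 else 0)"
  by (rule dual_basis_exists[OF vs B(2)]) blast
 have coact_v: "(SUM (v0, h)<-coact sV V \<rho> v. F v0 h) = (SUM h:B. F (x h) h)"
  if "vector_space sU" "bilinear_on sV scale sU V UNIV F" for sU and F :: "_ \<Rightarrow> _ \<Rightarrow> 'z::ab_group_add"
  by (rule coact_eq[OF \<rho> v that]) (use x in auto)
 define W where "W = V.span (x ` B)"
 have WV: "W \<subseteq> V" unfolding W_def by (intro V.span_minimal V(2)) (use x in auto)
 have W: "V.subspace W" unfolding W_def by simp
 define g where "g b a = (SUM (h1, h2)<-sweedler b. d a h2 *s h1)" for a b
 have \<rho>x: "\<rho> (x a) = (SUM b:B. tensor sV scale (x b) (g b a))" if a: "a \<in> B" for a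
 proof (rule tensor_eqI[OF V(4)[OF x(1)] sum_tensor_in_space[where V=V and W=UNIV]])
  fix \<beta> assume \<beta>: "bilinear_map sV scale (*) \<beta>"
  let ?\<phi> = "\<lambda>v h1 h2. \<beta> v h1 * d a h2"
  have \<phi>: "bilinear_map scale scale (*) (?\<phi> v)" "lin sV (*) (\<lambda>v. ?\<phi> v h1 h2)" for v h1 h2
   using \<beta> d(1) by (auto simp: bilinear_map_def intro: lin_mult_left lin_mult_right)
  have b1: "bilinear_on sV scale (*) V UNIV (\<lambda>v0 h. \<Delta> h (?\<phi> v0))"
  proof (rule bilinear_on_if_bilinear_map, rule bilinear_mapI)
   show "lin scale (*) (\<lambda>h. \<Delta> h (?\<phi> v0))" for v0
    using \<Delta>_linear by (auto simp: Vector_Spaces.linear_iff pointwise_scale_def vector_space_mult)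
   show "lin sV (*) (\<lambda>v0. \<Delta> h (?\<phi> v0))" for h
    unfolding sweedler_form[OF \<phi>(1), symmetric] split_def using \<phi>(2)
    by (intro lin_sum_list_fun V vector_space_mult) auto
  qed
  have b2: "bilinear_on sV scale (*) V UNIV (\<lambda>x h2. \<rho> x \<beta> * d a h2)"
   using V(3) lin_mult_left[OF d(1)]
   by (auto simp: bilinear_on_def linear_on_def Vector_Spaces.linear_iff pointwise_scale_def algebra_simps)
  have "\<rho> (x a) \<beta> = (SUM b:B. if b = a then \<rho> (x b) \<beta> else 0)" using a B by simp
  also have "\<dots> = (SUM b:B. \<rho> (x b) \<beta> * d a b)" using d(2) by (intro sum.cong) auto
  also have "\<dots> = (SUM (x, h2)<-coact sV V \<rho> v. \<rho> x \<beta> * d a h2)"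
   by (rule coact_v[OF vector_space_mult b2, symmetric])
  also have "\<dots> = (SUM (x, h2)<-coact sV V \<rho> v. SUM (v0, h1)<-coact sV V \<rho> x. ?\<phi> v0 h1 h2)"
  proof (rule sum_list_pair_cong)
   fix y h assume "(y, h) \<in> set (coact sV V \<rho> v)"
   then have "y \<in> V" using coact_subset[OF \<rho> v] by auto
   have "\<rho> y \<beta> = (SUM (v0, h1)<-coact sV V \<rho> y. \<beta> v0 h1)"
    by (rule coact_form[OF \<rho> \<open>y \<in> V\<close> \<beta>, symmetric])
   then show "\<rho> y \<beta> * d a h = (SUM (v0, h1)<-coact sV V \<rho> y. \<beta> v0 h1 * d a h)"
    by (simp add: sum_list_mult_const split_def)
  qed
  also have "\<dots> = (SUM (v0, h)<-coact sV V \<rho> v. \<Delta> h (?\<phi> v0))" by (rule coassoc_form[OF \<rho> v \<phi>])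
  also have "\<dots> = (SUM b:B. \<Delta> b (?\<phi> (x b)))" by (rule coact_v[OF vector_space_mult b1])
  also have "\<dots> = (SUM b:B. \<beta> (x b) (g b a))"
  proof -
   have "\<Delta> b (?\<phi> (x b)) = \<beta> (x b) (g b a)" for b
    unfolding sweedler_form[OF \<phi>(1), symmetric] g_def split_def
     lin_sum_list[OF bilinear_right[OF \<beta>]] lin_scale[OF bilinear_right[OF \<beta>]]
    by (simp only: mult.commute)
   then show ?thesis by simp
  qed
  finally show "\<rho> (x a) \<beta> = (SUM b:B. tensor sV scale (x b) (g b a)) \<beta>"
   by (simp add: sum_apply tensor_apply[OF \<beta>])
 qed (use x in auto)
 have "w \<in> V.span (x ` B) \<and> \<rho> w \<in> tensor_space sV scale W UNIV" if "w \<in> V.span (x ` B)" for w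
  using that
 proof (induction rule: V.span_induct_alt)
  case base
  interpret T: vector_space "tscale :: 'a \<Rightarrow> ('c, 'b, 'a) tensor \<Rightarrow> _" by (rule vector_space_tscale)
  have "\<rho> 0 = \<rho> (sV 0 v)" by simp
  also have "\<dots> = tscale 0 (\<rho> v)" using V(3) v unfolding linear_on_def by blast
  also have "\<dots> = 0" by (rule T.scale_zero_left)
  finally show ?case using T.subspace_0[OF subspace_tensor_space] V.span_zero by (simp only: simp_thms)
 next
  case (step c y z)
  interpret T: vector_space "tscale :: 'a \<Rightarrow> ('c, 'b, 'a) tensor \<Rightarrow> _" by (rule vector_space_tscale)
  obtain a where a: "a \<in> B" "y = x a" using step by auto
  have yz: "y \<in> V" "z \<in> V" using a x step(2) WV unfolding W_def by auto
  then have "\<rho> (sV c y + z) = tscale c (\<rho> y) + \<rho> z"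
   using V(3) V.subspace_scale[OF V(2)] unfolding linear_on_def by metis
  moreover have "\<rho> y \<in> tensor_space sV scale W UNIV"
   unfolding a(2) \<rho>x[OF a(1)] W_def by (intro sum_tensor_in_space) (auto intro: V.span_base)
  then have "tscale c (\<rho> y) + \<rho> z \<in> tensor_space sV scale W UNIV"
   using step(2) by (intro T.subspace_add T.subspace_scale subspace_tensor_space) auto
  moreover have "sV c y + z \<in> V.span (x ` B)"
   using V.span_add[OF V.span_scale[OF V.span_base[OF step(1)]]] step(2) by blast
  ultimately show ?case by (simp only: simp_thms)
 qed
 then have \<rho>W: "\<rho> w \<in> tensor_space sV scale W UNIV" if "w \<in> W" for w
  using that by (simp only: W_def)
 have bs: "bilinear_on sV scale sV V UNIV (\<lambda>v0 h. sV (f h) v0)" if "lin scale (*) f" for f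
  by (intro bilinear_on_if_bilinear_map bilinear_mapI lin_scale_fun[OF that V(1)] lin_scale_const lin_id V(1))
 have "v = (SUM h:B. sV (\<epsilon> h) (x h))"
  using V(5)[OF v] coact_v[OF V(1) bs[OF \<epsilon>_linear]] by simp
 moreover have "(SUM h:B. sV (\<epsilon> h) (x h)) \<in> W"
  unfolding W_def by (intro V.span_sum V.span_scale V.span_base imageI)
 ultimately have vW: "v \<in> W" by simp
 have cyc: "\<exists>f. lin scale (*) f \<and> w = (SUM (v0, h)<-coact sV V \<rho> v. sV (f h) v0)" if "w \<in> W" for w
 proof -
  have "\<exists>u. w = (SUM h:B. sV (u h) (x h))"
   using that unfolding W_def
  proof (induction rule: V.span_induct_alt)
   case base
   show ?case by (rule exI[of _ "\<lambda>_. 0"]) simp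
  next
   case (step c y z)
   then obtain a u where a: "a \<in> B" "y = x a" and u: "z = (SUM h:B. sV (u h) (x h))" by auto
   have "(SUM h:B. sV ((if h = a then c else 0) + u h) (x h)) = (SUM h:B. (if h = a then sV c (x h) else 0) + sV (u h) (x h))"
    by (rule sum.cong) (auto simp: V.scale_left_distrib)
   also have "\<dots> = sV c y + z" using a B u by (simp add: sum.distrib)
   finally show ?case by metis
  qed
  then obtain u where u: "w = (SUM h:B. sV (u h) (x h))" ..
  obtain f where f: "lin scale (*) f" "\<And>h. h \<in> B \<Longrightarrow> f h = u h"
   by (rule lin_extend_independent[OF vs vector_space_mult B(2), where f=u]) (rule that)
  have "w = (SUM h:B. sV (f h) (x h))" using u f by simp
  then show ?thesis using coact_v[OF V(1) bs[OF f(1)]] f(1) by auto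
 qed
 show ?thesis
  by (rule that[of W "x ` B"]) (use subcomodule[OF \<rho> W WV \<rho>W] WV vW B cyc W_def in auto)
qed

text \<open>Hence every element of \<open>H\<close> is a linear combination of entries of comatrices, and multilinear
 identities on \<open>H\<close> only need to be checked there.\<close>
lemma in_span_comatrix:
 obtains R :: "'b set" and A where "comatrix R A" "h \<in> span {A i j | i j. i \<in> R \<and> j \<in> R}"
proof -
 obtain W X where W: "right_comodule scale W \<Delta>" "h \<in> W" "finite X" "W = span X"
  by (rule cyclic_subcomodule[OF right_comodule_self UNIV_I, of h]) blast
 obtain E where E: "E \<subseteq> X" "independent E" "X \<subseteq> span E" by (rule maximal_independent_subset)
 have sp: "W = span E" using E W by (simp add: span_eq) (meson span_superset order_trans)
 have "finite E" using E W finite_subset by auto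
 from comodule_comatrix[OF W(1) this E(2) sp] obtain A where A: "comatrix E A"
  "\<And>b. b \<in> E \<Longrightarrow> \<Delta> b = (SUM a:E. a \<otimes> A a b)" by metis
 let ?S = "span {A i j | i j. i \<in> E \<and> j \<in> E}"
 have "bilinear_map scale scale scale (\<lambda>a1 a2. \<epsilon> a1 *s a2)"
  by (intro bilinear_mapI lin_scale_const lin_id vs lin_scale_fun \<epsilon>_linear)
 then have eq: "b = (SUM a:E. \<epsilon> a *s A a b)" if "b \<in> E" for b
  using counit_left[of b] sweedler_eq[OF vs _ A(2)[OF that]] by simp
 have "b \<in> ?S" if "b \<in> E" for b
  by (subst eq[OF that], intro span_sum span_scale span_base) (use that in blast)
 then have "W \<subseteq> ?S" unfolding sp by (intro span_minimal subspace_span) auto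
 then show ?thesis using that A(1) W(2) by blast
qed

lemma lin_eq_if_comatrix:
 assumes "lin scale sU f" "lin scale sU g"
  and "\<And>R A i j. comatrix (R :: 'b set) A \<Longrightarrow> i \<in> R \<Longrightarrow> j \<in> R \<Longrightarrow> f (A i j) = g (A i j)"
 shows "f h = g h"
proof -
 obtain R :: "'b set" and A where A: "comatrix R A" "h \<in> span {A i j | i j. i \<in> R \<and> j \<in> R}"
  by (rule in_span_comatrix)
 interpret vector_space_pair scale sU using lin_vs[OF assms(1)] by (simp add: vector_space_pair_def)
 show ?thesis by (rule linear_eq_on[OF assms(1,2) A(2)]) (use assms(3)[OF A(1)] in auto)
qed

text \<open>A simple comodule is spanned by the elements \<open>f(v\<^sub>1) v\<^sub>0\<close> for any of its nonzero elements \<open>v\<close>, so it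
 is finite-dimensional and given by an irreducible comatrix.\<close>
lemma simple_comodule_comatrix:
 assumes S: "simple_right_comodule sV V \<rho>"
 obtains E A where "V = module.span sV E" "\<not> module.dependent sV E" "irreducible_comatrix E A"
  "\<And>b. b \<in> E \<Longrightarrow> \<rho> b = (SUM a:E. tensor sV scale a (A a b))"
proof -
 have \<rho>: "right_comodule sV V \<rho>" and ne: "V \<noteq> {0}"
  and simple: "\<And>W. W \<subseteq> V \<Longrightarrow> right_comodule sV W \<rho> \<Longrightarrow> W = {0} \<or> W = V"
  using S unfolding simple_right_comodule_def by auto
 note V = comoduleD[OF \<rho>]
 interpret V: vector_space sV by (rule V)
 have cyc: "\<exists>X. finite X \<and> V = V.span X \<and> (\<forall>w\<in>V. \<exists>f. lin scale (*) f \<and> w = (SUM (v0, h)<-coact sV V \<rho> v. sV (f h) v0))"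
  if "v \<in> V" "v \<noteq> 0" for v
 proof (rule cyclic_subcomodule[OF \<rho> that(1)])
  fix W X
  assume W: "right_comodule sV W \<rho>" "W \<subseteq> V" "v \<in> W" "finite X" "W = V.span X"
   and *: "\<And>w. w \<in> W \<Longrightarrow> \<exists>f. lin scale (*) f \<and> w = (SUM (v0, h)<-coact sV V \<rho> v. sV (f h) v0)"
  have "W = V" using simple[OF W(2,1)] W(3) that(2) by auto
  then have "finite X \<and> V = V.span X \<and> (\<forall>w\<in>V. \<exists>f. lin scale (*) f \<and> w = (SUM (v0, h)<-coact sV V \<rho> v. sV (f h) v0))"
   using W(4,5) * by simp
  then show ?thesis by (rule exI)
 qed
 obtain v where "v \<in> V" "v \<noteq> 0" using ne V.subspace_0[OF V(2)] by blast
 with cyc obtain X where X: "finite X" "V = V.span X" by blast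
 obtain E where E: "E \<subseteq> X" "V.independent E" "X \<subseteq> V.span E" by (rule V.maximal_independent_subset)
 have sp: "V = V.span E" using E X by (metis V.span_mono V.span_span subset_antisym)
 have fin: "finite E" using E X finite_subset by auto
 have "E \<noteq> {}" using ne sp by auto
 obtain A where A: "comatrix E A" "\<And>b. b \<in> E \<Longrightarrow> \<rho> b = (SUM a:E. tensor sV scale a (A a b))"
  by (rule comodule_comatrix[OF \<rho> fin E(2) sp]) blast
 obtain d where d: "\<And>a. lin sV (*) (d a)"
  "\<And>a b. a \<in> E \<Longrightarrow> b \<in> E \<Longrightarrow> d a b = (if a = b then 1 else 0)"
  by (rule finite_basis_dual[OF V(1) fin E(2) sp]) blast
 have dsum: "d a (SUM b:E. sV (x b) b) = x a" if "a \<in> E" for a x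
 proof -
  have "d a (SUM b:E. sV (x b) b) = (SUM b:E. if b = a then x b else 0)"
   unfolding lin_sum[OF d(1)] lin_scale[OF d(1)] using d(2)[OF that] by (intro sum.cong) auto
  then show ?thesis using fin that by simp
 qed
 have EV: "a \<in> V" if "a \<in> E" for a using that sp V.span_base by auto
 have inV: "(SUM b:E. sV (x b) b) \<in> V" for x
  by (intro V.subspace_sum V.subspace_scale V(2) EV)
 have irr: "irreducible_comatrix E A" unfolding irreducible_comatrix_def
 proof (intro conjI allI impI A(1) \<open>E \<noteq> {}\<close>)
  fix x y :: "'c \<Rightarrow> 'a" assume "\<exists>j\<in>E. x j \<noteq> 0"
  let ?v = "SUM b:E. sV (x b) b" and ?w = "SUM b:E. sV (y b) b"
  have "?v \<noteq> 0" using \<open>\<exists>j\<in>E. x j \<noteq> 0\<close> dsum lin_zero[OF d(1)] by metis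
  then obtain f where f: "lin scale (*) f" "?w = (SUM (v0, h)<-coact sV V \<rho> ?v. sV (f h) v0)"
   using cyc[OF inV] inV by blast
  have bs: "bilinear_on sV scale sV V UNIV (\<lambda>v0 h. sV (f h) v0)"
   by (intro bilinear_on_if_bilinear_map bilinear_mapI lin_scale_fun[OF f(1) V(1)] lin_scale_const lin_id V(1))
  let ?F = "\<lambda>v. SUM (v0, h)<-coact sV V \<rho> v. sV (f h) v0"
  have lin: "linear_on sV sV V ?F" by (rule coact_linear_on[OF \<rho> V(1) bs])
  have F0: "?F 0 = 0"
  proof -
   have "?F (sV 0 0) = sV 0 (?F 0)" using lin V.subspace_0[OF V(2)] unfolding linear_on_def by blast
   then show ?thesis by simp
  qed
  have add: "\<And>a b. a \<in> V \<Longrightarrow> b \<in> V \<Longrightarrow> ?F (a + b) = ?F a + ?F b"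
   and scal: "\<And>a c. a \<in> V \<Longrightarrow> ?F (sV c a) = sV c (?F a)"
   using lin by (simp_all only: linear_on_def)
  have "?F (SUM b:E'. sV (x b) b) = (SUM b:E'. sV (x b) (?F b))" if "E' \<subseteq> E" for E'
  proof -
   have "finite E'" using that fin finite_subset by auto
   then show ?thesis using that
   proof (induction E')
    case empty
    then show ?case using F0 by simp
   next
    case (insert b E')
    have "sV (x b) b \<in> V" "b \<in> V" "(SUM b:E'. sV (x b) b) \<in> V"
     using insert EV by (auto intro!: V.subspace_sum V.subspace_scale V(2))
    from add[OF this(1,3)] scal[OF this(2), of "x b"]
    show ?case using insert by (simp only: sum.insert insert_subset simp_thms)
   qed
  qed
  from this[OF order_refl] have "?w = (SUM b:E. sV (x b) (?F b))" using f(2) by simp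
  also have "\<dots> = (SUM b:E. sV (x b) (SUM a:E. sV (f (A a b)) a))"
   by (intro sum.cong refl arg_cong[where f="sV _"] coact_eq[OF \<rho> EV V(1) bs EV A(2)])
  also have "\<dots> = (SUM a:E. sV (SUM b:E. f (A a b) * x b) a)"
   unfolding V.scale_sum_right V.scale_sum_left V.scale_scale by (subst sum.swap) (simp add: mult.commute)
  finally have "y a = (SUM b:E. f (A a b) * x b)" if "a \<in> E" for a
   using dsum[OF that, of y] dsum[OF that, of "\<lambda>a. SUM b:E. f (A a b) * x b"] by simp
  then show "\<exists>f. lin scale (*) f \<and> (\<forall>i\<in>E. y i = (SUM j:E. f (A i j) * x j))"
   using f(1) by (intro exI[of _ f]) simp
 qed
 show ?thesis by (rule that[OF sp E(2) irr A(2)])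
qed

end

section \<open>Schur's lemma and linear independence of matrix coefficients\<close>

lemma sum_delta_mult:
 assumes "finite R" "r \<in> R"
 shows "(SUM i:R. (if i = r then 1 else 0) * x i) = (x r :: 'k::field)"
  "(SUM i:R. (if r = i then 1 else 0) * x i) = x r"
  "(SUM i:R. x i * (if i = r then 1 else 0)) = x r"
  "(SUM i:R. x i * (if r = i then 1 else 0)) = x r"
  "(SUM i:R. (if r = i then c else 0) * x i) = c * x r"
  "(SUM i:R. x i * (if i = r then c else 0)) = x r * c"
 using assms by (simp_all add: if_distrib if_distribR cong: if_cong)

text \<open>Gaussian elimination.\<close>
lemma homogeneous_system:
 fixes s :: "'t \<Rightarrow> 'r \<Rightarrow> 'k::field"
 assumes "finite T" "finite R" "card T < card R"
 shows "\<exists>x. (\<exists>r\<in>R. x r \<noteq> 0) \<and> (\<forall>t\<in>T. (SUM r:R. s t r * x r) = 0)"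
 using assms
proof (induction T arbitrary: R s)
 case empty
 then obtain r where "r \<in> R" by fastforce
 then show ?case by (intro exI[of _ "\<lambda>_. 1"]) auto
next
 case (insert t0 T)
 show ?case
 proof (cases "\<forall>r\<in>R. s t0 r = 0")
  case True
  obtain x where "(\<exists>r\<in>R. x r \<noteq> 0)" "\<forall>t\<in>T. (SUM r:R. s t r * x r) = 0"
   using insert.IH[of R s] insert.prems insert.hyps by (auto dest: Suc_lessD)
  then show ?thesis using True by (intro exI[of _ x]) auto
 next
  case False
  then obtain r0 where r0: "r0 \<in> R" "s t0 r0 \<noteq> 0" by auto
  let ?R = "R - {r0}"
  have "card T < card ?R" using insert r0 by simp
  from insert.IH[OF _ this, of "\<lambda>t r. s t r - s t r0 * s t0 r / s t0 r0"]
  obtain x where x: "\<exists>r\<in>?R. x r \<noteq> 0"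
   "\<And>t. t \<in> T \<Longrightarrow> (SUM r:?R. (s t r - s t r0 * s t0 r / s t0 r0) * x r) = 0"
   using insert by auto
  define c where "c = - (SUM r:?R. s t0 r * x r) / s t0 r0"
  define y where "y = x(r0 := c)"
  have split: "(SUM r:R. s t r * y r) = s t r0 * c + (SUM r:?R. s t r * x r)" for t
   using r0 insert.prems(1) by (simp add: sum.remove y_def)
  have "(SUM r:R. s t r * y r) = 0" if "t \<in> insert t0 T" for t
  proof (cases "t = t0")
   case True
   then show ?thesis using r0 unfolding split c_def by simp
  next
   case False
   have "(SUM r:?R. (s t r - s t r0 * s t0 r / s t0 r0) * x r) =
    (SUM r:?R. s t r * x r) - s t r0 * ((SUM r:?R. s t0 r * x r) / s t0 r0)"
    by (simp add: sum_subtractf sum_distrib_left sum_divide_distrib algebra_simps)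
   then show ?thesis using x(2)[of t] that False unfolding split c_def by simp
  qed
  moreover have "\<exists>r\<in>R. y r \<noteq> 0" using x(1) unfolding y_def by auto
  ultimately show ?thesis by blast
 qed
qed

lemma card_le_if_injective_matrix:
 fixes s :: "'t \<Rightarrow> 'r \<Rightarrow> 'k::field"
 assumes "finite T" "finite R"
  and "\<And>x. (\<And>t. t \<in> T \<Longrightarrow> (SUM r:R. s t r * x r) = 0) \<Longrightarrow> (\<forall>r\<in>R. x r = 0)"
 shows "card R \<le> card T"
 using homogeneous_system[OF assms(1,2), of s] assms(3) by (meson not_le)

text \<open>Solving \<open>A y = e\<close> for a unit vector \<open>e\<close>: the extended matrix
 \<open>(A, - e)\<close> has more columns than rows, and injectivity of \<open>A\<close> makes the
 last coordinate of a kernel vector nonzero.\<close>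
lemma square_injective_inverse:
 fixes A :: "'t \<Rightarrow> 'r \<Rightarrow> 'k::field"
 assumes fin: "finite T" "finite R" and card: "card T = card R"
  and inj: "\<And>x. (\<And>t. t \<in> T \<Longrightarrow> (SUM r:R. A t r * x r) = 0) \<Longrightarrow> \<forall>r\<in>R. x r = 0"
 obtains M where "\<And>t t'. t \<in> T \<Longrightarrow> t' \<in> T \<Longrightarrow> (SUM r:R. A t r * M r t') = (if t = t' then 1 else 0)"
  and "\<And>r r'. r \<in> R \<Longrightarrow> r' \<in> R \<Longrightarrow> (SUM t:T. M r t * A t r') = (if r = r' then 1 else 0)"
proof -
 have "\<exists>y. \<forall>t\<in>T. (SUM r:R. A t r * y r) = (if t = t' then 1 else 0)" if t': "t' \<in> T" for t'
 proof -
  let ?R = "insert None (Some ` R)"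
  let ?s = "\<lambda>t. case_option (if t = t' then - 1 else 0) (A t)"
  have "card T < card ?R" using fin card by (simp add: card_image)
  then obtain x where x: "\<exists>r\<in>?R. x r \<noteq> 0" "\<And>t. t \<in> T \<Longrightarrow> (SUM r:?R. ?s t r * x r) = 0"
   using homogeneous_system[of T ?R ?s] fin by auto
  have eq: "(SUM r:R. A t r * x (Some r)) = (if t = t' then x None else 0)" if "t \<in> T" for t
   using x(2)[OF that] fin by (auto simp: sum.reindex split: if_splits)
  have c: "x None \<noteq> 0"
  proof
   assume "x None = 0"
   then have "\<forall>r\<in>R. x (Some r) = 0" using eq by (intro inj) auto
   then show False using x(1) \<open>x None = 0\<close> by auto
  qed
  have "(SUM r:R. A t r * (x (Some r) / x None)) = (if t = t' then 1 else 0)" if "t \<in> T" for t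
  proof -
   have "(SUM r:R. A t r * (x (Some r) / x None)) = (SUM r:R. A t r * x (Some r)) / x None"
    by (simp add: sum_divide_distrib)
   then show ?thesis using eq[OF that] c by simp
  qed
  then show ?thesis by (intro exI[of _ "\<lambda>r. x (Some r) / x None"]) blast
 qed
 then obtain m where m: "\<And>t t'. t' \<in> T \<Longrightarrow> t \<in> T \<Longrightarrow> (SUM r:R. A t r * m t' r) = (if t = t' then 1 else 0)"
  by metis
 define M where "M r t = m t r" for r t
 have 1: "(SUM r:R. A t r * M r t') = (if t = t' then 1 else 0)" if "t \<in> T" "t' \<in> T" for t t'
  using m that by (simp add: M_def)
 have 2: "(SUM t:T. M r t * A t r') = (if r = r' then 1 else 0)" if r: "r \<in> R" "r' \<in> R" for r r'
 proof -
  have "(SUM r:R. A t r * ((SUM t:T. M r t * A t r') - (if r = r' then 1 else 0))) = 0" if t: "t \<in> T" for t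
  proof -
   have "(SUM r:R. A t r * (SUM t:T. M r t * A t r')) = (SUM t':T. (SUM r:R. A t r * M r t') * A t' r')"
    by (simp add: sum_distrib_left sum_distrib_right mult.assoc) (rule sum.swap)
   also have "\<dots> = (SUM t':T. (if t = t' then 1 else 0) * A t' r')" by (intro sum.cong refl) (simp add: 1[OF t])
   also have "\<dots> = A t r'" by (rule sum_delta_mult(2)[OF fin(1) t])
   finally show ?thesis by (simp add: right_diff_distrib sum_subtractf sum_delta_mult[OF fin(2) r(2)])
  qed
  from inj[OF this] r show ?thesis by auto
 qed
 show ?thesis by (rule that[of M]) (use 1 2 in auto)
qed

lemma eigenvector_exists:
 fixes M :: "'r \<Rightarrow> 'r \<Rightarrow> 'k::alg_closed_field"
 assumes "finite R" "R \<noteq> {}"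
 obtains c x where "\<exists>r\<in>R. x r \<noteq> 0" "\<And>r. r \<in> R \<Longrightarrow> (SUM r':R. M r r' * x r') = c * x r"
proof -
 obtain h where h: "bij_betw h {0..<card R} R" using ex_bij_betw_nat_finite[OF assms(1)] by blast
 let ?n = "card R"
 define A where "A = mat ?n ?n (\<lambda>(i, j). M (h i) (h j))"
 have A: "A \<in> carrier_mat ?n ?n" unfolding A_def by simp
 have "degree (char_poly A) > 0" using degree_monic_char_poly[OF A] assms by auto
 then obtain c where "poly (char_poly A) c = 0" using alg_closed_imp_poly_has_root by blast
 then have "eigenvalue A c" using eigenvalue_root_char_poly[OF A] by simp
 then obtain v where v: "v \<in> carrier_vec ?n" "v \<noteq> 0\<^sub>v ?n" "A *\<^sub>v v = c \<cdot>\<^sub>v v"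
  using A unfolding eigenvalue_def eigenvector_def by auto
 define x where "x r = v $ (the_inv_into {0..<?n} h r)" for r
 have inv: "the_inv_into {0..<?n} h (h i) = i" if "i < ?n" for i
  using h that by (simp add: bij_betw_def the_inv_into_f_f)
 have hR: "h i \<in> R" if "i < ?n" for i using h that by (auto simp: bij_betw_def)
 obtain i where "i < ?n" "v $ i \<noteq> 0" using v(1,2) by (metis carrier_vecD eq_vecI index_zero_vec)
 then have "\<exists>r\<in>R. x r \<noteq> 0" using inv hR unfolding x_def by force
 moreover have "(SUM r':R. M r r' * x r') = c * x r" if "r \<in> R" for r
 proof -
  obtain i where i: "i < ?n" "r = h i" using \<open>r \<in> R\<close> h unfolding bij_betw_def by force
  have "(SUM r':R. M r r' * x r') = (SUM j:{0..<?n}. M r (h j) * x (h j))"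
   by (rule sum.reindex_bij_betw[OF h, symmetric])
  also have "\<dots> = (SUM j:{0..<?n}. A $$ (i, j) * v $ j)"
   using i by (intro sum.cong) (auto simp: A_def x_def inv)
  also have "\<dots> = (A *\<^sub>v v) $ i" using i A v(1) by (auto simp: scalar_prod_def intro!: sum.cong)
  also have "\<dots> = c * x r" using v i by (simp add: x_def inv)
  finally show ?thesis .
 qed
 ultimately show ?thesis using that[of x c] by blast
qed

lemma independent_family_dual:
 assumes s: "vector_space (s :: 'k::field \<Rightarrow> _)" and "finite P"
  and ind: "\<And>x. (SUM p:P. s (x p) (z p)) = 0 \<Longrightarrow> \<forall>p\<in>P. x p = 0"
 obtains d where "\<And>p. lin s (*) (d p)" "\<And>p q. p \<in> P \<Longrightarrow> q \<in> P \<Longrightarrow> d p (z q) = (if p = q then 1 else 0)"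
proof -
 interpret vector_space s by fact
 have inj: "inj_on z P"
 proof (rule inj_onI, rule ccontr)
  fix p q assume pq: "p \<in> P" "q \<in> P" "z p = z q" "p \<noteq> q"
  let ?x = "\<lambda>r. if r = p then 1 else if r = q then - 1 else 0 :: 'k"
  have "(SUM r:P. s (?x r) (z r)) = (SUM r:{p, q}. s (?x r) (z r))"
   by (rule sum.mono_neutral_right) (use pq assms(2) in auto)
  also have "\<dots> = 0" using pq by simp
  finally show False using ind[of ?x] pq by auto
 qed
 have "independent (z ` P)"
 proof (rule independent_if_scalars_zero)
  fix f x assume f: "(SUM x:z ` P. s (f x) x) = 0" "x \<in> z ` P"
  have "(SUM p:P. s (f (z p)) (z p)) = 0" using f(1) by (simp add: sum.reindex[OF inj])
  then show "f x = 0" using ind[of "\<lambda>p. f (z p)"] f(2) by auto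
 qed (use assms in simp)
 then obtain d where d: "\<And>b. lin s (*) (d b)" "\<And>a b. a \<in> z ` P \<Longrightarrow> d b a = (if a = b then 1 else 0)"
  by (rule dual_basis_exists[OF s]) blast
 show ?thesis by (rule that[of "\<lambda>p. d (z p)"]) (use d inj in \<open>auto simp: inj_on_def\<close>)
qed

context coalgebra
begin

text \<open>The convolution product of linear forms, with \<open>\<Delta> a\<close> evaluated at a
 bilinear form.\<close>
definition conv :: "('b \<Rightarrow> 'a) \<Rightarrow> ('b \<Rightarrow> 'a) \<Rightarrow> 'b \<Rightarrow> 'a" where
 "conv f g = (\<lambda>a. \<Delta> a (\<lambda>x y. f x * g y))"

lemma lin_\<Delta>_form: "lin scale (*) (\<lambda>a. \<Delta> a b)"
 using \<Delta>_linear by (auto simp: Vector_Spaces.linear_iff pointwise_scale_def vector_space_mult)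

lemma lin_conv: "lin scale (*) (conv f g)"
 unfolding conv_def by (rule lin_\<Delta>_form)

lemma conv_comatrix:
 assumes "comatrix R A" "i \<in> R" "j \<in> R" "lin scale (*) f" "lin scale (*) g"
 shows "conv f g (A i j) = (SUM k:R. f (A i k) * g (A k j))"
 unfolding conv_def
 by (simp add: comatrixD(2)[OF assms(1-3)] sum_apply tensor_apply[OF bilinear_form_functionals[OF assms(4,5)]])

text \<open>\<open>\<Lambda>A = B\<Lambda>\<close>: a homomorphism from the comodule of \<open>A\<close> to that of \<open>B\<close>.\<close>
definition comatrix_hom ::
 "'r set \<Rightarrow> ('r \<Rightarrow> 'r \<Rightarrow> 'b) \<Rightarrow> 't set \<Rightarrow> ('t \<Rightarrow> 't \<Rightarrow> 'b) \<Rightarrow> ('t \<Rightarrow> 'r \<Rightarrow> 'a) \<Rightarrow> bool" where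
 "comatrix_hom R A T B \<Lambda> \<longleftrightarrow>
   (\<forall>t\<in>T. \<forall>r\<in>R. (SUM r':R. \<Lambda> t r' *s A r' r) = (SUM t':T. \<Lambda> t' r *s B t t'))"

lemma comatrix_homD:
 "comatrix_hom R A T B \<Lambda> \<Longrightarrow> t \<in> T \<Longrightarrow> r \<in> R \<Longrightarrow>
  (SUM r':R. \<Lambda> t r' *s A r' r) = (SUM t':T. \<Lambda> t' r *s B t t')"
 by (simp add: comatrix_hom_def)

lemma comatrix_hom_functional:
 assumes "comatrix_hom R A T B \<Lambda>" "lin scale (*) f" "t \<in> T" "r \<in> R"
 shows "(SUM r':R. \<Lambda> t r' * f (A r' r)) = (SUM t':T. f (B t t') * \<Lambda> t' r)"
 using arg_cong[OF comatrix_homD[OF assms(1,3,4)], of f]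
 by (simp add: lin_sum[OF assms(2)] lin_scale[OF assms(2)] mult.commute)

lemma comatrix_homI:
 assumes "\<And>f t r. lin scale (*) f \<Longrightarrow> t \<in> T \<Longrightarrow> r \<in> R \<Longrightarrow>
  (SUM r':R. \<Lambda> t r' * f (A r' r)) = (SUM t':T. f (B t t') * \<Lambda> t' r)"
 shows "comatrix_hom R A T B \<Lambda>"
 unfolding comatrix_hom_def
proof (intro ballI functionals_separate[OF vs])
 fix t r f assume "t \<in> T" "r \<in> R" "lin scale (*) f"
 then show "f (SUM r':R. \<Lambda> t r' *s A r' r) = f (SUM t':T. \<Lambda> t' r *s B t t')"
  using assms[of f t r] by (simp add: lin_sum lin_scale[of _ _ f] mult.commute)
qed

lemma comatrix_hom_compose:
 assumes "comatrix_hom R A T B \<Lambda>" "comatrix_hom T B U C M"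
 shows "comatrix_hom R A U C (\<lambda>u r. SUM t:T. M u t * \<Lambda> t r)"
proof (rule comatrix_homI)
 fix f u r assume f: "lin scale (*) f" and u: "u \<in> U" and r: "r \<in> R"
 have "(SUM r':R. (SUM t:T. M u t * \<Lambda> t r') * f (A r' r)) = (SUM t:T. M u t * (SUM r':R. \<Lambda> t r' * f (A r' r)))"
  by (simp add: sum_distrib_left sum_distrib_right mult.assoc) (rule sum.swap)
 also have "\<dots> = (SUM t:T. M u t * (SUM t':T. f (B t t') * \<Lambda> t' r))"
  by (intro sum.cong refl) (simp add: comatrix_hom_functional[OF assms(1) f _ r])
 also have "\<dots> = (SUM t':T. (SUM t:T. M u t * f (B t t')) * \<Lambda> t' r)"
  by (simp add: sum_distrib_left sum_distrib_right mult.assoc) (rule sum.swap)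
 also have "\<dots> = (SUM t':T. (SUM u':U. f (C u u') * M u' t') * \<Lambda> t' r)"
  by (intro sum.cong refl) (simp add: comatrix_hom_functional[OF assms(2) f u])
 also have "\<dots> = (SUM u':U. f (C u u') * (SUM t:T. M u' t * \<Lambda> t r))"
  by (simp add: sum_distrib_left sum_distrib_right mult.assoc) (rule sum.swap)
 finally show "(SUM r':R. (SUM t:T. M u t * \<Lambda> t r') * f (A r' r)) =
  (SUM u':U. f (C u u') * (SUM t:T. M u' t * \<Lambda> t r))" .
qed

lemma inverse_hom:
 assumes fin: "finite R" "finite T" and \<Lambda>: "comatrix_hom R A T B \<Lambda>"
  and \<Lambda>M: "\<And>t t'. t \<in> T \<Longrightarrow> t' \<in> T \<Longrightarrow> (SUM r:R. \<Lambda> t r * M r t') = (if t = t' then 1 else 0)"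
  and M\<Lambda>: "\<And>r r'. r \<in> R \<Longrightarrow> r' \<in> R \<Longrightarrow> (SUM t:T. M r t * \<Lambda> t r') = (if r = r' then 1 else 0)"
 shows "comatrix_hom T B R A M"
proof (rule comatrix_homI)
 fix f r t assume f: "lin scale (*) f" and r: "r \<in> R" and t: "t \<in> T"
 have "(SUM t':T. M r t' * f (B t' t)) = (SUM t':T. M r t' * (SUM t'':T. f (B t' t'') * (SUM r':R. \<Lambda> t'' r' * M r' t)))"
  by (simp add: \<Lambda>M fin t if_distrib cong: sum.cong if_cong)
 also have "\<dots> = (SUM t':T. M r t' * (SUM r':R. (SUM t'':T. f (B t' t'') * \<Lambda> t'' r') * M r' t))"
  by (rule sum.cong[OF refl], rule arg_cong[where f="(*) _"])
   (simp add: sum_distrib_left sum_distrib_right mult.assoc, rule sum.swap)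
 also have "\<dots> = (SUM t':T. M r t' * (SUM r':R. (SUM r'':R. \<Lambda> t' r'' * f (A r'' r')) * M r' t))"
  by (intro sum.cong refl arg_cong[where f="(*) _"] arg_cong[where f="\<lambda>x. x * _"]
    comatrix_hom_functional[OF \<Lambda> f, symmetric])
 also have "\<dots> = (SUM t':T. M r t' * (SUM r'':R. \<Lambda> t' r'' * (SUM r':R. f (A r'' r') * M r' t)))"
  by (rule sum.cong[OF refl], rule arg_cong[where f="(*) _"])
   (simp add: sum_distrib_left sum_distrib_right mult.assoc, rule sum.swap)
 also have "\<dots> = (SUM r'':R. (SUM t':T. M r t' * \<Lambda> t' r'') * (SUM r':R. f (A r'' r') * M r' t))"
  by (simp add: sum_distrib_left[where r="M r _"] sum_distrib_right[where r="SUM r':R. _ r'"] mult.assoc) (rule sum.swap)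
 also have "\<dots> = (SUM r'':R. (if r = r'' then 1 else 0) * (SUM r':R. f (A r'' r') * M r' t))"
  by (rule sum.cong[OF refl]) (simp only: M\<Lambda>[OF r])
 also have "\<dots> = (SUM r':R. f (A r r') * M r' t)" by (rule sum_delta_mult(2)[OF fin(1) r])
 finally show "(SUM t':T. M r t' * f (B t' t)) = (SUM r':R. f (A r r') * M r' t)" .
qed

lemma irreducibleD:
 assumes "irreducible_comatrix R A"
 shows "comatrix R A" "finite R" "R \<noteq> {}"
  and "\<And>x y. \<exists>j\<in>R. x j \<noteq> 0 \<Longrightarrow> \<exists>f. lin scale (*) f \<and> (\<forall>i\<in>R. (SUM j:R. f (A i j) * x j) = y i)"
proof -
 show "comatrix R A" "finite R" "R \<noteq> {}" using assms unfolding irreducible_comatrix_def comatrix_def by blast+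
 fix x y :: "'c \<Rightarrow> 'a" assume "\<exists>j\<in>R. x j \<noteq> 0"
 then obtain f where "lin scale (*) f" "\<forall>i\<in>R. y i = (SUM j:R. f (A i j) * x j)"
  using assms unfolding irreducible_comatrix_def by blast
 then show "\<exists>f. lin scale (*) f \<and> (\<forall>i\<in>R. (SUM j:R. f (A i j) * x j) = y i)" by (intro exI[of _ f]) simp
qed

text \<open>The kernel of \<open>\<Lambda>\<close> is invariant under the action of linear forms, so
 it contains every vector as soon as it contains a nonzero one.\<close>
lemma schur_injective:
 assumes A: "irreducible_comatrix R A" and \<Lambda>: "comatrix_hom R A T B \<Lambda>"
  and x: "\<exists>r\<in>R. x r \<noteq> 0" and 0: "\<And>t. t \<in> T \<Longrightarrow> (SUM r:R. \<Lambda> t r * x r) = 0"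
  and t: "t \<in> T" and r: "r \<in> R"
 shows "\<Lambda> t r = 0"
proof -
 obtain f where f: "lin scale (*) f" "\<And>i. i \<in> R \<Longrightarrow> (SUM j:R. f (A i j) * x j) = (if i = r then 1 else 0)"
  using irreducibleD(4)[OF A x, of "\<lambda>i. if i = r then 1 else 0"] by blast
 have "\<Lambda> t r = (SUM i:R. \<Lambda> t i * (SUM j:R. f (A i j) * x j))"
  by (simp add: f(2) sum_delta_mult[OF irreducibleD(2)[OF A] r] cong: sum.cong)
 also have "\<dots> = (SUM j:R. (SUM i:R. \<Lambda> t i * f (A i j)) * x j)"
  by (simp add: sum_distrib_left sum_distrib_right mult.assoc) (rule sum.swap)
 also have "\<dots> = (SUM j:R. (SUM t':T. f (B t t') * \<Lambda> t' j) * x j)"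
  by (intro sum.cong refl) (simp add: comatrix_hom_functional[OF \<Lambda> f(1) t])
 also have "\<dots> = (SUM t':T. f (B t t') * (SUM j:R. \<Lambda> t' j * x j))"
  by (simp add: sum_distrib_left sum_distrib_right mult.assoc) (rule sum.swap)
 finally show ?thesis by (simp add: 0)
qed

text \<open>The image of \<open>\<Lambda>\<close> contains a nonzero vector, from which every vector
 is reached by the action of a linear form.\<close>
lemma schur_surjective:
 assumes B: "irreducible_comatrix T B" and \<Lambda>: "comatrix_hom R A T B \<Lambda>"
  and 0: "t0 \<in> T" "r0 \<in> R" "\<Lambda> t0 r0 \<noteq> 0"
 obtains x where "\<And>t. t \<in> T \<Longrightarrow> (SUM r:R. \<Lambda> t r * x r) = y t"
proof -
 obtain f where f: "lin scale (*) f" "\<forall>t\<in>T. (SUM t':T. f (B t t') * \<Lambda> t' r0) = y t"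
  using irreducibleD(4)[OF B, of "\<lambda>t. \<Lambda> t r0" y] 0 by blast
 show ?thesis by (rule that[of "\<lambda>r. f (A r r0)"])
   (use f(2) comatrix_hom_functional[OF \<Lambda> f(1) _ 0(2)] in auto)
qed

lemma schur_cokernel:
 assumes B: "irreducible_comatrix T B" and \<Lambda>: "comatrix_hom R A T B \<Lambda>"
  and 0: "t0 \<in> T" "r0 \<in> R" "\<Lambda> t0 r0 \<noteq> 0"
  and x: "\<And>r. r \<in> R \<Longrightarrow> (SUM t:T. \<Lambda> t r * x t) = 0"
 shows "\<forall>t\<in>T. x t = 0"
proof
 fix t assume t: "t \<in> T"
 obtain z where z: "\<And>t'. t' \<in> T \<Longrightarrow> (SUM r:R. \<Lambda> t' r * z r) = (if t' = t then 1 else 0)"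
  by (rule schur_surjective[OF B \<Lambda> 0, of "\<lambda>t'. if t' = t then 1 else 0"]) (rule that)
 have "x t = (SUM t':T. x t' * (SUM r:R. \<Lambda> t' r * z r))"
  by (simp add: z sum_delta_mult[OF irreducibleD(2)[OF B] t] cong: sum.cong)
 also have "\<dots> = (SUM r:R. (SUM t':T. \<Lambda> t' r * x t') * z r)"
  unfolding sum_distrib_left sum_distrib_right by (subst sum.swap) (simp add: ac_simps)
 also have "\<dots> = 0" by (simp add: x)
 finally show "x t = 0" .
qed

lemma schur_iso:
 assumes A: "irreducible_comatrix R A" and B: "irreducible_comatrix T B" and \<Lambda>: "comatrix_hom R A T B \<Lambda>"
  and 0: "t0 \<in> T" "r0 \<in> R" "\<Lambda> t0 r0 \<noteq> 0"
 obtains M where "comatrix_hom T B R A M"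
  "\<And>t t'. t \<in> T \<Longrightarrow> t' \<in> T \<Longrightarrow> (SUM r:R. \<Lambda> t r * M r t') = (if t = t' then 1 else 0)"
  "\<And>r r'. r \<in> R \<Longrightarrow> r' \<in> R \<Longrightarrow> (SUM t:T. M r t * \<Lambda> t r') = (if r = r' then 1 else 0)"
proof -
 note fin = irreducibleD(2)[OF B] irreducibleD(2)[OF A]
 have inj: "\<forall>r\<in>R. x r = 0" if "\<And>t. t \<in> T \<Longrightarrow> (SUM r:R. \<Lambda> t r * x r) = 0" for x
  using schur_injective[OF A \<Lambda> _ that 0(1,2)] 0(3) by blast
 have card: "card T = card R"
  using card_le_if_injective_matrix[OF fin inj] card_le_if_injective_matrix[OF fin(2,1) schur_cokernel[OF B \<Lambda> 0]]
  by (meson antisym)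
 obtain M where M: "\<And>t t'. t \<in> T \<Longrightarrow> t' \<in> T \<Longrightarrow> (SUM r:R. \<Lambda> t r * M r t') = (if t = t' then 1 else 0)"
  "\<And>r r'. r \<in> R \<Longrightarrow> r' \<in> R \<Longrightarrow> (SUM t:T. M r t * \<Lambda> t r') = (if r = r' then 1 else 0)"
  by (rule square_injective_inverse[OF fin card inj]) (assumption, rule that)
 show ?thesis by (rule that[OF inverse_hom[OF fin(2,1) \<Lambda> M] M])
qed


lemma hom_sub_scalar:
 assumes A: "comatrix R A" and \<Lambda>: "comatrix_hom R A R A \<Lambda>"
 shows "comatrix_hom R A R A (\<lambda>r r'. \<Lambda> r r' - (if r = r' then c else 0))"
proof (rule comatrix_homI)
 fix f t r assume f: "lin scale (*) f" and t: "t \<in> R" and r: "r \<in> R"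
 have "(SUM r':R. (\<Lambda> t r' - (if t = r' then c else 0)) * f (A r' r)) =
  (SUM r':R. \<Lambda> t r' * f (A r' r)) - c * f (A t r)"
  by (simp only: left_diff_distrib sum_subtractf sum_delta_mult[OF comatrixD(1)[OF A] t])
 moreover have "(SUM t':R. f (A t t') * (\<Lambda> t' r - (if t' = r then c else 0))) =
  (SUM t':R. f (A t t') * \<Lambda> t' r) - c * f (A t r)"
  by (simp only: right_diff_distrib sum_subtractf sum_delta_mult[OF comatrixD(1)[OF A] r] mult.commute[of _ c])
 ultimately show "(SUM r':R. (\<Lambda> t r' - (if t = r' then c else 0)) * f (A r' r)) =
  (SUM t':R. f (A t t') * (\<Lambda> t' r - (if t' = r then c else 0)))"
  using comatrix_hom_functional[OF \<Lambda> f t r] by simp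
qed

end

locale coalgebra_alg_closed = coalgebra scale \<Delta> \<epsilon>
 for scale :: "'k::alg_closed_field \<Rightarrow> 'h::ab_group_add \<Rightarrow> 'h" (infixr \<open>*s\<close> 75) and \<Delta> \<epsilon>
begin

text \<open>An eigenvalue \<open>c\<close> exists because the field is algebraically closed;
 \<open>\<Lambda> - c\<close> is a non-injective homomorphism and therefore zero.\<close>
lemma schur_scalar:
 fixes A :: "'r \<Rightarrow> 'r \<Rightarrow> 'h" and \<Lambda> :: "'r \<Rightarrow> 'r \<Rightarrow> 'k"
 assumes A: "irreducible_comatrix R A" and \<Lambda>: "comatrix_hom R A R A \<Lambda>"
 obtains c where "\<And>r r'. r \<in> R \<Longrightarrow> r' \<in> R \<Longrightarrow> \<Lambda> r r' = (if r = r' then c else 0)"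
proof -
 obtain c x where x: "\<exists>r\<in>R. x r \<noteq> 0" "\<And>r. r \<in> R \<Longrightarrow> (SUM r':R. \<Lambda> r r' * x r') = c * x r"
  by (rule eigenvector_exists[OF irreducibleD(2,3)[OF A], where M=\<Lambda>], rule that)
 let ?M = "\<lambda>r r'. \<Lambda> r r' - (if r = r' then c else 0)"
 have "(SUM r':R. ?M r r' * x r') = 0" if "r \<in> R" for r
  using x(2)[OF that]
  by (simp only: left_diff_distrib sum_subtractf sum_delta_mult[OF irreducibleD(2)[OF A] that] diff_self)
 from schur_injective[OF A hom_sub_scalar[OF irreducibleD(1)[OF A] \<Lambda>] x(1) this]
 have "?M r r' = 0" if "r \<in> R" "r' \<in> R" for r r' using that by blast
 then show ?thesis by (intro that[of c]) auto
qed

text \<open>Matrix coefficients of pairwise non-isomorphic simple comodules are linearly independent. The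
 relations among them form a subcomodule of a direct sum of simple comodules; a relation of minimal
 support is spread over isomorphic copies by homomorphisms which are scalars, by Schur's lemma. Acting
 on it by linear forms one may prescribe its components, and the counit then gives a contradiction.\<close>
theorem irreducible_entries_independent:
 fixes E :: "'i \<Rightarrow> 'r set" and A :: "'i \<Rightarrow> 'r \<Rightarrow> 'r \<Rightarrow> 'h"
 assumes "finite F" and A: "\<And>t. t \<in> F \<Longrightarrow> irreducible_comatrix (E t) (A t)"
  and hom0: "\<And>s t \<Lambda> a b. s \<in> F \<Longrightarrow> t \<in> F \<Longrightarrow> s \<noteq> t \<Longrightarrow> comatrix_hom (E s) (A s) (E t) (A t) \<Lambda> \<Longrightarrow>
   a \<in> E t \<Longrightarrow> b \<in> E s \<Longrightarrow> \<Lambda> a b = 0"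
  and rel: "(SUM (t, a):Sigma F E. SUM b:E t. x t a b *s A t a b) = 0"
 shows "\<forall>(t, a)\<in>Sigma F E. \<forall>b\<in>E t. x t a b = 0"
proof (rule ccontr)
 let ?P = "Sigma F E"
 have finE: "finite (E t)" if "t \<in> F" for t using irreducibleD(2)[OF A[OF that]] .
 have finP: "finite ?P" using \<open>finite F\<close> finE by simp
 define K where "K x \<longleftrightarrow> (SUM (t, a):?P. SUM b:E t. x t a b *s A t a b) = 0" for x
 define supp where "supp x = {(t, a) \<in> ?P. \<exists>b\<in>E t. x t a b \<noteq> 0}" for x :: "'i \<Rightarrow> 'r \<Rightarrow> 'r \<Rightarrow> 'k"
 define act where "act f x t a c = (SUM b:E t. f (A t c b) * x t a b)" for f :: "'h \<Rightarrow> 'k" and x t and a :: 'r and c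
 have K_act: "K (act f x)" if x: "K x" and f: "lin scale (*) f" for f x
  unfolding K_def
 proof (rule functionals_separate[OF vs])
  fix g assume g: "lin scale (*) g"
  have "0 = conv g f (SUM (t, a):?P. SUM b:E t. x t a b *s A t a b)"
   using x by (simp add: K_def lin_zero[OF lin_conv])
  also have "\<dots> = (SUM (t, a):?P. SUM b:E t. x t a b * conv g f (A t a b))"
   by (simp add: split_def lin_sum[OF lin_conv] lin_scale[OF lin_conv])
  also have "\<dots> = (SUM (t, a):?P. SUM b:E t. x t a b * (SUM c:E t. g (A t a c) * f (A t c b)))"
   by (intro sum.cong refl) (auto simp: conv_comatrix[OF irreducibleD(1)[OF A] _ _ g f])
  also have "\<dots> = (SUM (t, a):?P. SUM c:E t. act f x t a c * g (A t a c))"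
  proof (intro sum.cong refl, clarify)
   fix t a
   show "(SUM b:E t. x t a b * (SUM c:E t. g (A t a c) * f (A t c b))) = (SUM c:E t. act f x t a c * g (A t a c))"
    unfolding act_def sum_distrib_left sum_distrib_right
    by (subst sum.swap) (simp add: mult.commute mult.left_commute)
  qed
  also have "\<dots> = g (SUM (t, a):?P. SUM b:E t. act f x t a b *s A t a b)"
   by (simp add: split_def lin_sum[OF g] lin_scale[OF g])
  finally show "g (SUM (t, a):?P. SUM b:E t. act f x t a b *s A t a b) = g 0" by (simp add: lin_zero[OF g])
 qed
 assume "\<not> (\<forall>(t, a)\<in>?P. \<forall>b\<in>E t. x t a b = 0)"
 then have "K x \<and> supp x \<noteq> {}" using rel by (auto simp: K_def supp_def)
 then obtain x where x: "K x" "supp x \<noteq> {}"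
  and min: "\<And>y. K y \<Longrightarrow> supp y \<noteq> {} \<Longrightarrow> card (supp x) \<le> card (supp y)"
  using ex_has_least_nat[of "\<lambda>x. K x \<and> supp x \<noteq> {}" x "\<lambda>x. card (supp x)"] by blast
 then obtain t0 a0 where ta0: "(t0, a0) \<in> supp x" by auto
 then have t0: "t0 \<in> F" and a0: "a0 \<in> E t0" and x0: "\<exists>b\<in>E t0. x t0 a0 b \<noteq> 0"
  by (auto simp: supp_def)
 have fin_supp: "finite (supp y)" for y unfolding supp_def by (rule finite_subset[OF _ finP]) auto
 have kill: "act f x t a c = 0"
  if f: "lin scale (*) f" and 0: "\<And>c. c \<in> E t0 \<Longrightarrow> act f x t0 a0 c = 0"
   and t: "t \<in> F" "a \<in> E t" "c \<in> E t" for f t a c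
 proof (rule ccontr)
  assume "act f x t a c \<noteq> 0"
  then have "supp (act f x) \<noteq> {}" using t by (auto simp: supp_def)
  moreover have "supp (act f x) \<subseteq> supp x - {(t0, a0)}"
  proof
   fix q assume "q \<in> supp (act f x)"
   then obtain t a c where q: "q = (t, a)" "t \<in> F" "a \<in> E t" "c \<in> E t" "act f x t a c \<noteq> 0"
    by (auto simp: supp_def)
   have "\<exists>b\<in>E t. x t a b \<noteq> 0"
   proof (rule ccontr)
    assume "\<not> ?thesis"
    then have "act f x t a c = 0" unfolding act_def by (intro sum.neutral) auto
    then show False using q by simp
   qed
   then show "q \<in> supp x - {(t0, a0)}" using q 0 by (auto simp: supp_def)
  qed
  then have "card (supp (act f x)) < card (supp x)"
   using ta0 fin_supp by (intro psubset_card_mono) auto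
  ultimately show False using min[OF K_act[OF x(1) f]] by simp
 qed
 have "\<exists>f. lin scale (*) f \<and> (\<forall>c\<in>E t0. act f x t0 a0 c = (if c = b then 1 else 0))" for b
  unfolding act_def using irreducibleD(4)[OF A[OF t0] x0, of "\<lambda>c. if c = b then 1 else 0"] .
 then obtain G where G: "\<And>b. lin scale (*) (G b)"
  "\<And>b c. c \<in> E t0 \<Longrightarrow> act (G b) x t0 a0 c = (if c = b then 1 else 0)" by metis
 have hom: "comatrix_hom (E t0) (A t0) (E t) (A t) (\<lambda>c b. act (G b) x t a c)"
  if t: "t \<in> F" and a: "a \<in> E t" for t a
 proof (rule comatrix_homI)
  fix g c b assume g: "lin scale (*) g" and c: "c \<in> E t" and b: "b \<in> E t0"
  let ?f = "\<lambda>h. conv g (G b) h - (SUM b':E t0. g (A t0 b' b) * G b' h)"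
  have f: "lin scale (*) ?f"
   by (intro lin_minus lin_conv lin_sum_fun vs vector_space_mult lin_mult_left G(1))
  have act_f: "act ?f x t a c = (SUM d:E t. g (A t c d) * act (G b) x t a d) - (SUM b':E t0. g (A t0 b' b) * act (G b') x t a c)"
   if t: "t \<in> F" and c: "c \<in> E t" for t a c
  proof -
   have "act ?f x t a c = (SUM b'':E t. (SUM d:E t. g (A t c d) * G b (A t d b'')) * x t a b'')
     - (SUM b'':E t. (SUM b':E t0. g (A t0 b' b) * G b' (A t c b'')) * x t a b'')"
    unfolding act_def
    by (simp add: left_diff_distrib sum_subtractf conv_comatrix[OF irreducibleD(1)[OF A[OF t]] c _ g G(1)] cong: sum.cong)
   also have "(SUM b'':E t. (SUM d:E t. g (A t c d) * G b (A t d b'')) * x t a b'') = (SUM d:E t. g (A t c d) * act (G b) x t a d)"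
    unfolding act_def by (simp add: sum_distrib_left sum_distrib_right mult.assoc) (rule sum.swap)
   also have "(SUM b'':E t. (SUM b':E t0. g (A t0 b' b) * G b' (A t c b'')) * x t a b'') = (SUM b':E t0. g (A t0 b' b) * act (G b') x t a c)"
    unfolding act_def by (simp add: sum_distrib_left sum_distrib_right mult.assoc) (rule sum.swap)
   finally show ?thesis .
  qed
  have "act ?f x t0 a0 c' = 0" if "c' \<in> E t0" for c'
   unfolding act_f[OF t0 that] using finE[OF t0] that b
   by (simp add: G(2) if_distrib cong: if_cong sum.cong)
  from kill[OF f this t a c]
  show "(SUM b':E t0. act (G b') x t a c * g (A t0 b' b)) = (SUM d:E t. g (A t c d) * act (G b) x t a d)"
   unfolding act_f[OF t c] by (simp add: mult.commute)
 qed
 have recover: "x t a c = (SUM b:E t0. x t0 a0 b * act (G b) x t a c)"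
  if t: "t \<in> F" and a: "a \<in> E t" and c: "c \<in> E t" for t a c
 proof -
  let ?f = "\<lambda>h. \<epsilon> h - (SUM b:E t0. x t0 a0 b * G b h)"
  have f: "lin scale (*) ?f"
   by (intro lin_minus \<epsilon>_linear lin_sum_fun vs vector_space_mult lin_mult_left G(1))
  have act_f: "act ?f x t a c = x t a c - (SUM b:E t0. x t0 a0 b * act (G b) x t a c)"
   if t: "t \<in> F" and c: "c \<in> E t" for t a c
  proof -
   have "act ?f x t a c = (SUM b':E t. (if c = b' then 1 else 0) * x t a b')
     - (SUM b':E t. (SUM b:E t0. x t0 a0 b * G b (A t c b')) * x t a b')"
    unfolding act_def
    by (simp add: left_diff_distrib sum_subtractf comatrixD(3)[OF irreducibleD(1)[OF A[OF t]] c] cong: sum.cong)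
   also have "(SUM b':E t. (if c = b' then 1 else 0) * x t a b') = x t a c"
    by (rule sum_delta_mult(2)[OF finE[OF t] c])
   also have "(SUM b':E t. (SUM b:E t0. x t0 a0 b * G b (A t c b')) * x t a b') = (SUM b:E t0. x t0 a0 b * act (G b) x t a c)"
    unfolding act_def by (simp add: sum_distrib_left sum_distrib_right mult.assoc) (rule sum.swap)
   finally show ?thesis .
  qed
  have "act ?f x t0 a0 c' = 0" if "c' \<in> E t0" for c'
   unfolding act_f[OF t0 that] using finE[OF t0] that
   by (simp add: G(2) if_distrib cong: if_cong sum.cong)
  from kill[OF f this t a c] show ?thesis unfolding act_f[OF t c] by simp
 qed
 have zero: "x t a c = 0" if "t \<in> F" "t \<noteq> t0" "a \<in> E t" "c \<in> E t" for t a c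
  using recover[OF that(1,3,4)] hom0[OF t0 that(1) that(2)[symmetric] hom[OF that(1,3)] that(4)] by simp
 have "\<exists>\<mu>. \<forall>c\<in>E t0. \<forall>b\<in>E t0. act (G b) x t0 a c = (if c = b then \<mu> else 0)" if "a \<in> E t0" for a
  by (rule schur_scalar[OF A[OF t0] hom[OF t0 that]]) blast
 then obtain \<mu> where \<mu>: "\<And>a c b. a \<in> E t0 \<Longrightarrow> c \<in> E t0 \<Longrightarrow> b \<in> E t0 \<Longrightarrow> act (G b) x t0 a c = (if c = b then \<mu> a else 0)"
  by metis
 have scal: "x t0 a c = \<mu> a * x t0 a0 c" if "a \<in> E t0" "c \<in> E t0" for a c
  using recover[OF t0 that] that finE[OF t0] by (simp add: \<mu> if_distrib mult.commute cong: if_cong sum.cong)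
 obtain f where f: "lin scale (*) f" "\<And>c. c \<in> E t0 \<Longrightarrow> act f x t0 a0 c = (if c = a0 then 1 else 0)"
  using G by blast
 have act_scal: "act f x t0 a c = \<mu> a * act f x t0 a0 c" if "a \<in> E t0" for a c
  unfolding act_def sum_distrib_left by (rule sum.cong) (auto simp: scal[OF that] ac_simps)
 have "0 = \<epsilon> (SUM (t, a):?P. SUM b:E t. act f x t a b *s A t a b)"
  using K_act[OF x(1) f(1)] by (simp add: K_def lin_zero[OF \<epsilon>_linear])
 also have "\<dots> = (SUM (t, a):?P. SUM b:E t. act f x t a b * \<epsilon> (A t a b))"
  by (simp add: split_def lin_sum[OF \<epsilon>_linear] lin_scale[OF \<epsilon>_linear])
 also have "\<dots> = (SUM (t, a):?P. act f x t a a)"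
 proof (intro sum.cong refl, clarify)
  fix t a assume ta: "t \<in> F" "a \<in> E t"
  have "(SUM b:E t. act f x t a b * \<epsilon> (A t a b)) = (SUM b:E t. act f x t a b * (if a = b then 1 else 0))"
   by (intro sum.cong refl) (simp add: comatrixD(3)[OF irreducibleD(1)[OF A[OF ta(1)]] ta(2)])
  then show "(SUM b:E t. act f x t a b * \<epsilon> (A t a b)) = act f x t a a"
   by (simp only: sum_delta_mult[OF finE[OF ta(1)] ta(2)])
 qed
 also have "\<dots> = act f x t0 a0 a0"
 proof -
  have "act f x t a a = 0" if ta: "t \<in> F" "a \<in> E t" "(t, a) \<noteq> (t0, a0)" for t a
  proof (cases "t = t0")
   case True
   then show ?thesis using act_scal f(2) ta by auto
  next
   case False
   then show ?thesis unfolding act_def using zero[OF ta(1) False ta(2)] by simp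
  qed
  then have "(SUM (t, a):?P. act f x t a a) = (SUM (t, a):{(t0, a0)}. act f x t a a)"
   using finP t0 a0 by (intro sum.mono_neutral_right) auto
  then show ?thesis by simp
 qed
 also have "\<dots> = 1" using f(2)[OF a0] by simp
 finally show False by simp
qed

end

section \<open>Bases of quotient spaces\<close>

context vector_space
begin

text \<open>A family indexed by \<open>P\<close>, rather than a set, in order to obtain injectivity
 of the index map as well.\<close>
lemma basis_modI_family:
 assumes U: "subspace U" and W: "subspace W" "W \<subseteq> U"
  and z: "z ` P \<subseteq> U" and sp: "U \<subseteq> span (W \<union> z ` P)"
  and ind: "\<And>F c. finite F \<Longrightarrow> F \<subseteq> P \<Longrightarrow> (SUM p:F. scale (c p) (z p)) \<in> W \<Longrightarrow> \<forall>p\<in>F. c p = 0"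
 shows "inj_on z P" "basis_mod U W (z ` P)"
proof -
 show inj: "inj_on z P"
 proof (rule inj_onI, rule ccontr)
  fix p q assume pq: "p \<in> P" "q \<in> P" "z p = z q" "p \<noteq> q"
  have "(SUM r:{p, q}. scale ((if r = p then 1 else - 1)) (z r)) = 0" using pq by simp
  then have "(SUM r:{p, q}. scale ((if r = p then 1 else - 1)) (z r)) \<in> W" using subspace_0[OF W(1)] by simp
  from ind[OF _ _ this] pq show False by auto
 qed
 show "basis_mod U W (z ` P)" unfolding basis_mod_def
 proof (intro conjI ballI notI)
  show "span (W \<union> z ` P) = U" using sp z W(2) by (intro subset_antisym span_minimal U) auto
  fix b assume b: "b \<in> z ` P" "b \<in> span (W \<union> (z ` P - {b}))"
  then obtain p where p: "p \<in> P" "b = z p" by auto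
  have eq: "z ` P - {b} = z ` (P - {p})" using p inj by (auto simp: inj_on_def)
  obtain w v where wv: "w \<in> W" "v \<in> span (z ` (P - {p}))" "b = w + v"
   using b(2) unfolding eq span_Un span_eq_iff[THEN iffD2, OF W(1)] by auto
  obtain t r where t: "finite t" "t \<subseteq> z ` (P - {p})" "v = (SUM a:t. scale (r a) a)"
   using wv(2) unfolding span_explicit by auto
  obtain F where F: "F \<subseteq> P - {p}" "inj_on z F" "t = z ` F" using t(2) by (metis subset_image_inj)
  have finF: "finite F" using t(1) F(2,3) finite_image_iff by auto
  have v: "v = (SUM q:F. scale (r (z q)) (z q))" using t(3) F by (simp add: sum.reindex)
  let ?c = "\<lambda>q. if q = p then 1 else - r (z q)"
  have "(SUM q:insert p F. scale (?c q) (z q)) = z p + (SUM q:F. scale (?c q) (z q))"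
   using F finF by (subst sum.insert) auto
  also have "(SUM q:F. scale (?c q) (z q)) = - v" unfolding v sum_negf[symmetric]
   by (rule sum.cong) (use F in auto)
  finally have "(SUM q:insert p F. scale (?c q) (z q)) \<in> W" using wv p by simp
  moreover have "insert p F \<subseteq> P" "finite (insert p F)" using F finF p by auto
  ultimately have "\<forall>q\<in>insert p F. ?c q = 0" by (intro ind)
  then show False by auto
 qed (use z in auto)
qed

lemma basis_mod_independent:
 assumes B: "basis_mod U W B" and "finite F" "F \<subseteq> B" "(SUM b:F. scale (c b) b) \<in> span W" "b \<in> F"
 shows "c b = 0"
proof (rule ccontr)
 assume c: "c b \<noteq> 0"
 let ?S = "span (W \<union> (B - {b}))"
 have eq: "scale (c b) b = (SUM b:F. scale (c b) b) - (SUM b':F - {b}. scale (c b') b')"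
  using sum.remove[OF assms(2,5), of "\<lambda>b. scale (c b) b"] by simp
 have "(SUM b':F - {b}. scale (c b') b') \<in> ?S"
  by (intro span_sum span_scale span_base) (use assms in auto)
 moreover have "(SUM b:F. scale (c b) b) \<in> ?S" using assms(4) span_mono[of W "W \<union> (B - {b})"] by auto
 ultimately have "scale (c b) b \<in> ?S" unfolding eq by (intro span_diff)
 then have "scale (inverse (c b)) (scale (c b) b) \<in> ?S" by (rule span_scale)
 then have "b \<in> ?S" using c by simp
 then show False using B assms(3,5) unfolding basis_mod_def by blast
qed

lemma basis_mod_exists:
 assumes U: "subspace U" and W: "subspace W" "W \<subseteq> U"
 obtains B where "basis_mod U W B"
proof -
 obtain B0 where B0: "B0 \<subseteq> W" "independent B0" "W \<subseteq> span B0" by (rule maximal_independent_subset)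
 have sB0: "span B0 = W" using B0 W(1) by (meson span_subspace)
 obtain B1 where B1: "B0 \<subseteq> B1" "B1 \<subseteq> U" "independent B1" "U \<subseteq> span B1"
  using maximal_independent_subset_extend[of B0 U] B0 W by (metis subset_trans)
 have sB1: "span B1 = U" using B1 U by (meson span_subspace)
 have "basis_mod U W (B1 - B0)" unfolding basis_mod_def
 proof (intro conjI ballI notI)
  show "B1 - B0 \<subseteq> U" using B1 by auto
  show "span (W \<union> (B1 - B0)) = U"
  proof
   show "span (W \<union> (B1 - B0)) \<subseteq> U" using W B1 by (intro span_minimal U) auto
   show "U \<subseteq> span (W \<union> (B1 - B0))" unfolding sB1[symmetric] using B0 by (intro span_mono) auto
  qed
  fix b assume b: "b \<in> B1 - B0" "b \<in> span (W \<union> (B1 - B0 - {b}))"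
  have "span (W \<union> (B1 - B0 - {b})) \<subseteq> span (B1 - {b})"
  proof (rule span_minimal)
   show "W \<union> (B1 - B0 - {b}) \<subseteq> span (B1 - {b})"
    unfolding sB0[symmetric] using b B1 span_mono[of B0 "B1 - {b}"] by (auto intro: span_base)
  qed simp
  then show False using b B1(3) unfolding dependent_def by auto
 qed
 then show ?thesis using that by blast
qed

text \<open>The dimension of a quotient space is well defined: \<open>h = id - p\<close> with a
 projection \<open>p\<close> onto \<open>W\<close> has kernel \<open>W\<close>, so it maps both sets
 bijectively to bases of the same space.\<close>
lemma basis_mod_eqpoll:
 assumes B: "basis_mod U W B" and B': "basis_mod U W B'" and W: "subspace W"
 shows "B \<approx> B'"
proof -
 interpret P: vector_space_pair scale scale by unfold_locales
 obtain p where p: "lin scale scale p" "\<And>x. p x \<in> W" "\<And>w. w \<in> W \<Longrightarrow> p w = w"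
  by (rule projection_exists[OF vector_space_axioms W]) (rule that)
 define h where "h = (\<lambda>x. x - p x)"
 have h: "lin scale scale h" unfolding h_def by (rule lin_minus[OF lin_id[OF vector_space_axioms] p(1)])
 have hW: "h w = 0" if "w \<in> W" for w using that by (simp add: h_def p(3))
 have ker: "x \<in> W" if "h x = 0" for x
 proof -
  have "x = p x" using that by (simp add: h_def)
  then show ?thesis using p(2)[of x] by simp
 qed
 have main: "inj_on h B \<and> independent (h ` B) \<and> span (h ` B) = h ` U" if B: "basis_mod U W B" for B
 proof -
  have U: "U = span (W \<union> B)" "B \<subseteq> U" using B unfolding basis_mod_def by auto
  have sub: "subspace (h ` U)" unfolding U(1) by (rule P.linear_subspace_image[OF h subspace_span])
  have sp: "h ` U \<subseteq> span ({0} \<union> h ` B)"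
   unfolding U(1) P.linear_span_image[OF h, symmetric] by (rule span_minimal) (auto simp: hW intro: span_base span_zero)
  have ind: "\<forall>b\<in>F. c b = 0" if F: "finite F" "F \<subseteq> B" "(SUM b:F. scale (c b) (h b)) \<in> {0}" for F c
  proof
   have "h (SUM b:F. scale (c b) b) = 0" using F(3) by (simp add: lin_sum[OF h] lin_scale[OF h])
   then show "c b = 0" if "b \<in> F" for b
    by (intro basis_mod_independent[OF B F(1,2) _ that] span_base ker)
  qed
  note fam = basis_modI_family[OF sub subspace_single_0 _ image_mono[OF U(2)] sp ind]
  have "inj_on h B" "basis_mod (h ` U) {0} (h ` B)"
   by (rule fam; use subspace_0[OF sub] in simp)+
  then show ?thesis unfolding basis_mod_def dependent_def by simp
 qed
 have "\<exists>f. bij_betw f (h ` B) (h ` B')"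
  using main[OF B] main[OF B'] by (intro bij_if_span_eq_span_bases) auto
 then have "h ` B \<approx> h ` B'" unfolding eqpoll_def .
 moreover have "h ` B \<approx> B" "h ` B' \<approx> B'" using main[OF B] main[OF B'] by (auto intro: inj_on_image_eqpoll_self)
 ultimately show ?thesis by (meson eqpoll_sym eqpoll_trans)
qed

end

text \<open>Maps \<open>g p\<close> and \<open>h p\<close> that are inverse to each other modulo \<open>B\<close> and \<open>B' p\<close> identify \<open>Z / B\<close> with the
 direct sum of the \<open>Z' p / B' p\<close>.\<close>
lemma basis_mod_direct_sum:
 fixes s1 :: "'k::field \<Rightarrow> 'u::ab_group_add \<Rightarrow> 'u" and s2 :: "'k \<Rightarrow> 'v::ab_group_add \<Rightarrow> 'v"
 assumes vs: "vector_space s1" "vector_space s2" and P: "finite P"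
  and ZB: "module.subspace s1 Z" "module.subspace s1 B" "B \<subseteq> Z"
  and B': "\<And>p. p \<in> P \<Longrightarrow> module.subspace s2 (B' p)"
  and lin: "\<And>p. lin s2 s1 (g p)" "\<And>p. lin s1 s2 (h p)"
  and g: "\<And>p y. p \<in> P \<Longrightarrow> y \<in> Z' p \<Longrightarrow> g p y \<in> Z" "\<And>p y. p \<in> P \<Longrightarrow> y \<in> B' p \<Longrightarrow> g p y \<in> B"
  and h: "\<And>p x. p \<in> P \<Longrightarrow> x \<in> Z \<Longrightarrow> h p x \<in> Z' p" "\<And>p x. p \<in> P \<Longrightarrow> x \<in> B \<Longrightarrow> h p x \<in> B' p"
  and hg: "\<And>p q y. p \<in> P \<Longrightarrow> q \<in> P \<Longrightarrow> y \<in> Z' q \<Longrightarrow> h p (g q y) - (if p = q then y else 0) \<in> B' p"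
  and gh: "\<And>x. x \<in> Z \<Longrightarrow> (SUM p:P. g p (h p x)) - x \<in> B"
  and \<beta>: "vector_space.basis_mod s1 Z B \<beta>"
  and \<gamma>: "\<And>p. p \<in> P \<Longrightarrow> vector_space.basis_mod s2 (Z' p) (B' p) (\<gamma> p)"
 shows "\<beta> \<approx> Sigma P \<gamma>"
proof -
 interpret X: vector_space s1 by fact
 interpret Y: vector_space s2 by fact
 let ?z = "\<lambda>(p, c). g p c" and ?S = "Sigma P \<gamma>"
 have \<gamma>Z: "\<gamma> p \<subseteq> Z' p" and spZ': "Z' p = Y.span (B' p \<union> \<gamma> p)" if "p \<in> P" for p
  using \<gamma>[OF that] unfolding Y.basis_mod_def by auto
 have zZ: "?z ` ?S \<subseteq> Z" using \<gamma>Z g(1) by fastforce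
 have sp: "Z \<subseteq> X.span (B \<union> ?z ` ?S)"
 proof
  fix x assume x: "x \<in> Z"
  have "g p (h p x) \<in> X.span (B \<union> ?z ` ?S)" if p: "p \<in> P" for p
  proof -
   have "h p x \<in> Y.span (B' p \<union> \<gamma> p)" using h(1)[OF p x] spZ'[OF p] by simp
   then show ?thesis
   proof (induction rule: Y.span_induct_alt)
    case base show ?case by (simp add: lin_zero[OF lin(1)] X.span_zero)
   next
    case (step c y z)
    have "g p y \<in> X.span (B \<union> ?z ` ?S)" using step.hyps p g(2)[OF p] by (intro X.span_base) force
    with step.IH show ?case by (auto simp: lin_add[OF lin(1)] lin_scale[OF lin(1)] intro: X.span_add X.span_scale)
   qed
  qed
  then have "(SUM p:P. g p (h p x)) \<in> X.span (B \<union> ?z ` ?S)" by (rule X.span_sum)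
  moreover have "(SUM p:P. g p (h p x)) - x \<in> X.span (B \<union> ?z ` ?S)" using gh[OF x] by (intro X.span_base) blast
  ultimately have "(SUM p:P. g p (h p x)) - ((SUM p:P. g p (h p x)) - x) \<in> X.span (B \<union> ?z ` ?S)" by (rule X.span_diff)
  then show "x \<in> X.span (B \<union> ?z ` ?S)" by simp
 qed
 have ind: "\<forall>r\<in>F. c r = 0" if F: "finite F" "F \<subseteq> ?S" and B: "(SUM r:F. s1 (c r) (?z r)) \<in> B" for F c
 proof
  fix r assume r: "r \<in> F"
  obtain p b where pb: "r = (p, b)" "p \<in> P" "b \<in> \<gamma> p" using r F by auto
  let ?F = "{b. (p, b) \<in> F}"
  have finF: "finite ?F" by (rule finite_subset[of _ "snd ` F"]) (use F in force)+
  have "h p (SUM r:F. s1 (c r) (?z r)) - (SUM r:F. s2 (c r) (h p (?z r) - (if p = fst r then snd r else 0))) \<in> B' p"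
  proof (rule Y.subspace_diff[OF B'[OF pb(2)] h(2)[OF pb(2) B]], rule Y.subspace_sum[OF B'[OF pb(2)]], rule Y.subspace_scale[OF B'[OF pb(2)]])
   fix r assume "r \<in> F"
   then obtain q d where "r = (q, d)" "q \<in> P" "d \<in> Z' q" using F \<gamma>Z by blast
   then show "h p (?z r) - (if p = fst r then snd r else 0) \<in> B' p" using hg[OF pb(2), of q d] by (cases "p = q") simp_all
  qed
  also have "h p (SUM r:F. s1 (c r) (?z r)) - (SUM r:F. s2 (c r) (h p (?z r) - (if p = fst r then snd r else 0))) =
   (SUM r:F. s2 (c r) (if p = fst r then snd r else 0))"
   by (simp add: lin_sum[OF lin(2)] lin_scale[OF lin(2)] Y.scale_right_diff_distrib sum_subtractf)
  also have "\<dots> = (SUM r:(\<lambda>b. (p, b)) ` ?F. s2 (c r) (if p = fst r then snd r else 0))"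
   using F by (intro sum.mono_neutral_right) auto
  also have "\<dots> = (SUM b:?F. s2 (c (p, b)) b)" by (subst sum.reindex) (auto intro: inj_onI)
  finally have "(SUM b:?F. s2 (c (p, b)) b) \<in> Y.span (B' p)" by (rule Y.span_base)
  from Y.basis_mod_independent[OF \<gamma>[OF pb(2)] finF _ this, of b] show "c r = 0" using r pb F by auto
 qed
 note fam = X.basis_modI_family[OF ZB zZ sp ind]
 have "\<beta> \<approx> ?z ` ?S" by (rule X.basis_mod_eqpoll[OF \<beta> _ ZB(2)]) (rule fam(2))
 also have "?z ` ?S \<approx> ?S" by (rule inj_on_image_eqpoll_self) (rule fam(1))
 finally show ?thesis .
qed


section \<open>Extensions and the wedge of two simple subcoalgebras\<close>

abbreviation mscale :: "('k \<Rightarrow> 'h \<Rightarrow> 'h) \<Rightarrow> 'k \<Rightarrow> ('r \<Rightarrow> 't \<Rightarrow> 'h) \<Rightarrow> 'r \<Rightarrow> 't \<Rightarrow> 'h" where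
 "mscale s \<equiv> pointwise_scale (pointwise_scale s)"

context coalgebra
begin

lemma vs_matrices: "vector_space (mscale scale)"
 by (intro vector_space_pointwise vs)

text \<open>A matrix \<open>X\<close> is a cocycle iff the block triangular matrix with diagonal blocks \<open>C\<close>, \<open>D\<close> and
 upper right block \<open>X\<close> is a comatrix, that is, defines an extension of the comodule of \<open>D\<close> by the
 comodule of \<open>C\<close>; it is a coboundary iff this extension splits. Only the entries with indices in
 \<open>R \<times> T\<close> matter, so all matrices vanishing there are among the coboundaries.\<close>
definition ext_cocycles ::
 "'r set \<Rightarrow> ('r \<Rightarrow> 'r \<Rightarrow> 'b) \<Rightarrow> 't set \<Rightarrow> ('t \<Rightarrow> 't \<Rightarrow> 'b) \<Rightarrow> ('r \<Rightarrow> 't \<Rightarrow> 'b) set" where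
 "ext_cocycles R C T D =
   {X. \<forall>p\<in>R. \<forall>q\<in>T. \<Delta> (X p q) = (SUM k:R. C p k \<otimes> X k q) + (SUM l:T. X p l \<otimes> D l q)}"

definition ext_coboundaries ::
 "'r set \<Rightarrow> ('r \<Rightarrow> 'r \<Rightarrow> 'b) \<Rightarrow> 't set \<Rightarrow> ('t \<Rightarrow> 't \<Rightarrow> 'b) \<Rightarrow> ('r \<Rightarrow> 't \<Rightarrow> 'b) set" where
 "ext_coboundaries R C T D =
   {X. \<exists>M. \<forall>p\<in>R. \<forall>q\<in>T. X p q = (SUM k:R. M k q *s C p k) - (SUM l:T. M p l *s D l q)}"

definition entries :: "'r set \<Rightarrow> ('r \<Rightarrow> 'r \<Rightarrow> 'b) \<Rightarrow> 'b set" where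
 "entries R C = span {C i j | i j. i \<in> R \<and> j \<in> R}"

lemma ext_cocycleD:
 "X \<in> ext_cocycles R C T D \<Longrightarrow> p \<in> R \<Longrightarrow> q \<in> T \<Longrightarrow>
  \<Delta> (X p q) = (SUM k:R. C p k \<otimes> X k q) + (SUM l:T. X p l \<otimes> D l q)"
 by (simp add: ext_cocycles_def)

lemma ext_cocycle_eq:
 assumes "finite R" "finite T" "X \<in> ext_cocycles R C T D" "p \<in> R" "q \<in> T"
  and "vector_space sU" "bilinear_map scale scale sU B"
 shows "(SUM (a1, a2)<-sweedler (X p q). B a1 a2) = (SUM k:R. B (C p k) (X k q)) + (SUM l:T. B (X p l) (D l q))"
proof -
 let ?x = "case_sum (\<lambda>k. C p k) (\<lambda>l. X p l)" and ?y = "case_sum (\<lambda>k. X k q) (\<lambda>l. D l q)"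
 have "\<Delta> (X p q) = (SUM i:R <+> T. ?x i \<otimes> ?y i)"
  using assms(1,2) ext_cocycleD[OF assms(3-5)] by (simp add: sum.Plus)
 from sweedler_eq[OF assms(6,7) this] show ?thesis using assms(1,2) by (simp add: sum.Plus)
qed

lemma pure_tensor_bilinear: "bilinear_map scale scale tscale (\<otimes>)"
 by (rule tensor_bilinear[OF vs vs])

lemma conv_ext_cocycle:
 assumes "X \<in> ext_cocycles R C T D" "p \<in> R" "q \<in> T" "lin scale (*) f" "lin scale (*) g"
 shows "conv f g (X p q) = (SUM k:R. f (C p k) * g (X k q)) + (SUM l:T. f (X p l) * g (D l q))"
 unfolding conv_def
 by (simp add: ext_cocycleD[OF assms(1-3)] sum_apply tensor_apply[OF bilinear_form_functionals[OF assms(4,5)]])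

text \<open>Products of linear forms separate tensors.\<close>
lemma ext_cocycleI:
 assumes "\<And>p q f g. p \<in> R \<Longrightarrow> q \<in> T \<Longrightarrow> lin scale (*) f \<Longrightarrow> lin scale (*) g \<Longrightarrow>
  conv f g (X p q) = (SUM k:R. f (C p k) * g (X k q)) + (SUM l:T. f (X p l) * g (D l q))"
 shows "X \<in> ext_cocycles R C T D"
 unfolding ext_cocycles_def
proof (intro CollectI ballI tensor_eq_if_functionals[OF vs vs \<Delta>_tensor])
 fix p q assume pq: "p \<in> R" "q \<in> T"
 interpret T: vector_space "tscale :: 'a \<Rightarrow> ('b, 'b, 'a) tensor \<Rightarrow> _" by (rule vector_space_tscale)
 show "(SUM k:R. C p k \<otimes> X k q) + (SUM l:T. X p l \<otimes> D l q) \<in> tensor_space scale scale UNIV UNIV"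
  by (intro T.subspace_add[OF subspace_tensor_space] sum_tensor_in_space) auto
 fix f g assume fg: "lin scale (*) f" "lin scale (*) g"
 show "\<Delta> (X p q) (\<lambda>x y. f x * g y) = ((SUM k:R. C p k \<otimes> X k q) + (SUM l:T. X p l \<otimes> D l q)) (\<lambda>x y. f x * g y)"
  using assms[OF pq fg] by (simp add: conv_def sum_apply tensor_apply[OF bilinear_form_functionals[OF fg]])
qed

lemma subspace_ext_cocycles: "module.subspace (mscale scale) (ext_cocycles R C T D)"
proof -
 interpret M: vector_space "mscale scale" by (rule vs_matrices)
 show ?thesis
 proof (rule M.subspaceI)
  show "0 \<in> ext_cocycles R C T D"
   by (rule ext_cocycleI) (simp add: lin_zero lin_zero[OF lin_conv])
  fix X Y c assume X: "X \<in> ext_cocycles R C T D"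
  show "mscale scale c X \<in> ext_cocycles R C T D"
   by (rule ext_cocycleI)
    (simp add: pointwise_scale_def lin_scale lin_scale[OF lin_conv] conv_ext_cocycle[OF X]
     lin_scale[where s=scale and s'="(*)"] distrib_left sum_distrib_left mult.left_commute mult.assoc)
  assume Y: "Y \<in> ext_cocycles R C T D"
  show "X + Y \<in> ext_cocycles R C T D"
   by (rule ext_cocycleI)
    (simp add: lin_add lin_add[OF lin_conv] conv_ext_cocycle[OF X] conv_ext_cocycle[OF Y] lin_add[where s=scale and s'="(*)"]
     sum.distrib algebra_simps)
 qed
qed

lemma subspace_ext_coboundaries: "module.subspace (mscale scale) (ext_coboundaries R C T D)"
proof -
 interpret M: vector_space "mscale scale" by (rule vs_matrices)
 show ?thesis
 proof (rule M.subspaceI)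
  show "0 \<in> ext_coboundaries R C T D"
   unfolding ext_coboundaries_def by (rule CollectI, rule exI[of _ "\<lambda>_ _. 0"]) simp
  fix X Y c assume X: "X \<in> ext_coboundaries R C T D"
  then obtain M where M: "\<And>p q. p \<in> R \<Longrightarrow> q \<in> T \<Longrightarrow> X p q = (SUM k:R. M k q *s C p k) - (SUM l:T. M p l *s D l q)"
   unfolding ext_coboundaries_def by blast
  show "mscale scale c X \<in> ext_coboundaries R C T D"
   unfolding ext_coboundaries_def
   by (rule CollectI, rule exI[of _ "\<lambda>p q. c * M p q"])
    (simp add: M pointwise_scale_def scale_right_diff_distrib scale_sum_right)
  assume "Y \<in> ext_coboundaries R C T D"
  then obtain N where N: "\<And>p q. p \<in> R \<Longrightarrow> q \<in> T \<Longrightarrow> Y p q = (SUM k:R. N k q *s C p k) - (SUM l:T. N p l *s D l q)"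
   unfolding ext_coboundaries_def by blast
  show "X + Y \<in> ext_coboundaries R C T D"
   unfolding ext_coboundaries_def
   by (rule CollectI, rule exI[of _ "\<lambda>p q. M p q + N p q"])
    (simp add: M N scale_left_distrib sum.distrib)
 qed
qed

lemma sum_conv_comatrix:
 assumes C: "comatrix R C" and f: "lin scale (*) f" "lin scale (*) g" and p: "p \<in> R"
 shows "conv f g (SUM k:R. x k *s C p k) = (SUM m:R. f (C p m) * g (SUM k:R. x k *s C m k))"
proof -
 have "conv f g (SUM k:R. x k *s C p k) = (SUM k:R. x k * (SUM m:R. f (C p m) * g (C m k)))"
  by (simp add: lin_sum[OF lin_conv] lin_scale[OF lin_conv] conv_comatrix[OF C p _ f])
 also have "\<dots> = (SUM m:R. f (C p m) * g (SUM k:R. x k *s C m k))"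
  by (simp add: lin_sum[OF f(2)] lin_scale[OF f(2)] sum_distrib_left mult.left_commute) (rule sum.swap)
 finally show ?thesis .
qed

lemma sum_conv_comatrix':
 assumes D: "comatrix T D" and f: "lin scale (*) f" "lin scale (*) g" and q: "q \<in> T"
 shows "conv f g (SUM l:T. x l *s D l q) = (SUM m:T. f (SUM l:T. x l *s D l m) * g (D m q))"
proof -
 have "conv f g (SUM l:T. x l *s D l q) = (SUM l:T. x l * (SUM m:T. f (D l m) * g (D m q)))"
  by (simp add: lin_sum[OF lin_conv] lin_scale[OF lin_conv] conv_comatrix[OF D _ q f])
 also have "\<dots> = (SUM m:T. f (SUM l:T. x l *s D l m) * g (D m q))"
  by (simp add: lin_sum[OF f(1)] lin_scale[OF f(1)] sum_distrib_left sum_distrib_right mult.assoc) (rule sum.swap)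
 finally show ?thesis .
qed

lemma ext_coboundaries_subset:
 assumes C: "comatrix R C" and D: "comatrix T D"
 shows "ext_coboundaries R C T D \<subseteq> ext_cocycles R C T D"
proof
 fix X assume "X \<in> ext_coboundaries R C T D"
 then obtain M where M: "\<And>p q. p \<in> R \<Longrightarrow> q \<in> T \<Longrightarrow> X p q = (SUM k:R. M k q *s C p k) - (SUM l:T. M p l *s D l q)"
  unfolding ext_coboundaries_def by blast
 show "X \<in> ext_cocycles R C T D"
 proof (rule ext_cocycleI)
  fix p q f g assume pq: "p \<in> R" "q \<in> T" and f: "lin scale (*) f" and g: "lin scale (*) g"
  have "(SUM k:R. f (C p k) * g (SUM l:T. M k l *s D l q)) = (SUM l:T. f (SUM k:R. M k l *s C p k) * g (D l q))"
   by (simp add: lin_sum[OF f] lin_scale[OF f] lin_sum[OF g] lin_scale[OF g] sum_distrib_left sum_distrib_right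
     mult.assoc mult.left_commute) (rule sum.swap)
  then show "conv f g (X p q) = (SUM k:R. f (C p k) * g (X k q)) + (SUM l:T. f (X p l) * g (D l q))"
   by (simp add: M pq lin_diff[OF lin_conv] lin_diff[OF f] lin_diff[OF g] sum_conv_comatrix[OF C f g pq(1)]
     sum_conv_comatrix'[OF D f g pq(2)] right_diff_distrib left_diff_distrib sum_subtractf)
 qed
qed

text \<open>The linear forms act on \<open>H\<close> from both sides by \<open>f(w\<^sub>1) w\<^sub>2\<close> and \<open>w\<^sub>1 g(w\<^sub>2)\<close>.\<close>
definition lact :: "('b \<Rightarrow> 'a) \<Rightarrow> 'b \<Rightarrow> 'b" where
 "lact f w = (SUM (a1, a2)<-sweedler w. f a1 *s a2)"

definition ract :: "('b \<Rightarrow> 'a) \<Rightarrow> 'b \<Rightarrow> 'b" where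
 "ract g w = (SUM (a1, a2)<-sweedler w. g a2 *s a1)"

lemma lact_bil: "lin scale (*) f \<Longrightarrow> bilinear_map scale scale scale (\<lambda>a1 a2. f a1 *s a2)"
 and ract_bil: "lin scale (*) f \<Longrightarrow> bilinear_map scale scale scale (\<lambda>a1 a2. f a2 *s a1)"
 by (intro bilinear_mapI lin_scale_const lin_scale_fun lin_id vs; assumption)+

lemma lin_lact: "lin scale (*) f \<Longrightarrow> lin scale scale (lact f)"
 and lin_ract: "lin scale (*) f \<Longrightarrow> lin scale scale (ract f)"
 unfolding lact_def ract_def by (intro lin_sweedler vs lact_bil ract_bil; assumption)+

lemma conv_sweedler:
 "lin scale (*) f \<Longrightarrow> lin scale (*) g \<Longrightarrow> conv f g w = (SUM (a1, a2)<-sweedler w. f a1 * g a2)"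
 unfolding conv_def by (rule sweedler_form[symmetric]) (rule bilinear_form_functionals)

lemma functional_lact: "lin scale (*) f \<Longrightarrow> lin scale (*) g \<Longrightarrow> g (lact f w) = conv f g w"
 and functional_ract: "lin scale (*) f \<Longrightarrow> lin scale (*) g \<Longrightarrow> g (ract f w) = conv g f w"
 by (simp_all add: lact_def ract_def conv_sweedler lin_sum_list split_def lin_scale[where f=g] mult.commute)

lemma conv_assoc:
 assumes f: "lin scale (*) f" and g: "lin scale (*) g" and h: "lin scale (*) h"
 shows "conv (conv f g) h w = conv f (conv g h) w"
proof -
 have c: "coact scale UNIV \<Delta> = sweedler" by (simp add: fun_eq_iff coact_def sweedler_def)
 let ?\<phi> = "\<lambda>a b c. f a * (g b * h c)"
 have \<phi>: "bilinear_map scale scale (*) (?\<phi> a)" "lin scale (*) (\<lambda>a. ?\<phi> a b c)" for a b c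
  by (intro bilinear_mapI lin_mult_left lin_mult_right f g h)+
 have "conv (conv f g) h w = (SUM (x, a3)<-sweedler w. conv f g x * h a3)"
  by (rule conv_sweedler[OF lin_conv h])
 also have "\<dots> = (SUM (x, a3)<-sweedler w. SUM (a1, a2)<-sweedler x. ?\<phi> a1 a2 a3)"
  by (simp add: conv_sweedler[OF f g] split_def mult.assoc flip: sum_list_mult_const)
 also have "\<dots> = (SUM (a1, x)<-sweedler w. \<Delta> x (?\<phi> a1))"
  using coassoc_form[OF right_comodule_self UNIV_I \<phi>] unfolding c .
 also have "\<dots> = (SUM (a1, x)<-sweedler w. f a1 * conv g h x)"
  unfolding conv_def
  by (rule sum_list_pair_cong, rule tensor_form_plus(2)[OF \<Delta>_tensor])
   (rule bilinear_form_functionals[OF g h])+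
 also have "\<dots> = conv f (conv g h) w" by (rule conv_sweedler[OF f lin_conv, symmetric])
 finally show ?thesis .
qed

lemma lact_counit: "lact \<epsilon> w = w" and ract_counit: "ract \<epsilon> w = w"
 unfolding lact_def ract_def by (rule counit_left counit_right)+

lemma lact_comatrix:
 assumes "comatrix R C" "i \<in> R" "j \<in> R" "lin scale (*) f"
 shows "lact f (C i j) = (SUM k:R. f (C i k) *s C k j)" "ract f (C i j) = (SUM k:R. f (C k j) *s C i k)"
 unfolding lact_def ract_def
 by (rule sweedler_eq[OF vs lact_bil[OF assms(4)] comatrixD(2)[OF assms(1-3)]]
   sweedler_eq[OF vs ract_bil[OF assms(4)] comatrixD(2)[OF assms(1-3)]])+

lemma subspace_entries: "subspace (entries R C)" by (simp add: entries_def)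

lemma in_entries: "i \<in> R \<Longrightarrow> j \<in> R \<Longrightarrow> C i j \<in> entries R C"
 unfolding entries_def by (rule span_base) auto

lemma wedge_conv:
 assumes "w \<in> V \<and>\<^sub>c W" "lin scale (*) f" "lin scale (*) g"
  and f0: "\<And>x. x \<in> V \<Longrightarrow> f x = 0" and g0: "\<And>x. x \<in> W \<Longrightarrow> g x = 0"
 shows "conv f g w = 0"
proof -
 interpret T: vector_space "tscale :: 'a \<Rightarrow> ('b, 'b, 'a) tensor \<Rightarrow> _" by (rule vector_space_tscale)
 let ?b = "\<lambda>x y. f x * g y"
 have b: "bilinear_map scale scale (*) ?b" by (rule bilinear_form_functionals[OF assms(2,3)])
 have 1: "t ?b = 0" if "t \<in> tensor_space scale scale V UNIV" for t
  using that unfolding tensor_space_def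
  by (induction rule: T.span_induct_alt) (auto simp: pointwise_scale_def tensor_apply[OF b] f0)
 have 2: "t ?b = 0" if "t \<in> tensor_space scale scale UNIV W" for t
  using that unfolding tensor_space_def
  by (induction rule: T.span_induct_alt) (auto simp: pointwise_scale_def tensor_apply[OF b] g0)
 obtain s t where "s \<in> tensor_space scale scale V UNIV" "t \<in> tensor_space scale scale UNIV W" "\<Delta> w = s + t"
  using assms(1) unfolding wedge_def by (auto elim: set_plus_elim)
 then show ?thesis by (simp add: conv_def 1 2)
qed

lemma subspace_wedge: "subspace (V \<and>\<^sub>c W)"
proof -
 interpret T: vector_space "tscale :: 'a \<Rightarrow> ('b, 'b, 'a) tensor \<Rightarrow> _" by (rule vector_space_tscale)
 let ?T = "tensor_space scale scale V UNIV + tensor_space scale scale UNIV W"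
 have "?T = {x + y | x y. x \<in> tensor_space scale scale V UNIV \<and> y \<in> tensor_space scale scale UNIV W}"
  by (auto simp: set_plus_def)
 then have S: "T.subspace ?T" using T.subspace_sums[OF subspace_tensor_space subspace_tensor_space] by simp
 show ?thesis unfolding wedge_def
  by (rule subspaceI)
   (simp_all only: mem_Collect_eq lin_zero[OF \<Delta>_linear] lin_add[OF \<Delta>_linear] lin_scale[OF \<Delta>_linear]
    T.subspace_0[OF S] T.subspace_add[OF S] T.subspace_scale[OF S])
qed

lemma wedgeI:
 assumes "\<Delta> w = s + t" "s \<in> tensor_space scale scale V UNIV" "t \<in> tensor_space scale scale UNIV W"
 shows "w \<in> V \<and>\<^sub>c W"
 using assms unfolding wedge_def by (auto intro: set_plus_intro)


lemma conv_diff_left: "lin scale (*) f \<Longrightarrow> lin scale (*) f' \<Longrightarrow> lin scale (*) g \<Longrightarrow>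
  conv (\<lambda>h. f h - f' h) g w = conv f g w - conv f' g w"
 and conv_diff_right: "lin scale (*) f \<Longrightarrow> lin scale (*) g \<Longrightarrow> lin scale (*) g' \<Longrightarrow>
  conv f (\<lambda>h. g h - g' h) w = conv f g w - conv f g' w"
 by (simp_all add: conv_sweedler lin_minus split_def algebra_simps sum_list_subtractf)

lemma conv_sum_left: "(\<And>i. i \<in> I \<Longrightarrow> lin scale (*) (f i)) \<Longrightarrow> lin scale (*) g \<Longrightarrow>
  conv (\<lambda>h. SUM i:I. c i * f i h) g w = (SUM i:I. c i * conv (f i) g w)"
 and conv_sum_right: "(\<And>i. i \<in> I \<Longrightarrow> lin scale (*) (f i)) \<Longrightarrow> lin scale (*) g \<Longrightarrow>
  conv g (\<lambda>h. SUM i:I. c i * f i h) w = (SUM i:I. c i * conv g (f i) w)"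
 by (simp_all add: conv_sweedler lin_sum_fun[OF vs vector_space_mult] lin_mult_left split_def
   sum_distrib_left sum_distrib_right sum_list_sum_swap mult.assoc mult.left_commute
   flip: sum_list_const_mult)

lemma lact_wedge:
 assumes "w \<in> V \<and>\<^sub>c W" "subspace W" "lin scale (*) f" "\<And>x. x \<in> V \<Longrightarrow> f x = 0"
 shows "lact f w \<in> W"
proof (rule ccontr)
 assume "lact f w \<notin> W"
 then obtain g where "lin scale (*) g" "\<And>x. x \<in> W \<Longrightarrow> g x = 0" "g (lact f w) = 1"
  using functional_separates_subspace[OF vs assms(2)] by metis
 then show False using wedge_conv[OF assms(1,3) _ assms(4)] by (simp add: functional_lact[OF assms(3)])
qed

lemma ract_wedge:
 assumes "w \<in> V \<and>\<^sub>c W" "subspace V" "lin scale (*) f" "\<And>x. x \<in> W \<Longrightarrow> f x = 0"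
 shows "ract f w \<in> V"
proof (rule ccontr)
 assume "ract f w \<notin> V"
 then obtain g where "lin scale (*) g" "\<And>x. x \<in> V \<Longrightarrow> g x = 0" "g (ract f w) = 1"
  using functional_separates_subspace[OF vs assms(2)] by metis
 then show False using wedge_conv[OF assms(1) _ assms(3) _ assms(4)] by (simp add: functional_ract[OF assms(3)])
qed

lemma subspace_plus: "subspace V \<Longrightarrow> subspace W \<Longrightarrow> subspace (V + W)"
proof -
 assume "subspace V" "subspace W"
 moreover have "V + W = {x + y | x y. x \<in> V \<and> y \<in> W}" by (auto simp: set_plus_def)
 ultimately show ?thesis using subspace_sums by simp
qed

text \<open>The comatrices \<open>C\<close>, \<open>D\<close> have linearly independent entries, with dual forms \<open>cs\<close>, \<open>ds\<close>.\<close>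
context
 fixes R :: "'r set" and C :: "'r \<Rightarrow> 'r \<Rightarrow> 'b" and T :: "'t set" and D :: "'t \<Rightarrow> 't \<Rightarrow> 'b"
  and cs :: "'r \<Rightarrow> 'r \<Rightarrow> 'b \<Rightarrow> 'a" and ds :: "'t \<Rightarrow> 't \<Rightarrow> 'b \<Rightarrow> 'a"
 assumes C: "comatrix R C" and D: "comatrix T D"
  and cs: "\<And>a b. lin scale (*) (cs a b)"
   "\<And>a b a' b'. a \<in> R \<Longrightarrow> b \<in> R \<Longrightarrow> a' \<in> R \<Longrightarrow> b' \<in> R \<Longrightarrow> cs a b (C a' b') = (if a = a' \<and> b = b' then 1 else 0)"
  and ds: "\<And>a b. lin scale (*) (ds a b)"
   "\<And>a b a' b'. a \<in> T \<Longrightarrow> b \<in> T \<Longrightarrow> a' \<in> T \<Longrightarrow> b' \<in> T \<Longrightarrow> ds a b (D a' b') = (if a = a' \<and> b = b' then 1 else 0)"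
begin

private lemma fin: "finite R" "finite T"
 using C D by (auto simp: comatrix_def)

text \<open>The matrix \<open>(c\<^sup>*\<^sub>a\<^sub>p(w\<^sub>1) w\<^sub>2 d\<^sup>*\<^sub>q\<^sub>b(w\<^sub>3))\<^sub>p\<^sub>q\<close> of an element \<open>w\<close> of the wedge.\<close>
private definition "component a b w = (\<lambda>p q. ract (ds q b) (lact (cs a p) w))"

text \<open>It is a cocycle up to a correction by a matrix with entries in the first subcoalgebra.\<close>
private lemma component_cocycle:
 assumes w: "w \<in> entries R C \<and>\<^sub>c entries T D" and a: "a \<in> R" and b: "b \<in> T"
 shows "(\<lambda>p q. component a b w p q - (SUM k:R. conv (cs a k) (ds q b) w *s C p k)) \<in> ext_cocycles R C T D"
proof (rule ext_cocycleI)
 fix p q f g assume p: "p \<in> R" and q: "q \<in> T" and f: "lin scale (*) f" and g: "lin scale (*) g"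
 let ?m = "\<lambda>k q. conv (cs a k) (ds q b) w"
 let ?X = "component a b w"
 have fX: "h (?X p q) = conv (cs a p) (conv h (ds q b)) w" if "lin scale (*) h" for h p q
  unfolding component_def functional_ract[OF ds(1) that] functional_lact[OF cs(1) lin_conv] ..
 let ?s = "\<lambda>h. SUM k:R. f (C p k) * cs a k h" and ?t = "\<lambda>h. SUM l:T. g (D l q) * ds l b h"
 have s: "lin scale (*) ?s" and t: "lin scale (*) ?t"
  by (intro lin_sum_fun vs vector_space_mult lin_mult_left cs ds)+
 let ?u = "\<lambda>h. conv (cs a p) f h - ?s h" and ?v = "\<lambda>h. conv g (ds q b) h - ?t h"
 have u: "lin scale (*) ?u" and v: "lin scale (*) ?v" by (intro lin_minus lin_conv s t)+
 have u0: "?u x = 0" if "x \<in> entries R C" for x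
  using that unfolding entries_def
 proof (induction rule: span_induct_alt)
  case base show ?case by (rule lin_zero[OF u])
 next
  case (step c x y)
  then obtain i j where ij: "i \<in> R" "j \<in> R" "x = C i j" by auto
  have "?s x = f (C p j) * cs a j (C i j)"
  proof -
   have "(SUM k:R. f (C p k) * cs a k (C i j)) = (SUM k:R. f (C p k) * (if k = j then cs a j (C i j) else 0))"
    by (intro sum.cong refl) (use ij a in \<open>auto simp: cs\<close>)
   then show ?thesis using fin ij by (simp add: if_distrib cong: if_cong)
  qed
  moreover have "conv (cs a p) f x = cs a p (C i p) * f (C p j)"
  proof -
   have "(SUM k:R. cs a p (C i k) * f (C k j)) = (SUM k:R. (if k = p then cs a p (C i p) * f (C p j) else 0))"
    by (intro sum.cong refl) (use ij a p in \<open>auto simp: cs\<close>)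
   then show ?thesis using fin p ij by (simp add: conv_comatrix[OF C _ _ cs(1) f])
  qed
  ultimately have "?u x = 0" using ij a p by (simp add: cs)
  then show ?case using step by (simp only: lin_add[OF u] lin_scale[OF u] mult_zero_right add_0_right)
 qed
 have v0: "?v x = 0" if "x \<in> entries T D" for x
  using that unfolding entries_def
 proof (induction rule: span_induct_alt)
  case base show ?case by (rule lin_zero[OF v])
 next
  case (step c x y)
  then obtain i j where ij: "i \<in> T" "j \<in> T" "x = D i j" by auto
  have "?t x = g (D i q) * ds i b (D i j)"
  proof -
   have "(SUM k:T. g (D k q) * ds k b (D i j)) = (SUM k:T. g (D k q) * (if k = i then ds i b (D i j) else 0))"
    by (intro sum.cong refl) (use ij b in \<open>auto simp: ds\<close>)
   then show ?thesis using fin ij by (simp add: if_distrib cong: if_cong)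
  qed
  moreover have "conv g (ds q b) x = g (D i q) * ds q b (D q j)"
  proof -
   have "(SUM k:T. g (D i k) * ds q b (D k j)) = (SUM k:T. (if k = q then g (D i q) * ds q b (D q j) else 0))"
    by (intro sum.cong refl) (use ij b q in \<open>auto simp: ds\<close>)
   then show ?thesis using fin q ij by (simp add: conv_comatrix[OF D _ _ g ds(1)])
  qed
  ultimately have "?v x = 0" using ij b q by (simp add: ds)
  then show ?case using step by (simp only: lin_add[OF v] lin_scale[OF v] mult_zero_right add_0_right)
 qed
 have "conv ?u ?v w = 0" by (rule wedge_conv[OF w u v u0 v0])
 then have "conv (conv (cs a p) f) (conv g (ds q b)) w - conv (conv (cs a p) f) ?t w =
   conv ?s (conv g (ds q b)) w - conv ?s ?t w"
  by (simp add: conv_diff_left[OF lin_conv s v] conv_diff_right[OF _ lin_conv t] lin_conv s)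
 then have main: "conv (conv (cs a p) f) (conv g (ds q b)) w =
   conv (conv (cs a p) f) ?t w + conv ?s (conv g (ds q b)) w - conv ?s ?t w"
  by (simp add: algebra_simps)
 have 1: "conv (conv (cs a p) f) ?t w = (SUM l:T. g (D l q) * f (?X p l))"
  by (simp add: conv_sum_right[OF ds(1) lin_conv] fX[OF f] conv_assoc[OF cs(1) f ds(1)])
 have 2: "conv ?s (conv g (ds q b)) w = (SUM k:R. f (C p k) * g (?X k q))"
  by (simp add: conv_sum_left[OF cs(1) lin_conv] fX[OF g])
 have 3: "conv ?s ?t w = (SUM k:R. f (C p k) * (SUM l:T. g (D l q) * ?m k l))"
  by (simp only: conv_sum_left[OF cs(1) t] conv_sum_right[OF ds(1) cs(1)])
 have "conv f g (?X p q) = conv (conv (cs a p) f) (conv g (ds q b)) w"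
  by (simp add: fX[OF lin_conv] conv_assoc[OF f g ds(1)] conv_assoc[OF cs(1) f lin_conv]
    conv_def[of "cs a p" "conv (conv f g) (ds q b)"] cong: conj_cong) (simp add: conv_def conv_assoc[OF f g ds(1), unfolded conv_def])
 then have X: "conv f g (?X p q) = (SUM l:T. g (D l q) * f (?X p l)) + (SUM k:R. f (C p k) * g (?X k q)) -
   (SUM k:R. f (C p k) * (SUM l:T. g (D l q) * ?m k l))"
  unfolding main 1 2 3 .
 have "(SUM l:T. f (SUM k:R. ?m k l *s C p k) * g (D l q)) = (SUM k:R. f (C p k) * (SUM l:T. g (D l q) * ?m k l))"
  by (simp add: lin_sum[OF f] lin_scale[OF f] sum_distrib_left sum_distrib_right mult.assoc mult.left_commute)
   (subst sum.swap, simp add: ac_simps)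
 then show "conv f g (?X p q - (SUM k:R. ?m k q *s C p k)) =
  (SUM k:R. f (C p k) * g (?X k q - (SUM k':R. ?m k' q *s C k k'))) +
  (SUM l:T. f (?X p l - (SUM k:R. ?m k l *s C p k)) * g (D l q))"
  by (simp add: lin_diff[OF lin_conv] lin_diff[OF f] lin_diff[OF g] X sum_conv_comatrix[OF C f g p]
    right_diff_distrib left_diff_distrib sum_subtractf mult.commute[of "g _"])
qed


private lemma ract_entries:
 assumes "lin scale (*) f" "x \<in> entries T D" shows "ract f x \<in> entries T D"
 using assms(2) unfolding entries_def
proof (induction rule: span_induct_alt)
 case base
 then show ?case by (simp only: lin_zero[OF lin_ract[OF assms(1)]] span_zero)
next
 case (step c x y)
 then obtain i j where ij: "i \<in> T" "j \<in> T" "x = D i j" by auto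
 have "ract f x \<in> entries T D"
  unfolding ij(3) lact_comatrix[OF D ij(1,2) assms(1)]
  by (intro subspace_sum subspace_scale subspace_entries in_entries ij)
 then show ?case using step unfolding entries_def
  by (simp only: lin_add[OF lin_ract[OF assms(1)]] lin_scale[OF lin_ract[OF assms(1)]] span_add span_scale)
qed

text \<open>Since \<open>\<Sum>\<^sub>a c\<^sup>*\<^sub>a\<^sub>a\<close> agrees with the counit on the first subcoalgebra, and likewise for the second, an
 element of the wedge is the sum of diagonal entries of its components, up to the two subcoalgebras.\<close>
private lemma component_sum:
 assumes w: "w \<in> entries R C \<and>\<^sub>c entries T D"
 obtains c d where "c \<in> entries R C" "d \<in> entries T D"
  "w = (SUM a:R. SUM b:T. component a b w a b) + c + d"
proof -
 let ?c = "\<lambda>h. SUM a:R. cs a a h" and ?d = "\<lambda>h. SUM b:T. ds b b h"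
 have lc: "lin scale (*) ?c" and ld: "lin scale (*) ?d"
  by (intro lin_sum_fun vs vector_space_mult cs ds)+
 have c\<epsilon>: "lin scale (*) (\<lambda>h. ?c h - \<epsilon> h)" and d\<epsilon>: "lin scale (*) (\<lambda>h. ?d h - \<epsilon> h)"
  by (intro lin_minus lc ld \<epsilon>_linear)+
 have c0: "?c x - \<epsilon> x = 0" if "x \<in> entries R C" for x
  using that unfolding entries_def
 proof (induction rule: span_induct_alt)
  case base show ?case by (rule lin_zero[OF c\<epsilon>])
 next
  case (step c x y)
  then obtain i j where ij: "i \<in> R" "j \<in> R" "x = C i j" by auto
  have "(SUM a:R. cs a a (C i j)) = (SUM a:R. if a = i then (if i = j then 1 else 0) else 0)"
   by (intro sum.cong refl) (use ij in \<open>auto simp: cs\<close>)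
  then have "?c x - \<epsilon> x = 0" using ij fin by (simp add: comatrixD(3)[OF C])
  then show ?case using step by (simp only: lin_add[OF c\<epsilon>] lin_scale[OF c\<epsilon>] mult_zero_right add_0_right)
 qed
 have d0: "?d x - \<epsilon> x = 0" if "x \<in> entries T D" for x
  using that unfolding entries_def
 proof (induction rule: span_induct_alt)
  case base show ?case by (rule lin_zero[OF d\<epsilon>])
 next
  case (step c x y)
  then obtain i j where ij: "i \<in> T" "j \<in> T" "x = D i j" by auto
  have "(SUM a:T. ds a a (D i j)) = (SUM a:T. if a = i then (if i = j then 1 else 0) else 0)"
   by (intro sum.cong refl) (use ij in \<open>auto simp: ds\<close>)
  then have "?d x - \<epsilon> x = 0" using ij fin by (simp add: comatrixD(3)[OF D])
  then show ?case using step by (simp only: lin_add[OF d\<epsilon>] lin_scale[OF d\<epsilon>] mult_zero_right add_0_right)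
 qed
 have diffl: "lact (\<lambda>h. f h - g h) w = lact f w - lact g w" for f g w
  by (simp add: lact_def split_def scale_left_diff_distrib sum_list_subtractf)
 have diffr: "ract (\<lambda>h. f h - g h) w = ract f w - ract g w" for f g w
  by (simp add: ract_def split_def scale_left_diff_distrib sum_list_subtractf)
 have suml: "lact ?c w = (SUM a:R. lact (cs a a) w)"
  by (simp add: lact_def split_def scale_sum_left sum_list_sum_swap)
 have sumr: "ract ?d w = (SUM b:T. ract (ds b b) w)" for w
  by (simp add: ract_def split_def scale_sum_left sum_list_sum_swap)
 have d: "lact ?c w - w \<in> entries T D"
  using lact_wedge[OF w subspace_entries c\<epsilon> c0] by (simp only: diffl lact_counit)
 have c: "ract ?d w - w \<in> entries R C"
  using ract_wedge[OF w subspace_entries d\<epsilon> d0] by (simp only: diffr ract_counit)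
 have "ract ?d (lact ?c w - w) \<in> entries T D" by (rule ract_entries[OF ld d])
 then have d': "ract ?d w - ract ?d (lact ?c w) \<in> entries T D"
  using subspace_neg[OF subspace_entries] by (metis (no_types, lifting) lin_diff[OF lin_ract[OF ld]] minus_diff_eq)
 have "ract ?d (lact ?c w) = (SUM a:R. SUM b:T. component a b w a b)"
  unfolding suml sumr component_def lin_sum[OF lin_ract[OF ds(1)]] by (rule sum.swap)
 then have "w = (SUM a:R. SUM b:T. component a b w a b) + (w - ract ?d w) + (ract ?d w - ract ?d (lact ?c w))"
  by simp
 moreover have "w - ract ?d w \<in> entries R C"
  using subspace_neg[OF subspace_entries c] by simp
 ultimately show ?thesis using that d' by blast
qed

text \<open>Applying \<open>c\<^sup>*\<^sub>a\<^sub>p(w\<^sub>1) w\<^sub>2 d\<^sup>*\<^sub>q\<^sub>b(w\<^sub>3)\<close> to the entries of a cocycle recovers the cocycle from a single entry,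
 up to matrices of the form \<open>CM\<close> and \<open>MD\<close>.\<close>
private lemma component_of_cocycle:
 assumes X: "X \<in> ext_cocycles R C T D" and a: "a \<in> R" and b: "b \<in> T"
  and p: "p \<in> R" "p0 \<in> R" and q: "q \<in> T" "q0 \<in> T"
 shows "component a b (X p q) p0 q0 =
  (if p = a \<and> q = b then X p0 q0 else 0) +
  (SUM k:R. (if p = a then ds q0 b (X k q) else 0) *s C p0 k) +
  (SUM l:T. (if q = b then cs a p0 (X p l) else 0) *s D l q0)"
proof -
 have l: "lact (cs a p0) (X p q) = (if p = a then X p0 q else 0) + (SUM l:T. cs a p0 (X p l) *s D l q)"
 proof -
  have "lact (cs a p0) (X p q) = (SUM k:R. cs a p0 (C p k) *s X k q) + (SUM l:T. cs a p0 (X p l) *s D l q)"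
   unfolding lact_def by (rule ext_cocycle_eq[OF fin X p(1) q(1) vs lact_bil[OF cs(1)]])
  also have "(SUM k:R. cs a p0 (C p k) *s X k q) = (SUM k:R. if k = p0 then (if p = a then X p0 q else 0) else 0)"
   by (intro sum.cong refl) (use p a in \<open>auto simp: cs\<close>)
  finally show ?thesis using fin p by simp
 qed
 have rX: "ract (ds q0 b) (X p0 q) = (if q = b then X p0 q0 else 0) + (SUM k:R. ds q0 b (X k q) *s C p0 k)"
 proof -
  have "ract (ds q0 b) (X p0 q) = (SUM k:R. ds q0 b (X k q) *s C p0 k) + (SUM l:T. ds q0 b (D l q) *s X p0 l)"
   unfolding ract_def by (rule ext_cocycle_eq[OF fin X p(2) q(1) vs ract_bil[OF ds(1)]])
  also have "(SUM l:T. ds q0 b (D l q) *s X p0 l) = (SUM l:T. if l = q0 then (if q = b then X p0 q0 else 0) else 0)"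
   by (intro sum.cong refl) (use q b in \<open>auto simp: ds\<close>)
  finally show ?thesis using fin q by simp
 qed
 have rD: "ract (ds q0 b) (D l q) = (if q = b then D l q0 else 0)" if l: "l \<in> T" for l
 proof -
  have "ract (ds q0 b) (D l q) = (SUM m:T. ds q0 b (D m q) *s D l m)"
   by (rule lact_comatrix(2)[OF D l q(1) ds(1)])
  also have "\<dots> = (SUM m:T. if m = q0 then (if q = b then D l q0 else 0) else 0)"
   by (intro sum.cong refl) (use q b l in \<open>auto simp: ds\<close>)
  finally show ?thesis using fin q by simp
 qed
 have "component a b (X p q) p0 q0 = (if p = a then ract (ds q0 b) (X p0 q) else 0) +
   (SUM l:T. cs a p0 (X p l) *s ract (ds q0 b) (D l q))"
  unfolding component_def l
  by (simp add: lin_add[OF lin_ract[OF ds(1)]] lin_zero[OF lin_ract[OF ds(1)]] lin_sum[OF lin_ract[OF ds(1)]] lin_scale[OF lin_ract[OF ds(1)]])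
 also have "(SUM l:T. cs a p0 (X p l) *s ract (ds q0 b) (D l q)) = (SUM l:T. (if q = b then cs a p0 (X p l) else 0) *s D l q0)"
  by (intro sum.cong refl) (simp add: rD)
 finally show ?thesis by (simp add: rX add.assoc)
qed

text \<open>A form \<open>cs a p\<close> applied to the left tensor factor of the coproduct of an
 entry of \<open>C\<close> gives zero or an entry of \<open>C\<close> in row \<open>p\<close>;
 likewise for \<open>ds\<close>, \<open>D\<close> and columns.\<close>
private lemma component_of_entries:
 assumes "w \<in> entries R C + entries T D" and a: "a \<in> R" and b: "b \<in> T"
 shows "\<exists>M N. \<forall>p0\<in>R. \<forall>q0\<in>T. component a b w p0 q0 = (SUM k:R. M k q0 *s C p0 k) + (SUM l:T. N p0 l *s D l q0)"
proof -
 have lin: "lin scale scale (\<lambda>w. component a b w p q)" for p q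
  unfolding component_def by (rule lin_comp[OF lin_lact[OF cs(1)] lin_ract[OF ds(1)]])
 have c: "\<exists>M. \<forall>p0\<in>R. \<forall>q0\<in>T. component a b w p0 q0 = (SUM k:R. M k q0 *s C p0 k)" if "w \<in> entries R C" for w
  using that unfolding entries_def
 proof (induction rule: span_induct_alt)
  case base show ?case by (rule exI[of _ "\<lambda>_ _. 0"]) (simp add: lin_zero[OF lin])
 next
  case (step c x y)
  then obtain i j M where ij: "i \<in> R" "j \<in> R" "x = C i j"
   and M: "\<forall>p0\<in>R. \<forall>q0\<in>T. component a b y p0 q0 = (SUM k:R. M k q0 *s C p0 k)" by auto
  have "component a b x p0 q0 = (SUM k:R. (if i = a then ds q0 b (C k j) else 0) *s C p0 k)"
   if p0: "p0 \<in> R" and "q0 \<in> T" for p0 q0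
  proof -
   have "lact (cs a p0) x = (SUM k:R. cs a p0 (C i k) *s C k j)"
    unfolding ij(3) by (rule lact_comatrix(1)[OF C ij(1,2) cs(1)])
   also have "\<dots> = (SUM k:R. if k = p0 then (if i = a then C p0 j else 0) else 0)"
    by (intro sum.cong refl) (use p0 a ij in \<open>auto simp: cs\<close>)
   finally have "lact (cs a p0) x = (if i = a then C p0 j else 0)" using fin p0 by simp
   then show ?thesis unfolding component_def
    by (simp add: lact_comatrix(2)[OF C p0 ij(2) ds(1)] lin_zero[OF lin_ract[OF ds(1)]])
  qed
  then show ?case using M
   by (intro exI[of _ "\<lambda>k q0. c * (if i = a then ds q0 b (C k j) else 0) + M k q0"])
    (simp add: lin_add[OF lin] lin_scale[OF lin] scale_left_distrib sum.distrib scale_sum_right)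
 qed
 have d: "\<exists>N. \<forall>p0\<in>R. \<forall>q0\<in>T. component a b w p0 q0 = (SUM l:T. N p0 l *s D l q0)" if "w \<in> entries T D" for w
  using that unfolding entries_def
 proof (induction rule: span_induct_alt)
  case base show ?case by (rule exI[of _ "\<lambda>_ _. 0"]) (simp add: lin_zero[OF lin])
 next
  case (step c x y)
  then obtain i j N where ij: "i \<in> T" "j \<in> T" "x = D i j"
   and N: "\<forall>p0\<in>R. \<forall>q0\<in>T. component a b y p0 q0 = (SUM l:T. N p0 l *s D l q0)" by auto
  have "component a b x p0 q0 = (SUM l:T. (if j = b then cs a p0 (D i l) else 0) *s D l q0)"
   if "p0 \<in> R" and q0: "q0 \<in> T" for p0 q0
  proof -
   have rD: "ract (ds q0 b) (D l j) = (if j = b then D l q0 else 0)" if l: "l \<in> T" for l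
   proof -
    have "ract (ds q0 b) (D l j) = (SUM m:T. ds q0 b (D m j) *s D l m)"
     by (rule lact_comatrix(2)[OF D l ij(2) ds(1)])
    also have "\<dots> = (SUM m:T. if m = q0 then (if j = b then D l q0 else 0) else 0)"
     by (intro sum.cong refl) (use q0 b l ij in \<open>auto simp: ds\<close>)
    finally show ?thesis using fin q0 by simp
   qed
   have "component a b x p0 q0 = (SUM l:T. cs a p0 (D i l) *s ract (ds q0 b) (D l j))"
    unfolding component_def ij(3)
    by (simp add: lact_comatrix(1)[OF D ij(1,2) cs(1)] lin_sum[OF lin_ract[OF ds(1)]] lin_scale[OF lin_ract[OF ds(1)]])
   also have "\<dots> = (SUM l:T. (if j = b then cs a p0 (D i l) else 0) *s D l q0)"
    by (intro sum.cong refl) (simp add: rD)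
   finally show ?thesis .
  qed
  then show ?case using N
   by (intro exI[of _ "\<lambda>p0 l. c * (if j = b then cs a p0 (D i l) else 0) + N p0 l"])
    (simp add: lin_add[OF lin] lin_scale[OF lin] scale_left_distrib sum.distrib scale_sum_right)
 qed
 obtain x y where xy: "x \<in> entries R C" "y \<in> entries T D" "w = x + y" using assms(1) by (auto elim: set_plus_elim)
 obtain M where "\<forall>p0\<in>R. \<forall>q0\<in>T. component a b x p0 q0 = (SUM k:R. M k q0 *s C p0 k)" using c[OF xy(1)] by blast
 moreover obtain N where "\<forall>p0\<in>R. \<forall>q0\<in>T. component a b y p0 q0 = (SUM l:T. N p0 l *s D l q0)" using d[OF xy(2)] by blast
 ultimately show ?thesis unfolding xy(3) by (intro exI[of _ M] exI[of _ N]) (simp add: lin_add[OF lin])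
qed

text \<open>Applying the dual forms \<open>cs k k\<close> and \<open>ds l l\<close> to the cocycle
 condition gives \<open>N k l = - M k l\<close>.\<close>
private lemma cocycle_split:
 assumes Y: "Y \<in> ext_cocycles R C T D"
  and eq: "\<And>p q. p \<in> R \<Longrightarrow> q \<in> T \<Longrightarrow> Y p q = (SUM k:R. M k q *s C p k) + (SUM l:T. N p l *s D l q)"
 shows "Y \<in> ext_coboundaries R C T D"
proof -
 have N: "N k l = - M k l" if k: "k \<in> R" and l: "l \<in> T" for k l
 proof -
  let ?f = "cs k k" and ?g = "ds l l"
  let ?c = "\<lambda>m q. SUM k:R. M k q *s C m k" and ?d = "\<lambda>p m. SUM l:T. N p l *s D l m"
  have f: "lin scale (*) ?f" and g: "lin scale (*) ?g" by (rule cs ds)+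
  have "conv ?f ?g (Y k l) = (SUM m:R. ?f (C k m) * ?g (?c m l)) + (SUM m:T. ?f (?d k m) * ?g (D m l))"
   unfolding eq[OF k l] lin_add[OF lin_conv] sum_conv_comatrix[OF C f g k] sum_conv_comatrix'[OF D f g l] ..
  moreover have "conv ?f ?g (Y k l) = (SUM m:R. ?f (C k m) * ?g (?c m l + ?d m l)) + (SUM m:T. ?f (?c k m + ?d k m) * ?g (D m l))"
   unfolding conv_ext_cocycle[OF Y k l f g] using k l by (simp add: eq)
  ultimately have 0: "(SUM m:R. ?f (C k m) * ?g (?d m l)) + (SUM m:T. ?f (?c k m) * ?g (D m l)) = 0"
   by (simp add: lin_add[OF f] lin_add[OF g] distrib_left distrib_right sum.distrib)
  have "(SUM m:R. ?f (C k m) * ?g (?d m l)) = (SUM m:R. if m = k then ?g (?d k l) else 0)"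
   by (intro sum.cong refl) (use k in \<open>auto simp: cs\<close>)
  also have "\<dots> = ?g (?d k l)" using fin k by simp
  also have "\<dots> = (SUM l':T. N k l' * (if l = l' then 1 else 0))"
   unfolding lin_sum[OF g] lin_scale[OF g] by (intro sum.cong refl) (use l in \<open>auto simp: ds\<close>)
  also have "\<dots> = N k l" by (rule sum_delta_mult(4)[OF fin(2) l])
  finally have 1: "(SUM m:R. ?f (C k m) * ?g (?d m l)) = N k l" .
  have "(SUM m:T. ?f (?c k m) * ?g (D m l)) = (SUM m:T. if m = l then ?f (?c k l) else 0)"
   by (intro sum.cong refl) (use l in \<open>auto simp: ds\<close>)
  also have "\<dots> = ?f (?c k l)" using fin l by simp
  also have "\<dots> = (SUM k':R. M k' l * (if k = k' then 1 else 0))"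
   unfolding lin_sum[OF f] lin_scale[OF f] by (intro sum.cong refl) (use k in \<open>auto simp: cs\<close>)
  also have "\<dots> = M k l" by (rule sum_delta_mult(4)[OF fin(1) k])
  finally have "N k l + M k l = 0" using 0 1 by simp
  then show ?thesis by (simp add: add_eq_0_iff2)
 qed
 show ?thesis unfolding ext_coboundaries_def
  by (rule CollectI, rule exI[of _ M]) (simp add: eq N sum_negf)
qed

text \<open>The entry at \<open>(p, q)\<close> is, up to \<open>C + D\<close>, inverse to forming the
 component at \<open>(p, q)\<close>, up to coboundaries; so the quotient of the wedge is a direct
 sum of copies of the extension group, one for each pair of indices. This is why its dimension is
 divided by the sizes of the two matrices.\<close>
theorem wedge_basis:
 assumes B: "basis_mod (entries R C \<and>\<^sub>c entries T D) (entries R C + entries T D) B"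
  and \<beta>: "vector_space.basis_mod (mscale scale) (ext_cocycles R C T D) (ext_coboundaries R C T D) \<beta>"
 shows "B \<approx> (R \<times> T) \<times> \<beta>"
proof -
 interpret M: vector_space "mscale scale" by (rule vs_matrices)
 let ?U = "entries R C \<and>\<^sub>c entries T D" and ?W = "entries R C + entries T D"
 let ?Z = "ext_cocycles R C T D" and ?B = "ext_coboundaries R C T D"
 interpret T: vector_space "tscale :: 'a \<Rightarrow> ('b, 'b, 'a) tensor \<Rightarrow> _" by (rule vector_space_tscale)
 have subW: "subspace ?W" by (intro subspace_plus subspace_entries)
 have CU: "entries R C \<subseteq> ?U" unfolding entries_def[of R C]
 proof (intro span_minimal subspace_wedge subsetI)
  fix x assume "x \<in> {C i j |i j. i \<in> R \<and> j \<in> R}"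
  then obtain i j where ij: "i \<in> R" "j \<in> R" "x = C i j" by auto
  show "x \<in> span {C i j |i j. i \<in> R \<and> j \<in> R} \<and>\<^sub>c entries T D"
   unfolding entries_def[symmetric]
  proof (rule wedgeI)
   show "\<Delta> x = (SUM k:R. C i k \<otimes> C k j) + 0" using comatrixD(2)[OF C ij(1,2)] by (simp only: ij(3) add_0_right)
   show "(SUM k:R. C i k \<otimes> C k j) \<in> tensor_space scale scale (entries R C) UNIV"
    by (rule sum_tensor_in_space) (use ij in \<open>auto intro: in_entries\<close>)
  qed (rule T.subspace_0[OF subspace_tensor_space])
 qed
 have DU: "entries T D \<subseteq> ?U" unfolding entries_def[of T D]
 proof (intro span_minimal subspace_wedge subsetI)
  fix x assume "x \<in> {D i j |i j. i \<in> T \<and> j \<in> T}"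
  then obtain i j where ij: "i \<in> T" "j \<in> T" "x = D i j" by auto
  show "x \<in> entries R C \<and>\<^sub>c span {D i j |i j. i \<in> T \<and> j \<in> T}"
   unfolding entries_def[of T D, symmetric]
  proof (rule wedgeI)
   show "\<Delta> x = 0 + (SUM k:T. D i k \<otimes> D k j)" using comatrixD(2)[OF D ij(1,2)] by (simp only: ij(3) add_0_left)
   show "(SUM k:T. D i k \<otimes> D k j) \<in> tensor_space scale scale UNIV (entries T D)"
    by (rule sum_tensor_in_space) (use ij in \<open>auto intro: in_entries\<close>)
  qed (rule T.subspace_0[OF subspace_tensor_space])
 qed
 have WU: "?W \<subseteq> ?U"
  using CU DU by (auto elim!: set_plus_elim intro!: subspace_add[OF subspace_wedge])
 have CW: "entries R C \<subseteq> ?W" "entries T D \<subseteq> ?W"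
 proof -
  show "entries R C \<subseteq> ?W"
   using set_plus_intro[of _ "entries R C" 0 "entries T D"] subspace_0[OF subspace_entries] by force
  show "entries T D \<subseteq> ?W"
   using set_plus_intro[of 0 "entries R C" _ "entries T D"] subspace_0[OF subspace_entries] by force
 qed
 have ZU: "X p q \<in> ?U" if "X \<in> ?Z" "p \<in> R" "q \<in> T" for X p q
  by (rule wedgeI[OF ext_cocycleD[OF that]])
   (rule sum_tensor_in_space; use that in \<open>auto intro: in_entries\<close>)+
 define g where "g x X = X (fst x) (snd x)" for x :: "'r \<times> 't" and X :: "'r \<Rightarrow> 't \<Rightarrow> 'b"
 \<comment> \<open>Subtracting this multiple of \<open>C\<close> makes the component of \<open>w\<close> a cocycle.\<close>
 define m where "m x w = (\<lambda>k q. conv (cs (fst x) k) (ds q (snd x)) w)" for x w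
 define h where "h x w = (\<lambda>p q. component (fst x) (snd x) w p q - (SUM k:R. m x w k q *s C p k))" for x w
 have lin: "lin scale scale (\<lambda>w. h x w p q)" for x p q
  unfolding h_def m_def component_def
  by (intro lin_minus lin_comp[OF lin_lact[OF cs(1)] lin_ract[OF ds(1)]] lin_sum_fun vs lin_scale_fun lin_conv)
 have hZ: "h x w \<in> ?Z" if "x \<in> R \<times> T" "w \<in> ?U" for x w
  using component_cocycle[OF that(2), of "fst x" "snd x"] that(1) unfolding h_def m_def by auto
 have "B \<approx> (SIGMA x:R \<times> T. \<beta>)"
 proof (rule basis_mod_direct_sum[OF vs vs_matrices _ subspace_wedge subW WU subspace_ext_coboundaries _ _ _ _ hZ _ _ _ B \<beta>])
  show "finite (R \<times> T)" using fin by simp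
  show "lin (mscale scale) scale (g x)" for x
   by (rule linI[OF vs_matrices vs]) (auto simp: g_def pointwise_scale_def)
  show "lin scale (mscale scale) (h x)" for x
   by (rule linI[OF vs vs_matrices]) (auto simp: fun_eq_iff pointwise_scale_def lin_add[OF lin] lin_scale[OF lin])
  show "g x X \<in> ?U" if "x \<in> R \<times> T" "X \<in> ?Z" for x X using ZU that by (auto simp: g_def)
  show "g x X \<in> ?W" if x: "x \<in> R \<times> T" and X: "X \<in> ?B" for x X
  proof -
   obtain M where "\<And>p q. p \<in> R \<Longrightarrow> q \<in> T \<Longrightarrow> X p q = (SUM k:R. M k q *s C p k) - (SUM l:T. M p l *s D l q)"
    using X unfolding ext_coboundaries_def by blast
   then have "g x X = (SUM k:R. M k (snd x) *s C (fst x) k) - (SUM l:T. M (fst x) l *s D l (snd x))"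
    using x by (auto simp: g_def)
   then show ?thesis using x
    by (simp only:) (intro subspace_diff[OF subW] subspace_sum[OF subW] subspace_scale[OF subW] subsetD[OF CW(1)] subsetD[OF CW(2)] in_entries; auto)
  qed
  show "h x w \<in> ?B" if x: "x \<in> R \<times> T" and w: "w \<in> ?W" for x w
  proof -
   obtain M N where MN: "\<And>p q. p \<in> R \<Longrightarrow> q \<in> T \<Longrightarrow> component (fst x) (snd x) w p q =
     (SUM k:R. M k q *s C p k) + (SUM l:T. N p l *s D l q)"
    using component_of_entries[OF w, of "fst x" "snd x"] x by auto
   show ?thesis
   proof (rule cocycle_split[OF hZ[OF x subsetD[OF WU w]], of "\<lambda>k q. M k q - m x w k q" N])
    show "h x w p q = (SUM k:R. (M k q - m x w k q) *s C p k) + (SUM l:T. N p l *s D l q)" if "p \<in> R" "q \<in> T" for p q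
     using MN[OF that] by (simp add: h_def scale_left_diff_distrib sum_subtractf)
   qed
  qed
  show "h x (g y X) - (if x = y then X else 0) \<in> ?B" if x: "x \<in> R \<times> T" and y: "y \<in> R \<times> T" and X: "X \<in> ?Z" for x y X
  proof -
   obtain a b c d where xy: "x = (a, b)" "y = (c, d)" "a \<in> R" "b \<in> T" "c \<in> R" "d \<in> T" using x y by auto
   let ?u = "\<lambda>k q. if c = a then ds q b (X k d) else 0" and ?v = "\<lambda>p l. if d = b then cs a p (X c l) else 0"
   have "h x (g y X) - (if x = y then X else 0) \<in> ?Z"
    by (rule M.subspace_diff[OF subspace_ext_cocycles hZ[OF x]])
     (use ZU[OF X] X xy M.subspace_0[OF subspace_ext_cocycles] in \<open>auto simp: g_def\<close>)
   then show ?thesis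
   proof (rule cocycle_split[where M="\<lambda>k q. ?u k q - m x (g y X) k q" and N="?v"])
    fix p q assume pq: "p \<in> R" "q \<in> T"
    have "component a b (X c d) p q = (if x = y then X else 0) p q + (SUM k:R. ?u k q *s C p k) + (SUM l:T. ?v p l *s D l q)"
     using component_of_cocycle[OF X xy(3,4,5) pq(1) xy(6) pq(2)] by (auto simp: xy)
    then show "(h x (g y X) - (if x = y then X else 0)) p q = (SUM k:R. (?u k q - m x (g y X) k q) *s C p k) + (SUM l:T. ?v p l *s D l q)"
     unfolding h_def by (simp add: g_def xy(1,2) scale_left_diff_distrib sum_subtractf)
   qed
  qed
  show "(SUM x:R \<times> T. g x (h x w)) - w \<in> ?W" if w: "w \<in> ?U" for w
  proof -
   obtain c d where cd: "c \<in> entries R C" "d \<in> entries T D"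
    "w = (SUM a:R. SUM b:T. component a b w a b) + c + d" by (rule component_sum[OF w])
   have S: "(SUM x:R \<times> T. F x) = (SUM a:R. SUM b:T. F (a, b))" for F :: "_ \<Rightarrow> 'b"
    by (simp add: sum.cartesian_product split_def)
   have "(SUM x:R \<times> T. g x (h x w)) = (SUM a:R. SUM b:T. component a b w a b) - (SUM a:R. SUM b:T. SUM k:R. m (a, b) w k b *s C a k)"
    by (simp add: S g_def h_def sum_subtractf)
   then have "(SUM x:R \<times> T. g x (h x w)) - w = - (SUM a:R. SUM b:T. SUM k:R. m (a, b) w k b *s C a k) - c - d"
    by (subst cd(3)) simp
   then show ?thesis
    by (simp only:) (intro subspace_diff[OF subW] subspace_neg[OF subW] subspace_sum[OF subW] subspace_scale[OF subW]
      subsetD[OF CW(1)] subsetD[OF CW(2)] in_entries cd(1,2); assumption)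
  qed
 qed
 then show ?thesis by simp
qed

end

end

section \<open>The associator on comatrices\<close>

definition mprod :: "'q set \<Rightarrow> ('p \<Rightarrow> 'q \<Rightarrow> 'k::field) \<Rightarrow> ('q \<Rightarrow> 'r \<Rightarrow> 'k) \<Rightarrow> 'p \<Rightarrow> 'r \<Rightarrow> 'k" where
 "mprod Q A B = (\<lambda>x z. SUM y:Q. A x y * B y z)"

lemma mprod_assoc: "mprod Q (mprod P A B) C = mprod P A (mprod Q B C)"
 unfolding mprod_def fun_eq_iff
 by (simp add: sum_distrib_left sum_distrib_right mult.assoc) (intro allI sum.swap)

definition inverse_matrices :: "'q set \<Rightarrow> ('q \<Rightarrow> 'q \<Rightarrow> 'k::field) \<Rightarrow> ('q \<Rightarrow> 'q \<Rightarrow> 'k) \<Rightarrow> bool" where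
 "inverse_matrices Q A B \<longleftrightarrow> finite Q \<and>
   (\<forall>x\<in>Q. \<forall>z\<in>Q. mprod Q A B x z = (if x = z then 1 else 0) \<and> mprod Q B A x z = (if x = z then 1 else 0))"

lemma inverse_matricesD:
 assumes "inverse_matrices Q A B"
 shows "\<And>X x z. x \<in> Q \<Longrightarrow> mprod Q A (mprod Q B X) x z = X x z"
  "\<And>X x z. x \<in> Q \<Longrightarrow> mprod Q B (mprod Q A X) x z = X x z"
  "\<And>X x z. z \<in> Q \<Longrightarrow> mprod Q (mprod Q X A) B x z = X x z"
  "\<And>X x z. z \<in> Q \<Longrightarrow> mprod Q (mprod Q X B) A x z = X x z"
proof -
 have fin: "finite Q" and I: "\<And>x z. x \<in> Q \<Longrightarrow> z \<in> Q \<Longrightarrow> mprod Q A B x z = (if x = z then 1 else 0)"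
  "\<And>x z. x \<in> Q \<Longrightarrow> z \<in> Q \<Longrightarrow> mprod Q B A x z = (if x = z then 1 else 0)"
  using assms unfolding inverse_matrices_def by blast+
 show "mprod Q A (mprod Q B X) x z = X x z" "mprod Q B (mprod Q A X) x z = X x z" if "x \<in> Q" for X x z
  unfolding mprod_assoc[symmetric] by (simp_all add: mprod_def[of Q "mprod Q _ _"] I that sum_delta_mult[OF fin that] cong: sum.cong)
 show "mprod Q (mprod Q X A) B x z = X x z" "mprod Q (mprod Q X B) A x z = X x z" if "z \<in> Q" for X x z
  unfolding mprod_assoc by (simp_all add: mprod_def[of Q X] I that sum_delta_mult[OF fin that] cong: sum.cong)
qed

lemma mprod_cong:
 "(\<And>y. y \<in> Q \<Longrightarrow> A x y = A' x y) \<Longrightarrow> (\<And>y. y \<in> Q \<Longrightarrow> B y z = B' y z) \<Longrightarrow> mprod Q A B x z = mprod Q A' B' x z"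
 unfolding mprod_def by (rule sum.cong) auto

lemma sum_Times3: "(SUM y:R \<times> S \<times> T. f y) = (SUM a:R. SUM b:S. SUM c:T. f (a, b, c))"
 by (simp add: sum.cartesian_product split_def)

lemma sum_Times4: "(SUM y:R \<times> S \<times> T \<times> U. f y) = (SUM a:R. SUM b:S. SUM c:T. SUM d:U. f (a, b, c, d))"
 by (simp add: sum.cartesian_product split_def)

lemma mprod_cong_on:
 assumes "\<And>x z. x \<in> Q \<Longrightarrow> z \<in> Q \<Longrightarrow> A x z = A' x z" "\<And>x z. x \<in> Q \<Longrightarrow> z \<in> Q \<Longrightarrow> B x z = B' x z"
  and "x \<in> Q" "z \<in> Q"
 shows "mprod Q A B x z = mprod Q A' B' x z"
 by (rule mprod_cong) (use assms in auto)

lemma intertwine_inverse: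
 assumes FG: "inverse_matrices Q F G"
  and eq: "\<And>x z. x \<in> Q \<Longrightarrow> z \<in> Q \<Longrightarrow> mprod Q P F x z = mprod Q F P' x z"
  and xz: "x \<in> Q" "z \<in> Q"
 shows "mprod Q G P x z = mprod Q P' G x z"
proof -
 have "mprod Q G P x z = mprod Q (mprod Q G (mprod Q P F)) G x z"
  using inverse_matricesD(3)[OF FG xz(2), of "mprod Q G P" x] by (simp add: mprod_assoc)
 also have "\<dots> = mprod Q (mprod Q G (mprod Q F P')) G x z"
  by (rule mprod_cong_on[OF mprod_cong_on[OF refl eq] refl xz])
 also have "\<dots> = mprod Q P' G x z"
  by (rule mprod_cong_on[OF _ refl xz]) (rule inverse_matricesD(2)[OF FG])
 finally show ?thesis .
qed

text \<open>The pentagon identity \<open>F\<^sub>1 F\<^sub>2 = F\<^sub>3 F\<^sub>4 F\<^sub>5\<close>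
 of invertible matrices can be solved for products of the inverses.\<close>
lemma pentagon_inverse:
 assumes inv: "inverse_matrices Q F1 G1" "inverse_matrices Q F2 G2" "inverse_matrices Q F3 G3"
   "inverse_matrices Q F4 G4" "inverse_matrices Q F5 G5"
  and eq: "\<And>x z. x \<in> Q \<Longrightarrow> z \<in> Q \<Longrightarrow> mprod Q F1 F2 x z = mprod Q F3 (mprod Q F4 F5) x z"
  and xz: "x \<in> Q" "z \<in> Q"
 shows "mprod Q G2 G1 x z = mprod Q G5 (mprod Q G4 G3) x z"
  and "mprod Q G1 (mprod Q F3 F4) x z = mprod Q F2 G5 x z"
proof -
 note D = inverse_matricesD
 let ?L = "mprod Q G5 (mprod Q G4 G3)"
 have "?L x z = mprod Q (mprod Q ?L F1) G1 x z" by (rule D(3)[OF inv(1) xz(2), symmetric])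
 also have "\<dots> = mprod Q (mprod Q (mprod Q (mprod Q ?L F1) F2) G2) G1 x z"
  by (rule mprod_cong_on[OF _ refl xz], rule D(3)[OF inv(2), symmetric])
 also have "\<dots> = mprod Q (mprod Q ?L (mprod Q F1 F2)) (mprod Q G2 G1) x z" by (simp add: mprod_assoc)
 also have "\<dots> = mprod Q (mprod Q ?L (mprod Q F3 (mprod Q F4 F5))) (mprod Q G2 G1) x z"
  by (rule mprod_cong_on[OF mprod_cong_on[OF refl eq] refl xz])
 also have "\<dots> = mprod Q G5 (mprod Q G4 (mprod Q G3 (mprod Q F3 (mprod Q F4 (mprod Q F5 (mprod Q G2 G1)))))) x z"
  by (simp add: mprod_assoc)
 also have "\<dots> = mprod Q G5 (mprod Q G4 (mprod Q F4 (mprod Q F5 (mprod Q G2 G1)))) x z"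
  by (rule mprod_cong_on[OF refl mprod_cong_on[OF refl D(2)[OF inv(3)]] xz])
 also have "\<dots> = mprod Q G5 (mprod Q F5 (mprod Q G2 G1)) x z"
  by (rule mprod_cong_on[OF refl D(2)[OF inv(4)] xz])
 also have "\<dots> = mprod Q G2 G1 x z" by (rule D(2)[OF inv(5) xz(1)])
 finally show "mprod Q G2 G1 x z = ?L x z" ..
 have "mprod Q G1 (mprod Q F3 F4) x z = mprod Q (mprod Q (mprod Q G1 (mprod Q F3 F4)) F5) G5 x z"
  by (rule D(3)[OF inv(5) xz(2), symmetric])
 also have "\<dots> = mprod Q (mprod Q G1 (mprod Q F3 (mprod Q F4 F5))) G5 x z" by (simp add: mprod_assoc)
 also have "\<dots> = mprod Q (mprod Q G1 (mprod Q F1 F2)) G5 x z"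
  by (rule mprod_cong_on[OF mprod_cong_on[OF refl eq[symmetric]] refl xz])
 also have "\<dots> = mprod Q F2 G5 x z"
  by (rule mprod_cong_on[OF D(2)[OF inv(1)] refl xz])
 finally show "mprod Q G1 (mprod Q F3 F4) x z = mprod Q F2 G5 x z" .
qed

lemma sum_Times: "(SUM y:R \<times> S. f y) = (SUM a:R. SUM b:S. f (a, b))"
 by (simp add: sum.cartesian_product split_def)

context coalgebra
begin

lemma sweedler_comatrix:
 assumes "comatrix R A" "i \<in> R" "j \<in> R" "vector_space sU"
  and "\<And>x. lin scale sU (F x)" "\<And>y. lin scale sU (\<lambda>x. F x y)"
 shows "(SUM (a1, a2)<-sweedler (A i j). F a1 a2) = (SUM k:R. F (A i k) (A k j))"
 by (rule sweedler_eq[OF assms(4) bilinear_mapI comatrixD(2)[OF assms(1-3)]]) (fact assms)+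

lemma lin_sweedler_sum: "vector_space sU \<Longrightarrow> (\<And>x y. lin scale sU (\<lambda>a. F a x y)) \<Longrightarrow>
  lin scale sU (\<lambda>a. SUM (x, y)<-sweedler b. F a x y)"
 unfolding split_def by (rule lin_sum_list_fun[OF vs])

lemma lin_sweedler_arg:
 "vector_space sU \<Longrightarrow> (\<And>x. lin scale sU (F x)) \<Longrightarrow> (\<And>y. lin scale sU (\<lambda>x. F x y)) \<Longrightarrow>
  lin scale sU (\<lambda>a. SUM (x, y)<-sweedler a. F x y)"
 by (rule lin_sweedler[OF _ bilinear_mapI])

lemma sweedler_comatrix2:
 assumes A: "comatrix R A" "a \<in> R" "a' \<in> R" and B: "comatrix S B" "b \<in> S" "b' \<in> S"
  and U: "vector_space sU"
  and F: "\<And>a2 b1 b2. lin scale sU (\<lambda>x. F x a2 b1 b2)" "\<And>a1 b1 b2. lin scale sU (\<lambda>x. F a1 x b1 b2)"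
   "\<And>a1 a2 b2. lin scale sU (\<lambda>x. F a1 a2 x b2)" "\<And>a1 a2 b1. lin scale sU (\<lambda>x. F a1 a2 b1 x)"
 shows "(SUM (a1, a2)<-sweedler (A a a'). SUM (b1, b2)<-sweedler (B b b'). F a1 a2 b1 b2) =
  (SUM i:R. SUM j:S. F (A a i) (A i a') (B b j) (B j b'))"
proof -
 have "(SUM (a1, a2)<-sweedler (A a a'). SUM (b1, b2)<-sweedler (B b b'). F a1 a2 b1 b2) =
  (SUM i:R. SUM (b1, b2)<-sweedler (B b b'). F (A a i) (A i a') b1 b2)"
  by (rule sweedler_comatrix[OF A U]) (intro lin_sweedler_sum U F)+
 also have "\<dots> = (SUM i:R. SUM j:S. F (A a i) (A i a') (B b j) (B j b'))"
  by (intro sum.cong refl sweedler_comatrix[OF B U] F)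
 finally show ?thesis .
qed

lemma sweedler_comatrix3:
 assumes A: "comatrix R A" "a \<in> R" "a' \<in> R" and B: "comatrix S B" "b \<in> S" "b' \<in> S"
  and C: "comatrix T C" "c \<in> T" "c' \<in> T" and U: "vector_space sU"
  and F: "\<And>a2 b1 b2 c1 c2. lin scale sU (\<lambda>x. F x a2 b1 b2 c1 c2)" "\<And>a1 b1 b2 c1 c2. lin scale sU (\<lambda>x. F a1 x b1 b2 c1 c2)"
   "\<And>a1 a2 b2 c1 c2. lin scale sU (\<lambda>x. F a1 a2 x b2 c1 c2)" "\<And>a1 a2 b1 c1 c2. lin scale sU (\<lambda>x. F a1 a2 b1 x c1 c2)"
   "\<And>a1 a2 b1 b2 c2. lin scale sU (\<lambda>x. F a1 a2 b1 b2 x c2)" "\<And>a1 a2 b1 b2 c1. lin scale sU (\<lambda>x. F a1 a2 b1 b2 c1 x)"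
 shows "(SUM (a1, a2)<-sweedler (A a a'). SUM (b1, b2)<-sweedler (B b b'). SUM (c1, c2)<-sweedler (C c c'). F a1 a2 b1 b2 c1 c2) =
  (SUM i:R. SUM j:S. SUM k:T. F (A a i) (A i a') (B b j) (B j b') (C c k) (C k c'))"
proof -
 have "(SUM (a1, a2)<-sweedler (A a a'). SUM (b1, b2)<-sweedler (B b b'). SUM (c1, c2)<-sweedler (C c c'). F a1 a2 b1 b2 c1 c2) =
  (SUM i:R. SUM j:S. SUM (c1, c2)<-sweedler (C c c'). F (A a i) (A i a') (B b j) (B j b') c1 c2)"
  by (rule sweedler_comatrix2[OF A B U]) (intro lin_sweedler_sum U F)+
 also have "\<dots> = (SUM i:R. SUM j:S. SUM k:T. F (A a i) (A i a') (B b j) (B j b') (C c k) (C k c'))"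
  by (intro sum.cong refl sweedler_comatrix[OF C U] F)
 finally show ?thesis .
qed

lemma sum_sweedler3:
 "(SUM (a1, a2, a3)<-sweedler3 a. F a1 a2 a3) = (SUM (a1, x)<-sweedler a. SUM (a2, a3)<-sweedler x. F a1 a2 a3)"
proof -
 have "(SUM (a1, a2, a3)<-[(a1, a2, a3). (a1, x) \<leftarrow> xs, (a2, a3) \<leftarrow> sweedler x]. F a1 a2 a3) =
  (SUM (a1, x)<-xs. SUM (a2, a3)<-sweedler x. F a1 a2 a3)" for xs
  by (induction xs) (auto simp: comp_def split_def)
 then show ?thesis unfolding sweedler3_def .
qed

lemma sum_sweedler5:
 "(SUM (a1, a2, a3, a4, a5)<-sweedler5 a. F a1 a2 a3 a4 a5) =
  (SUM (a1, a2, x)<-sweedler3 a. SUM (a3, a4, a5)<-sweedler3 x. F a1 a2 a3 a4 a5)"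
proof -
 have "(SUM (a1, a2, a3, a4, a5)<-[(a1, a2, a3, a4, a5). (a1, a2, x) \<leftarrow> xs, (a3, a4, a5) \<leftarrow> sweedler3 x]. F a1 a2 a3 a4 a5) =
  (SUM (a1, a2, x)<-xs. SUM (a3, a4, a5)<-sweedler3 x. F a1 a2 a3 a4 a5)" for xs
  by (induction xs) (auto simp: comp_def split_def)
 then show ?thesis unfolding sweedler5_def .
qed

lemma sweedler3_comatrix:
 assumes A: "comatrix R A" "i \<in> R" "j \<in> R" "vector_space sU"
  and F: "\<And>y z. lin scale sU (\<lambda>x. F x y z)" "\<And>x z. lin scale sU (\<lambda>y. F x y z)" "\<And>x y. lin scale sU (\<lambda>z. F x y z)"
 shows "(SUM (a1, a2, a3)<-sweedler3 (A i j). F a1 a2 a3) = (SUM k:R. SUM l:R. F (A i k) (A k l) (A l j))"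
proof -
 have "(SUM (a1, x)<-sweedler (A i j). SUM (a2, a3)<-sweedler x. F a1 a2 a3) =
  (SUM k:R. SUM (a2, a3)<-sweedler (A k j). F (A i k) a2 a3)"
 proof (rule sweedler_comatrix[OF A])
  show "lin scale sU (\<lambda>x. SUM (a2, a3)<-sweedler x. F a1 a2 a3)" for a1
   by (rule lin_sweedler[OF A(4) bilinear_mapI]) (rule F)+
  show "lin scale sU (\<lambda>a1. SUM (a2, a3)<-sweedler x. F a1 a2 a3)" for x
   unfolding split_def by (rule lin_sum_list_fun[OF vs A(4) F(1)])
 qed
 also have "\<dots> = (SUM k:R. SUM l:R. F (A i k) (A k l) (A l j))"
  by (intro sum.cong refl sweedler_comatrix[OF A(1) _ A(3,4)] F)
 finally show ?thesis unfolding sum_sweedler3 .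
qed

lemma lin_sweedler3:
 assumes U: "vector_space sU"
  and F: "\<And>y z. lin scale sU (\<lambda>x. F x y z)" "\<And>x z. lin scale sU (\<lambda>y. F x y z)" "\<And>x y. lin scale sU (\<lambda>z. F x y z)"
 shows "lin scale sU (\<lambda>a. SUM (a1, a2, a3)<-sweedler3 a. F a1 a2 a3)"
 unfolding sum_sweedler3
proof (rule lin_sweedler[OF U bilinear_mapI])
 show "lin scale sU (\<lambda>x. SUM (a2, a3)<-sweedler x. F a1 a2 a3)" for a1
  by (rule lin_sweedler[OF U bilinear_mapI]) (rule F)+
 show "lin scale sU (\<lambda>a1. SUM (a2, a3)<-sweedler x. F a1 a2 a3)" for x
  unfolding split_def by (rule lin_sum_list_fun[OF vs U F(1)])
qed

lemma sweedler5_comatrix: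
 assumes A: "comatrix R A" "i \<in> R" "j \<in> R" "vector_space sU"
  and F: "\<And>a2 a3 a4 a5. lin scale sU (\<lambda>x. F x a2 a3 a4 a5)" "\<And>a1 a3 a4 a5. lin scale sU (\<lambda>x. F a1 x a3 a4 a5)"
   "\<And>a1 a2 a4 a5. lin scale sU (\<lambda>x. F a1 a2 x a4 a5)" "\<And>a1 a2 a3 a5. lin scale sU (\<lambda>x. F a1 a2 a3 x a5)"
   "\<And>a1 a2 a3 a4. lin scale sU (\<lambda>x. F a1 a2 a3 a4 x)"
 shows "(SUM (a1, a2, a3, a4, a5)<-sweedler5 (A i j). F a1 a2 a3 a4 a5) =
  (SUM k:R. SUM l:R. SUM m:R. SUM n:R. F (A i k) (A k l) (A l m) (A m n) (A n j))"
proof -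
 have "(SUM (a1, a2, x)<-sweedler3 (A i j). SUM (a3, a4, a5)<-sweedler3 x. F a1 a2 a3 a4 a5) =
  (SUM k:R. SUM l:R. SUM (a3, a4, a5)<-sweedler3 (A l j). F (A i k) (A k l) a3 a4 a5)"
 proof (rule sweedler3_comatrix[OF A])
  show "lin scale sU (\<lambda>x. SUM (a3, a4, a5)<-sweedler3 z. F x y a3 a4 a5)"
   "lin scale sU (\<lambda>x. SUM (a3, a4, a5)<-sweedler3 z. F y x a3 a4 a5)" for y z
   unfolding split_def by (rule lin_sum_list_fun[OF vs A(4)], rule F)+
  show "lin scale sU (\<lambda>z. SUM (a3, a4, a5)<-sweedler3 z. F x y a3 a4 a5)" for x y
   by (rule lin_sweedler3[OF A(4)]) (rule F)+
 qed
 also have "\<dots> = (SUM k:R. SUM l:R. SUM m:R. SUM n:R. F (A i k) (A k l) (A l m) (A m n) (A n j))"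
  by (intro sum.cong refl sweedler3_comatrix[OF A(1) _ A(3,4)] F)
 finally show ?thesis unfolding sum_sweedler5 .
qed

end

text \<open>The inverse associator is a parameter of this locale, so that it can be instantiated by
 the opposite multiplication, where the roles of the two associators are exchanged.\<close>
locale coquasi_bialgebra_inverse =
 coquasi_bialgebra scale \<Delta> \<epsilon> mult one \<Phi> + coalgebra_alg_closed scale \<Delta> \<epsilon>
 for scale :: "'k::alg_closed_field \<Rightarrow> 'h::ab_group_add \<Rightarrow> 'h" (infixr \<open>*s\<close> 75) and \<Delta> \<epsilon>
  and mult (infixl \<open>\<cdot>\<close> 72) and one (\<open>\<one>\<close>) and \<Phi> +
 fixes \<Psi> :: "'h \<Rightarrow> 'h \<Rightarrow> 'h \<Rightarrow> 'k"
 assumes \<Psi>_inverse: "is_convolution_inverse3 \<Phi> \<Psi>"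
begin

lemma \<Psi>_trilinear: "trilinear_form scale \<Psi>"
 using \<Psi>_inverse by (simp add: is_convolution_inverse3_def)

lemma \<Phi>_lin:
 "lin scale scale f \<Longrightarrow> lin scale (*) (\<lambda>x. \<Phi> (f x) b c)"
 "lin scale scale f \<Longrightarrow> lin scale (*) (\<lambda>x. \<Phi> a (f x) c)"
 "lin scale scale f \<Longrightarrow> lin scale (*) (\<lambda>x. \<Phi> a b (f x))"
 using \<Phi>_trilinear unfolding trilinear_form_def by (auto intro: lin_comp)

lemma \<Psi>_lin:
 "lin scale scale f \<Longrightarrow> lin scale (*) (\<lambda>x. \<Psi> (f x) b c)"
 "lin scale scale f \<Longrightarrow> lin scale (*) (\<lambda>x. \<Psi> a (f x) c)"
 "lin scale scale f \<Longrightarrow> lin scale (*) (\<lambda>x. \<Psi> a b (f x))"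
 using \<Psi>_trilinear unfolding trilinear_form_def by (auto intro: lin_comp)

lemma mult_lin:
 "lin scale scale f \<Longrightarrow> lin scale scale (\<lambda>x. f x \<cdot> b)"
 "lin scale scale f \<Longrightarrow> lin scale scale (\<lambda>x. a \<cdot> f x)"
 by (auto intro: lin_comp bilinear_left[OF mult_bilinear] bilinear_right[OF mult_bilinear])

lemmas lin_sums = lin_sum_fun[OF vs vector_space_mult] lin_sum_fun[OF vs vs]
lemmas lin_intros = \<Phi>_lin \<Psi>_lin mult_lin lin_id[OF vs] lin_scale_const lin_scale_fun[OF _ vs]
 lin_mult_left lin_mult_right lin_sums

text \<open>The tensor product of comodules.\<close>
definition prod_comatrix :: "('r \<Rightarrow> 'r \<Rightarrow> 'h) \<Rightarrow> ('s \<Rightarrow> 's \<Rightarrow> 'h) \<Rightarrow> 'r \<times> 's \<Rightarrow> 'r \<times> 's \<Rightarrow> 'h" where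
 "prod_comatrix A B = (\<lambda>(i, k) (j, l). A i j \<cdot> B k l)"

lemma prod_comatrix_apply [simp]: "prod_comatrix A B (i, k) (j, l) = A i j \<cdot> B k l"
 by (simp add: prod_comatrix_def)

lemma \<Delta>_prod:
 assumes "comatrix R A" "comatrix S B" "i \<in> R" "j \<in> R" "k \<in> S" "l \<in> S"
 shows "\<Delta> (A i j \<cdot> B k l) = (SUM p:R. SUM q:S. (A i p \<cdot> B k q) \<otimes> (A p j \<cdot> B q l))"
proof -
 have t: "lin scale scale f \<Longrightarrow> lin scale tscale (\<lambda>x. f x \<otimes> y)" "lin scale scale f \<Longrightarrow> lin scale tscale (\<lambda>x. y \<otimes> f x)" for f y
  by (auto intro: lin_comp bilinear_left[OF pure_tensor_bilinear] bilinear_right[OF pure_tensor_bilinear])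
 have "(SUM (a1, a2)<-sweedler (A i j). SUM (b1, b2)<-sweedler (B k l). (a1 \<cdot> b1) \<otimes> (a2 \<cdot> b2)) =
  (SUM p:R. SUM (b1, b2)<-sweedler (B k l). (A i p \<cdot> b1) \<otimes> (A p j \<cdot> b2))"
  by (rule sweedler_comatrix[OF assms(1,3,4) vector_space_tscale])
   (intro lin_sweedler_sum vector_space_tscale t lin_intros)+
 also have "\<dots> = (SUM p:R. SUM q:S. (A i p \<cdot> B k q) \<otimes> (A p j \<cdot> B q l))"
  by (intro sum.cong refl sweedler_comatrix[OF assms(2,5,6) vector_space_tscale] t lin_intros)
 finally show ?thesis unfolding \<Delta>_mult .
qed

lemma comatrix_prod:
 assumes "comatrix R A" "comatrix S B"
 shows "comatrix (R \<times> S) (prod_comatrix A B)"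
 unfolding comatrix_def
proof (intro conjI ballI)
 show "finite (R \<times> S)" using assms by (simp add: comatrix_def)
 fix x z assume "x \<in> R \<times> S" "z \<in> R \<times> S"
 then obtain i k j l where *: "x = (i, k)" "z = (j, l)" "i \<in> R" "j \<in> R" "k \<in> S" "l \<in> S" by auto
 show "\<Delta> (prod_comatrix A B x z) = (SUM y:R \<times> S. prod_comatrix A B x y \<otimes> prod_comatrix A B y z)"
  by (simp add: * \<Delta>_prod[OF assms *(3-6)] sum_Times)
 show "\<epsilon> (prod_comatrix A B x z) = (if x = z then 1 else 0)"
  by (auto simp: * \<epsilon>_mult comatrixD(3)[OF assms(1)] comatrixD(3)[OF assms(2)])
qed

definition form_matrix where
 "form_matrix F A B C = (\<lambda>(a, b, c) (a', b', c'). F (A a a') (B b b') (C c c'))"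

lemma form_matrix_apply [simp]: "form_matrix F A B C (a, b, c) (a', b', c') = F (A a a') (B b b') (C c c')"
 by (simp add: form_matrix_def)

text \<open>On comatrices the convolution product is the product of matrices.\<close>
lemma associator_inverse:
 assumes A: "comatrix R A" and B: "comatrix S B" and C: "comatrix T C"
 shows "inverse_matrices (R \<times> S \<times> T) (form_matrix \<Phi> A B C) (form_matrix \<Psi> A B C)"
 unfolding inverse_matrices_def
proof (intro conjI ballI)
 show "finite (R \<times> S \<times> T)" using assms by (simp add: comatrix_def)
 fix x z assume "x \<in> R \<times> S \<times> T" "z \<in> R \<times> S \<times> T"
 then obtain a b c a' b' c' where *: "x = (a, b, c)" "z = (a', b', c')"
  "a \<in> R" "a' \<in> R" "b \<in> S" "b' \<in> S" "c \<in> T" "c' \<in> T" by auto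
 have expand: "(SUM (a1, a2)<-sweedler (A a a'). SUM (b1, b2)<-sweedler (B b b'). SUM (c1, c2)<-sweedler (C c c').
     F a1 b1 c1 * G a2 b2 c2) = (SUM i:R. SUM j:S. SUM k:T. F (A a i) (B b j) (C c k) * G (A i a') (B j b') (C k c'))"
  if F: "trilinear_form scale F" and G: "trilinear_form scale G" for F G
  by (rule sweedler_comatrix3[OF A *(3,4) B *(5,6) C *(7,8) vector_space_mult])
   (intro lin_mult_left lin_mult_right; use F G in \<open>simp add: trilinear_form_def\<close>)+
 have \<epsilon>: "\<epsilon> (A a a') * \<epsilon> (B b b') * \<epsilon> (C c c') = (if x = z then 1 else 0)"
  using * by (simp add: comatrixD(3)[OF A] comatrixD(3)[OF B] comatrixD(3)[OF C])
 show "mprod (R \<times> S \<times> T) (form_matrix \<Phi> A B C) (form_matrix \<Psi> A B C) x z = (if x = z then 1 else 0)"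
  using \<Psi>_inverse \<epsilon> unfolding is_convolution_inverse3_def mprod_def sum_Times3 *(1,2) form_matrix_apply
  by (simp flip: expand[OF \<Phi>_trilinear \<Psi>_trilinear])
 show "mprod (R \<times> S \<times> T) (form_matrix \<Psi> A B C) (form_matrix \<Phi> A B C) x z = (if x = z then 1 else 0)"
  using \<Psi>_inverse \<epsilon> unfolding is_convolution_inverse3_def mprod_def sum_Times3 *(1,2) form_matrix_apply
  by (simp flip: expand[OF \<Psi>_trilinear \<Phi>_trilinear])
qed


lemma quasi_assoc_comatrix:
 assumes A: "comatrix R A" "a \<in> R" "a'' \<in> R" and B: "comatrix S B" "b \<in> S" "b'' \<in> S"
 shows "(SUM a':R. SUM b':S. SUM (h1, h2)<-sweedler h. \<Phi> (A a' a'') (B b' b'') h2 *s (A a a' \<cdot> (B b b' \<cdot> h1))) =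
  (SUM a':R. SUM b':S. SUM (h1, h2)<-sweedler h. \<Phi> (A a a') (B b b') h1 *s ((A a' a'' \<cdot> B b' b'') \<cdot> h2))"
proof -
 note I = lin_sweedler_sum lin_sweedler_arg vs lin_intros
 have "(SUM (a1, a2)<-sweedler (A a a''). SUM (b1, b2)<-sweedler (B b b''). SUM (c1, c2)<-sweedler h.
     \<Phi> a2 b2 c2 *s (a1 \<cdot> (b1 \<cdot> c1))) =
  (SUM a':R. SUM b':S. SUM (h1, h2)<-sweedler h. \<Phi> (A a' a'') (B b' b'') h2 *s (A a a' \<cdot> (B b b' \<cdot> h1)))"
  by (rule sweedler_comatrix2[OF A B vs]) (intro I)+
 moreover have "(SUM (a1, a2)<-sweedler (A a a''). SUM (b1, b2)<-sweedler (B b b''). SUM (c1, c2)<-sweedler h.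
     \<Phi> a1 b1 c1 *s ((a2 \<cdot> b2) \<cdot> c2)) =
  (SUM a':R. SUM b':S. SUM (h1, h2)<-sweedler h. \<Phi> (A a a') (B b b') h1 *s ((A a' a'' \<cdot> B b' b'') \<cdot> h2))"
  by (rule sweedler_comatrix2[OF A B vs]) (intro I)+
 ultimately show ?thesis using quasi_assoc by simp
qed

text \<open>Multiplying quasi-associativity by the inverse of the associator on both sides.\<close>
lemma quasi_assoc_inverse:
 "(SUM (a1, a2)<-sweedler a. SUM (b1, b2)<-sweedler b. SUM (c1, c2)<-sweedler c.
   \<Psi> a1 b1 c1 *s (a2 \<cdot> (b2 \<cdot> c2))) =
  (SUM (a1, a2)<-sweedler a. SUM (b1, b2)<-sweedler b. SUM (c1, c2)<-sweedler c.
   \<Psi> a2 b2 c2 *s ((a1 \<cdot> b1) \<cdot> c1))"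
proof -
 note I = lin_sweedler_sum lin_sweedler_arg vs lin_intros
 have main: "(SUM (a1, a2)<-sweedler (A a a''). SUM (b1, b2)<-sweedler (B b b''). SUM (c1, c2)<-sweedler (C c c'').
   \<Psi> a1 b1 c1 *s (a2 \<cdot> (b2 \<cdot> c2))) =
  (SUM (a1, a2)<-sweedler (A a a''). SUM (b1, b2)<-sweedler (B b b''). SUM (c1, c2)<-sweedler (C c c'').
   \<Psi> a2 b2 c2 *s ((a1 \<cdot> b1) \<cdot> c1))"
  if A: "comatrix R A" "a \<in> R" "a'' \<in> R" and B: "comatrix S B" "b \<in> S" "b'' \<in> S"
   and C: "comatrix T C" "c \<in> T" "c'' \<in> T"
  for R S T :: "'h set" and A B C a a'' b b'' c c''
 proof (rule functionals_separate[OF vs])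
  fix f assume f: "lin scale (*) f"
  let ?Q = "R \<times> S \<times> T"
  let ?P = "\<lambda>(a, b, c) (a', b', c'). f (A a a' \<cdot> (B b b' \<cdot> C c c'))"
  let ?P' = "\<lambda>(a, b, c) (a', b', c'). f ((A a a' \<cdot> B b b') \<cdot> C c c')"
  have "mprod ?Q ?P (form_matrix \<Phi> A B C) x z = mprod ?Q (form_matrix \<Phi> A B C) ?P' x z"
   if x: "x \<in> ?Q" and z: "z \<in> ?Q" for x z
  proof -
   obtain a b c a'' b'' c'' where *: "x = (a, b, c)" "z = (a'', b'', c'')"
    "a \<in> R" "a'' \<in> R" "b \<in> S" "b'' \<in> S" "c \<in> T" "c'' \<in> T" using x z by auto
   have "f (SUM (a1, a2)<-sweedler (A a a''). SUM (b1, b2)<-sweedler (B b b''). SUM (c1, c2)<-sweedler (C c c'').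
     \<Phi> a2 b2 c2 *s (a1 \<cdot> (b1 \<cdot> c1))) = mprod ?Q ?P (form_matrix \<Phi> A B C) x z"
    by (subst sweedler_comatrix3[OF A(1) *(3,4) B(1) *(5,6) C(1) *(7,8) vs], (intro I)+)
     (simp add: lin_sum[OF f] lin_scale[OF f] mprod_def * sum_Times3 mult.commute)
   moreover have "f (SUM (a1, a2)<-sweedler (A a a''). SUM (b1, b2)<-sweedler (B b b''). SUM (c1, c2)<-sweedler (C c c'').
     \<Phi> a1 b1 c1 *s ((a2 \<cdot> b2) \<cdot> c2)) = mprod ?Q (form_matrix \<Phi> A B C) ?P' x z"
    by (subst sweedler_comatrix3[OF A(1) *(3,4) B(1) *(5,6) C(1) *(7,8) vs], (intro I)+)
     (simp add: lin_sum[OF f] lin_scale[OF f] mprod_def * sum_Times3 mult.commute)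
   ultimately show ?thesis using quasi_assoc by simp
  qed
  from intertwine_inverse[OF associator_inverse[OF A(1) B(1) C(1)] this, of "(a, b, c)" "(a'', b'', c'')"]
  have eq: "mprod ?Q (form_matrix \<Psi> A B C) ?P (a, b, c) (a'', b'', c'') = mprod ?Q ?P' (form_matrix \<Psi> A B C) (a, b, c) (a'', b'', c'')"
   using A B C by auto
  have 1: "f (SUM (a1, a2)<-sweedler (A a a''). SUM (b1, b2)<-sweedler (B b b''). SUM (c1, c2)<-sweedler (C c c'').
   \<Psi> a1 b1 c1 *s (a2 \<cdot> (b2 \<cdot> c2))) = mprod ?Q (form_matrix \<Psi> A B C) ?P (a, b, c) (a'', b'', c'')"
   by (subst sweedler_comatrix3[OF A B C vs], (intro I)+)
     (simp add: lin_sum[OF f] lin_scale[OF f] mprod_def sum_Times3 mult.commute)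
  have 2: "f (SUM (a1, a2)<-sweedler (A a a''). SUM (b1, b2)<-sweedler (B b b''). SUM (c1, c2)<-sweedler (C c c'').
   \<Psi> a2 b2 c2 *s ((a1 \<cdot> b1) \<cdot> c1)) = mprod ?Q ?P' (form_matrix \<Psi> A B C) (a, b, c) (a'', b'', c'')"
   by (subst sweedler_comatrix3[OF A B C vs], (intro I)+)
     (simp add: lin_sum[OF f] lin_scale[OF f] mprod_def sum_Times3 mult.commute)
  show "f (SUM (a1, a2)<-sweedler (A a a''). SUM (b1, b2)<-sweedler (B b b''). SUM (c1, c2)<-sweedler (C c c'').
   \<Psi> a1 b1 c1 *s (a2 \<cdot> (b2 \<cdot> c2))) = f (SUM (a1, a2)<-sweedler (A a a''). SUM (b1, b2)<-sweedler (B b b''). SUM (c1, c2)<-sweedler (C c c'').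
   \<Psi> a2 b2 c2 *s ((a1 \<cdot> b1) \<cdot> c1))"
   unfolding 1 2 eq ..
 qed
 show ?thesis
  by (rule lin_eq_if_comatrix[of scale _ _ a], (intro I)+,
    rule lin_eq_if_comatrix[of scale _ _ b], (intro I)+,
    rule lin_eq_if_comatrix[of scale _ _ c], (intro I)+, rule main)
qed


text \<open>The pentagon axiom evaluated on comatrices.\<close>
lemma pentagon_comatrix:
 assumes A: "comatrix R A" "a \<in> R" "a'' \<in> R" and B: "comatrix S B" "b \<in> S" "b'' \<in> S"
  and C: "comatrix T C" "c \<in> T" "c'' \<in> T" and D: "comatrix U D" "d \<in> U" "d'' \<in> U"
 shows "(SUM a':R. SUM b':S. SUM c':T. SUM d':U.
   \<Phi> (A a a') (B b b') (C c c' \<cdot> D d d') * \<Phi> (A a' a'' \<cdot> B b' b'') (C c' c'') (D d' d'')) =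
  (SUM a':R. SUM b1:S. SUM b2:S. SUM c1:T. SUM c2:T. SUM d':U.
   \<Phi> (B b b1) (C c c1) (D d d') * \<Phi> (A a a') (B b1 b2 \<cdot> C c1 c2) (D d' d'') * \<Phi> (A a' a'') (B b2 b'') (C c2 c''))"
proof -
 note I = lin_sweedler_sum lin_sweedler_arg vector_space_mult lin_intros
 have s3: "lin scale (*) (\<lambda>x. SUM (y, z, w)<-sweedler3 b. F x y z w)" if "\<And>y z w. lin scale (*) (\<lambda>x. F x y z w)" for F b
  unfolding split_def by (rule lin_sum_list_fun[OF vs vector_space_mult that])
 have "(SUM (a1, a2)<-sweedler (A a a''). SUM (b1, b2)<-sweedler (B b b'').
    SUM (c1, c2)<-sweedler (C c c''). SUM (d1, d2)<-sweedler (D d d'').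
     \<Phi> a1 b1 (c1 \<cdot> d1) * \<Phi> (a2 \<cdot> b2) c2 d2) =
  (SUM a':R. SUM b':S. SUM c':T. SUM (d1, d2)<-sweedler (D d d'').
   \<Phi> (A a a') (B b b') (C c c' \<cdot> d1) * \<Phi> (A a' a'' \<cdot> B b' b'') (C c' c'') d2)"
  by (rule sweedler_comatrix3[OF A B C vector_space_mult]) (intro I)+
 also have "\<dots> = (SUM a':R. SUM b':S. SUM c':T. SUM d':U.
   \<Phi> (A a a') (B b b') (C c c' \<cdot> D d d') * \<Phi> (A a' a'' \<cdot> B b' b'') (C c' c'') (D d' d''))"
  by (intro sum.cong refl sweedler_comatrix[OF D vector_space_mult] I)
 finally have lhs: "(SUM (a1, a2)<-sweedler (A a a''). SUM (b1, b2)<-sweedler (B b b'').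
    SUM (c1, c2)<-sweedler (C c c''). SUM (d1, d2)<-sweedler (D d d'').
     \<Phi> a1 b1 (c1 \<cdot> d1) * \<Phi> (a2 \<cdot> b2) c2 d2) = \<dots>" .
 have "(SUM (a1, a2)<-sweedler (A a a''). SUM (b1, b2, b3)<-sweedler3 (B b b'').
    SUM (c1, c2, c3)<-sweedler3 (C c c''). SUM (d1, d2)<-sweedler (D d d'').
     \<Phi> b1 c1 d1 * \<Phi> a1 (b2 \<cdot> c2) d2 * \<Phi> a2 b3 c3) =
  (SUM a':R. SUM (b1, b2, b3)<-sweedler3 (B b b''). SUM (c1, c2, c3)<-sweedler3 (C c c''). SUM (d1, d2)<-sweedler (D d d'').
     \<Phi> b1 c1 d1 * \<Phi> (A a a') (b2 \<cdot> c2) d2 * \<Phi> (A a' a'') b3 c3)"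
  by (rule sweedler_comatrix[OF A vector_space_mult]) (intro s3 I)+
 also have "\<dots> = (SUM a':R. SUM b1:S. SUM b2:S. SUM (c1, c2, c3)<-sweedler3 (C c c''). SUM (d1, d2)<-sweedler (D d d'').
     \<Phi> (B b b1) c1 d1 * \<Phi> (A a a') (B b1 b2 \<cdot> c2) d2 * \<Phi> (A a' a'') (B b2 b'') c3)"
  by (intro sum.cong refl sweedler3_comatrix[OF B vector_space_mult] s3 I)
 also have "\<dots> = (SUM a':R. SUM b1:S. SUM b2:S. SUM c1:T. SUM c2:T. SUM (d1, d2)<-sweedler (D d d'').
     \<Phi> (B b b1) (C c c1) d1 * \<Phi> (A a a') (B b1 b2 \<cdot> C c1 c2) d2 * \<Phi> (A a' a'') (B b2 b'') (C c2 c''))"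
  by (intro sum.cong refl sweedler3_comatrix[OF C vector_space_mult] I)
 also have "\<dots> = (SUM a':R. SUM b1:S. SUM b2:S. SUM c1:T. SUM c2:T. SUM d':U.
     \<Phi> (B b b1) (C c c1) (D d d') * \<Phi> (A a a') (B b1 b2 \<cdot> C c1 c2) (D d' d'') * \<Phi> (A a' a'') (B b2 b'') (C c2 c''))"
  by (intro sum.cong refl sweedler_comatrix[OF D vector_space_mult] I)
 finally show ?thesis
  using \<Phi>_cocycle[where a="A a a''" and b="B b b''" and c="C c c''" and d="D d d''"] unfolding lhs by simp
qed

lemma comatrix_one: "comatrix {()} (\<lambda>_ _. \<one>)"
 by (simp add: comatrix_def \<Delta>_one \<epsilon>_one)

lemma inverse_of_idempotent:
 assumes "inverse_matrices Q F G" "\<And>x z. x \<in> Q \<Longrightarrow> z \<in> Q \<Longrightarrow> mprod Q F F x z = F x z" "x \<in> Q" "z \<in> Q"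
 shows "F x z = (if x = z then 1 else 0)"
proof -
 have "F x z = mprod Q (mprod Q F F) G x z" by (rule inverse_matricesD(3)[OF assms(1,4), symmetric])
 also have "\<dots> = mprod Q F G x z" by (rule mprod_cong_on[OF assms(2) refl assms(3,4)])
 also have "\<dots> = (if x = z then 1 else 0)" using assms unfolding inverse_matrices_def by blast
 finally show ?thesis .
qed

text \<open>The associator is trivial if one of the outer arguments is the unit: by the pentagon axiom with
 two adjacent units it is idempotent, and it is invertible.\<close>
lemma \<Phi>_one_left: "\<Phi> \<one> a b = \<epsilon> a * \<epsilon> b" and \<Phi>_one_right: "\<Phi> a b \<one> = \<epsilon> a * \<epsilon> b"
proof -
 have left: "\<Phi> \<one> (C c c'') (D d d'') = (if c = c'' \<and> d = d'' then 1 else 0)"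
  if C: "comatrix T C" "c \<in> T" "c'' \<in> T" and D: "comatrix U D" "d \<in> U" "d'' \<in> U"
  for T U :: "'h set" and C D c c'' d d''
 proof -
  have e: "\<epsilon> (C x y) = (if x = y then 1 else 0)" if "x \<in> T" "y \<in> T" for x y by (rule comatrixD(3)[OF C(1) that])
  have e': "\<epsilon> (D x y) = (if x = y then 1 else 0)" if "x \<in> U" "y \<in> U" for x y by (rule comatrixD(3)[OF D(1) that])
  let ?Q = "{()} \<times> T \<times> U" and ?F = "form_matrix \<Phi> (\<lambda>_ _. \<one>) C D"
  note fin = comatrixD(1)[OF C(1)] comatrixD(1)[OF D(1)]
  have "mprod ?Q ?F ?F x z = ?F x z" if xz: "x \<in> ?Q" "z \<in> ?Q" for x z
  proof -
   obtain c c'' d d'' where *: "x = ((), c, d)" "z = ((), c'', d'')" "c \<in> T" "c'' \<in> T" "d \<in> U" "d'' \<in> U"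
    using xz by auto
   have "(SUM c':T. SUM d':U. \<Phi> \<one> \<one> (C c c' \<cdot> D d d') * \<Phi> (\<one> \<cdot> \<one>) (C c' c'') (D d' d'')) =
    (SUM c1:T. SUM c2:T. SUM d':U. \<Phi> \<one> (C c c1) (D d d') * \<Phi> \<one> (\<one> \<cdot> C c1 c2) (D d' d'') * \<Phi> \<one> \<one> (C c2 c''))"
    using pentagon_comatrix[OF comatrix_one _ _ comatrix_one _ _ C(1) *(3,4) D(1) *(5,6), of "()" "()" "()" "()"] by simp
   moreover have "(SUM c':T. SUM d':U. \<Phi> \<one> \<one> (C c c' \<cdot> D d d') * \<Phi> (\<one> \<cdot> \<one>) (C c' c'') (D d' d'')) =
    (SUM c':T. (if c = c' then 1 else 0) * (SUM d':U. (if d = d' then 1 else 0) * \<Phi> \<one> (C c' c'') (D d' d'')))"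
    unfolding sum_distrib_left by (intro sum.cong refl) (simp add: \<Phi>_one \<epsilon>_one \<epsilon>_mult e e' * mult_one_left)
   moreover have "\<dots> = ?F x z" by (simp only: sum_delta_mult[OF fin(1) *(3)] sum_delta_mult[OF fin(2) *(5)] *(1,2) form_matrix_apply)
   moreover have "(SUM c1:T. SUM c2:T. SUM d':U. \<Phi> \<one> (C c c1) (D d d') * \<Phi> \<one> (\<one> \<cdot> C c1 c2) (D d' d'') * \<Phi> \<one> \<one> (C c2 c'')) =
    (SUM c1:T. SUM c2:T. (SUM d':U. \<Phi> \<one> (C c c1) (D d d') * \<Phi> \<one> (C c1 c2) (D d' d'')) * (if c2 = c'' then 1 else 0))"
    unfolding sum_distrib_right by (intro sum.cong refl) (simp add: \<Phi>_one \<epsilon>_one e * mult_one_left)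
   moreover have "\<dots> = mprod ?Q ?F ?F x z"
    by (simp only: sum_delta_mult[OF fin(1) *(4)] mprod_def sum_Times3 *(1,2) form_matrix_apply) simp
   ultimately show ?thesis by simp
  qed
  from inverse_of_idempotent[OF associator_inverse[OF comatrix_one C(1) D(1)] this, of "((), c, d)" "((), c'', d'')"]
  show ?thesis using C D by simp
 qed
 have right: "\<Phi> (A a a'') (B b b'') \<one> = (if a = a'' \<and> b = b'' then 1 else 0)"
  if A: "comatrix R A" "a \<in> R" "a'' \<in> R" and B: "comatrix S B" "b \<in> S" "b'' \<in> S"
  for R S :: "'h set" and A B a a'' b b''
 proof -
  have e: "\<epsilon> (A x y) = (if x = y then 1 else 0)" if "x \<in> R" "y \<in> R" for x y by (rule comatrixD(3)[OF A(1) that])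
  have e': "\<epsilon> (B x y) = (if x = y then 1 else 0)" if "x \<in> S" "y \<in> S" for x y by (rule comatrixD(3)[OF B(1) that])
  let ?Q = "R \<times> S \<times> {()}" and ?F = "form_matrix \<Phi> A B (\<lambda>_ _. \<one>)"
  note fin = comatrixD(1)[OF A(1)] comatrixD(1)[OF B(1)]
  have "mprod ?Q ?F ?F x z = ?F x z" if xz: "x \<in> ?Q" "z \<in> ?Q" for x z
  proof -
   obtain a a'' b b'' where *: "x = (a, b, ())" "z = (a'', b'', ())" "a \<in> R" "a'' \<in> R" "b \<in> S" "b'' \<in> S"
    using xz by auto
   have "(SUM a':R. SUM b':S. \<Phi> (A a a') (B b b') (\<one> \<cdot> \<one>) * \<Phi> (A a' a'' \<cdot> B b' b'') \<one> \<one>) =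
    (SUM a':R. SUM b1:S. SUM b2:S. \<Phi> (B b b1) \<one> \<one> * \<Phi> (A a a') (B b1 b2 \<cdot> \<one>) \<one> * \<Phi> (A a' a'') (B b2 b'') \<one>)"
    using pentagon_comatrix[OF A(1) *(3,4) B(1) *(5,6) comatrix_one _ _ comatrix_one _ _, of "()" "()" "()" "()"] by simp
   moreover have "(SUM a':R. SUM b':S. \<Phi> (A a a') (B b b') (\<one> \<cdot> \<one>) * \<Phi> (A a' a'' \<cdot> B b' b'') \<one> \<one>) =
    (SUM a':R. (SUM b':S. \<Phi> (A a a') (B b b') \<one> * (if b' = b'' then 1 else 0)) * (if a' = a'' then 1 else 0))"
    unfolding sum_distrib_right by (intro sum.cong refl) (simp add: \<Phi>_one \<epsilon>_one \<epsilon>_mult e e' * mult_one_left)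
   moreover have "\<dots> = ?F x z" by (simp only: sum_delta_mult[OF fin(1) *(4)] sum_delta_mult[OF fin(2) *(6)] *(1,2) form_matrix_apply)
   moreover have "(SUM a':R. SUM b1:S. SUM b2:S. \<Phi> (B b b1) \<one> \<one> * \<Phi> (A a a') (B b1 b2 \<cdot> \<one>) \<one> * \<Phi> (A a' a'') (B b2 b'') \<one>) =
    (SUM a':R. SUM b1:S. (if b = b1 then 1 else 0) * (SUM b2:S. \<Phi> (A a a') (B b1 b2) \<one> * \<Phi> (A a' a'') (B b2 b'') \<one>))"
    unfolding sum_distrib_left by (intro sum.cong refl) (simp add: \<Phi>_one \<epsilon>_one e' * mult_one_right)
   moreover have "\<dots> = mprod ?Q ?F ?F x z"
    by (simp only: sum_delta_mult[OF fin(2) *(5)] mprod_def sum_Times3 *(1,2) form_matrix_apply) simp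
   ultimately show ?thesis by simp
  qed
  from inverse_of_idempotent[OF associator_inverse[OF A(1) B(1) comatrix_one] this, of "(a, b, ())" "(a'', b'', ())"]
  show ?thesis using A B by simp
 qed
 note I = lin_mult_left lin_mult_right \<epsilon>_linear lin_intros
 show "\<Phi> \<one> a b = \<epsilon> a * \<epsilon> b"
  by (rule lin_eq_if_comatrix[of "(*)" _ _ a], (intro I)+,
    rule lin_eq_if_comatrix[of "(*)" _ _ b], (intro I)+) (simp add: left comatrixD(3))
 show "\<Phi> a b \<one> = \<epsilon> a * \<epsilon> b"
  by (rule lin_eq_if_comatrix[of "(*)" _ _ a], (intro I)+,
    rule lin_eq_if_comatrix[of "(*)" _ _ b], (intro I)+) (simp add: right comatrixD(3))
qed


text \<open>The five matrices in the pentagon axiom, for a trilinear form \<open>F\<close>, on \<open>R \<times> S \<times> T \<times> U\<close>.\<close>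
definition "pentagon1 F A B C D = form_matrix F A B (prod_comatrix C D)"
definition "pentagon2 F A B C D = (\<lambda>(a, b, c, d) (a', b', c', d'). F (A a a' \<cdot> B b b') (C c c') (D d d'))"
definition "pentagon3 F A B C D = (\<lambda>(a, b, c, d) (a', b', c', d'). (if a = a' then 1 else 0) * F (B b b') (C c c') (D d d'))"
definition "pentagon4 F A B C D = (\<lambda>(a, b, c, d) (a', b', c', d'). F (A a a') (B b b' \<cdot> C c c') (D d d'))"
definition "pentagon5 F A B C D = (\<lambda>(a, b, c, d) (a', b', c', d'). F (A a a') (B b b') (C c c') * (if d = d' then 1 else 0))"

lemmas pentagon_defs = pentagon1_def pentagon2_def pentagon3_def pentagon4_def pentagon5_def

context
 fixes R :: "'r set" and A and S :: "'s set" and B and T :: "'t set" and C and U :: "'u set" and D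
 assumes A: "comatrix R A" and B: "comatrix S B" and C: "comatrix T C" and D: "comatrix U D"
begin

private lemma fin: "finite R" "finite S" "finite T" "finite U"
 using A B C D by (auto simp: comatrix_def)

private lemma inv_entries:
 assumes "comatrix R' A'" "comatrix S' B'" "comatrix T' C'"
  and "a \<in> R'" "b \<in> S'" "c \<in> T'" "a'' \<in> R'" "b'' \<in> S'" "c'' \<in> T'"
 shows "(SUM a':R'. SUM b':S'. SUM c':T'. \<Phi> (A' a a') (B' b b') (C' c c') * \<Psi> (A' a' a'') (B' b' b'') (C' c' c'')) =
   (if (a, b, c) = (a'', b'', c'') then 1 else 0)" (is ?th1)
  and "(SUM a':R'. SUM b':S'. SUM c':T'. \<Psi> (A' a a') (B' b b') (C' c c') * \<Phi> (A' a' a'') (B' b' b'') (C' c' c'')) =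
   (if (a, b, c) = (a'', b'', c'') then 1 else 0)" (is ?th2)
proof -
 have "mprod (R' \<times> S' \<times> T') (form_matrix \<Phi> A' B' C') (form_matrix \<Psi> A' B' C') (a, b, c) (a'', b'', c'') =
   (if (a, b, c) = (a'', b'', c'') then 1 else 0)"
  "mprod (R' \<times> S' \<times> T') (form_matrix \<Psi> A' B' C') (form_matrix \<Phi> A' B' C') (a, b, c) (a'', b'', c'') =
   (if (a, b, c) = (a'', b'', c'') then 1 else 0)"
  using associator_inverse[OF assms(1-3)] assms(4-) unfolding inverse_matrices_def by blast+
 then show ?th1 ?th2 by (simp_all only: mprod_def sum_Times3 form_matrix_apply)
qed

private lemma inverse_matricesI4:
 assumes "\<And>a b c d a'' b'' c'' d''. a \<in> R \<Longrightarrow> b \<in> S \<Longrightarrow> c \<in> T \<Longrightarrow> d \<in> U \<Longrightarrow>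
   a'' \<in> R \<Longrightarrow> b'' \<in> S \<Longrightarrow> c'' \<in> T \<Longrightarrow> d'' \<in> U \<Longrightarrow>
  (SUM a':R. SUM b':S. SUM c':T. SUM d':U. F (a, b, c, d) (a', b', c', d') * G (a', b', c', d') (a'', b'', c'', d'')) =
   (if (a, b, c, d) = (a'', b'', c'', d'') then 1 else 0)"
  "\<And>a b c d a'' b'' c'' d''. a \<in> R \<Longrightarrow> b \<in> S \<Longrightarrow> c \<in> T \<Longrightarrow> d \<in> U \<Longrightarrow>
   a'' \<in> R \<Longrightarrow> b'' \<in> S \<Longrightarrow> c'' \<in> T \<Longrightarrow> d'' \<in> U \<Longrightarrow>
  (SUM a':R. SUM b':S. SUM c':T. SUM d':U. G (a, b, c, d) (a', b', c', d') * F (a', b', c', d') (a'', b'', c'', d'')) =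
   (if (a, b, c, d) = (a'', b'', c'', d'') then 1 else 0)"
 shows "inverse_matrices (R \<times> S \<times> T \<times> U) F G"
 unfolding inverse_matrices_def mprod_def sum_Times4
proof (intro conjI ballI)
 show "finite (R \<times> S \<times> T \<times> U)" using fin by simp
 fix x z assume "x \<in> R \<times> S \<times> T \<times> U" "z \<in> R \<times> S \<times> T \<times> U"
 then obtain a b c d a'' b'' c'' d'' where x: "x = (a, b, c, d)" "a \<in> R" "b \<in> S" "c \<in> T" "d \<in> U"
  and z: "z = (a'', b'', c'', d'')" "a'' \<in> R" "b'' \<in> S" "c'' \<in> T" "d'' \<in> U" by auto
 show "(SUM a:R. SUM b:S. SUM c:T. SUM d:U. F x (a, b, c, d) * G (a, b, c, d) z) = (if x = z then 1 else 0)"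
  unfolding x(1) z(1) by (rule assms(1)[OF x(2-) z(2-)])
 show "(SUM a:R. SUM b:S. SUM c:T. SUM d:U. G x (a, b, c, d) * F (a, b, c, d) z) = (if x = z then 1 else 0)"
  unfolding x(1) z(1) by (rule assms(2)[OF x(2-) z(2-)])
qed

lemma pentagon_inverses:
 "inverse_matrices (R \<times> S \<times> T \<times> U) (pentagon1 \<Phi> A B C D) (pentagon1 \<Psi> A B C D)"
 "inverse_matrices (R \<times> S \<times> T \<times> U) (pentagon2 \<Phi> A B C D) (pentagon2 \<Psi> A B C D)"
 "inverse_matrices (R \<times> S \<times> T \<times> U) (pentagon3 \<Phi> A B C D) (pentagon3 \<Psi> A B C D)"
 "inverse_matrices (R \<times> S \<times> T \<times> U) (pentagon4 \<Phi> A B C D) (pentagon4 \<Psi> A B C D)"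
 "inverse_matrices (R \<times> S \<times> T \<times> U) (pentagon5 \<Phi> A B C D) (pentagon5 \<Psi> A B C D)"
proof -
 show "inverse_matrices (R \<times> S \<times> T \<times> U) (pentagon1 \<Phi> A B C D) (pentagon1 \<Psi> A B C D)"
  unfolding pentagon_defs by (rule associator_inverse[OF A B comatrix_prod[OF C D]])
 show "inverse_matrices (R \<times> S \<times> T \<times> U) (pentagon2 \<Phi> A B C D) (pentagon2 \<Psi> A B C D)"
 proof (rule inverse_matricesI4, goal_cases)
  case (1 a b c d a'' b'' c'' d'')
  then show ?case
   using inv_entries(1)[OF comatrix_prod[OF A B] C D, of "(a, b)" c d "(a'', b'')" c'' d'']
   by (simp add: pentagon_defs sum_Times)
 next
  case (2 a b c d a'' b'' c'' d'')
  then show ?case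
   using inv_entries(2)[OF comatrix_prod[OF A B] C D, of "(a, b)" c d "(a'', b'')" c'' d'']
   by (simp add: pentagon_defs sum_Times)
 qed
 show "inverse_matrices (R \<times> S \<times> T \<times> U) (pentagon4 \<Phi> A B C D) (pentagon4 \<Psi> A B C D)"
 proof (rule inverse_matricesI4, goal_cases)
  case (1 a b c d a'' b'' c'' d'')
  then show ?case
   using inv_entries(1)[OF A comatrix_prod[OF B C] D, of a "(b, c)" d a'' "(b'', c'')" d'']
   by (simp add: pentagon_defs sum_Times)
 next
  case (2 a b c d a'' b'' c'' d'')
  then show ?case
   using inv_entries(2)[OF A comatrix_prod[OF B C] D, of a "(b, c)" d a'' "(b'', c'')" d'']
   by (simp add: pentagon_defs sum_Times)
 qed
 show "inverse_matrices (R \<times> S \<times> T \<times> U) (pentagon3 \<Phi> A B C D) (pentagon3 \<Psi> A B C D)"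
 proof (rule inverse_matricesI4, goal_cases)
  case (1 a b c d a'' b'' c'' d'')
  have "(SUM a':R. SUM b':S. SUM c':T. SUM d':U. pentagon3 \<Phi> A B C D (a, b, c, d) (a', b', c', d') * pentagon3 \<Psi> A B C D (a', b', c', d') (a'', b'', c'', d'')) =
   (SUM a':R. (if a = a' then 1 else 0) * ((if a' = a'' then 1 else 0) * (if (b, c, d) = (b'', c'', d'') then 1 else 0)))"
   by (simp only: pentagon_defs prod.case inv_entries(1)[OF B C D 1(2-4,6-8), symmetric] sum_distrib_left ac_simps)
  then show ?case using 1 fin by (simp add: sum_delta_mult)
 next
  case (2 a b c d a'' b'' c'' d'')
  have "(SUM a':R. SUM b':S. SUM c':T. SUM d':U. pentagon3 \<Psi> A B C D (a, b, c, d) (a', b', c', d') * pentagon3 \<Phi> A B C D (a', b', c', d') (a'', b'', c'', d'')) =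
   (SUM a':R. (if a = a' then 1 else 0) * ((if a' = a'' then 1 else 0) * (if (b, c, d) = (b'', c'', d'') then 1 else 0)))"
   by (simp only: pentagon_defs prod.case inv_entries(2)[OF B C D 2(2-4,6-8), symmetric] sum_distrib_left ac_simps)
  then show ?case using 2 fin by (simp add: sum_delta_mult)
 qed
 show "inverse_matrices (R \<times> S \<times> T \<times> U) (pentagon5 \<Phi> A B C D) (pentagon5 \<Psi> A B C D)"
 proof (rule inverse_matricesI4, goal_cases)
  case (1 a b c d a'' b'' c'' d'')
  have "(SUM d':U. x * (if d = d' then 1 else 0) * (y * (if d' = d'' then 1 else 0))) = x * y * (if d = d'' then 1 else 0)" for x y :: 'k
   using 1 fin sum_delta_mult(4)[OF fin(4) 1(4), of "\<lambda>d'. x * (y * (if d' = d'' then 1 else 0))"] by (simp add: ac_simps)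
  then have "(SUM a':R. SUM b':S. SUM c':T. SUM d':U. pentagon5 \<Phi> A B C D (a, b, c, d) (a', b', c', d') * pentagon5 \<Psi> A B C D (a', b', c', d') (a'', b'', c'', d'')) =
   (if (a, b, c) = (a'', b'', c'') then 1 else 0) * (if d = d'' then 1 else 0)"
   by (simp only: pentagon_defs prod.case inv_entries(1)[OF A B C 1(1-3,5-7), symmetric] sum_distrib_right)
  then show ?case by simp
 next
  case (2 a b c d a'' b'' c'' d'')
  have "(SUM d':U. x * (if d = d' then 1 else 0) * (y * (if d' = d'' then 1 else 0))) = x * y * (if d = d'' then 1 else 0)" for x y :: 'k
   using 2 fin sum_delta_mult(4)[OF fin(4) 2(4), of "\<lambda>d'. x * (y * (if d' = d'' then 1 else 0))"] by (simp add: ac_simps)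
  then have "(SUM a':R. SUM b':S. SUM c':T. SUM d':U. pentagon5 \<Psi> A B C D (a, b, c, d) (a', b', c', d') * pentagon5 \<Phi> A B C D (a', b', c', d') (a'', b'', c'', d'')) =
   (if (a, b, c) = (a'', b'', c'') then 1 else 0) * (if d = d'' then 1 else 0)"
   by (simp only: pentagon_defs prod.case inv_entries(2)[OF A B C 2(1-3,5-7), symmetric] sum_distrib_right)
  then show ?case by simp
 qed
qed

lemma pentagon_matrices:
 assumes "x \<in> R \<times> S \<times> T \<times> U" "z \<in> R \<times> S \<times> T \<times> U"
 shows "mprod (R \<times> S \<times> T \<times> U) (pentagon1 \<Phi> A B C D) (pentagon2 \<Phi> A B C D) x z =
  mprod (R \<times> S \<times> T \<times> U) (pentagon3 \<Phi> A B C D) (mprod (R \<times> S \<times> T \<times> U) (pentagon4 \<Phi> A B C D) (pentagon5 \<Phi> A B C D)) x z"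
proof -
 obtain a b c d a'' b'' c'' d'' where x: "x = (a, b, c, d)" "a \<in> R" "b \<in> S" "c \<in> T" "d \<in> U"
  and z: "z = (a'', b'', c'', d'')" "a'' \<in> R" "b'' \<in> S" "c'' \<in> T" "d'' \<in> U" using assms by auto
 let ?Q = "R \<times> S \<times> T \<times> U"
 have 45: "mprod ?Q (pentagon4 \<Phi> A B C D) (pentagon5 \<Phi> A B C D) (a1, b1, c1, d1) z =
  (SUM a':R. SUM b':S. SUM c':T. \<Phi> (A a1 a') (B b1 b' \<cdot> C c1 c') (D d1 d'') * \<Phi> (A a' a'') (B b' b'') (C c' c''))"
  for a1 b1 c1 d1
 proof -
  have "(SUM d':U. \<Phi> x y (D d1 d') * (w * (if d' = d'' then 1 else 0))) = \<Phi> x y (D d1 d'') * w" for x y w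
   using sum_delta_mult(3)[OF fin(4) z(5), of "\<lambda>d'. \<Phi> x y (D d1 d') * w"] by (simp add: ac_simps)
  then show ?thesis by (simp only: mprod_def sum_Times4 z(1) pentagon_defs prod.case)
 qed
 let ?G = "\<lambda>a b1 c1 d'. SUM a':R. SUM b2:S. SUM c2:T. \<Phi> (A a a') (B b1 b2 \<cdot> C c1 c2) (D d' d'') * \<Phi> (A a' a'') (B b2 b'') (C c2 c'')"
 have "mprod ?Q (pentagon3 \<Phi> A B C D) (mprod ?Q (pentagon4 \<Phi> A B C D) (pentagon5 \<Phi> A B C D)) x z =
  (SUM a1:R. (if a = a1 then 1 else 0) * (SUM b1:S. SUM c1:T. SUM d':U. \<Phi> (B b b1) (C c c1) (D d d') * ?G a1 b1 c1 d'))"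
  unfolding mprod_def[of ?Q "pentagon3 \<Phi> A B C D"] sum_Times4 45 x(1)
  by (simp only: pentagon3_def prod.case sum_distrib_left mult.assoc)
 also have "\<dots> = (SUM b1:S. SUM c1:T. SUM d':U. \<Phi> (B b b1) (C c c1) (D d d') * ?G a b1 c1 d')"
  by (rule sum_delta_mult(2)[OF fin(1) x(2)])
 also have "\<dots> = (SUM b1:S. SUM c1:T. SUM d':U. SUM a':R. SUM b2:S. SUM c2:T.
   \<Phi> (B b b1) (C c c1) (D d d') * \<Phi> (A a a') (B b1 b2 \<cdot> C c1 c2) (D d' d'') * \<Phi> (A a' a'') (B b2 b'') (C c2 c''))"
  by (simp only: sum_distrib_left mult.assoc)
 also have "\<dots> = (SUM b1:S. SUM c1:T. SUM a':R. SUM b2:S. SUM c2:T. SUM d':U.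
   \<Phi> (B b b1) (C c c1) (D d d') * \<Phi> (A a a') (B b1 b2 \<cdot> C c1 c2) (D d' d'') * \<Phi> (A a' a'') (B b2 b'') (C c2 c''))"
  by (simp only: sum.swap[of _ U])
 also have "\<dots> = (SUM a':R. SUM b1:S. SUM b2:S. SUM c1:T. SUM c2:T. SUM d':U.
   \<Phi> (B b b1) (C c c1) (D d d') * \<Phi> (A a a') (B b1 b2 \<cdot> C c1 c2) (D d' d'') * \<Phi> (A a' a'') (B b2 b'') (C c2 c''))"
 proof -
  have "(SUM b1:S. SUM c1:T. SUM a':R. SUM b2:S. F b1 c1 a' b2) = (SUM a':R. SUM b1:S. SUM b2:S. SUM c1:T. F b1 c1 a' b2)" for F :: "_ \<Rightarrow> _ \<Rightarrow> _ \<Rightarrow> _ \<Rightarrow> 'k"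
  proof -
   have "(SUM b1:S. SUM c1:T. SUM a':R. SUM b2:S. F b1 c1 a' b2) = (SUM b1:S. SUM a':R. SUM c1:T. SUM b2:S. F b1 c1 a' b2)"
    by (intro sum.cong refl sum.swap)
   also have "\<dots> = (SUM a':R. SUM b1:S. SUM c1:T. SUM b2:S. F b1 c1 a' b2)" by (rule sum.swap)
   also have "\<dots> = (SUM a':R. SUM b1:S. SUM b2:S. SUM c1:T. F b1 c1 a' b2)" by (intro sum.cong refl sum.swap)
   finally show ?thesis .
  qed
  then show ?thesis .
 qed
 also have "\<dots> = (SUM a':R. SUM b':S. SUM c':T. SUM d':U.
   \<Phi> (A a a') (B b b') (C c c' \<cdot> D d d') * \<Phi> (A a' a'' \<cdot> B b' b'') (C c' c'') (D d' d''))"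
  by (rule pentagon_comatrix[OF A x(2) z(2) B x(3) z(3) C x(4) z(4) D x(5) z(5), symmetric])
 also have "\<dots> = mprod ?Q (pentagon1 \<Phi> A B C D) (pentagon2 \<Phi> A B C D) x z"
  by (simp only: mprod_def sum_Times4 x(1) z(1) pentagon_defs prod.case form_matrix_apply prod_comatrix_apply)
 finally show ?thesis ..
qed

lemmas pentagon_inverse_matrices = pentagon_inverse[OF pentagon_inverses pentagon_matrices]

end

end

section \<open>The opposite multiplication\<close>

lemma sum_list_swap: "(SUM x<-xs. SUM y<-ys. f x y) = (SUM y<-ys. SUM x<-xs. f x y)"
 for f :: "_ \<Rightarrow> _ \<Rightarrow> 'z::ab_group_add"
 by (induction xs) (simp_all add: sum_list_addf)

lemma sum_list_pair_swap:
 "(SUM (x, x')<-xs. SUM (y, y')<-ys. f x x' y y') = (SUM (y, y')<-ys. SUM (x, x')<-xs. f x x' y y')"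
 for f :: "_ \<Rightarrow> _ \<Rightarrow> _ \<Rightarrow> _ \<Rightarrow> 'z::ab_group_add"
 unfolding split_def by (rule sum_list_swap)

lemma sum_list_pair_reverse:
 "(SUM (x, x')<-xs. SUM (y, y')<-ys. SUM (z, z')<-zs. f x x' y y' z z') =
  (SUM (z, z')<-zs. SUM (y, y')<-ys. SUM (x, x')<-xs. f x x' y y' z z')"
 for f :: "_ \<Rightarrow> _ \<Rightarrow> _ \<Rightarrow> _ \<Rightarrow> _ \<Rightarrow> _ \<Rightarrow> 'z::ab_group_add"
proof -
 have "(SUM (x, x')<-xs. SUM (y, y')<-ys. SUM (z, z')<-zs. f x x' y y' z z') =
  (SUM (x, x')<-xs. SUM (z, z')<-zs. SUM (y, y')<-ys. f x x' y y' z z')"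
  by (intro sum_list_pair_cong sum_list_pair_swap)
 also have "\<dots> = (SUM (z, z')<-zs. SUM (x, x')<-xs. SUM (y, y')<-ys. f x x' y y' z z')"
  by (rule sum_list_pair_swap)
 also have "\<dots> = (SUM (z, z')<-zs. SUM (y, y')<-ys. SUM (x, x')<-xs. f x x' y y' z z')"
  by (intro sum_list_pair_cong sum_list_pair_swap)
 finally show ?thesis .
qed

lemma inverse_of_identity:
 assumes "inverse_matrices Q F G" "\<And>x z. x \<in> Q \<Longrightarrow> z \<in> Q \<Longrightarrow> F x z = (if x = z then 1 else 0)"
  and xz: "x \<in> Q" "z \<in> Q"
 shows "G x z = (if x = z then 1 else 0)"
proof -
 have "finite Q" using assms by (simp add: inverse_matrices_def)
 then have "mprod Q F G x z = G x z"
  using sum_delta_mult(2)[of Q x "\<lambda>y. G y z"] xz by (simp add: mprod_def assms(2) cong: sum.cong)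
 then show ?thesis using assms unfolding inverse_matrices_def by auto
qed

context coquasi_bialgebra_inverse
begin

text \<open>The matrix of \<open>\<Phi>\<close> with a unit argument is the identity matrix, hence so
 is its inverse.\<close>
lemma \<Psi>_one: "\<Psi> a \<one> b = \<epsilon> a * \<epsilon> b" and \<Psi>_one_right: "\<Psi> a b \<one> = \<epsilon> a * \<epsilon> b"
proof -
 note I = lin_mult_left lin_mult_right \<epsilon>_linear lin_intros
 have middle: "\<Psi> (A a a'') \<one> (B b b'') = (if a = a'' \<and> b = b'' then 1 else 0)"
  if A: "comatrix R A" "a \<in> R" "a'' \<in> R" and B: "comatrix S B" "b \<in> S" "b'' \<in> S"
  for R S :: "'h set" and A B a a'' b b''
 proof -
  have "form_matrix \<Phi> A (\<lambda>_ _. \<one>) B x z = (if x = z then 1 else 0)" if "x \<in> R \<times> {()} \<times> S" "z \<in> R \<times> {()} \<times> S" for x z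
   using that by (auto simp: \<Phi>_one comatrixD(3)[OF A(1)] comatrixD(3)[OF B(1)] split: if_splits)
  from inverse_of_identity[OF associator_inverse[OF A(1) comatrix_one B(1)] this, of "(a, (), b)" "(a'', (), b'')"]
  show ?thesis using A B by simp
 qed
 have right: "\<Psi> (A a a'') (B b b'') \<one> = (if a = a'' \<and> b = b'' then 1 else 0)"
  if A: "comatrix R A" "a \<in> R" "a'' \<in> R" and B: "comatrix S B" "b \<in> S" "b'' \<in> S"
  for R S :: "'h set" and A B a a'' b b''
 proof -
  have "form_matrix \<Phi> A B (\<lambda>_ _. \<one>) x z = (if x = z then 1 else 0)" if "x \<in> R \<times> S \<times> {()}" "z \<in> R \<times> S \<times> {()}" for x z
   using that by (auto simp: \<Phi>_one_right comatrixD(3)[OF A(1)] comatrixD(3)[OF B(1)] split: if_splits)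
  from inverse_of_identity[OF associator_inverse[OF A(1) B(1) comatrix_one] this, of "(a, b, ())" "(a'', b'', ())"]
  show ?thesis using A B by simp
 qed
 show "\<Psi> a \<one> b = \<epsilon> a * \<epsilon> b"
  by (rule lin_eq_if_comatrix[of "(*)" _ _ a], (intro I)+,
    rule lin_eq_if_comatrix[of "(*)" _ _ b], (intro I)+) (simp add: middle comatrixD(3))
 show "\<Psi> a b \<one> = \<epsilon> a * \<epsilon> b"
  by (rule lin_eq_if_comatrix[of "(*)" _ _ a], (intro I)+,
    rule lin_eq_if_comatrix[of "(*)" _ _ b], (intro I)+) (simp add: right comatrixD(3))
qed

text \<open>The pentagon axiom for the inverse of the associator, with the order of all factors reversed.\<close>
lemma \<Psi>_cocycle_comatrix:
 assumes A: "comatrix R A" "a \<in> R" "a'' \<in> R" and B: "comatrix S B" "b \<in> S" "b'' \<in> S"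
  and C: "comatrix T C" "c \<in> T" "c'' \<in> T" and D: "comatrix U D" "d \<in> U" "d'' \<in> U"
 shows "(SUM a1:R. SUM b1:S. SUM c1:T. SUM d1:U.
   \<Psi> (D d d1 \<cdot> C c c1) (B b b1) (A a a1) * \<Psi> (D d1 d'') (C c1 c'') (B b1 b'' \<cdot> A a1 a'')) =
  (SUM a1:R. SUM b1:S. SUM b2:S. SUM c1:T. SUM c2:T. SUM d1:U.
   \<Psi> (D d d1) (C c c1) (B b b1) * \<Psi> (D d1 d'') (C c1 c2 \<cdot> B b1 b2) (A a a1) * \<Psi> (C c2 c'') (B b2 b'') (A a1 a''))"
proof -
 let ?Q = "U \<times> T \<times> S \<times> R"
 let ?x = "(d, c, b, a)" and ?z = "(d'', c'', b'', a'')"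
 note fin = comatrixD(1)[OF A(1)] comatrixD(1)[OF B(1)] comatrixD(1)[OF C(1)] comatrixD(1)[OF D(1)]
 have eq: "mprod ?Q (pentagon2 \<Psi> D C B A) (pentagon1 \<Psi> D C B A) ?x ?z =
  mprod ?Q (pentagon5 \<Psi> D C B A) (mprod ?Q (pentagon4 \<Psi> D C B A) (pentagon3 \<Psi> D C B A)) ?x ?z"
  by (rule pentagon_inverse_matrices(1)[OF D(1) C(1) B(1) A(1)]) (use A B C D in auto)
 have "mprod ?Q (pentagon2 \<Psi> D C B A) (pentagon1 \<Psi> D C B A) ?x ?z =
  (SUM d1:U. SUM c1:T. SUM b1:S. SUM a1:R.
   \<Psi> (D d d1 \<cdot> C c c1) (B b b1) (A a a1) * \<Psi> (D d1 d'') (C c1 c'') (B b1 b'' \<cdot> A a1 a''))"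
  by (simp only: mprod_def sum_Times4 pentagon_defs prod.case form_matrix_apply prod_comatrix_apply)
 also have "\<dots> = (SUM a1:R. SUM b1:S. SUM c1:T. SUM d1:U.
   \<Psi> (D d d1 \<cdot> C c c1) (B b b1) (A a a1) * \<Psi> (D d1 d'') (C c1 c'') (B b1 b'' \<cdot> A a1 a''))"
  unfolding sum.cartesian_product
  by (rule sum.reindex_bij_witness[of _ "\<lambda>(a, b, c, d). (d, c, b, a)" "\<lambda>(d, c, b, a). (a, b, c, d)"]) auto
 finally have lhs: "mprod ?Q (pentagon2 \<Psi> D C B A) (pentagon1 \<Psi> D C B A) ?x ?z = \<dots>" .
 have 43: "mprod ?Q (pentagon4 \<Psi> D C B A) (pentagon3 \<Psi> D C B A) (d1, c1, b1, a1) ?z =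
  (SUM c2:T. SUM b2:S. SUM a2:R. \<Psi> (D d1 d'') (C c1 c2 \<cdot> B b1 b2) (A a1 a2) * \<Psi> (C c2 c'') (B b2 b'') (A a2 a''))"
  for d1 c1 b1 a1
 proof -
  have "mprod ?Q (pentagon4 \<Psi> D C B A) (pentagon3 \<Psi> D C B A) (d1, c1, b1, a1) ?z =
   (SUM d2:U. (SUM c2:T. SUM b2:S. SUM a2:R. \<Psi> (D d1 d2) (C c1 c2 \<cdot> B b1 b2) (A a1 a2) * \<Psi> (C c2 c'') (B b2 b'') (A a2 a''))
     * (if d2 = d'' then 1 else 0))"
   unfolding mprod_def sum_Times4 pentagon_defs prod.case sum_distrib_right by (simp only: ac_simps)
  then show ?thesis by (simp only: sum_delta_mult[OF fin(4) D(3)])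
 qed
 let ?G = "\<lambda>d1 c1 b1 a1. SUM c2:T. SUM b2:S. SUM a2:R. \<Psi> (D d1 d'') (C c1 c2 \<cdot> B b1 b2) (A a1 a2) * \<Psi> (C c2 c'') (B b2 b'') (A a2 a'')"
 have "mprod ?Q (pentagon5 \<Psi> D C B A) (mprod ?Q (pentagon4 \<Psi> D C B A) (pentagon3 \<Psi> D C B A)) ?x ?z =
  (SUM d1:U. SUM c1:T. SUM b1:S. SUM a1:R. (if a = a1 then 1 else 0) * (\<Psi> (D d d1) (C c c1) (B b b1) * ?G d1 c1 b1 a1))"
  unfolding mprod_def[of ?Q "pentagon5 \<Psi> D C B A"] sum_Times4 43
  by (simp only: pentagon5_def prod.case ac_simps)
 also have "\<dots> = (SUM d1:U. SUM c1:T. SUM b1:S. \<Psi> (D d d1) (C c c1) (B b b1) * ?G d1 c1 b1 a)"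
  by (simp only: sum_delta_mult[OF fin(1) A(2)])
 also have "\<dots> = (SUM d1:U. SUM c1:T. SUM b1:S. SUM c2:T. SUM b2:S. SUM a1:R.
   \<Psi> (D d d1) (C c c1) (B b b1) * \<Psi> (D d1 d'') (C c1 c2 \<cdot> B b1 b2) (A a a1) * \<Psi> (C c2 c'') (B b2 b'') (A a1 a''))"
  by (simp only: sum_distrib_left mult.assoc)
 also have "\<dots> = (SUM a1:R. SUM b1:S. SUM b2:S. SUM c1:T. SUM c2:T. SUM d1:U.
   \<Psi> (D d d1) (C c c1) (B b b1) * \<Psi> (D d1 d'') (C c1 c2 \<cdot> B b1 b2) (A a a1) * \<Psi> (C c2 c'') (B b2 b'') (A a1 a''))"
  unfolding sum.cartesian_product
  by (rule sum.reindex_bij_witness[of _ "\<lambda>(a, b, c, d, e, f). (f, d, b, e, c, a)" "\<lambda>(f, d, b, e, c, a). (a, b, c, d, e, f)"]) auto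
 finally show ?thesis using eq unfolding lhs by simp
qed

text \<open>By linearity in each argument it is enough to consider entries of comatrices.\<close>
lemma \<Psi>_cocycle:
 "(SUM (a1, a2)<-sweedler a. SUM (b1, b2)<-sweedler b. SUM (c1, c2)<-sweedler c. SUM (d1, d2)<-sweedler d.
   \<Psi> (d1 \<cdot> c1) b1 a1 * \<Psi> d2 c2 (b2 \<cdot> a2)) =
  (SUM (a1, a2)<-sweedler a. SUM (b1, b2, b3)<-sweedler3 b. SUM (c1, c2, c3)<-sweedler3 c. SUM (d1, d2)<-sweedler d.
   \<Psi> d1 c1 b1 * \<Psi> d2 (c2 \<cdot> b2) a1 * \<Psi> c3 b3 a2)"
proof -
 note I = lin_sweedler_sum lin_sweedler_arg vector_space_mult lin_intros
 have s3: "lin scale (*) (\<lambda>x. SUM (y, z, w)<-sweedler3 b. F x y z w)" if "\<And>y z w. lin scale (*) (\<lambda>x. F x y z w)"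
  for F :: "'h \<Rightarrow> 'h \<Rightarrow> 'h \<Rightarrow> 'h \<Rightarrow> 'k" and b
  unfolding split_def by (rule lin_sum_list_fun[OF vs vector_space_mult that])
 have a3: "lin scale (*) (\<lambda>a. SUM (x, y, z)<-sweedler3 a. F x y z)"
  if "\<And>y z. lin scale (*) (\<lambda>x. F x y z)" "\<And>x z. lin scale (*) (\<lambda>y. F x y z)" "\<And>x y. lin scale (*) (\<lambda>z. F x y z)"
  for F :: "'h \<Rightarrow> 'h \<Rightarrow> 'h \<Rightarrow> 'k"
  by (rule lin_sweedler3[OF vector_space_mult that])
 have main: "(SUM (a1, a2)<-sweedler (A a a''). SUM (b1, b2)<-sweedler (B b b''). SUM (c1, c2)<-sweedler (C c c''). SUM (d1, d2)<-sweedler (D d d'').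
   \<Psi> (d1 \<cdot> c1) b1 a1 * \<Psi> d2 c2 (b2 \<cdot> a2)) =
  (SUM (a1, a2)<-sweedler (A a a''). SUM (b1, b2, b3)<-sweedler3 (B b b''). SUM (c1, c2, c3)<-sweedler3 (C c c''). SUM (d1, d2)<-sweedler (D d d'').
   \<Psi> d1 c1 b1 * \<Psi> d2 (c2 \<cdot> b2) a1 * \<Psi> c3 b3 a2)" (is "?L = ?R")
  if A: "comatrix R A" "a \<in> R" "a'' \<in> R" and B: "comatrix S B" "b \<in> S" "b'' \<in> S"
   and C: "comatrix T C" "c \<in> T" "c'' \<in> T" and D: "comatrix U D" "d \<in> U" "d'' \<in> U"
  for R S T U :: "'h set" and A B C D a a'' b b'' c c'' d d''
 proof -
  have "?L = (SUM a':R. SUM b':S. SUM c':T. SUM (d1, d2)<-sweedler (D d d'').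
    \<Psi> (d1 \<cdot> C c c') (B b b') (A a a') * \<Psi> d2 (C c' c'') (B b' b'' \<cdot> A a' a''))"
   by (rule sweedler_comatrix3[OF A B C vector_space_mult]) (intro I)+
  also have "\<dots> = (SUM a':R. SUM b':S. SUM c':T. SUM d':U.
    \<Psi> (D d d' \<cdot> C c c') (B b b') (A a a') * \<Psi> (D d' d'') (C c' c'') (B b' b'' \<cdot> A a' a''))"
   by (intro sum.cong refl sweedler_comatrix[OF D vector_space_mult] I)
  finally have l: "?L = \<dots>" .
  have "?R = (SUM a':R. SUM (b1, b2, b3)<-sweedler3 (B b b''). SUM (c1, c2, c3)<-sweedler3 (C c c''). SUM (d1, d2)<-sweedler (D d d'').
    \<Psi> d1 c1 b1 * \<Psi> d2 (c2 \<cdot> b2) (A a a') * \<Psi> c3 b3 (A a' a''))"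
   by (rule sweedler_comatrix[OF A vector_space_mult]) (intro s3 I)+
  also have "\<dots> = (SUM a':R. SUM b1:S. SUM b2:S. SUM (c1, c2, c3)<-sweedler3 (C c c''). SUM (d1, d2)<-sweedler (D d d'').
    \<Psi> d1 c1 (B b b1) * \<Psi> d2 (c2 \<cdot> B b1 b2) (A a a') * \<Psi> c3 (B b2 b'') (A a' a''))"
   by (intro sum.cong refl sweedler3_comatrix[OF B vector_space_mult] s3 I)
  also have "\<dots> = (SUM a':R. SUM b1:S. SUM b2:S. SUM c1:T. SUM c2:T. SUM (d1, d2)<-sweedler (D d d'').
    \<Psi> d1 (C c c1) (B b b1) * \<Psi> d2 (C c1 c2 \<cdot> B b1 b2) (A a a') * \<Psi> (C c2 c'') (B b2 b'') (A a' a''))"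
   by (intro sum.cong refl sweedler3_comatrix[OF C vector_space_mult] I)
  also have "\<dots> = (SUM a':R. SUM b1:S. SUM b2:S. SUM c1:T. SUM c2:T. SUM d1:U.
    \<Psi> (D d d1) (C c c1) (B b b1) * \<Psi> (D d1 d'') (C c1 c2 \<cdot> B b1 b2) (A a a') * \<Psi> (C c2 c'') (B b2 b'') (A a' a''))"
   by (intro sum.cong refl sweedler_comatrix[OF D vector_space_mult] I)
  finally show "?L = ?R" unfolding l \<Psi>_cocycle_comatrix[OF A B C D] by simp
 qed
 note J = s3 a3 lin_sweedler_sum[OF vector_space_mult] lin_sweedler_arg[OF vector_space_mult] lin_intros
 show ?thesis
 proof (rule lin_eq_if_comatrix[of "(*)" _ _ a], goal_cases)
  case 1 show ?case by (intro J)
 next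
  case 2 show ?case by (intro J)
 next
  case A: (3 R A i j)
  show ?case
  proof (rule lin_eq_if_comatrix[of "(*)" _ _ b], goal_cases)
   case 1 show ?case by (intro J)
  next
   case 2 show ?case by (intro J)
  next
   case B: (3 S B k l)
   show ?case
   proof (rule lin_eq_if_comatrix[of "(*)" _ _ c], goal_cases)
    case 1 show ?case by (intro J)
   next
    case 2 show ?case by (intro J)
   next
    case C: (3 T C m n)
    show ?case
    proof (rule lin_eq_if_comatrix[of "(*)" _ _ d], goal_cases)
     case 1 show ?case by (intro J)
    next
     case 2 show ?case by (intro J)
    next
     case D: (3 U D p q)
     show ?case by (rule main[OF A B C D])
    qed
   qed
  qed
 qed
qed

text \<open>Reversing the multiplication gives again a coquasi-bialgebra, with associator \<open>\<Psi>(c, b, a)\<close>. This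
 exchanges the two tensor factors in the category of comodules.\<close>
lemma opposite:
 "coquasi_bialgebra_inverse scale \<Delta> \<epsilon> (\<lambda>a b. b \<cdot> a) \<one> (\<lambda>a b c. \<Psi> c b a) (\<lambda>a b c. \<Phi> c b a)"
proof -
 have inv: "is_convolution_inverse3 (\<lambda>a b c. \<Psi> c b a) (\<lambda>a b c. \<Phi> c b a)"
  unfolding is_convolution_inverse3_def
 proof (intro conjI allI)
  show "trilinear_form scale (\<lambda>a b c. \<Phi> c b a)" using \<Phi>_trilinear unfolding trilinear_form_def by auto
  fix a b c
  show "(SUM (a1, a2)<-sweedler a. SUM (b1, b2)<-sweedler b. SUM (c1, c2)<-sweedler c. \<Psi> c1 b1 a1 * \<Phi> c2 b2 a2) = \<epsilon> a * \<epsilon> b * \<epsilon> c"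
   "(SUM (a1, a2)<-sweedler a. SUM (b1, b2)<-sweedler b. SUM (c1, c2)<-sweedler c. \<Phi> c1 b1 a1 * \<Psi> c2 b2 a2) = \<epsilon> a * \<epsilon> b * \<epsilon> c"
   using \<Psi>_inverse unfolding is_convolution_inverse3_def
   by (subst sum_list_pair_reverse, simp)+
 qed
 show ?thesis
 proof (unfold_locales, goal_cases)
  case 1
  show ?case using mult_bilinear by (auto simp: bilinear_map_def)
 next
  case (2 a b)
  show ?case unfolding \<Delta>_mult by (rule sum_list_pair_swap)
 next
  case (3 a b)
  show ?case by (simp add: \<epsilon>_mult)
 next
  case 4 show ?case by (rule \<Delta>_one)
 next
  case 5 show ?case by (rule \<epsilon>_one)
 next
  case 6 show ?case using \<Psi>_trilinear unfolding trilinear_form_def by auto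
 next
  case 7 show ?case using inv by blast
 next
  case (8 a b c)
  show ?case by (subst (1 2) sum_list_pair_reverse) (rule quasi_assoc_inverse[symmetric])
 next
  case (9 a) show ?case by (rule mult_one_right)
 next
  case (10 a) show ?case by (rule mult_one_left)
 next
  case (11 a b c d) show ?case by (rule \<Psi>_cocycle)
 next
  case (12 a b) show ?case by (simp add: \<Psi>_one)
 next
  case 13 show ?case by (rule inv)
 qed
qed


section \<open>Dual comodules and the adjunction on extensions\<close>

text \<open>\<open>U\<close> is a left dual of \<open>V\<close>: \<open>\<kappa>\<close> and \<open>\<mu>\<close> are the coefficients of homomorphisms from the unit to
 \<open>V \<otimes> U\<close> and from \<open>U \<otimes> V\<close> to the unit, and they satisfy the two triangle identities.\<close>
definition dual_pair ::
 "'r set \<Rightarrow> ('r \<Rightarrow> 'r \<Rightarrow> 'h) \<Rightarrow> 't set \<Rightarrow> ('t \<Rightarrow> 't \<Rightarrow> 'h) \<Rightarrow> ('r \<Rightarrow> 't \<Rightarrow> 'k) \<Rightarrow> ('t \<Rightarrow> 'r \<Rightarrow> 'k) \<Rightarrow> bool" where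
 "dual_pair R V T U \<kappa> \<mu> \<longleftrightarrow> comatrix R V \<and> comatrix T U \<and>
  (\<forall>v\<in>R. \<forall>u\<in>T. (SUM v':R. SUM u':T. \<kappa> v' u' *s (V v v' \<cdot> U u u')) = \<kappa> v u *s \<one>) \<and>
  (\<forall>u\<in>T. \<forall>v\<in>R. (SUM u':T. SUM v':R. \<mu> u' v' *s (U u' u \<cdot> V v' v)) = \<mu> u v *s \<one>) \<and>
  (\<forall>v0\<in>R. \<forall>v'\<in>R. (SUM p:R. SUM q:T. SUM s:T. SUM t:R. \<mu> s t * \<Phi> (V v0 p) (U s q) (V t v') * \<kappa> p q) = (if v0 = v' then 1 else 0)) \<and>
  (\<forall>u1\<in>T. \<forall>u0\<in>T. (SUM p:T. SUM q:R. SUM s:R. SUM t:T. \<mu> p q * \<Psi> (U p u1) (V q s) (U u0 t) * \<kappa> s t) = (if u1 = u0 then 1 else 0))"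

text \<open>Quasi-associativity with a third argument that is only known through its coproduct, so
 that it applies to entries of comatrices and of cocycles alike.\<close>
lemma quasi_assoc_expand:
 assumes A: "comatrix R A" "a \<in> R" "a'' \<in> R" and B: "comatrix S B" "b \<in> S" "b'' \<in> S"
  and h: "\<Delta> h = (SUM i:I. x i \<otimes> y i)"
 shows "(SUM a':R. SUM b':S. SUM i:I. \<Phi> (A a' a'') (B b' b'') (y i) *s (A a a' \<cdot> (B b b' \<cdot> x i))) =
  (SUM a':R. SUM b':S. SUM i:I. \<Phi> (A a a') (B b b') (x i) *s ((A a' a'' \<cdot> B b' b'') \<cdot> y i))"
proof -
 have "(SUM (h1, h2)<-sweedler h. \<Phi> (A a' a'') (B b' b'') h2 *s (A a a' \<cdot> (B b b' \<cdot> h1))) =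
  (SUM i:I. \<Phi> (A a' a'') (B b' b'') (y i) *s (A a a' \<cdot> (B b b' \<cdot> x i)))" for a' b'
  by (rule sweedler_eq[OF vs bilinear_mapI h]) (intro vs lin_intros)+
 moreover have "(SUM (h1, h2)<-sweedler h. \<Phi> (A a a') (B b b') h1 *s ((A a' a'' \<cdot> B b' b'') \<cdot> h2)) =
  (SUM i:I. \<Phi> (A a a') (B b b') (x i) *s ((A a' a'' \<cdot> B b' b'') \<cdot> y i))" for a' b'
  by (rule sweedler_eq[OF vs bilinear_mapI h]) (intro vs lin_intros)+
 ultimately show ?thesis using quasi_assoc_comatrix[OF A B, of h] by simp
qed

lemma quasi_assoc_inverse_expand:
 assumes A: "comatrix R A" "a \<in> R" "a'' \<in> R" and B: "comatrix S B" "b \<in> S" "b'' \<in> S"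
  and h: "\<Delta> h = (SUM i:I. x i \<otimes> y i)"
 shows "(SUM a':R. SUM b':S. SUM i:I. \<Psi> (A a a') (B b b') (x i) *s (A a' a'' \<cdot> (B b' b'' \<cdot> y i))) =
  (SUM a':R. SUM b':S. SUM i:I. \<Psi> (A a' a'') (B b' b'') (y i) *s ((A a a' \<cdot> B b b') \<cdot> x i))"
proof -
 note I = lin_sweedler_sum lin_sweedler_arg vs lin_intros
 have e1: "(SUM (h1, h2)<-sweedler h. \<Psi> (A a a') (B b b') h1 *s (A a' a'' \<cdot> (B b' b'' \<cdot> h2))) =
  (SUM i:I. \<Psi> (A a a') (B b b') (x i) *s (A a' a'' \<cdot> (B b' b'' \<cdot> y i)))" for a' b'
  by (rule sweedler_eq[OF vs bilinear_mapI h]) (intro vs lin_intros)+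
 have e2: "(SUM (h1, h2)<-sweedler h. \<Psi> (A a' a'') (B b' b'') h2 *s ((A a a' \<cdot> B b b') \<cdot> h1)) =
  (SUM i:I. \<Psi> (A a' a'') (B b' b'') (y i) *s ((A a a' \<cdot> B b b') \<cdot> x i))" for a' b'
  by (rule sweedler_eq[OF vs bilinear_mapI h]) (intro vs lin_intros)+
 have "(SUM (a1, a2)<-sweedler (A a a''). SUM (b1, b2)<-sweedler (B b b''). SUM (c1, c2)<-sweedler h.
     \<Psi> a1 b1 c1 *s (a2 \<cdot> (b2 \<cdot> c2))) =
  (SUM a':R. SUM b':S. SUM (h1, h2)<-sweedler h. \<Psi> (A a a') (B b b') h1 *s (A a' a'' \<cdot> (B b' b'' \<cdot> h2)))"
  by (rule sweedler_comatrix2[OF A B vs]) (intro I)+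
 moreover have "(SUM (a1, a2)<-sweedler (A a a''). SUM (b1, b2)<-sweedler (B b b''). SUM (c1, c2)<-sweedler h.
     \<Psi> a2 b2 c2 *s ((a1 \<cdot> b1) \<cdot> c1)) =
  (SUM a':R. SUM b':S. SUM (h1, h2)<-sweedler h. \<Psi> (A a' a'') (B b' b'') h2 *s ((A a a' \<cdot> B b b') \<cdot> h1))"
  by (rule sweedler_comatrix2[OF A B vs]) (intro I)+
 ultimately show ?thesis using quasi_assoc_inverse unfolding e1 e2 by simp
qed

lemma conv_mult:
 assumes a: "comatrix R A" "i \<in> R" "j \<in> R" and b: "\<Delta> b = (SUM l:L. x l \<otimes> y l)"
  and f: "lin scale (*) f" and g: "lin scale (*) g"
 shows "conv f g (A i j \<cdot> b) = (SUM p:R. SUM l:L. f (A i p \<cdot> x l) * g (A p j \<cdot> y l))"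
proof -
 have fl: "lin scale (*) (\<lambda>x. f (F x))" "lin scale (*) (\<lambda>x. g (F x))" if "lin scale scale F" for F
  using that f g by (auto intro: lin_comp)
 have b': "bilinear_map scale scale (*) (\<lambda>u v. f u * g v)" by (rule bilinear_form_functionals[OF f g])
 have "conv f g (A i j \<cdot> b) = (SUM (a1, a2)<-sweedler (A i j). SUM (b1, b2)<-sweedler b. f (a1 \<cdot> b1) * g (a2 \<cdot> b2))"
  unfolding conv_def \<Delta>_mult by (simp add: sum_list_apply split_def tensor_apply[OF b'])
 also have "\<dots> = (SUM p:R. SUM (b1, b2)<-sweedler b. f (A i p \<cdot> b1) * g (A p j \<cdot> b2))"
  by (rule sweedler_comatrix[OF a vector_space_mult])
   (intro lin_sweedler_sum vector_space_mult lin_mult_left lin_mult_right fl mult_lin lin_id vs)+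
 also have "\<dots> = (SUM p:R. SUM l:L. f (A i p \<cdot> x l) * g (A p j \<cdot> y l))"
  by (intro sum.cong refl sweedler_eq[OF vector_space_mult bilinear_mapI b])
   (intro lin_mult_left lin_mult_right fl mult_lin lin_id vs)+
 finally show ?thesis .
qed

context
 fixes R :: "'r set" and V and T :: "'t set" and U and \<kappa> and \<mu>
 assumes dual: "dual_pair R V T U \<kappa> \<mu>"
begin

private lemma V: "comatrix R V" and U: "comatrix T U"
 using dual by (auto simp: dual_pair_def)

private lemma finRT: "finite R" "finite T" using V U by (auto simp: comatrix_def)

private lemma coev: "v \<in> R \<Longrightarrow> u \<in> T \<Longrightarrow> (SUM v':R. SUM u':T. \<kappa> v' u' *s (V v v' \<cdot> U u u')) = \<kappa> v u *s \<one>"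
 and ev: "u \<in> T \<Longrightarrow> v \<in> R \<Longrightarrow> (SUM u':T. SUM v':R. \<mu> u' v' *s (U u' u \<cdot> V v' v)) = \<mu> u v *s \<one>"
 and triangle1: "v0 \<in> R \<Longrightarrow> v' \<in> R \<Longrightarrow> (SUM p:R. SUM q:T. SUM s:T. SUM t:R. \<mu> s t * \<Phi> (V v0 p) (U s q) (V t v') * \<kappa> p q) = (if v0 = v' then 1 else 0)"
 and triangle2: "u1 \<in> T \<Longrightarrow> u0 \<in> T \<Longrightarrow> (SUM p:T. SUM q:R. SUM s:R. SUM t:T. \<mu> p q * \<Psi> (U p u1) (V q s) (U u0 t) * \<kappa> s t) = (if u1 = u0 then 1 else 0)"
 using dual unfolding dual_pair_def by blast+

text \<open>The matrix entries of the unit \<open>X \<rightarrow> V \<otimes> (U \<otimes> X)\<close> and of the counit \<open>U \<otimes> (V \<otimes> X) \<rightarrow> X\<close> of the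
 adjunction are obtained by applying these forms to the entries of the comatrix of \<open>X\<close>.\<close>
private definition "unit_form v u h = (SUM v':R. SUM u':T. \<kappa> v' u' * \<Phi> (V v v') (U u u') h)"
private definition "counit_form u v h = (SUM u':T. SUM v':R. \<mu> u' v' * \<Psi> (U u' u) (V v' v) h)"

private lemma lin_counit_form: "lin scale (*) (counit_form u v)"
 unfolding counit_form_def by (intro lin_intros)

text \<open>\<open>X \<rightarrow> V \<otimes> (U \<otimes> X)\<close> is a homomorphism:
 quasi-associativity moves the brackets, and then \<open>\<kappa>\<close> turns \<open>V U\<close>
 into the unit.\<close>
private lemma unit_natural:
 assumes h: "\<Delta> h = (SUM i:I. x i \<otimes> y i)" and v: "v \<in> R" and u: "u \<in> T"
 shows "(SUM v':R. SUM u':T. SUM i:I. unit_form v' u' (y i) *s (V v v' \<cdot> (U u u' \<cdot> x i))) = (SUM i:I. unit_form v u (x i) *s y i)"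
proof -
 have "(SUM v':R. SUM u':T. SUM i:I. unit_form v' u' (y i) *s (V v v' \<cdot> (U u u' \<cdot> x i))) =
  (SUM v':R. SUM u':T. SUM i:I. SUM w:R. SUM z:T. \<kappa> w z *s (\<Phi> (V v' w) (U u' z) (y i) *s (V v v' \<cdot> (U u u' \<cdot> x i))))"
  by (simp add: unit_form_def scale_sum_left)
 also have "\<dots> = (SUM w:R. SUM z:T. \<kappa> w z *s (SUM v':R. SUM u':T. SUM i:I. \<Phi> (V v' w) (U u' z) (y i) *s (V v v' \<cdot> (U u u' \<cdot> x i))))"
  unfolding scale_sum_right sum.cartesian_product
  by (rule sum.reindex_bij_witness[of _ "\<lambda>(a, b, c, d, e). (c, d, e, a, b)" "\<lambda>(c, d, e, a, b). (a, b, c, d, e)"]) auto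
 also have "\<dots> = (SUM w:R. SUM z:T. \<kappa> w z *s (SUM v':R. SUM u':T. SUM i:I. \<Phi> (V v v') (U u u') (x i) *s ((V v' w \<cdot> U u' z) \<cdot> y i)))"
  by (intro sum.cong refl) (simp add: quasi_assoc_expand[OF V v _ U u _ h])
 also have "\<dots> = (SUM v':R. SUM u':T. SUM i:I. \<Phi> (V v v') (U u u') (x i) *s (SUM w:R. SUM z:T. \<kappa> w z *s ((V v' w \<cdot> U u' z) \<cdot> y i)))"
  unfolding scale_sum_right scale_left_commute[of "\<kappa> _ _"] sum.cartesian_product
  by (rule sum.reindex_bij_witness[of _ "\<lambda>(a, b, c, d, e). (d, e, a, b, c)" "\<lambda>(d, e, a, b, c). (a, b, c, d, e)"]) auto
 also have "\<dots> = (SUM v':R. SUM u':T. SUM i:I. \<Phi> (V v v') (U u u') (x i) *s (\<kappa> v' u' *s y i))"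
 proof (intro sum.cong refl arg_cong[where f="scale _"])
  fix v' u' i assume "v' \<in> R" "u' \<in> T"
  have "(SUM w:R. SUM z:T. \<kappa> w z *s ((V v' w \<cdot> U u' z) \<cdot> y i)) = (SUM w:R. SUM z:T. \<kappa> w z *s (V v' w \<cdot> U u' z)) \<cdot> y i"
   by (simp add: lin_sum[OF mult_lin(1)[OF lin_id[OF vs]]] lin_scale[OF mult_lin(1)[OF lin_id[OF vs]]])
  also have "\<dots> = \<kappa> v' u' *s y i"
   by (simp add: coev[OF \<open>v' \<in> R\<close> \<open>u' \<in> T\<close>] lin_scale[OF mult_lin(1)[OF lin_id[OF vs]]] mult_one_left)
  finally show "(SUM w:R. SUM z:T. \<kappa> w z *s ((V v' w \<cdot> U u' z) \<cdot> y i)) = \<kappa> v' u' *s y i" .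
 qed
 also have "\<dots> = (SUM i:I. unit_form v u (x i) *s y i)"
  unfolding unit_form_def scale_sum_left scale_scale mult.commute[of "\<Phi> _ _ _"] sum.cartesian_product
  by (rule sum.reindex_bij_witness[of _ "\<lambda>(a, b, c). (b, c, a)" "\<lambda>(b, c, a). (a, b, c)"]) auto
 finally show ?thesis .
qed

text \<open>Likewise for \<open>U \<otimes> (V \<otimes> X) \<rightarrow> X\<close>, with the inverse
 associator and \<open>\<mu>\<close>.\<close>
private lemma counit_natural:
 assumes h: "\<Delta> h = (SUM i:I. x i \<otimes> y i)" and u: "u \<in> T" and v: "v \<in> R"
 shows "(SUM u1:T. SUM v1:R. SUM i:I. counit_form u1 v1 (x i) *s (U u1 u \<cdot> (V v1 v \<cdot> y i))) = (SUM i:I. counit_form u v (y i) *s x i)"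
proof -
 have "(SUM u1:T. SUM v1:R. SUM i:I. counit_form u1 v1 (x i) *s (U u1 u \<cdot> (V v1 v \<cdot> y i))) =
  (SUM u1:T. SUM v1:R. SUM i:I. SUM w:T. SUM z:R. \<mu> w z *s (\<Psi> (U w u1) (V z v1) (x i) *s (U u1 u \<cdot> (V v1 v \<cdot> y i))))"
  by (simp add: counit_form_def scale_sum_left)
 also have "\<dots> = (SUM w:T. SUM z:R. \<mu> w z *s (SUM u1:T. SUM v1:R. SUM i:I. \<Psi> (U w u1) (V z v1) (x i) *s (U u1 u \<cdot> (V v1 v \<cdot> y i))))"
  unfolding scale_sum_right sum.cartesian_product
  by (rule sum.reindex_bij_witness[of _ "\<lambda>(a, b, c, d, e). (c, d, e, a, b)" "\<lambda>(c, d, e, a, b). (a, b, c, d, e)"]) auto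
 also have "\<dots> = (SUM w:T. SUM z:R. \<mu> w z *s (SUM u1:T. SUM v1:R. SUM i:I. \<Psi> (U u1 u) (V v1 v) (y i) *s ((U w u1 \<cdot> V z v1) \<cdot> x i)))"
  by (intro sum.cong refl) (simp add: quasi_assoc_inverse_expand[OF U _ u V _ v h])
 also have "\<dots> = (SUM u1:T. SUM v1:R. SUM i:I. \<Psi> (U u1 u) (V v1 v) (y i) *s (SUM w:T. SUM z:R. \<mu> w z *s ((U w u1 \<cdot> V z v1) \<cdot> x i)))"
  unfolding scale_sum_right scale_left_commute[of "\<mu> _ _"] sum.cartesian_product
  by (rule sum.reindex_bij_witness[of _ "\<lambda>(a, b, c, d, e). (d, e, a, b, c)" "\<lambda>(d, e, a, b, c). (a, b, c, d, e)"]) auto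
 also have "\<dots> = (SUM u1:T. SUM v1:R. SUM i:I. \<Psi> (U u1 u) (V v1 v) (y i) *s (\<mu> u1 v1 *s x i))"
 proof (intro sum.cong refl arg_cong[where f="scale _"])
  fix u1 v1 i assume "u1 \<in> T" "v1 \<in> R"
  have "(SUM w:T. SUM z:R. \<mu> w z *s ((U w u1 \<cdot> V z v1) \<cdot> x i)) = (SUM w:T. SUM z:R. \<mu> w z *s (U w u1 \<cdot> V z v1)) \<cdot> x i"
   by (simp add: lin_sum[OF mult_lin(1)[OF lin_id[OF vs]]] lin_scale[OF mult_lin(1)[OF lin_id[OF vs]]])
  also have "\<dots> = \<mu> u1 v1 *s x i"
   by (simp add: ev[OF \<open>u1 \<in> T\<close> \<open>v1 \<in> R\<close>] lin_scale[OF mult_lin(1)[OF lin_id[OF vs]]] mult_one_left)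
  finally show "(SUM w:T. SUM z:R. \<mu> w z *s ((U w u1 \<cdot> V z v1) \<cdot> x i)) = \<mu> u1 v1 *s x i" .
 qed
 also have "\<dots> = (SUM i:I. counit_form u v (y i) *s x i)"
  unfolding counit_form_def scale_sum_left scale_scale mult.commute[of "\<Psi> _ _ _"] sum.cartesian_product
  by (rule sum.reindex_bij_witness[of _ "\<lambda>(a, b, c). (b, c, a)" "\<lambda>(b, c, a). (a, b, c)"]) auto
 finally show ?thesis .
qed

text \<open>The triangle identity for \<open>U \<otimes> X\<close>: by the pentagon axiom it follows from the one for \<open>U\<close>, since
 the associators with \<open>V \<otimes> U\<close> or \<open>U \<otimes> V\<close> as one argument become trivial when restricted along
 \<open>\<kappa>\<close> and \<open>\<mu>\<close>.\<close>
private lemma triangle2_tensor: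
 assumes X: "comatrix W X" and u: "u0 \<in> T" "u1 \<in> T" and x: "x0 \<in> W" "x1 \<in> W"
 shows "(SUM v:R. SUM u:T. SUM x:W. counit_form u1 v (U u0 u \<cdot> X x0 x) * unit_form v u (X x x1)) =
  (if u0 = u1 \<and> x0 = x1 then 1 else 0)"
proof -
 let ?Q = "T \<times> R \<times> T \<times> W"
 note finW = comatrixD(1)[OF X]
 let ?L = "\<lambda>_::unit. \<lambda>(a, b, c, d). \<mu> a b * ((if c = u0 then 1 else 0) * (if d = x0 then 1 else 0))"
 let ?K = "\<lambda>(a, b, c, d). \<lambda>_::unit. (if a = u1 then 1 else 0) * ((if d = x1 then 1 else 0) * \<kappa> b c)"
 let ?F2 = "pentagon2 \<Phi> U V U X" and ?F3 = "pentagon3 \<Phi> U V U X" and ?F4 = "pentagon4 \<Phi> U V U X"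
 let ?G1 = "pentagon1 \<Psi> U V U X" and ?G5 = "pentagon5 \<Psi> U V U X"
 have pent: "mprod ?Q ?G1 (mprod ?Q ?F3 ?F4) y z = mprod ?Q ?F2 ?G5 y z" if "y \<in> ?Q" "z \<in> ?Q" for y z
  by (rule pentagon_inverse_matrices(2)[OF U V U X]) (use that in auto)
 have F4K: "mprod ?Q ?F4 ?K y () = ?K y ()" if y: "y \<in> ?Q" for y
 proof -
  obtain a b c d where y: "y = (a, b, c, d)" "a \<in> T" "b \<in> R" "c \<in> T" "d \<in> W" using y by auto
  have lin1: "lin scale (*) (\<lambda>h. \<Phi> (U a u1) h (X d x1))" by (intro lin_intros)
  have "mprod ?Q ?F4 ?K y () = (SUM a':T. (SUM b':R. SUM c':T. (SUM d':W. (\<Phi> (U a a') (V b b' \<cdot> U c c') (X d d') * \<kappa> b' c') * (if d' = x1 then 1 else 0))) * (if a' = u1 then 1 else 0))"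
   unfolding mprod_def sum_Times4 y(1) pentagon4_def prod.case sum_distrib_right by (simp only: ac_simps)
  also have "\<dots> = (SUM b':R. SUM c':T. \<Phi> (U a u1) (V b b' \<cdot> U c c') (X d x1) * \<kappa> b' c')"
   by (simp only: sum_delta_mult[OF finW x(2)] sum_delta_mult[OF finRT(2) u(2)])
  also have "\<dots> = \<Phi> (U a u1) (SUM b':R. SUM c':T. \<kappa> b' c' *s (V b b' \<cdot> U c c')) (X d x1)"
   by (simp add: lin_sum[OF lin1] lin_scale[OF lin1] mult.commute)
  also have "\<dots> = ?K y ()"
   using y u x by (simp add: coev[OF y(3,4)] lin_scale[OF lin1] \<Phi>_one comatrixD(3)[OF U] comatrixD(3)[OF X])
  finally show ?thesis .
 qed
 have LF2: "mprod ?Q ?L ?F2 () y = ?L () y" if y: "y \<in> ?Q" for y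
 proof -
  obtain a b c d where y: "y = (a, b, c, d)" "a \<in> T" "b \<in> R" "c \<in> T" "d \<in> W" using y by auto
  have lin1: "lin scale (*) (\<lambda>h. \<Phi> h (U u0 c) (X x0 d))" by (intro lin_intros)
  have "mprod ?Q ?L ?F2 () y = (SUM a':T. SUM b':R. (SUM c':T. (SUM d':W. \<mu> a' b' * \<Phi> (U a' a \<cdot> V b' b) (U c' c) (X d' d) * (if d' = x0 then 1 else 0)) * (if c' = u0 then 1 else 0)))"
   unfolding mprod_def sum_Times4 y(1) pentagon2_def prod.case sum_distrib_right by (simp only: ac_simps)
  also have "\<dots> = (SUM a':T. SUM b':R. \<mu> a' b' * \<Phi> (U a' a \<cdot> V b' b) (U u0 c) (X x0 d))"
   by (simp only: sum_delta_mult[OF finW x(1)] sum_delta_mult[OF finRT(2) u(1)])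
  also have "\<dots> = \<Phi> (SUM a':T. SUM b':R. \<mu> a' b' *s (U a' a \<cdot> V b' b)) (U u0 c) (X x0 d)"
   by (simp add: lin_sum[OF lin1] lin_scale[OF lin1])
  also have "\<dots> = ?L () y"
   using y u x by (simp add: ev[OF y(2,3)] lin_scale[OF lin1] \<Phi>_one_left comatrixD(3)[OF U] comatrixD(3)[OF X])
  finally show ?thesis .
 qed
 have "mprod ?Q ?L (mprod ?Q ?G1 (mprod ?Q ?F3 ?K)) () () = mprod ?Q ?L (mprod ?Q ?G1 (mprod ?Q ?F3 (mprod ?Q ?F4 ?K))) () ()"
 proof (rule mprod_cong)
  fix y assume "y \<in> ?Q"
  show "mprod ?Q ?G1 (mprod ?Q ?F3 ?K) y () = mprod ?Q ?G1 (mprod ?Q ?F3 (mprod ?Q ?F4 ?K)) y ()"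
   by (intro mprod_cong refl) (rule F4K[symmetric])
 qed simp
 also have "\<dots> = mprod ?Q ?L (mprod ?Q (mprod ?Q ?G1 (mprod ?Q ?F3 ?F4)) ?K) () ()"
  by (simp only: mprod_assoc)
 also have "\<dots> = mprod ?Q ?L (mprod ?Q (mprod ?Q ?F2 ?G5) ?K) () ()"
  by (rule mprod_cong, rule refl, rule mprod_cong, rule pent, assumption+, rule refl)
 also have "\<dots> = mprod ?Q (mprod ?Q ?L ?F2) (mprod ?Q ?G5 ?K) () ()"
  by (simp only: mprod_assoc)
 also have "\<dots> = mprod ?Q ?L (mprod ?Q ?G5 ?K) () ()"
  by (intro mprod_cong refl) (rule LF2)
 also have "\<dots> = (if u0 = u1 \<and> x0 = x1 then 1 else 0)"
 proof -
  have G5K: "mprod ?Q ?G5 ?K (a, b, c, d) () = (SUM b':R. SUM c':T. \<Psi> (U a u1) (V b b') (U c c') * \<kappa> b' c') * (if d = x1 then 1 else 0)" for a b c d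
  proof -
   have "mprod ?Q ?G5 ?K (a, b, c, d) () = (SUM a':T. (SUM b':R. SUM c':T. (SUM d':W. (\<Psi> (U a a') (V b b') (U c c') * \<kappa> b' c' * (if d = d' then 1 else 0)) * (if d' = x1 then 1 else 0))) * (if a' = u1 then 1 else 0))"
    unfolding mprod_def sum_Times4 pentagon5_def prod.case sum_distrib_right by (simp only: ac_simps)
   also have "\<dots> = (SUM b':R. SUM c':T. \<Psi> (U a u1) (V b b') (U c c') * \<kappa> b' c' * (if d = x1 then 1 else 0))"
    by (simp only: sum_delta_mult[OF finW x(2)] sum_delta_mult[OF finRT(2) u(2)])
   finally show ?thesis by (simp only: sum_distrib_right)
  qed
  have "mprod ?Q ?L (mprod ?Q ?G5 ?K) () () = (SUM a:T. SUM b:R. SUM c:T. (SUM d:W. (\<mu> a b * mprod ?Q ?G5 ?K (a, b, c, d) ()) * (if d = x0 then 1 else 0)) * (if c = u0 then 1 else 0))"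
   unfolding mprod_def[of ?Q ?L] sum_Times4 prod.case sum_distrib_right by (simp only: ac_simps)
  also have "\<dots> = (SUM a:T. SUM b:R. \<mu> a b * mprod ?Q ?G5 ?K (a, b, u0, x0) ())"
   by (simp only: sum_delta_mult[OF finW x(1)] sum_delta_mult[OF finRT(2) u(1)])
  also have "\<dots> = (SUM p:T. SUM q:R. SUM s:R. SUM t:T. \<mu> p q * \<Psi> (U p u1) (V q s) (U u0 t) * \<kappa> s t) * (if x0 = x1 then 1 else 0)"
   unfolding G5K sum_distrib_left sum_distrib_right by (simp only: mult.assoc)
  finally show ?thesis unfolding triangle2[OF u(2,1)] by auto
 qed
 finally have "mprod ?Q ?L (mprod ?Q ?G1 (mprod ?Q ?F3 ?K)) () () = (if u0 = u1 \<and> x0 = x1 then 1 else 0)" .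
 moreover have "mprod ?Q ?L (mprod ?Q ?G1 (mprod ?Q ?F3 ?K)) () () =
  (SUM v:R. SUM u:T. SUM x:W. counit_form u1 v (U u0 u \<cdot> X x0 x) * unit_form v u (X x x1))"
 proof -
  have F3K: "mprod ?Q ?F3 ?K (a, b, c, d) () = (if a = u1 then 1 else 0) * unit_form b c (X d x1)" for a b c d
  proof -
   have "mprod ?Q ?F3 ?K (a, b, c, d) () = (SUM a':T. (if a = a' then 1 else 0) * (SUM b':R. SUM c':T. (SUM d':W. (\<Phi> (V b b') (U c c') (X d d') * \<kappa> b' c') * (if d' = x1 then 1 else 0))) * (if a' = u1 then 1 else 0))"
    unfolding mprod_def sum_Times4 pentagon3_def prod.case sum_distrib_right sum_distrib_left by (simp only: ac_simps)
   also have "\<dots> = (if a = u1 then 1 else 0) * (SUM b':R. SUM c':T. \<Phi> (V b b') (U c c') (X d x1) * \<kappa> b' c')"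
    by (simp only: sum_delta_mult[OF finW x(2)] sum_delta_mult[OF finRT(2) u(2)])
   finally show ?thesis by (simp only: unit_form_def mult.commute)
  qed
  have G1F3K: "mprod ?Q ?G1 (mprod ?Q ?F3 ?K) (a, b, c, d) () = (SUM b':R. SUM c':T. SUM d':W. \<Psi> (U a u1) (V b b') (U c c' \<cdot> X d d') * unit_form b' c' (X d' x1))" for a b c d
  proof -
   have "mprod ?Q ?G1 (mprod ?Q ?F3 ?K) (a, b, c, d) () = (SUM a':T. (SUM b':R. SUM c':T. SUM d':W. \<Psi> (U a a') (V b b') (U c c' \<cdot> X d d') * unit_form b' c' (X d' x1)) * (if a' = u1 then 1 else 0))"
    unfolding mprod_def[of ?Q ?G1] sum_Times4 F3K sum_distrib_right
    by (simp only: pentagon1_def form_matrix_apply prod_comatrix_apply ac_simps)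
   then show ?thesis by (simp only: sum_delta_mult[OF finRT(2) u(2)])
  qed
  have "mprod ?Q ?L (mprod ?Q ?G1 (mprod ?Q ?F3 ?K)) () () = (SUM a:T. SUM b:R. SUM c:T. (SUM d:W. (\<mu> a b * mprod ?Q ?G1 (mprod ?Q ?F3 ?K) (a, b, c, d) ()) * (if d = x0 then 1 else 0)) * (if c = u0 then 1 else 0))"
   unfolding mprod_def[of ?Q ?L] sum_Times4 prod.case sum_distrib_right by (simp only: ac_simps)
  also have "\<dots> = (SUM a:T. SUM b:R. \<mu> a b * mprod ?Q ?G1 (mprod ?Q ?F3 ?K) (a, b, u0, x0) ())"
   by (simp only: sum_delta_mult[OF finW x(1)] sum_delta_mult[OF finRT(2) u(1)])
  also have "\<dots> = (SUM a:T. SUM b:R. SUM v:R. SUM u:T. SUM x:W. \<mu> a b * \<Psi> (U a u1) (V b v) (U u0 u \<cdot> X x0 x) * unit_form v u (X x x1))"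
   unfolding G1F3K sum_distrib_left by (simp only: mult.assoc)
  also have "\<dots> = (SUM v:R. SUM u:T. SUM x:W. counit_form u1 v (U u0 u \<cdot> X x0 x) * unit_form v u (X x x1))"
   unfolding counit_form_def sum_distrib_right sum.cartesian_product
   by (rule sum.reindex_bij_witness[of _ "\<lambda>(a, b, c, d, e). (d, e, a, b, c)" "\<lambda>(d, e, a, b, c). (a, b, c, d, e)"]) auto
  finally show ?thesis .
 qed
 ultimately show ?thesis by simp
qed


private lemma unit_natural_form:
 assumes h: "\<Delta> h = (SUM i:I. x i \<otimes> y i)" and v: "v \<in> R" and u: "u \<in> T" and f: "lin scale (*) f"
 shows "(SUM v':R. SUM u':T. SUM i:I. unit_form v' u' (y i) * f (V v v' \<cdot> (U u u' \<cdot> x i))) = (SUM i:I. unit_form v u (x i) * f (y i))"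
 using arg_cong[OF unit_natural[OF h v u], of f] by (simp add: lin_sum[OF f] lin_scale[OF f])

private lemma counit_natural_form:
 assumes h: "\<Delta> h = (SUM i:I. x i \<otimes> y i)" and u: "u \<in> T" and v: "v \<in> R" and f: "lin scale (*) f"
 shows "(SUM u1:T. SUM v1:R. SUM i:I. counit_form u1 v1 (x i) * f (U u1 u \<cdot> (V v1 v \<cdot> y i))) = (SUM i:I. counit_form u v (y i) * f (x i))"
 using arg_cong[OF counit_natural[OF h u v], of f] by (simp add: lin_sum[OF f] lin_scale[OF f])

private lemma ev_form:
 assumes "lin scale (*) f" "u \<in> T" "v \<in> R"
 shows "(SUM u':T. SUM v':R. \<mu> u' v' * f (U u' u \<cdot> V v' v)) = \<mu> u v * f \<one>"
 using arg_cong[OF ev[OF assms(2,3)], of f] by (simp add: lin_sum[OF assms(1)] lin_scale[OF assms(1)])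

private lemma lin_mult_form: "lin scale (*) f \<Longrightarrow> lin scale (*) (\<lambda>h. f (a \<cdot> h))"
 by (rule lin_comp[OF mult_lin(2)[OF lin_id[OF vs]]])

context
 fixes W :: "'w set" and X
 assumes X: "comatrix W X"
begin

private lemma finW: "finite W" using X by (simp add: comatrix_def)

private lemma unit_natural_X:
 assumes "v \<in> R" "u \<in> T" "x0 \<in> W" "x1 \<in> W" "lin scale (*) f"
 shows "(SUM v':R. SUM u':T. SUM x:W. unit_form v' u' (X x x1) * f (V v v' \<cdot> (U u u' \<cdot> X x0 x))) = (SUM x:W. unit_form v u (X x0 x) * f (X x x1))"
 by (rule unit_natural_form[OF comatrixD(2)[OF X assms(3,4)] assms(1,2,5)])

text \<open>\<open>F\<close> tensors a homomorphism with \<open>V\<close> and composes it with the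
 unit \<open>X \<rightarrow> V \<otimes> (U \<otimes> X)\<close>. It is injective since tensoring
 with \<open>U\<close> and composing with the counit recovers the homomorphism, by the triangle
 identity for \<open>U \<otimes> X\<close>.\<close>
lemma hom_adjunction:
 assumes "finite S"
 obtains F :: "('s \<Rightarrow> 't \<times> 'w \<Rightarrow> 'k) \<Rightarrow> 'r \<times> 's \<Rightarrow> 'w \<Rightarrow> 'k" where
  "\<And>g B. comatrix_hom (T \<times> W) (prod_comatrix U X) S B g \<Longrightarrow> comatrix_hom W X (R \<times> S) (prod_comatrix V B) (F g)"
  "\<And>g B. comatrix_hom (T \<times> W) (prod_comatrix U X) S B g \<Longrightarrow> (\<And>y x. y \<in> R \<times> S \<Longrightarrow> x \<in> W \<Longrightarrow> F g y x = 0) \<Longrightarrow>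
   (\<forall>y\<in>S. \<forall>z\<in>T \<times> W. g y z = 0)"
  "\<And>(J :: nat set) c g. F (\<lambda>y z. SUM j:J. c j * g j y z) = (\<lambda>y x. SUM j:J. c j * F (g j) y x)"
proof -
 define F :: "('s \<Rightarrow> 't \<times> 'w \<Rightarrow> 'k) \<Rightarrow> 'r \<times> 's \<Rightarrow> 'w \<Rightarrow> 'k" where
  "F g = (\<lambda>(v, y) x. SUM u:T. SUM x':W. g y (u, x') * unit_form v u (X x' x))" for g
 show ?thesis
 proof (rule that[of F])
  fix g B assume g: "comatrix_hom (T \<times> W) (prod_comatrix U X) S B g"
  have g': "(SUM u:T. SUM x':W. g y (u, x') * f (U u u' \<cdot> X x' x'')) = (SUM y':S. f (B y y') * g y' (u', x''))"
   if "lin scale (*) f" "y \<in> S" "u' \<in> T" "x'' \<in> W" for f y u' x''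
   using comatrix_hom_functional[OF g that(1,2), of "(u', x'')"] that by (simp add: sum_Times)
  show "comatrix_hom W X (R \<times> S) (prod_comatrix V B) (F g)"
  proof (rule comatrix_homI)
   fix f z x assume f: "lin scale (*) f" and z: "z \<in> R \<times> S" and x: "x \<in> W"
   obtain v y where vy: "z = (v, y)" "v \<in> R" "y \<in> S" using z by auto
   have "(SUM x'':W. F g z x'' * f (X x'' x)) = (SUM u:T. SUM x':W. g y (u, x') * (SUM x'':W. unit_form v u (X x' x'') * f (X x'' x)))"
    unfolding F_def vy(1) prod.case sum_distrib_left sum_distrib_right mult.assoc sum.cartesian_product
    by (rule sum.reindex_bij_witness[of _ "\<lambda>(a, b, c). (c, a, b)" "\<lambda>(c, a, b). (a, b, c)"]) auto
   also have "\<dots> = (SUM u:T. SUM x':W. g y (u, x') * (SUM v':R. SUM u':T. SUM x'':W. unit_form v' u' (X x'' x) * f (V v v' \<cdot> (U u u' \<cdot> X x' x''))))"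
    by (intro sum.cong refl) (simp add: unit_natural_X[OF vy(2) _ _ x f])
   also have "\<dots> = (SUM v':R. SUM u':T. SUM x'':W. unit_form v' u' (X x'' x) * (SUM u:T. SUM x':W. g y (u, x') * f (V v v' \<cdot> (U u u' \<cdot> X x' x''))))"
    unfolding sum_distrib_left sum.cartesian_product
    by (rule sum.reindex_bij_witness[of _ "\<lambda>(a, b, c, d, e). (d, e, a, b, c)" "\<lambda>(d, e, a, b, c). (a, b, c, d, e)"])
     (auto simp: ac_simps)
   also have "\<dots> = (SUM v':R. SUM u':T. SUM x'':W. unit_form v' u' (X x'' x) * (SUM y':S. f (V v v' \<cdot> B y y') * g y' (u', x'')))"
    by (intro sum.cong refl) (simp add: g'[OF lin_mult_form[OF f] vy(3)])
   also have "\<dots> = (SUM z':R \<times> S. f (prod_comatrix V B z z') * F g z' x)"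
    unfolding F_def vy(1) sum_Times prod_comatrix_apply prod.case sum_distrib_left
    unfolding sum.cartesian_product
    by (rule sum.reindex_bij_witness[of _ "\<lambda>(a, b, c, d). (a, c, d, b)" "\<lambda>(a, c, d, b). (a, b, c, d)"])
     (auto simp: ac_simps)
   finally show "(SUM x'':W. F g z x'' * f (X x'' x)) = (SUM z':R \<times> S. f (prod_comatrix V B z z') * F g z' x)" .
  qed
  assume 0: "\<And>y x. y \<in> R \<times> S \<Longrightarrow> x \<in> W \<Longrightarrow> F g y x = 0"
  show "\<forall>y\<in>S. \<forall>z\<in>T \<times> W. g y z = 0"
  proof (intro ballI)
   fix y z assume y: "y \<in> S" and "z \<in> T \<times> W"
   then obtain u1 x where z: "z = (u1, x)" "u1 \<in> T" "x \<in> W" by auto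
   have "0 = (SUM v:R. SUM y':S. counit_form u1 v (B y y') * F g (v, y') x)"
    using z by (simp add: 0)
   also have "\<dots> = (SUM v:R. SUM u:T. SUM x':W. unit_form v u (X x' x) * (SUM y':S. counit_form u1 v (B y y') * g y' (u, x')))"
    unfolding F_def prod.case sum_distrib_left sum.cartesian_product
    by (rule sum.reindex_bij_witness[of _ "\<lambda>(a, b, c, d). (a, d, b, c)" "\<lambda>(a, d, b, c). (a, b, c, d)"])
     (auto simp: ac_simps)
   also have "\<dots> = (SUM v:R. SUM u:T. SUM x':W. unit_form v u (X x' x) * (SUM a:T. SUM b:W. g y (a, b) * counit_form u1 v (U a u \<cdot> X b x')))"
    by (intro sum.cong refl) (simp add: g'[OF lin_counit_form y])
   also have "\<dots> = (SUM a:T. SUM b:W. g y (a, b) * (SUM v:R. SUM u:T. SUM x':W. counit_form u1 v (U a u \<cdot> X b x') * unit_form v u (X x' x)))"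
    unfolding sum_distrib_left sum.cartesian_product
    by (rule sum.reindex_bij_witness[of _ "\<lambda>(a, b, c, d, e). (c, d, e, a, b)" "\<lambda>(c, d, e, a, b). (a, b, c, d, e)"])
     (auto simp: ac_simps)
   also have "\<dots> = (SUM a:T. SUM b:W. g y (a, b) * (if a = u1 \<and> b = x then 1 else 0))"
    by (intro sum.cong refl) (simp add: triangle2_tensor[OF X _ z(2) _ z(3)])
   also have "\<dots> = (SUM a:T. (SUM b:W. g y (a, b) * (if b = x then 1 else 0)) * (if a = u1 then 1 else 0))"
    unfolding sum_distrib_right by (intro sum.cong refl) auto
   also have "\<dots> = g y (u1, x)"
    by (simp only: sum_delta_mult[OF finW z(3)] sum_delta_mult[OF finRT(2) z(2)])
   finally show "g y z = 0" unfolding z(1) by simp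
  qed
 next
  fix J :: "nat set" and c and g :: "nat \<Rightarrow> 's \<Rightarrow> 't \<times> 'w \<Rightarrow> 'k"
  have "(SUM u:T. SUM x':W. (SUM j:J. c j * g j y (u, x')) * unit_form v u (X x' x)) =
   (SUM j:J. c j * (SUM u:T. SUM x':W. g j y (u, x') * unit_form v u (X x' x)))" for v y x
   unfolding sum_distrib_left sum_distrib_right mult.assoc sum.cartesian_product
   by (rule sum.reindex_bij_witness[of _ "\<lambda>(a, b, c). (b, c, a)" "\<lambda>(b, c, a). (a, b, c)"]) auto
  then show "F (\<lambda>y z. SUM j:J. c j * g j y z) = (\<lambda>y x. SUM j:J. c j * F (g j) y x)"
   by (auto simp: F_def fun_eq_iff)
 qed
qed

text \<open>Tensoring an extension of \<open>X\<close> by \<open>V\<close> with \<open>U\<close> and pushing it out along \<open>U \<otimes> V \<rightarrow> 1\<close> gives an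
 extension of \<open>U \<otimes> X\<close> by the unit; in the other direction, an extension of \<open>U \<otimes> X\<close> by the unit is
 tensored with \<open>V\<close> and pulled back along \<open>X \<rightarrow> V \<otimes> (U \<otimes> X)\<close>.\<close>
definition push :: "('r \<Rightarrow> 'w \<Rightarrow> 'h) \<Rightarrow> unit \<Rightarrow> 't \<times> 'w \<Rightarrow> 'h" where
 "push Y = (\<lambda>_ (u, x). SUM u':T. SUM v:R. \<mu> u' v *s (U u' u \<cdot> Y v x))"

definition pull :: "(unit \<Rightarrow> 't \<times> 'w \<Rightarrow> 'h) \<Rightarrow> 'r \<Rightarrow> 'w \<Rightarrow> 'h" where
 "pull Y = (\<lambda>v x. SUM v':R. SUM u:T. SUM x':W. unit_form v' u (X x' x) *s (V v v' \<cdot> Y () (u, x')))"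

private lemma push_form:
 "lin scale (*) f \<Longrightarrow> f (push Y () (u, x)) = (SUM u':T. SUM v:R. \<mu> u' v * f (U u' u \<cdot> Y v x))"
 by (simp add: push_def lin_sum lin_scale[of _ _ f])

private lemma pull_form:
 "lin scale (*) f \<Longrightarrow> f (pull Y v x) = (SUM v':R. SUM u:T. SUM x':W. unit_form v' u (X x' x) * f (V v v' \<cdot> Y () (u, x')))"
 by (simp add: pull_def lin_sum lin_scale[of _ _ f])

abbreviation "UX \<equiv> prod_comatrix U X"
abbreviation "one_matrix \<equiv> \<lambda>(_::unit) (_::unit). \<one>"

private lemma cocycle_X:
 assumes "Y \<in> ext_cocycles R V W X" "v \<in> R" "x \<in> W"
 shows "\<Delta> (Y v x) = (SUM i:R <+> W. case_sum (V v) (Y v) i \<otimes> case_sum (\<lambda>k. Y k x) (\<lambda>l. X l x) i)"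
 using ext_cocycleD[OF assms] finRT finW by (simp add: sum.Plus)

private lemma cocycle_UX:
 assumes "Y \<in> ext_cocycles {()} one_matrix (T \<times> W) UX" "u \<in> T" "x \<in> W"
 shows "\<Delta> (Y () (u, x)) = (SUM i:{()} <+> (T \<times> W). case_sum (\<lambda>_. \<one>) (Y ()) i \<otimes> case_sum (\<lambda>_. Y () (u, x)) (\<lambda>l. UX l (u, x)) i)"
 using ext_cocycleD[OF assms(1), of "()" "(u, x)"] assms(2,3) finRT finW by (simp add: sum.Plus)

text \<open>In the coproduct of \<open>U Y\<close>, the term that comes from \<open>V\<close>
 contains \<open>U V\<close>, which \<open>\<mu>\<close> turns into the unit.\<close>
lemma push_cocycle:
 assumes Y: "Y \<in> ext_cocycles R V W X"
 shows "push Y \<in> ext_cocycles {()} one_matrix (T \<times> W) UX"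
proof (rule ext_cocycleI)
 fix p :: unit and q f g assume q: "q \<in> T \<times> W" and f: "lin scale (*) f" and g: "lin scale (*) g"
 obtain u x where ux: "q = (u, x)" "u \<in> T" "x \<in> W" using q by auto
 have c: "conv f g (U u' u \<cdot> Y v x) = (SUM a:T. SUM k:R. f (U u' a \<cdot> V v k) * g (U a u \<cdot> Y k x)) + (SUM a:T. SUM l:W. f (U u' a \<cdot> Y v l) * g (U a u \<cdot> X l x))"
  if "u' \<in> T" "v \<in> R" for u' v
  using conv_mult[OF U that(1) ux(2) cocycle_X[OF Y that(2) ux(3)] f g] finRT finW
  by (simp add: sum.Plus sum.distrib)
 have "conv f g (push Y p q) = (SUM u':T. SUM v:R. \<mu> u' v * conv f g (U u' u \<cdot> Y v x))"
  unfolding ux(1) by (simp add: push_form[OF lin_conv])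
 also have "\<dots> = (SUM u':T. SUM v:R. SUM a:T. SUM k:R. \<mu> u' v * (f (U u' a \<cdot> V v k) * g (U a u \<cdot> Y k x))) +
   (SUM u':T. SUM v:R. SUM a:T. SUM l:W. \<mu> u' v * (f (U u' a \<cdot> Y v l) * g (U a u \<cdot> X l x)))"
  by (simp add: c distrib_left sum.distrib sum_distrib_left)
 also have "(SUM u':T. SUM v:R. SUM a:T. SUM k:R. \<mu> u' v * (f (U u' a \<cdot> V v k) * g (U a u \<cdot> Y k x))) =
   (SUM a:T. SUM k:R. (SUM u':T. SUM v:R. \<mu> u' v * f (U u' a \<cdot> V v k)) * g (U a u \<cdot> Y k x))"
  unfolding sum_distrib_right mult.assoc sum.cartesian_product
  by (rule sum.reindex_bij_witness[of _ "\<lambda>(a, b, c, d). (c, d, a, b)" "\<lambda>(c, d, a, b). (a, b, c, d)"]) auto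
 also have "\<dots> = (SUM a:T. SUM k:R. \<mu> a k * f \<one> * g (U a u \<cdot> Y k x))"
  by (intro sum.cong refl) (simp add: ev_form[OF f])
 also have "\<dots> = (SUM k:{()}. f \<one> * g (push Y k q))"
  unfolding ux(1) by (simp add: push_form[OF g] sum_distrib_left ac_simps)
 also have "(SUM u':T. SUM v:R. SUM a:T. SUM l:W. \<mu> u' v * (f (U u' a \<cdot> Y v l) * g (U a u \<cdot> X l x))) =
   (SUM a:T. SUM l:W. (SUM u':T. SUM v:R. \<mu> u' v * f (U u' a \<cdot> Y v l)) * g (U a u \<cdot> X l x))"
  unfolding sum_distrib_right mult.assoc sum.cartesian_product
  by (rule sum.reindex_bij_witness[of _ "\<lambda>(a, b, c, d). (c, d, a, b)" "\<lambda>(c, d, a, b). (a, b, c, d)"]) auto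
 also have "\<dots> = (SUM l:T \<times> W. f (push Y p l) * g (UX l q))"
  unfolding ux(1) by (simp add: push_form[OF f] sum_Times)
 finally show "conv f g (push Y p q) = (SUM k:{()}. f \<one> * g (push Y k q)) + (SUM l:T \<times> W. f (push Y p l) * g (UX l q))" .
qed

lemma pull_cocycle:
 assumes Y: "Y \<in> ext_cocycles {()} one_matrix (T \<times> W) UX"
 shows "pull Y \<in> ext_cocycles R V W X"
proof (rule ext_cocycleI)
 fix v x f g assume v: "v \<in> R" and x: "x \<in> W" and f: "lin scale (*) f" and g: "lin scale (*) g"
 have c: "conv f g (V v v' \<cdot> Y () (u, x')) = (SUM p:R. f (V v p) * g (V p v' \<cdot> Y () (u, x'))) +
   (SUM p:R. SUM a:T. SUM b:W. f (V v p \<cdot> Y () (a, b)) * g (V p v' \<cdot> (U a u \<cdot> X b x')))"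
  if "v' \<in> R" "u \<in> T" "x' \<in> W" for v' u x'
  using conv_mult[OF V v that(1) cocycle_UX[OF Y that(2,3)] f g] finRT finW
  by (simp add: sum.Plus sum.distrib mult_one_right sum_Times)
 have "conv f g (pull Y v x) = (SUM v':R. SUM u:T. SUM x':W. unit_form v' u (X x' x) * conv f g (V v v' \<cdot> Y () (u, x')))"
  by (rule pull_form[OF lin_conv])
 also have "\<dots> = (SUM v':R. SUM u:T. SUM x':W. SUM p:R. unit_form v' u (X x' x) * (f (V v p) * g (V p v' \<cdot> Y () (u, x')))) +
  (SUM v':R. SUM u:T. SUM x':W. SUM p:R. SUM a:T. SUM b:W. unit_form v' u (X x' x) * (f (V v p \<cdot> Y () (a, b)) * g (V p v' \<cdot> (U a u \<cdot> X b x'))))"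
  by (simp add: c distrib_left sum.distrib sum_distrib_left)
 also have "(SUM v':R. SUM u:T. SUM x':W. SUM p:R. unit_form v' u (X x' x) * (f (V v p) * g (V p v' \<cdot> Y () (u, x')))) =
  (SUM p:R. f (V v p) * g (pull Y p x))"
  unfolding pull_form[OF g] sum_distrib_left sum.cartesian_product
  by (rule sum.reindex_bij_witness[of _ "\<lambda>(a, b, c, d). (b, c, d, a)" "\<lambda>(b, c, d, a). (a, b, c, d)"])
   (auto simp: ac_simps)
 also have "(SUM v':R. SUM u:T. SUM x':W. SUM p:R. SUM a:T. SUM b:W. unit_form v' u (X x' x) * (f (V v p \<cdot> Y () (a, b)) * g (V p v' \<cdot> (U a u \<cdot> X b x')))) =
  (SUM p:R. SUM a:T. SUM b:W. f (V v p \<cdot> Y () (a, b)) * (SUM v':R. SUM u:T. SUM x':W. unit_form v' u (X x' x) * g (V p v' \<cdot> (U a u \<cdot> X b x'))))"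
  unfolding sum_distrib_left sum.cartesian_product
  by (rule sum.reindex_bij_witness[of _ "\<lambda>(a, b, c, d, e, f). (d, e, f, a, b, c)" "\<lambda>(d, e, f, a, b, c). (a, b, c, d, e, f)"])
   (auto simp: ac_simps)
 also have "\<dots> = (SUM p:R. SUM a:T. SUM b:W. f (V v p \<cdot> Y () (a, b)) * (SUM x':W. unit_form p a (X b x') * g (X x' x)))"
  by (intro sum.cong refl) (simp add: unit_natural_X[OF _ _ _ x g])
 also have "\<dots> = (SUM x':W. f (pull Y v x') * g (X x' x))"
  unfolding pull_form[OF f] sum_distrib_left sum_distrib_right sum.cartesian_product
  by (rule sum.reindex_bij_witness[of _ "\<lambda>(a, b, c, d). (b, c, d, a)" "\<lambda>(b, c, d, a). (a, b, c, d)"]) (auto simp: ac_simps)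
 finally show "conv f g (pull Y v x) = (SUM p:R. f (V v p) * g (pull Y p x)) + (SUM x':W. f (pull Y v x') * g (X x' x))" .
qed


lemma lin_push: "lin (mscale scale) (mscale scale) push"
proof (intro linI vs_matrices ext)
 show "push (Y + Z) p q = (push Y + push Z) p q" for Y Z p q
  by (cases q) (simp add: push_def lin_add[OF mult_lin(2)[OF lin_id[OF vs]]] scale_right_distrib sum.distrib)
 show "push (mscale scale c Y) p q = mscale scale c (push Y) p q" for c Y p q
  by (cases q) (simp add: push_def pointwise_scale_def lin_scale[OF mult_lin(2)[OF lin_id[OF vs]]] scale_sum_right mult.commute)
qed

lemma lin_pull: "lin (mscale scale) (mscale scale) pull"
proof (intro linI vs_matrices ext)
 show "pull (Y + Z) p q = (pull Y + pull Z) p q" for Y Z p q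
  by (simp add: pull_def lin_add[OF mult_lin(2)[OF lin_id[OF vs]]] scale_right_distrib sum.distrib)
 show "pull (mscale scale c Y) p q = mscale scale c (pull Y) p q" for c Y p q
  by (simp add: pull_def pointwise_scale_def lin_scale[OF mult_lin(2)[OF lin_id[OF vs]]] scale_sum_right mult.commute)
qed

private lemma coboundaryI:
 assumes "\<And>p q f. p \<in> R' \<Longrightarrow> q \<in> T' \<Longrightarrow> lin scale (*) f \<Longrightarrow>
  f (Y p q) = (SUM k:R'. M k q * f (C p k)) - (SUM l:T'. M p l * f (D l q))"
 shows "Y \<in> ext_coboundaries R' C T' D"
 unfolding ext_coboundaries_def
proof (rule CollectI, rule exI[of _ M], intro ballI functionals_separate[OF vs])
 fix p q f assume "p \<in> R'" "q \<in> T'" and f: "lin scale (*) f"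
 then show "f (Y p q) = f ((SUM k:R'. M k q *s C p k) - (SUM l:T'. M p l *s D l q))"
  using assms[of p q f] by (simp add: lin_diff[OF f] lin_sum[OF f] lin_scale[OF f])
qed

lemma push_coboundary:
 assumes "Y \<in> ext_coboundaries R V W X"
 shows "push Y \<in> ext_coboundaries {()} one_matrix (T \<times> W) UX"
proof -
 obtain M where M: "\<And>v x. v \<in> R \<Longrightarrow> x \<in> W \<Longrightarrow> Y v x = (SUM k:R. M k x *s V v k) - (SUM l:W. M v l *s X l x)"
  using assms unfolding ext_coboundaries_def by blast
 let ?N = "\<lambda>_::unit. \<lambda>(u, x). SUM k:R. \<mu> u k * M k x"
 show ?thesis
 proof (rule coboundaryI[where M="?N"])
  fix p :: unit and q f assume q: "q \<in> T \<times> W" and f: "lin scale (*) f"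
  obtain u x where ux: "q = (u, x)" "u \<in> T" "x \<in> W" using q by auto
  have "f (push Y p q) = (SUM u':T. SUM v:R. \<mu> u' v * f (U u' u \<cdot> Y v x))"
   unfolding ux(1) by (simp add: push_form[OF f])
  also have "\<dots> = (SUM u':T. SUM v:R. \<mu> u' v * ((SUM k:R. M k x * f (U u' u \<cdot> V v k)) - (SUM l:W. M v l * f (U u' u \<cdot> X l x))))"
   by (intro sum.cong refl) (simp add: M ux lin_diff[OF lin_mult_form[OF f]] lin_sum[OF lin_mult_form[OF f]] lin_scale[OF lin_mult_form[OF f]])
  also have "\<dots> = (SUM u':T. SUM v:R. SUM k:R. \<mu> u' v * (M k x * f (U u' u \<cdot> V v k))) - (SUM u':T. SUM v:R. SUM l:W. \<mu> u' v * (M v l * f (U u' u \<cdot> X l x)))"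
   by (simp add: right_diff_distrib sum_subtractf sum_distrib_left)
  also have "(SUM u':T. SUM v:R. SUM k:R. \<mu> u' v * (M k x * f (U u' u \<cdot> V v k))) = (SUM k:R. M k x * (SUM u':T. SUM v:R. \<mu> u' v * f (U u' u \<cdot> V v k)))"
   unfolding sum_distrib_left sum.cartesian_product
   by (rule sum.reindex_bij_witness[of _ "\<lambda>(a, b, c). (b, c, a)" "\<lambda>(b, c, a). (a, b, c)"]) (auto simp: ac_simps)
  also have "\<dots> = (SUM k:R. M k x * (\<mu> u k * f \<one>))"
   by (intro sum.cong refl) (simp add: ev_form[OF f ux(2)])
  also have "\<dots> = (SUM k:{()}. ?N k q * f \<one>)" by (simp add: ux(1) sum_distrib_right sum_distrib_left ac_simps)
  also have "(SUM u':T. SUM v:R. SUM l:W. \<mu> u' v * (M v l * f (U u' u \<cdot> X l x))) = (SUM u':T. SUM l:W. SUM v:R. \<mu> u' v * M v l * f (U u' u \<cdot> X l x))"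
   by (rule sum.cong[OF refl], subst sum.swap) (simp add: mult.assoc)
  also have "\<dots> = (SUM l:T \<times> W. ?N p l * f (UX l q))"
   by (simp add: ux(1) sum_Times sum_distrib_right)
  finally show "f (push Y p q) = (SUM k:{()}. ?N k q * f \<one>) - (SUM l:T \<times> W. ?N p l * f (UX l q))" .
 qed
qed

lemma pull_coboundary:
 assumes "Y \<in> ext_coboundaries {()} one_matrix (T \<times> W) UX"
 shows "pull Y \<in> ext_coboundaries R V W X"
proof -
 obtain M where M: "\<And>q. q \<in> T \<times> W \<Longrightarrow> Y () q = (SUM k:{()}. M k q *s \<one>) - (SUM l:T \<times> W. M () l *s UX l q)"
  using assms unfolding ext_coboundaries_def by blast
 define N where "N v x = (SUM a:T. SUM b:W. M () (a, b) * unit_form v a (X b x))" for v x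
 show ?thesis
 proof (rule coboundaryI[where M=N])
  fix v x f assume v: "v \<in> R" and x: "x \<in> W" and f: "lin scale (*) f"
  have "f (pull Y v x) = (SUM v':R. SUM u:T. SUM x':W. unit_form v' u (X x' x) * f (V v v' \<cdot> Y () (u, x')))"
   by (rule pull_form[OF f])
  also have "\<dots> = (SUM v':R. SUM u:T. SUM x':W. unit_form v' u (X x' x) * (M () (u, x') * f (V v v') - (SUM a:T. SUM b:W. M () (a, b) * f (V v v' \<cdot> (U a u \<cdot> X b x')))))"
   by (intro sum.cong refl) (simp add: M lin_diff[OF lin_mult_form[OF f]] lin_sum[OF lin_mult_form[OF f]] lin_scale[OF lin_mult_form[OF f]] mult_one_right sum_Times)
  also have "\<dots> = (SUM v':R. SUM u:T. SUM x':W. unit_form v' u (X x' x) * (M () (u, x') * f (V v v'))) -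
    (SUM v':R. SUM u:T. SUM x':W. SUM a:T. SUM b:W. unit_form v' u (X x' x) * (M () (a, b) * f (V v v' \<cdot> (U a u \<cdot> X b x'))))"
   by (simp add: right_diff_distrib sum_subtractf sum_distrib_left)
  also have "(SUM v':R. SUM u:T. SUM x':W. unit_form v' u (X x' x) * (M () (u, x') * f (V v v'))) = (SUM k:R. N k x * f (V v k))"
   unfolding N_def sum_distrib_right by (simp only: ac_simps)
  also have "(SUM v':R. SUM u:T. SUM x':W. SUM a:T. SUM b:W. unit_form v' u (X x' x) * (M () (a, b) * f (V v v' \<cdot> (U a u \<cdot> X b x')))) =
    (SUM a:T. SUM b:W. M () (a, b) * (SUM v':R. SUM u:T. SUM x':W. unit_form v' u (X x' x) * f (V v v' \<cdot> (U a u \<cdot> X b x'))))"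
   unfolding sum_distrib_left sum.cartesian_product
   by (rule sum.reindex_bij_witness[of _ "\<lambda>(a, b, c, d, e). (c, d, e, a, b)" "\<lambda>(c, d, e, a, b). (a, b, c, d, e)"]) (auto simp: ac_simps)
  also have "\<dots> = (SUM a:T. SUM b:W. M () (a, b) * (SUM x':W. unit_form v a (X b x') * f (X x' x)))"
   by (intro sum.cong refl) (simp add: unit_natural_X[OF v _ _ x f])
  also have "\<dots> = (SUM l:W. N v l * f (X l x))"
   unfolding N_def sum_distrib_left sum_distrib_right sum.cartesian_product
   by (rule sum.reindex_bij_witness[of _ "\<lambda>(a, b, c). (b, c, a)" "\<lambda>(b, c, a). (a, b, c)"]) (auto simp: ac_simps)
  finally show "f (pull Y v x) = (SUM k:R. N k x * f (V v k)) - (SUM l:W. N v l * f (X l x))" .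
 qed
qed

text \<open>Naturality of the unit for the entries of \<open>Y\<close>, summed against
 \<open>\<mu>\<close>: one of the four terms is \<open>Y\<close> by the triangle identity for
 \<open>V\<close>, one is \<open>pull (push Y)\<close>, and the remaining two form a
 coboundary.\<close>
lemma pull_push:
 assumes Y: "Y \<in> ext_cocycles R V W X"
 shows "pull (push Y) - Y \<in> ext_coboundaries R V W X"
proof -
 define A where "A v x = (SUM u:T. SUM k:R. \<mu> u k * unit_form v u (Y k x))" for v x
 show ?thesis
 proof (rule coboundaryI[where M="\<lambda>v x. - A v x"])
  fix v x f assume v: "v \<in> R" and x: "x \<in> W" and f: "lin scale (*) f"
  have nat: "(SUM v':R. SUM u:T. (SUM k:R. unit_form v' u (Y k x) * f (V v v' \<cdot> (U u' u \<cdot> V w k))) +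
     (SUM x':W. unit_form v' u (X x' x) * f (V v v' \<cdot> (U u' u \<cdot> Y w x')))) =
    (SUM k:R. unit_form v u' (V w k) * f (Y k x)) + (SUM x':W. unit_form v u' (Y w x') * f (X x' x))"
   if "u' \<in> T" "w \<in> R" for u' w
   using unit_natural_form[OF cocycle_X[OF Y that(2) x] v that(1) f] finRT finW by (simp add: sum.Plus)
  have "(SUM u':T. SUM w:R. \<mu> u' w * (SUM v':R. SUM u:T. (SUM k:R. unit_form v' u (Y k x) * f (V v v' \<cdot> (U u' u \<cdot> V w k))) +
     (SUM x':W. unit_form v' u (X x' x) * f (V v v' \<cdot> (U u' u \<cdot> Y w x'))))) =
    (SUM u':T. SUM w:R. \<mu> u' w * ((SUM k:R. unit_form v u' (V w k) * f (Y k x)) + (SUM x':W. unit_form v u' (Y w x') * f (X x' x))))"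
   by (intro sum.cong refl) (simp only: nat)
  then have eq: "(SUM u':T. SUM w:R. SUM v':R. SUM u:T. SUM k:R. \<mu> u' w * (unit_form v' u (Y k x) * f (V v v' \<cdot> (U u' u \<cdot> V w k)))) +
    (SUM u':T. SUM w:R. SUM v':R. SUM u:T. SUM x':W. \<mu> u' w * (unit_form v' u (X x' x) * f (V v v' \<cdot> (U u' u \<cdot> Y w x')))) =
    (SUM u':T. SUM w:R. SUM k:R. \<mu> u' w * (unit_form v u' (V w k) * f (Y k x))) +
    (SUM u':T. SUM w:R. SUM x':W. \<mu> u' w * (unit_form v u' (Y w x') * f (X x' x)))"
   by (simp only: distrib_left sum.distrib sum_distrib_left)
  have 1: "(SUM u':T. SUM w:R. SUM v':R. SUM u:T. SUM k:R. \<mu> u' w * (unit_form v' u (Y k x) * f (V v v' \<cdot> (U u' u \<cdot> V w k)))) = (SUM k:R. A k x * f (V v k))"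
  proof -
   have "(SUM u':T. SUM w:R. SUM v':R. SUM u:T. SUM k:R. \<mu> u' w * (unit_form v' u (Y k x) * f (V v v' \<cdot> (U u' u \<cdot> V w k)))) =
    (SUM v':R. SUM u:T. SUM k:R. unit_form v' u (Y k x) * (SUM u':T. SUM w:R. \<mu> u' w * f (V v v' \<cdot> (U u' u \<cdot> V w k))))"
    unfolding sum_distrib_left sum.cartesian_product
    by (rule sum.reindex_bij_witness[of _ "\<lambda>(a, b, c, d, e). (d, e, a, b, c)" "\<lambda>(d, e, a, b, c). (a, b, c, d, e)"]) (auto simp: ac_simps)
   also have "\<dots> = (SUM v':R. SUM u:T. SUM k:R. unit_form v' u (Y k x) * (\<mu> u k * f (V v v')))"
    by (intro sum.cong refl) (simp add: ev_form[OF lin_mult_form[OF f]] mult_one_right)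
   also have "\<dots> = (SUM k:R. A k x * f (V v k))"
    unfolding A_def sum_distrib_right by (simp only: ac_simps)
   finally show ?thesis .
  qed
  have 2: "(SUM u':T. SUM w:R. SUM v':R. SUM u:T. SUM x':W. \<mu> u' w * (unit_form v' u (X x' x) * f (V v v' \<cdot> (U u' u \<cdot> Y w x')))) = f (pull (push Y) v x)"
   unfolding pull_form[OF f] push_form[OF lin_mult_form[OF f]] sum_distrib_left sum.cartesian_product
   by (rule sum.reindex_bij_witness[of _ "\<lambda>(a, b, c, d, e). (d, e, a, b, c)" "\<lambda>(d, e, a, b, c). (a, b, c, d, e)"]) (auto simp: ac_simps)
  have 3: "(SUM u':T. SUM w:R. SUM k:R. \<mu> u' w * (unit_form v u' (V w k) * f (Y k x))) = f (Y v x)"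
  proof -
   have "(SUM u':T. SUM w:R. SUM k:R. \<mu> u' w * (unit_form v u' (V w k) * f (Y k x))) =
    (SUM k:R. (SUM p:R. SUM q:T. SUM s:T. SUM t:R. \<mu> s t * \<Phi> (V v p) (U s q) (V t k) * \<kappa> p q) * f (Y k x))"
    unfolding unit_form_def sum_distrib_left sum_distrib_right sum.cartesian_product
    by (rule sum.reindex_bij_witness[of _ "\<lambda>(a, b, c, d, e). (d, e, a, b, c)" "\<lambda>(d, e, a, b, c). (a, b, c, d, e)"]) (auto simp: ac_simps)
   also have "\<dots> = (SUM k:R. (if v = k then 1 else 0) * f (Y k x))"
    by (intro sum.cong refl) (simp add: triangle1[OF v])
   also have "\<dots> = f (Y v x)" by (rule sum_delta_mult(2)[OF finRT(1) v])
   finally show ?thesis .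
  qed
  have 4: "(SUM u':T. SUM w:R. SUM x':W. \<mu> u' w * (unit_form v u' (Y w x') * f (X x' x))) = (SUM l:W. A v l * f (X l x))"
   unfolding A_def sum_distrib_right sum.cartesian_product
   by (rule sum.reindex_bij_witness[of _ "\<lambda>(a, b, c). (b, c, a)" "\<lambda>(b, c, a). (a, b, c)"]) (auto simp: ac_simps)
  show "f ((pull (push Y) - Y) v x) = (SUM k:R. - A k x * f (V v k)) - (SUM l:W. - A v l * f (X l x))"
   using eq unfolding 1 2 3 4 by (simp add: lin_diff[OF f] sum_negf algebra_simps)
 qed
qed

text \<open>Naturality of the counit for the entries of \<open>Y\<close>, with the triangle identity
 for \<open>U \<otimes> X\<close> in place of that for \<open>V\<close>.\<close>
lemma push_pull:
 assumes Y: "Y \<in> ext_cocycles {()} one_matrix (T \<times> W) UX"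
 shows "push (pull Y) - Y \<in> ext_coboundaries {()} one_matrix (T \<times> W) UX"
proof -
 define A where "A u x = (SUM v:R. SUM a:T. SUM b:W. counit_form u v (Y () (a, b)) * unit_form v a (X b x))" for u x
 let ?M = "\<lambda>_::unit. \<lambda>(u, x). A u x"
 have counit_one: "counit_form u v \<one> = \<mu> u v" if "u \<in> T" "v \<in> R" for u v
 proof -
  have "counit_form u v \<one> = (SUM u':T. (SUM v':R. \<mu> u' v' * (if v' = v then 1 else 0)) * (if u' = u then 1 else 0))"
   unfolding counit_form_def sum_distrib_right
   by (intro sum.cong refl) (simp add: \<Psi>_one_right comatrixD(3)[OF U _ that(1)] comatrixD(3)[OF V _ that(2)])
  then show ?thesis by (simp only: sum_delta_mult[OF finRT(1) that(2)] sum_delta_mult[OF finRT(2) that(1)])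
 qed
 show ?thesis
 proof (rule coboundaryI[where M="?M"])
  fix p :: unit and q f assume q: "q \<in> T \<times> W" and f: "lin scale (*) f"
  obtain u x where ux: "q = (u, x)" "u \<in> T" "x \<in> W" using q by auto
  have nat: "(SUM u1:T. SUM v1:R. \<mu> u1 v1 * f (U u1 u \<cdot> (V v1 v \<cdot> Y () (a, b))) +
    (SUM c:T. SUM d:W. counit_form u1 v1 (Y () (c, d)) * f (U u1 u \<cdot> (V v1 v \<cdot> (U c a \<cdot> X d b))))) =
   counit_form u v (Y () (a, b)) * f \<one> + (SUM c:T. SUM d:W. counit_form u v (U c a \<cdot> X d b) * f (Y () (c, d)))"
   if "a \<in> T" "b \<in> W" "v \<in> R" for a b v
   using counit_natural_form[OF cocycle_UX[OF Y that(1,2)] ux(2) that(3) f] finRT finW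
   by (simp add: sum.Plus sum_Times counit_one cong: sum.cong)
  have "(SUM v:R. SUM a:T. SUM b:W. unit_form v a (X b x) * (SUM u1:T. SUM v1:R. \<mu> u1 v1 * f (U u1 u \<cdot> (V v1 v \<cdot> Y () (a, b))) +
    (SUM c:T. SUM d:W. counit_form u1 v1 (Y () (c, d)) * f (U u1 u \<cdot> (V v1 v \<cdot> (U c a \<cdot> X d b)))))) =
   (SUM v:R. SUM a:T. SUM b:W. unit_form v a (X b x) * (counit_form u v (Y () (a, b)) * f \<one> + (SUM c:T. SUM d:W. counit_form u v (U c a \<cdot> X d b) * f (Y () (c, d)))))"
   by (intro sum.cong refl) (simp only: nat)
  then have eq: "(SUM v:R. SUM a:T. SUM b:W. SUM u1:T. SUM v1:R. unit_form v a (X b x) * (\<mu> u1 v1 * f (U u1 u \<cdot> (V v1 v \<cdot> Y () (a, b))))) +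
   (SUM v:R. SUM a:T. SUM b:W. SUM u1:T. SUM v1:R. SUM c:T. SUM d:W. unit_form v a (X b x) * (counit_form u1 v1 (Y () (c, d)) * f (U u1 u \<cdot> (V v1 v \<cdot> (U c a \<cdot> X d b))))) =
   (SUM v:R. SUM a:T. SUM b:W. unit_form v a (X b x) * (counit_form u v (Y () (a, b)) * f \<one>)) +
   (SUM v:R. SUM a:T. SUM b:W. SUM c:T. SUM d:W. unit_form v a (X b x) * (counit_form u v (U c a \<cdot> X d b) * f (Y () (c, d))))"
   by (simp only: distrib_left sum.distrib sum_distrib_left)
  have 1: "(SUM v:R. SUM a:T. SUM b:W. SUM u1:T. SUM v1:R. unit_form v a (X b x) * (\<mu> u1 v1 * f (U u1 u \<cdot> (V v1 v \<cdot> Y () (a, b))))) = f (push (pull Y) p q)"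
  proof -
   have "f (push (pull Y) () (u, x)) = (SUM u1:T. SUM v1:R. \<mu> u1 v1 * (SUM v:R. SUM a:T. SUM b:W. unit_form v a (X b x) * f (U u1 u \<cdot> (V v1 v \<cdot> Y () (a, b)))))"
    unfolding push_form[OF f] by (intro sum.cong refl) (simp add: pull_form[OF lin_mult_form[OF f]])
   also have "\<dots> = (SUM v:R. SUM a:T. SUM b:W. SUM u1:T. SUM v1:R. unit_form v a (X b x) * (\<mu> u1 v1 * f (U u1 u \<cdot> (V v1 v \<cdot> Y () (a, b)))))"
    unfolding sum_distrib_left sum.cartesian_product
    by (rule sum.reindex_bij_witness[of _ "\<lambda>(a, b, c, d, e). (d, e, a, b, c)" "\<lambda>(d, e, a, b, c). (a, b, c, d, e)"]) (auto simp: ac_simps)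
   finally show ?thesis unfolding ux(1) by simp
  qed
  have 2: "(SUM v:R. SUM a:T. SUM b:W. SUM u1:T. SUM v1:R. SUM c:T. SUM d:W. unit_form v a (X b x) * (counit_form u1 v1 (Y () (c, d)) * f (U u1 u \<cdot> (V v1 v \<cdot> (U c a \<cdot> X d b))))) =
   (SUM l:T \<times> W. ?M p l * f (UX l q))"
  proof -
   have "(SUM v:R. SUM a:T. SUM b:W. SUM u1:T. SUM v1:R. SUM c:T. SUM d:W. unit_form v a (X b x) * (counit_form u1 v1 (Y () (c, d)) * f (U u1 u \<cdot> (V v1 v \<cdot> (U c a \<cdot> X d b))))) =
    (SUM u1:T. SUM v1:R. SUM c:T. SUM d:W. counit_form u1 v1 (Y () (c, d)) * (SUM v:R. SUM a:T. SUM b:W. unit_form v a (X b x) * f (U u1 u \<cdot> (V v1 v \<cdot> (U c a \<cdot> X d b)))))"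
    unfolding sum_distrib_left sum.cartesian_product
    by (rule sum.reindex_bij_witness[of _ "\<lambda>(a, b, c, d, e, f, g). (e, f, g, a, b, c, d)" "\<lambda>(e, f, g, a, b, c, d). (a, b, c, d, e, f, g)"]) (auto simp: ac_simps)
   also have "\<dots> = (SUM u1:T. SUM v1:R. SUM c:T. SUM d:W. counit_form u1 v1 (Y () (c, d)) * (SUM b:W. unit_form v1 c (X d b) * f (U u1 u \<cdot> X b x)))"
    by (intro sum.cong refl) (simp add: unit_natural_X[OF _ _ _ ux(3) lin_mult_form[OF f]])
   also have "\<dots> = (SUM u1:T. SUM b:W. A u1 b * f (U u1 u \<cdot> X b x))"
    unfolding A_def sum_distrib_left sum_distrib_right sum.cartesian_product
    by (rule sum.reindex_bij_witness[of _ "\<lambda>(a, b, c, d, e). (a, c, d, e, b)" "\<lambda>(a, c, d, e, b). (a, b, c, d, e)"]) (auto simp: ac_simps)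
   finally show ?thesis by (simp add: ux(1) sum_Times)
  qed
  have 3: "(SUM v:R. SUM a:T. SUM b:W. unit_form v a (X b x) * (counit_form u v (Y () (a, b)) * f \<one>)) = (SUM k:{()}. ?M k q * f \<one>)"
   by (simp add: ux(1) A_def sum_distrib_right sum_distrib_left ac_simps)
  have 4: "(SUM v:R. SUM a:T. SUM b:W. SUM c:T. SUM d:W. unit_form v a (X b x) * (counit_form u v (U c a \<cdot> X d b) * f (Y () (c, d)))) = f (Y p q)"
  proof -
   have "(SUM v:R. SUM a:T. SUM b:W. SUM c:T. SUM d:W. unit_form v a (X b x) * (counit_form u v (U c a \<cdot> X d b) * f (Y () (c, d)))) =
    (SUM c:T. SUM d:W. (SUM v:R. SUM a:T. SUM b:W. counit_form u v (U c a \<cdot> X d b) * unit_form v a (X b x)) * f (Y () (c, d)))"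
    unfolding sum_distrib_right sum.cartesian_product
    by (rule sum.reindex_bij_witness[of _ "\<lambda>(a, b, c, d, e). (c, d, e, a, b)" "\<lambda>(c, d, e, a, b). (a, b, c, d, e)"]) (auto simp: ac_simps)
   also have "\<dots> = (SUM c:T. SUM d:W. (if c = u \<and> d = x then 1 else 0) * f (Y () (c, d)))"
    by (intro sum.cong refl) (simp add: triangle2_tensor[OF X _ ux(2) _ ux(3)])
   also have "\<dots> = (SUM c:T. (if c = u then 1 else 0) * (SUM d:W. (if d = x then 1 else 0) * f (Y () (c, d))))"
    unfolding sum_distrib_left by (intro sum.cong refl) auto
   also have "\<dots> = f (Y () (u, x))"
    by (simp only: sum_delta_mult[OF finRT(2) ux(2)] sum_delta_mult[OF finW ux(3)])
   finally show ?thesis unfolding ux(1) by simp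
  qed
  show "f ((push (pull Y) - Y) p q) = (SUM k:{()}. ?M k q * f \<one>) - (SUM l:T \<times> W. ?M p l * f (UX l q))"
   using eq unfolding 1 2 3 4 by (simp add: lin_diff[OF f] algebra_simps)
 qed
qed

end

end

end

section \<open>Duals of simple comodules\<close>

context coquasi_bialgebra_inverse
begin

lemma dual_pairD:
 assumes "dual_pair R V T U \<kappa> \<mu>"
 shows "comatrix R V" "comatrix T U"
  "\<And>v u. v \<in> R \<Longrightarrow> u \<in> T \<Longrightarrow> (SUM v':R. SUM u':T. \<kappa> v' u' *s (V v v' \<cdot> U u u')) = \<kappa> v u *s \<one>"
  "\<And>v u. u \<in> T \<Longrightarrow> v \<in> R \<Longrightarrow> (SUM u':T. SUM v':R. \<mu> u' v' *s (U u' u \<cdot> V v' v)) = \<mu> u v *s \<one>"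
  "\<And>v0 v'. v0 \<in> R \<Longrightarrow> v' \<in> R \<Longrightarrow> (SUM p:R. SUM q:T. SUM s:T. SUM t:R. \<mu> s t * \<Phi> (V v0 p) (U s q) (V t v') * \<kappa> p q) = (if v0 = v' then 1 else 0)"
  "\<And>u1 u0. u1 \<in> T \<Longrightarrow> u0 \<in> T \<Longrightarrow> (SUM p:T. SUM q:R. SUM s:R. SUM t:T. \<mu> p q * \<Psi> (U p u1) (V q s) (U u0 t) * \<kappa> s t) = (if u1 = u0 then 1 else 0)"
 using assms unfolding dual_pair_def by blast+

text \<open>Composing the coevaluation with a homomorphism \<open>\<Lambda>\<close> on
 \<open>U\<close>.\<close>
lemma coev_hom:
 assumes dual: "dual_pair R V T U \<kappa> \<mu>" and \<Lambda>: "comatrix_hom T U T' U' \<Lambda>" and v: "v \<in> R" and u: "u \<in> T'"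
 shows "(SUM v':R. SUM u':T'. (SUM z:T. \<Lambda> u' z * \<kappa> v' z) *s (V v v' \<cdot> U' u u')) = (SUM z:T. \<Lambda> u z * \<kappa> v z) *s \<one>"
proof (rule functionals_separate[OF vs])
 fix f assume f: "lin scale (*) f"
 have fm: "lin scale (*) (\<lambda>h. f (a \<cdot> h))" for a by (rule lin_comp[OF mult_lin(2)[OF lin_id[OF vs]] f])
 have "f (SUM v':R. SUM u':T'. (SUM z:T. \<Lambda> u' z * \<kappa> v' z) *s (V v v' \<cdot> U' u u')) =
  (SUM v':R. SUM z:T. \<kappa> v' z * (SUM u':T'. f (V v v' \<cdot> U' u u') * \<Lambda> u' z))"
  unfolding lin_sum[OF f] lin_scale[OF f] unfolding sum_distrib_left sum_distrib_right sum.cartesian_product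
  by (rule sum.reindex_bij_witness[of _ "\<lambda>(a, b, c). (a, c, b)" "\<lambda>(a, c, b). (a, b, c)"]) (auto simp: ac_simps)
 also have "\<dots> = (SUM v':R. SUM z:T. \<kappa> v' z * (SUM z':T. \<Lambda> u z' * f (V v v' \<cdot> U z' z)))"
  by (intro sum.cong refl) (simp add: comatrix_hom_functional[OF \<Lambda> fm u])
 also have "\<dots> = (SUM z':T. \<Lambda> u z' * f (SUM v':R. SUM z:T. \<kappa> v' z *s (V v v' \<cdot> U z' z)))"
  unfolding lin_sum[OF f] lin_scale[OF f] unfolding sum_distrib_left sum_distrib_right sum.cartesian_product
  by (rule sum.reindex_bij_witness[of _ "\<lambda>(a, b, c). (b, c, a)" "\<lambda>(b, c, a). (a, b, c)"]) (auto simp: ac_simps)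
 also have "\<dots> = f ((SUM z:T. \<Lambda> u z * \<kappa> v z) *s \<one>)"
  by (simp add: dual_pairD(3)[OF dual v] lin_scale[OF f] sum_distrib_right mult.assoc cong: sum.cong)
 finally show "f (SUM v':R. SUM u':T'. (SUM z:T. \<Lambda> u' z * \<kappa> v' z) *s (V v v' \<cdot> U' u u')) = f ((SUM z:T. \<Lambda> u z * \<kappa> v z) *s \<one>)" .
qed

text \<open>Transport of the coefficients along an isomorphism \<open>\<Lambda>\<close> with inverse
 \<open>M\<close>.\<close>
lemma dual_pair_iso:
 assumes dual: "dual_pair R V T U \<kappa> \<mu>" and U': "comatrix T' U'" and \<Lambda>: "comatrix_hom T U T' U' \<Lambda>"
  and \<Lambda>M: "\<And>t t'. t \<in> T' \<Longrightarrow> t' \<in> T' \<Longrightarrow> (SUM r:T. \<Lambda> t r * M r t') = (if t = t' then 1 else 0)"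
  and M\<Lambda>: "\<And>r r'. r \<in> T \<Longrightarrow> r' \<in> T \<Longrightarrow> (SUM t:T'. M r t * \<Lambda> t r') = (if r = r' then 1 else 0)"
 obtains \<kappa>' \<mu>' where "dual_pair R V T' U' \<kappa>' \<mu>'"
proof -
 note D = dual_pairD[OF dual]
 note fin = comatrixD(1)[OF D(1)] comatrixD(1)[OF D(2)] comatrixD(1)[OF U']
 have M: "comatrix_hom T' U' T U M" by (rule inverse_hom[OF fin(2,3) \<Lambda> \<Lambda>M M\<Lambda>])
 define \<kappa>' where "\<kappa>' v u' = (SUM z:T. \<Lambda> u' z * \<kappa> v z)" for v u'
 define \<mu>' where "\<mu>' u' v = (SUM z:T. \<mu> z v * M z u')" for u' v
 have \<Lambda>f: "(SUM t:T'. f (U' u t) * \<Lambda> t z) = (SUM z':T. \<Lambda> u z' * f (U z' z))" if "lin scale (*) f" "u \<in> T'" "z \<in> T" for f u z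
  by (rule comatrix_hom_functional[OF \<Lambda> that, symmetric])
 have Mf: "(SUM t:T'. M z t * f (U' t u)) = (SUM z':T. f (U z z') * M z' u)" if "lin scale (*) f" "u \<in> T'" "z \<in> T" for f u z
  by (rule comatrix_hom_functional[OF M that(1,3,2)])
 have "dual_pair R V T' U' \<kappa>' \<mu>'"
  unfolding dual_pair_def
 proof (intro conjI ballI D(1) U')
  fix v u assume v: "v \<in> R" and u: "u \<in> T'"
  show "(SUM v':R. SUM u':T'. \<kappa>' v' u' *s (V v v' \<cdot> U' u u')) = \<kappa>' v u *s \<one>"
   unfolding \<kappa>'_def by (rule coev_hom[OF dual \<Lambda> v u])
  show "(SUM u':T'. SUM v':R. \<mu>' u' v' *s (U' u' u \<cdot> V v' v)) = \<mu>' u v *s \<one>"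
  proof (rule functionals_separate[OF vs])
   fix f assume f: "lin scale (*) f"
   have fm: "lin scale (*) (\<lambda>h. f (h \<cdot> a))" for a by (rule lin_comp[OF mult_lin(1)[OF lin_id[OF vs]] f])
   have "f (SUM u':T'. SUM v':R. \<mu>' u' v' *s (U' u' u \<cdot> V v' v)) =
    (SUM v':R. SUM z:T. \<mu> z v' * (SUM u':T'. M z u' * f (U' u' u \<cdot> V v' v)))"
    unfolding \<mu>'_def lin_sum[OF f] lin_scale[OF f] unfolding sum_distrib_left sum_distrib_right sum.cartesian_product
    by (rule sum.reindex_bij_witness[of _ "\<lambda>(a, b, c). (c, a, b)" "\<lambda>(c, a, b). (a, b, c)"]) (auto simp: ac_simps)
   also have "\<dots> = (SUM v':R. SUM z:T. \<mu> z v' * (SUM z':T. f (U z z' \<cdot> V v' v) * M z' u))"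
    by (intro sum.cong refl) (simp add: Mf[OF fm u])
   also have "\<dots> = (SUM z':T. f (SUM z:T. SUM v':R. \<mu> z v' *s (U z z' \<cdot> V v' v)) * M z' u)"
    unfolding lin_sum[OF f] lin_scale[OF f] unfolding sum_distrib_left sum_distrib_right sum.cartesian_product
    by (rule sum.reindex_bij_witness[of _ "\<lambda>(a, b, c). (c, b, a)" "\<lambda>(c, b, a). (a, b, c)"]) (auto simp: ac_simps)
   also have "\<dots> = f (\<mu>' u v *s \<one>)"
    by (simp add: D(4)[OF _ v] lin_scale[OF f] \<mu>'_def sum_distrib_left sum_distrib_right ac_simps cong: sum.cong)
   finally show "f (SUM u':T'. SUM v':R. \<mu>' u' v' *s (U' u' u \<cdot> V v' v)) = f (\<mu>' u v *s \<one>)" .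
  qed
 next
  fix v0 v' assume v: "v0 \<in> R" "v' \<in> R"
  have fm: "lin scale (*) (\<lambda>h. \<Phi> (V v0 p) h (V t v'))" for p t by (intro lin_intros)
  have "(SUM p:R. SUM q:T'. SUM s:T'. SUM t:R. \<mu>' s t * \<Phi> (V v0 p) (U' s q) (V t v') * \<kappa>' p q) =
   (SUM p:R. SUM t:R. SUM a:T. SUM b:T. \<mu> a t * \<kappa> p b * (SUM s:T'. M a s * (SUM q:T'. \<Phi> (V v0 p) (U' s q) (V t v') * \<Lambda> q b)))"
   unfolding \<mu>'_def \<kappa>'_def sum_distrib_left sum_distrib_right sum.cartesian_product
   by (rule sum.reindex_bij_witness[of _ "\<lambda>(a, b, c, d, e, f). (a, f, e, b, d, c)" "\<lambda>(a, f, e, b, d, c). (a, b, c, d, e, f)"]) (auto simp: ac_simps)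
  also have "\<dots> = (SUM p:R. SUM t:R. SUM a:T. SUM b:T. \<mu> a t * \<kappa> p b * (SUM s:T'. M a s * (SUM z:T. \<Lambda> s z * \<Phi> (V v0 p) (U z b) (V t v'))))"
   by (intro sum.cong refl) (simp add: \<Lambda>f[OF fm] cong: sum.cong)
  also have "\<dots> = (SUM p:R. SUM t:R. SUM a:T. SUM b:T. \<mu> a t * \<kappa> p b * (SUM z:T. (SUM s:T'. M a s * \<Lambda> s z) * \<Phi> (V v0 p) (U z b) (V t v')))"
   by (intro sum.cong refl arg_cong[where f="(*) _"]) (simp add: sum_distrib_left sum_distrib_right mult.assoc, rule sum.swap)
  also have "\<dots> = (SUM p:R. SUM t:R. SUM a:T. SUM b:T. \<mu> a t * \<kappa> p b * \<Phi> (V v0 p) (U a b) (V t v'))"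
   by (intro sum.cong refl arg_cong[where f="(*) _"]) (simp add: M\<Lambda> sum_delta_mult[OF fin(2)] cong: sum.cong)
  also have "\<dots> = (SUM p:R. SUM q:T. SUM s:T. SUM t:R. \<mu> s t * \<Phi> (V v0 p) (U s q) (V t v') * \<kappa> p q)"
   unfolding sum.cartesian_product
   by (rule sum.reindex_bij_witness[of _ "\<lambda>(p, q, s, t). (p, t, s, q)" "\<lambda>(p, t, a, b). (p, b, a, t)"]) (auto simp: ac_simps)
  also have "\<dots> = (if v0 = v' then 1 else 0)" by (rule D(5)[OF v])
  finally show "(SUM p:R. SUM q:T'. SUM s:T'. SUM t:R. \<mu>' s t * \<Phi> (V v0 p) (U' s q) (V t v') * \<kappa>' p q) = (if v0 = v' then 1 else 0)" .
 next
  fix u1 u0 assume u: "u1 \<in> T'" "u0 \<in> T'"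
  have fm1: "lin scale (*) (\<lambda>h. \<Psi> h (V q s) y)" and fm2: "lin scale (*) (\<lambda>h. \<Psi> y (V q s) h)" for q s y by (intro lin_intros)+
  have "(SUM p:T'. SUM q:R. SUM s:R. SUM t:T'. \<mu>' p q * \<Psi> (U' p u1) (V q s) (U' u0 t) * \<kappa>' s t) =
   (SUM q:R. SUM s:R. SUM a:T. SUM b:T. \<mu> a q * \<kappa> s b * (SUM t:T'. (SUM p:T'. M a p * \<Psi> (U' p u1) (V q s) (U' u0 t)) * \<Lambda> t b))"
   unfolding \<mu>'_def \<kappa>'_def sum_distrib_left sum_distrib_right sum.cartesian_product
   by (rule sum.reindex_bij_witness[of _ "\<lambda>(a, b, c, d, e, f). (f, a, b, e, d, c)" "\<lambda>(f, a, b, e, d, c). (a, b, c, d, e, f)"]) (auto simp: ac_simps)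
  also have "\<dots> = (SUM q:R. SUM s:R. SUM a:T. SUM b:T. \<mu> a q * \<kappa> s b * (SUM t:T'. (SUM z:T. \<Psi> (U a z) (V q s) (U' u0 t) * M z u1) * \<Lambda> t b))"
   by (intro sum.cong refl) (simp add: Mf[OF fm1 u(1)] cong: sum.cong)
  also have "\<dots> = (SUM q:R. SUM s:R. SUM a:T. SUM b:T. \<mu> a q * \<kappa> s b * (SUM z:T. M z u1 * (SUM t:T'. \<Psi> (U a z) (V q s) (U' u0 t) * \<Lambda> t b)))"
   by (intro sum.cong refl arg_cong[where f="(*) _"]) (simp add: sum_distrib_left sum_distrib_right ac_simps, rule sum.swap)
  also have "\<dots> = (SUM q:R. SUM s:R. SUM a:T. SUM b:T. \<mu> a q * \<kappa> s b * (SUM z:T. M z u1 * (SUM w:T. \<Lambda> u0 w * \<Psi> (U a z) (V q s) (U w b))))"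
   by (intro sum.cong refl) (simp add: \<Lambda>f[OF fm2 u(2)] cong: sum.cong)
  also have "\<dots> = (SUM z:T. M z u1 * (SUM w:T. \<Lambda> u0 w * (SUM p:T. SUM q:R. SUM s:R. SUM t:T. \<mu> p q * \<Psi> (U p z) (V q s) (U w t) * \<kappa> s t)))"
   unfolding sum_distrib_left sum_distrib_right sum.cartesian_product
   by (rule sum.reindex_bij_witness[of _ "\<lambda>(a, b, c, d, e, f). (d, e, c, f, a, b)" "\<lambda>(d, e, c, f, a, b). (a, b, c, d, e, f)"]) (auto simp: ac_simps)
  also have "\<dots> = (SUM z:T. M z u1 * (SUM w:T. \<Lambda> u0 w * (if z = w then 1 else 0)))"
   by (intro sum.cong refl) (simp add: D(6) cong: sum.cong)
  also have "\<dots> = (SUM z:T. \<Lambda> u0 z * M z u1)"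
   by (intro sum.cong refl) (simp add: sum_delta_mult[OF fin(2)] mult.commute)
  also have "\<dots> = (if u1 = u0 then 1 else 0)" using \<Lambda>M[OF u(2,1)] by auto
  finally show "(SUM p:T'. SUM q:R. SUM s:R. SUM t:T'. \<mu>' p q * \<Psi> (U' p u1) (V q s) (U' u0 t) * \<kappa>' s t) = (if u1 = u0 then 1 else 0)" .
 qed
 then show ?thesis by (rule that)
qed

text \<open>Reversing the order of all factors exchanges the two triangle identities.\<close>
lemma dual_pair_opposite:
 assumes "dual_pair R V T U \<kappa> \<mu>"
 shows "coquasi_bialgebra_inverse.dual_pair scale \<Delta> \<epsilon> (\<lambda>a b. b \<cdot> a) \<one> (\<lambda>a b c. \<Psi> c b a) (\<lambda>a b c. \<Phi> c b a)
  T U R V (\<lambda>u v. \<kappa> v u) (\<lambda>v u. \<mu> u v)"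
proof -
 interpret op: coquasi_bialgebra_inverse scale \<Delta> \<epsilon> "\<lambda>a b. b \<cdot> a" \<one> "\<lambda>a b c. \<Psi> c b a" "\<lambda>a b c. \<Phi> c b a"
  by (rule opposite)
 note D = dual_pairD[OF assms]
 show ?thesis unfolding op.dual_pair_def
 proof (intro conjI ballI D(1,2))
  fix u v assume "u \<in> T" "v \<in> R"
  then show "(SUM v':T. SUM u':R. \<kappa> u' v' *s (V v u' \<cdot> U u v')) = \<kappa> v u *s \<one>"
   using D(3)[of v u] by (simp add: sum.swap[of _ T R])
 next
  fix v u assume "v \<in> R" "u \<in> T"
  then show "(SUM u':R. SUM v':T. \<mu> v' u' *s (U v' u \<cdot> V u' v)) = \<mu> u v *s \<one>"
   using D(4)[of u v] by (simp add: sum.swap[of _ R T])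
 next
  fix v0 v' assume v: "v0 \<in> T" "v' \<in> T"
  have "(SUM p:T. SUM q:R. SUM s:R. SUM t:T. \<mu> t s * \<Psi> (U t v') (V s q) (U v0 p) * \<kappa> q p) =
   (SUM p:T. SUM q:R. SUM s:R. SUM t:T. \<mu> p q * \<Psi> (U p v') (V q s) (U v0 t) * \<kappa> s t)"
   unfolding sum.cartesian_product
   by (rule sum.reindex_bij_witness[of _ "\<lambda>(p, q, s, t). (t, s, q, p)" "\<lambda>(p, q, s, t). (t, s, q, p)"]) auto
  then show "(SUM p:T. SUM q:R. SUM s:R. SUM t:T. \<mu> t s * \<Psi> (U t v') (V s q) (U v0 p) * \<kappa> q p) = (if v0 = v' then 1 else 0)"
   using D(6)[OF v(2,1)] by auto
 next
  fix u1 u0 assume u: "u1 \<in> R" "u0 \<in> R"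
  have "(SUM p:R. SUM q:T. SUM s:T. SUM t:R. \<mu> q p * \<Phi> (V u0 t) (U q s) (V p u1) * \<kappa> t s) =
   (SUM p:R. SUM q:T. SUM s:T. SUM t:R. \<mu> s t * \<Phi> (V u0 p) (U s q) (V t u1) * \<kappa> p q)"
   unfolding sum.cartesian_product
   by (rule sum.reindex_bij_witness[of _ "\<lambda>(p, q, s, t). (t, s, q, p)" "\<lambda>(p, q, s, t). (t, s, q, p)"]) auto
  then show "(SUM p:R. SUM q:T. SUM s:T. SUM t:R. \<mu> q p * \<Phi> (V u0 t) (U q s) (V p u1) * \<kappa> t s) = (if u1 = u0 then 1 else 0)"
   using D(5)[OF u(2,1)] by auto
 qed
qed

text \<open>The form \<open>convolution_inverse3 \<Phi>\<close> in the axioms of a coquasi-Hopf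
 algebra is therefore \<open>\<Psi>\<close>.\<close>
lemma convolution_inverse_unique:
 assumes "is_convolution_inverse3 \<Phi> \<Psi>'"
 shows "\<Psi>' = \<Psi>"
proof (intro ext)
 fix a b c
 interpret i: coquasi_bialgebra_inverse scale \<Delta> \<epsilon> mult one \<Phi> \<Psi>'
  by unfold_locales (rule assms)
 have main: "\<Psi>' (A a a'') (B b b'') (C c c'') = \<Psi> (A a a'') (B b b'') (C c c'')"
  if A: "comatrix R A" "a \<in> R" "a'' \<in> R" and B: "comatrix S B" "b \<in> S" "b'' \<in> S"
   and C: "comatrix T C" "c \<in> T" "c'' \<in> T"
  for R S T :: "'h set" and A B C a a'' b b'' c c''
 proof -
  let ?Q = "R \<times> S \<times> T"
  let ?F = "form_matrix \<Phi> A B C" and ?G = "form_matrix \<Psi> A B C" and ?H = "form_matrix \<Psi>' A B C"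
  have xz: "(a, b, c) \<in> ?Q" "(a'', b'', c'') \<in> ?Q" using A B C by auto
  have "?H (a, b, c) (a'', b'', c'') = mprod ?Q (mprod ?Q ?H ?F) ?G (a, b, c) (a'', b'', c'')"
   by (rule inverse_matricesD(3)[OF associator_inverse[OF A(1) B(1) C(1)] xz(2), symmetric])
  also have "\<dots> = mprod ?Q ?H (mprod ?Q ?F ?G) (a, b, c) (a'', b'', c'')" by (simp add: mprod_assoc)
  also have "\<dots> = ?G (a, b, c) (a'', b'', c'')"
   by (rule inverse_matricesD(2)[OF i.associator_inverse[OF A(1) B(1) C(1)] xz(1)])
  finally show ?thesis by simp
 qed
 show "\<Psi>' a b c = \<Psi> a b c"
  by (rule lin_eq_if_comatrix[of "(*)" _ _ a], (intro lin_intros i.lin_intros)+,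
    rule lin_eq_if_comatrix[of "(*)" _ _ b], (intro lin_intros i.lin_intros)+,
    rule lin_eq_if_comatrix[of "(*)" _ _ c], (intro lin_intros i.lin_intros)+, rule main)
qed

text \<open>The axioms for \<open>S\<close>, \<open>\<alpha>\<close>, \<open>\<beta>\<close>,
 evaluated at entries of \<open>V\<close>, are the axioms of a dual pair.\<close>
lemma antipode_dual:
 assumes hopf: "coquasi_hopf_algebra scale \<Delta> \<epsilon> mult one \<Phi> S \<alpha> \<beta>" and V: "comatrix R V"
 shows "dual_pair R V R (\<lambda>u u'. S (V u' u)) (\<lambda>v u. \<beta> (V v u)) (\<lambda>u v. \<alpha> (V u v))"
proof -
 interpret H: coquasi_hopf_algebra scale \<Delta> \<epsilon> mult one \<Phi> S \<alpha> \<beta> by (rule hopf)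
 have inv: "convolution_inverse3 \<Phi> = \<Psi>"
  unfolding convolution_inverse3_def by (rule the_equality[where P="is_convolution_inverse3 \<Phi>", OF \<Psi>_inverse convolution_inverse_unique])
 have S: "lin scale scale (\<lambda>x. S (f x))" if "lin scale scale f" for f by (rule lin_comp[OF that H.S_linear])
 have ab: "lin scale (*) (\<lambda>x. \<alpha> (f x))" "lin scale (*) (\<lambda>x. \<beta> (f x))" if "lin scale scale f" for f
  by (rule lin_comp[OF that H.\<alpha>_linear] lin_comp[OF that H.\<beta>_linear])+
 note fin = comatrixD(1)[OF V]
 show ?thesis unfolding dual_pair_def
 proof (intro conjI ballI V)
  show "comatrix R (\<lambda>u u'. S (V u' u))" unfolding comatrix_def
  proof (intro conjI ballI fin)
   fix i j assume ij: "i \<in> R" "j \<in> R"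
   have t: "lin scale scale f \<Longrightarrow> lin scale tscale (\<lambda>x. f x \<otimes> y)" "lin scale scale f \<Longrightarrow> lin scale tscale (\<lambda>x. y \<otimes> f x)" for f y
    by (rule lin_comp[OF _ bilinear_left[OF pure_tensor_bilinear]] lin_comp[OF _ bilinear_right[OF pure_tensor_bilinear]], assumption)+
   show "\<Delta> (S (V j i)) = (SUM k:R. S (V k i) \<otimes> S (V j k))"
    unfolding H.\<Delta>_S by (rule sweedler_comatrix[OF V ij(2,1) vector_space_tscale]) (intro t S lin_id vs)+
   show "\<epsilon> (S (V j i)) = (if i = j then 1 else 0)"
    by (auto simp: H.\<epsilon>_S comatrixD(3)[OF V ij(2,1)])
  qed
 next
  fix v u assume vu: "v \<in> R" "u \<in> R"
  have "(SUM (a1, a2, a3)<-sweedler3 (V v u). \<beta> a2 *s (a1 \<cdot> S a3)) = (SUM k:R. SUM l:R. \<beta> (V k l) *s (V v k \<cdot> S (V l u)))"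
   by (rule sweedler3_comatrix[OF V vu vs]) (intro lin_intros S ab)+
  then show "(SUM v':R. SUM u':R. \<beta> (V v' u') *s (V v v' \<cdot> S (V u' u))) = \<beta> (V v u) *s \<one>"
   using H.S_\<beta>[of "V v u"] by simp
 next
  fix u v assume uv: "u \<in> R" "v \<in> R"
  have "(SUM (a1, a2, a3)<-sweedler3 (V u v). \<alpha> a2 *s (S a1 \<cdot> a3)) = (SUM k:R. SUM l:R. \<alpha> (V k l) *s (S (V u k) \<cdot> V l v))"
   by (rule sweedler3_comatrix[OF V uv vs]) (intro lin_intros S ab)+
  then show "(SUM u':R. SUM v':R. \<alpha> (V u' v') *s (S (V u u') \<cdot> V v' v)) = \<alpha> (V u v) *s \<one>"
   using H.S_\<alpha>[of "V u v"] by simp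
 next
  fix v0 v' assume v: "v0 \<in> R" "v' \<in> R"
  have "(SUM (a1, a2, a3, a4, a5)<-sweedler5 (V v0 v'). \<Phi> a1 (S a3) a5 * \<beta> a2 * \<alpha> a4) =
   (SUM k:R. SUM l:R. SUM m:R. SUM n:R. \<Phi> (V v0 k) (S (V l m)) (V n v') * \<beta> (V k l) * \<alpha> (V m n))"
   by (rule sweedler5_comatrix[OF V v vector_space_mult]) (intro lin_intros S ab)+
  then show "(SUM p:R. SUM q:R. SUM s:R. SUM t:R. \<alpha> (V s t) * \<Phi> (V v0 p) (S (V q s)) (V t v') * \<beta> (V p q)) = (if v0 = v' then 1 else 0)"
   using H.\<Phi>_S[of "V v0 v'"] by (simp add: comatrixD(3)[OF V v] ac_simps)
 next
  fix u1 u0 assume u: "u1 \<in> R" "u0 \<in> R"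
  have "(SUM (a1, a2, a3, a4, a5)<-sweedler5 (V u1 u0). \<Psi> (S a1) a3 (S a5) * \<alpha> a2 * \<beta> a4) =
   (SUM k:R. SUM l:R. SUM m:R. SUM n:R. \<Psi> (S (V u1 k)) (V l m) (S (V n u0)) * \<alpha> (V k l) * \<beta> (V m n))"
   by (rule sweedler5_comatrix[OF V u vector_space_mult]) (intro lin_intros S ab)+
  then show "(SUM p:R. SUM q:R. SUM s:R. SUM t:R. \<alpha> (V p q) * \<Psi> (S (V u1 p)) (V q s) (S (V t u0)) * \<beta> (V s t)) = (if u1 = u0 then 1 else 0)"
   using H.\<Phi>_inverse_S[of "V u1 u0"] by (simp add: inv comatrixD(3)[OF V u] ac_simps)
 qed
qed

end

context coalgebra_alg_closed
begin

lemma span_Union_finite: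
 assumes "h \<in> span (\<Union>t\<in>I. X t)"
 obtains F where "finite F" "F \<subseteq> I" "h \<in> span (\<Union>t\<in>F. X t)"
proof -
 have "\<exists>F. finite F \<and> F \<subseteq> I \<and> h \<in> span (\<Union>t\<in>F. X t)" using assms
 proof (induction rule: span_induct_alt)
  case base
  show ?case by (rule exI[of _ "{}"]) (simp add: span_zero)
 next
  case (step c x y)
  then obtain F t where F: "finite F" "F \<subseteq> I" "y \<in> span (\<Union>t\<in>F. X t)" "t \<in> I" "x \<in> X t" by blast
  have "y \<in> span (\<Union>t\<in>insert t F. X t)" using F(3) by (rule rev_subsetD) (intro span_mono UN_mono, auto)
  moreover have "x \<in> span (\<Union>t\<in>insert t F. X t)" using F(5) by (intro span_base) blast
  ultimately show ?case using F by (intro exI[of _ "insert t F"] conjI span_add span_scale) auto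
 qed
 then show ?thesis using that by blast
qed

text \<open>A row of a comatrix is a homomorphism from its comodule to the regular comodule. If the row lies in
 the span of simple coefficient coalgebras, its coordinates with respect to the basis of matrix entries
 are homomorphisms to the corresponding simple comodules, not all of them zero.\<close>
lemma hom_to_irreducible:
 assumes U: "comatrix R U" "R \<noteq> {}"
  and A: "\<And>t. t \<in> I \<Longrightarrow> irreducible_comatrix (E t) (A t)"
  and hom0: "\<And>s t \<Lambda> a b. s \<in> I \<Longrightarrow> t \<in> I \<Longrightarrow> s \<noteq> t \<Longrightarrow> comatrix_hom (E s) (A s) (E t) (A t) \<Lambda> \<Longrightarrow>
   a \<in> E t \<Longrightarrow> b \<in> E s \<Longrightarrow> \<Lambda> a b = 0"
  and sp: "\<And>u u'. u \<in> R \<Longrightarrow> u' \<in> R \<Longrightarrow> U u u' \<in> span (\<Union>t\<in>I. {A t a b | a b. a \<in> E t \<and> b \<in> E t})"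
 obtains t \<Lambda> a b where "t \<in> I" "comatrix_hom R U (E t) (A t) \<Lambda>" "a \<in> E t" "b \<in> R" "\<Lambda> a b \<noteq> 0"
proof -
 let ?X = "\<lambda>t. {A t a b | a b. a \<in> E t \<and> b \<in> E t}"
 obtain u0 where u0: "u0 \<in> R" using U(2) by auto
 let ?Q = "\<lambda>u F. finite F \<and> F \<subseteq> I \<and> U u0 u \<in> span (\<Union>t\<in>F. ?X t)"
 have "\<forall>u\<in>R. \<exists>F. ?Q u F"
 proof
  fix u assume u: "u \<in> R"
  show "\<exists>F. ?Q u F" by (rule span_Union_finite[OF sp[OF u0 u]]) (intro exI conjI)
 qed
 then obtain G where G: "\<forall>u\<in>R. ?Q u (G u)" using bchoice[of R ?Q] by blast
 \<comment> \<open>The row involves only finitely many of the simple coalgebras, so dual forms for their entries exist.\<close>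
 define F where "F = (\<Union>u\<in>R. G u)"
 have F: "finite F" "F \<subseteq> I" using G comatrixD(1)[OF U(1)] by (auto simp: F_def)
 have UF: "U u0 u \<in> span (\<Union>t\<in>F. ?X t)" if "u \<in> R" for u
  by (rule rev_subsetD[OF _ span_mono[of "\<Union>t\<in>G u. ?X t"]]) (use G that in \<open>auto simp: F_def\<close>)
 define P where "P = (SIGMA p:Sigma F E. E (fst p))"
 have P: "((t, a), b) \<in> P \<longleftrightarrow> t \<in> F \<and> a \<in> E t \<and> b \<in> E t" for t a b by (simp add: P_def)
 have finE: "finite (E t)" if "t \<in> F" for t using that A F irreducibleD(2) by blast
 have finP: "finite P" unfolding P_def using F(1) finE by (intro finite_SigmaI) auto
 let ?z = "\<lambda>((t, a), b). A t a b"
 have Psum: "(SUM p:P. f p) = (SUM (t, a):Sigma F E. SUM b:E t. f ((t, a), b))" for f :: "_ \<Rightarrow> 'h"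
  using sum.Sigma[of "Sigma F E" "\<lambda>q. E (fst q)" "\<lambda>q b. f (q, b)"] F(1) finE by (auto simp: P_def split_def)
 have ind: "\<forall>p\<in>P. x p = 0" if "(SUM p:P. x p *s ?z p) = 0" for x
 proof -
  have "(SUM (t, a):Sigma F E. SUM b:E t. x ((t, a), b) *s A t a b) = 0"
   using that by (simp add: Psum split_def)
  from irreducible_entries_independent[OF F(1) _ _ this] A F(2) hom0
  have "\<forall>(t, a)\<in>Sigma F E. \<forall>b\<in>E t. x ((t, a), b) = 0" by blast
  then show ?thesis by (auto simp: P_def)
 qed
 obtain d where d: "\<And>p. lin scale (*) (d p)" "\<And>p q. p \<in> P \<Longrightarrow> q \<in> P \<Longrightarrow> d p (?z q) = (if p = q then 1 else 0)"
  by (rule independent_family_dual[OF vs finP ind]) (assumption, rule that)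
 interpret E: vector_space_pair scale scale using vs by (simp add: vector_space_pair_def)
 interpret K: vector_space_pair scale "(*) :: 'k \<Rightarrow> _" using vs vector_space_mult by (simp add: vector_space_pair_def)
 have expand: "h = (SUM p:P. d p h *s ?z p)" if h: "h \<in> span (\<Union>t\<in>F. ?X t)" for h
 proof (rule E.linear_eq_on[OF lin_id[OF vs] _ h])
  show "lin scale scale (\<lambda>h. SUM p:P. d p h *s ?z p)" by (intro lin_sum_fun vs lin_scale_fun d)
  fix x assume "x \<in> (\<Union>t\<in>F. ?X t)"
  then obtain q where q: "q \<in> P" "x = ?z q" using P by auto
  have "(SUM p:P. d p (?z q) *s ?z p) = (SUM p:P. if p = q then ?z p else 0)"
   by (rule sum.cong) (auto simp: d(2)[OF _ q(1)])
  then show "x = (SUM p:P. d p x *s ?z p)" using q finP by simp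
 qed
 have conv: "conv (d ((t, a), e)) f h = (SUM b:E t. d ((t, a), b) h * f (A t e b))"
  if h: "h \<in> span (\<Union>t\<in>F. ?X t)" and f: "lin scale (*) f" and tae: "t \<in> F" "a \<in> E t" "e \<in> E t" for t a e f h
 proof (rule K.linear_eq_on[OF lin_conv _ h])
  show "lin scale (*) (\<lambda>h. SUM b:E t. d ((t, a), b) h * f (A t e b))"
   by (intro lin_sum_fun vs vector_space_mult lin_mult_left lin_mult_right d)
  fix x assume "x \<in> (\<Union>t\<in>F. ?X t)"
  then obtain s a' b' where x: "x = A s a' b'" "s \<in> F" "a' \<in> E s" "b' \<in> E s" by auto
  have "conv (d ((t, a), e)) f x = (SUM k:E s. d ((t, a), e) (A s a' k) * f (A s k b'))"
   unfolding x(1) using A x F by (intro conv_comatrix[OF irreducibleD(1) _ _ d(1) f]) auto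
  also have "\<dots> = (SUM k:E s. (if k = e then if t = s \<and> a = a' then f (A s e b') else 0 else 0))"
   by (rule sum.cong) (use d(2)[of "((t, a), e)" "((s, a'), _)"] tae x in \<open>auto simp: P\<close>)
  also have "\<dots> = (if t = s \<and> a = a' then f (A t e b') else 0)" using tae x finE by auto
  also have "\<dots> = (SUM b:E t. if b = b' then if t = s \<and> a = a' then f (A t e b') else 0 else 0)"
   using tae x finE by auto
  also have "\<dots> = (SUM b:E t. d ((t, a), b) x * f (A t e b))"
   by (rule sum.cong) (use d(2)[of "((t, a), _)" "((s, a'), b')"] tae x in \<open>auto simp: P\<close>)
  finally show "conv (d ((t, a), e)) f x = (SUM b:E t. d ((t, a), b) x * f (A t e b))" .
 qed
 have "U u0 u0 \<noteq> 0" using comatrixD(3)[OF U(1) u0 u0] lin_zero[OF \<epsilon>_linear] by auto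
 have "\<exists>p\<in>P. d p (U u0 u0) \<noteq> 0"
 proof (rule ccontr)
  assume "\<not> ?thesis"
  then have "U u0 u0 = 0" by (subst expand[OF UF[OF u0]]) simp
  with \<open>U u0 u0 \<noteq> 0\<close> show False by contradiction
 qed
 then obtain t a b where nz: "t \<in> F" "a \<in> E t" "b \<in> E t" "d ((t, a), b) (U u0 u0) \<noteq> 0"
  by (auto simp: P_def)
 have "comatrix_hom R U (E t) (A t) (\<lambda>e u. d ((t, a), e) (U u0 u))"
 proof (rule comatrix_homI)
  fix f e u assume f: "lin scale (*) f" and e: "e \<in> E t" and u: "u \<in> R"
  show "(SUM k:R. d ((t, a), e) (U u0 k) * f (U k u)) = (SUM b:E t. f (A t e b) * d ((t, a), b) (U u0 u))"
   using conv[OF UF[OF u] f nz(1,2) e] conv_comatrix[OF U(1) u0 u d(1) f] by (simp add: mult.commute)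
 qed
 then show ?thesis using that[of t _ b u0] nz u0 F by blast
qed

end

text \<open>The comodule of \<open>G\<close> is the direct sum of those of \<open>A (fst p)\<close>, \<open>p \<in> P\<close>, with injections \<open>\<iota>\<close> and
 projections \<open>\<pi>\<close>.\<close>
definition (in coalgebra) decomposition where
 "decomposition X G P E A \<iota> \<pi> \<longleftrightarrow> finite P \<and>
  (\<forall>p\<in>P. comatrix_hom (E (fst p)) (A (fst p)) X G (\<iota> p) \<and> comatrix_hom X G (E (fst p)) (A (fst p)) (\<pi> p)) \<and>
  (\<forall>p\<in>P. \<forall>q\<in>P. \<forall>c\<in>E (fst p). \<forall>c'\<in>E (fst q). (SUM x:X. \<pi> p c x * \<iota> q x c') = (if p = q \<and> c = c' then 1 else 0)) \<and>
  (\<forall>x\<in>X. \<forall>x'\<in>X. (SUM p:P. SUM c:E (fst p). \<iota> p x c * \<pi> p c x') = (if x = x' then 1 else 0))"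

lemma (in coalgebra) decompositionD:
 assumes "decomposition X G P E A \<iota> \<pi>"
 shows "finite P"
  "\<And>p. p \<in> P \<Longrightarrow> comatrix_hom (E (fst p)) (A (fst p)) X G (\<iota> p)"
  "\<And>p. p \<in> P \<Longrightarrow> comatrix_hom X G (E (fst p)) (A (fst p)) (\<pi> p)"
  "\<And>p q c c'. p \<in> P \<Longrightarrow> q \<in> P \<Longrightarrow> c \<in> E (fst p) \<Longrightarrow> c' \<in> E (fst q) \<Longrightarrow>
   (SUM x:X. \<pi> p c x * \<iota> q x c') = (if p = q \<and> c = c' then 1 else 0)"
  "\<And>x x'. x \<in> X \<Longrightarrow> x' \<in> X \<Longrightarrow> (SUM p:P. SUM c:E (fst p). \<iota> p x c * \<pi> p c x') = (if x = x' then 1 else 0)"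
 using assms unfolding decomposition_def by blast+

text \<open>A family of pairwise non-isomorphic simple comodules that contains the unit and is closed
 under tensor products, with multiplicities \<open>N\<close>.\<close>
locale fusion_family = coquasi_bialgebra_inverse scale \<Delta> \<epsilon> mult one \<Phi> \<Psi>
 for scale :: "'k::alg_closed_field \<Rightarrow> 'h::ab_group_add \<Rightarrow> 'h" (infixr \<open>*s\<close> 75) and \<Delta> \<epsilon>
  and mult (infixl \<open>\<cdot>\<close> 72) and one (\<open>\<one>\<close>) and \<Phi> \<Psi> +
 fixes I :: "'i set" and E :: "'i \<Rightarrow> 'e set" and A :: "'i \<Rightarrow> 'e \<Rightarrow> 'e \<Rightarrow> 'h" and N :: "'i \<Rightarrow> 'i \<Rightarrow> 'i \<Rightarrow> nat"
  and i0 e0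
 assumes irreducible: "t \<in> I \<Longrightarrow> irreducible_comatrix (E t) (A t)"
  and hom0: "s \<in> I \<Longrightarrow> t \<in> I \<Longrightarrow> s \<noteq> t \<Longrightarrow> comatrix_hom (E s) (A s) (E t) (A t) \<Lambda> \<Longrightarrow>
   a \<in> E t \<Longrightarrow> b \<in> E s \<Longrightarrow> \<Lambda> a b = 0"
  and fusion: "s \<in> I \<Longrightarrow> t \<in> I \<Longrightarrow>
   \<exists>\<iota> \<pi>. decomposition (E s \<times> E t) (prod_comatrix (A s) (A t)) (SIGMA k:I. {..<N s t k}) E A \<iota> \<pi>"
  and unit: "i0 \<in> I" "E i0 = {e0}" "A i0 e0 e0 = \<one>"
begin

lemma comatrix_E: "t \<in> I \<Longrightarrow> comatrix (E t) (A t)" and finite_E: "t \<in> I \<Longrightarrow> finite (E t)"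
 using irreducibleD(1,2)[OF irreducible] by blast+

text \<open>The left dual \<open>U\<close> of \<open>A i\<close> has a simple quotient \<open>A t\<close>, through the coevaluation of which the unit maps
 nontrivially to \<open>A i \<otimes> A t\<close>. By complete reducibility there is then also a nonzero homomorphism from
 \<open>A i \<otimes> A t\<close> to the unit, and hence from \<open>A i\<close> to a dual \<open>U'\<close> of \<open>A t\<close>. As \<open>A i\<close>, \<open>U\<close> and \<open>A t\<close>, \<open>U'\<close> have
 the same dimension, both homomorphisms are isomorphisms.\<close>
lemma simple_duals:
 assumes dual: "\<And>t. t \<in> I \<Longrightarrow> \<exists>U \<kappa> \<mu>. dual_pair (E t) (A t) (E t) U \<kappa> \<mu> \<and>
   (\<forall>u\<in>E t. \<forall>u'\<in>E t. U u u' \<in> span (\<Union>t\<in>I. {A t a b | a b. a \<in> E t \<and> b \<in> E t}))"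
  and i: "i \<in> I"
 obtains t \<kappa> \<mu> \<kappa>' \<mu>' where "t \<in> I" "dual_pair (E i) (A i) (E t) (A t) \<kappa> \<mu>" "dual_pair (E t) (A t) (E i) (A i) \<kappa>' \<mu>'"
proof -
 obtain U \<kappa> \<mu> where U: "dual_pair (E i) (A i) (E i) U \<kappa> \<mu>"
  and sp: "\<And>u u'. u \<in> E i \<Longrightarrow> u' \<in> E i \<Longrightarrow> U u u' \<in> span (\<Union>t\<in>I. {A t a b | a b. a \<in> E t \<and> b \<in> E t})"
  using dual[OF i] by (elim exE conjE) (rule that, assumption, blast)
 obtain t \<Lambda> y0 u0 where t: "t \<in> I" and \<Lambda>: "comatrix_hom (E i) U (E t) (A t) \<Lambda>"
  and nz: "y0 \<in> E t" "u0 \<in> E i" "\<Lambda> y0 u0 \<noteq> 0"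
 proof (rule hom_to_irreducible[where I=I and E=E and A=A, OF dual_pairD(2)[OF U] irreducibleD(3)[OF irreducible[OF i]] irreducible])
  show "\<Lambda> a b = 0" if "s \<in> I" "t \<in> I" "s \<noteq> t" "comatrix_hom (E s) (A s) (E t) (A t) \<Lambda>" "a \<in> E t" "b \<in> E s" for s t \<Lambda> a b
   using that by (rule hom0)
  qed (assumption, erule (1) sp, erule (4) that)
 obtain W \<kappa>' \<mu>' where W: "dual_pair (E t) (A t) (E t) W \<kappa>' \<mu>'" using dual[OF t] by (elim exE conjE) (rule that)
 note inj\<Lambda> = schur_cokernel[OF irreducible[OF t] \<Lambda> nz]
 define \<omega> where "\<omega> x = (SUM z:E i. \<Lambda> (snd x) z * \<kappa> (fst x) z)" for x
 have \<omega>: "comatrix_hom (E i0) (A i0) (E i \<times> E t) (prod_comatrix (A i) (A t)) (\<lambda>x _. \<omega> x)"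
  unfolding comatrix_hom_def \<omega>_def using coev_hom[OF U \<Lambda>] by (auto simp: unit sum_Times)
 have "\<exists>x\<in>E i \<times> E t. \<omega> x \<noteq> 0"
 proof (rule ccontr)
  assume "\<not> ?thesis"
  then have 0: "\<omega> (s, y) = 0" if "s \<in> E i" "y \<in> E t" for s y using that by blast
  have f: "lin scale (*) (\<Psi> a b)" for a b by (intro lin_intros)
  have "\<Lambda> y0 u0 = (SUM z:E i. (if u0 = z then 1 else 0) * \<Lambda> y0 z)"
   by (simp add: sum_delta_mult[OF finite_E[OF i] nz(2)])
  also have "\<dots> = (SUM z:E i. (SUM p:E i. SUM q:E i. SUM s:E i. SUM v:E i. \<mu> p q * \<Psi> (U p u0) (A i q s) (U z v) * \<kappa> s v) * \<Lambda> y0 z)"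
   by (rule sum.cong) (simp_all add: dual_pairD(6)[OF U nz(2)])
  also have "\<dots> = (SUM p:E i. SUM q:E i. SUM s:E i. SUM v:E i. \<mu> p q * \<kappa> s v * (SUM z:E i. \<Lambda> y0 z * \<Psi> (U p u0) (A i q s) (U z v)))"
   unfolding sum_distrib_left sum_distrib_right sum.cartesian_product
   by (rule sum.reindex_bij_witness[of _ "\<lambda>(a, b, c, d, e). (e, a, b, c, d)" "\<lambda>(e, a, b, c, d). (a, b, c, d, e)"]) (auto simp: ac_simps)
  also have "\<dots> = (SUM p:E i. SUM q:E i. SUM s:E i. SUM v:E i. \<mu> p q * \<kappa> s v * (SUM y:E t. \<Psi> (U p u0) (A i q s) (A t y0 y) * \<Lambda> y v))"
   by (intro sum.cong refl) (simp add: comatrix_hom_functional[OF \<Lambda> f nz(1)])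
  also have "\<dots> = (SUM p:E i. SUM q:E i. SUM s:E i. SUM y:E t. \<mu> p q * \<Psi> (U p u0) (A i q s) (A t y0 y) * \<omega> (s, y))"
   unfolding \<omega>_def fst_conv snd_conv sum_distrib_left sum.cartesian_product
   by (rule sum.reindex_bij_witness[of _ "\<lambda>(a, b, c, d, e). (a, b, c, e, d)" "\<lambda>(a, b, c, e, d). (a, b, c, d, e)"]) (auto simp: ac_simps)
  also have "\<dots> = 0" by (simp add: 0)
  finally show False using nz by simp
 qed
 then obtain x0 where x0: "x0 \<in> E i \<times> E t" "\<omega> x0 \<noteq> 0" by blast
 obtain \<iota> \<pi> where dec: "decomposition (E i \<times> E t) (prod_comatrix (A i) (A t)) (SIGMA k:I. {..<N i t k}) E A \<iota> \<pi>"
  using fusion[OF i t] by blast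
 note D = decompositionD[OF dec]
 have "\<omega> x0 = (SUM x:E i \<times> E t. (SUM p:(SIGMA k:I. {..<N i t k}). SUM c:E (fst p). \<iota> p x0 c * \<pi> p c x) * \<omega> x)"
  by (simp add: D(5)[OF x0(1)] sum_delta_mult[OF _ x0(1)] finite_E i t cong: sum.cong)
 also have "\<dots> = (SUM p:(SIGMA k:I. {..<N i t k}). SUM c:E (fst p). \<iota> p x0 c * (SUM x:E i \<times> E t. \<pi> p c x * \<omega> x))"
  unfolding sum_distrib_left sum_distrib_right
  by (subst sum.swap, rule sum.cong[OF refl], subst sum.swap) (simp add: mult.assoc)
 finally have "(SUM p:(SIGMA k:I. {..<N i t k}). SUM c:E (fst p). \<iota> p x0 c * (SUM x:E i \<times> E t. \<pi> p c x * \<omega> x)) \<noteq> 0"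
  using x0(2) by simp
 then obtain p c where p: "p \<in> (SIGMA k:I. {..<N i t k})" "c \<in> E (fst p)" "(SUM x:E i \<times> E t. \<pi> p c x * \<omega> x) \<noteq> 0"
 proof (rule contrapos_np, intro sum.neutral ballI)
  fix p c assume "\<not> thesis" "p \<in> (SIGMA k:I. {..<N i t k})" "c \<in> E (fst p)"
  then show "\<iota> p x0 c * (SUM x:E i \<times> E t. \<pi> p c x * \<omega> x) = 0" using that[of p c] by (cases "(SUM x:E i \<times> E t. \<pi> p c x * \<omega> x) = 0") simp_all
 qed
 have pI: "fst p \<in> I" using p by auto
 have p0: "fst p = i0"
 proof (rule ccontr)
  assume "fst p \<noteq> i0"
  then have "(SUM x:E i \<times> E t. \<pi> p c x * \<omega> x) = 0"
   by (intro hom0[OF unit(1) pI _ comatrix_hom_compose[OF \<omega> D(3)[OF p(1)]] p(2), of e0]) (auto simp: unit(2))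
  with p(3) show False by contradiction
 qed
 have "(SUM x:E i \<times> E t. \<pi> p e0 x * \<iota> p x e0) = 1" using D(4)[OF p(1) p(1), of e0 e0] by (simp add: p0 unit(2))
 then have \<theta>nz: "\<exists>x\<in>E i \<times> E t. \<pi> p e0 x \<noteq> 0"
  by (rule contrapos_pp) (subst sum.neutral; auto)
 interpret op: coquasi_bialgebra_inverse scale \<Delta> \<epsilon> "\<lambda>a b. b \<cdot> a" \<one> "\<lambda>a b c. \<Psi> c b a" "\<lambda>a b c. \<Phi> c b a"
  by (rule opposite)
 obtain F where F: "\<And>g B. comatrix_hom (E t \<times> E i) (op.prod_comatrix (A t) (A i)) {e0} B g \<Longrightarrow>
   comatrix_hom (E i) (A i) (E t \<times> {e0}) (op.prod_comatrix W B) (F g)"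
  "\<And>g B. comatrix_hom (E t \<times> E i) (op.prod_comatrix (A t) (A i)) {e0} B g \<Longrightarrow>
   (\<And>y x. y \<in> E t \<times> {e0} \<Longrightarrow> x \<in> E i \<Longrightarrow> F g y x = 0) \<Longrightarrow> (\<forall>y\<in>{e0}. \<forall>z\<in>E t \<times> E i. g y z = 0)"
  "\<And>(J :: nat set) c g. F (\<lambda>y z. SUM j:J. c j * g j y z) = (\<lambda>y x. SUM j:J. c j * F (g j) y x)"
 proof (rule op.hom_adjunction[OF dual_pair_opposite[OF W] comatrix_E[OF i], of "{e0}"], simp, goal_cases)
  case (1 F)
  show ?case by (rule 1(1)[of F]) (fact 1)+
 qed
 define \<theta> where "\<theta> y x = \<pi> p y (snd x, fst x)" for y x
 have \<theta>: "comatrix_hom (E t \<times> E i) (op.prod_comatrix (A t) (A i)) {e0} (A i0) \<theta>"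
 proof (rule comatrix_homI)
  fix f y x assume f: "lin scale (*) f" and y: "y \<in> {e0}" and x: "x \<in> E t \<times> E i"
  obtain a b where ab: "x = (a, b)" "a \<in> E t" "b \<in> E i" using x by auto
  have "(SUM x':E t \<times> E i. \<theta> y x' * f (op.prod_comatrix (A t) (A i) x' x)) =
   (SUM x':E i \<times> E t. \<pi> p y x' * f (prod_comatrix (A i) (A t) x' (b, a)))"
   by (rule sum.reindex_bij_witness[of _ "\<lambda>(a, b). (b, a)" "\<lambda>(a, b). (b, a)"]) (auto simp: ab \<theta>_def)
  also have "\<dots> = (SUM y':{e0}. f (A i0 y y') * \<theta> y' x)"
   using comatrix_hom_functional[OF D(3)[OF p(1)] f, of y "(b, a)"] y ab by (simp add: p0 unit(2) \<theta>_def)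
  finally show "(SUM x':E t \<times> E i. \<theta> y x' * f (op.prod_comatrix (A t) (A i) x' x)) = (SUM y':{e0}. f (A i0 y y') * \<theta> y' x)" .
 qed
 define \<Omega> where "\<Omega> y x = F \<theta> (y, e0) x" for y x
 have \<Omega>: "comatrix_hom (E i) (A i) (E t) W \<Omega>"
  using F(1)[OF \<theta>] unfolding comatrix_hom_def by (auto simp: \<Omega>_def sum_Times unit mult_one_left)
 have "\<exists>y\<in>E t. \<exists>x\<in>E i. \<Omega> y x \<noteq> 0"
  using F(2)[OF \<theta>] \<theta>nz by (fastforce simp: \<Omega>_def \<theta>_def)
 then obtain y1 x1 where nz1: "y1 \<in> E t" "x1 \<in> E i" "\<Omega> y1 x1 \<noteq> 0" by blast
 have inj\<Omega>: "\<forall>x\<in>E i. z x = 0" if "\<And>y. y \<in> E t \<Longrightarrow> (SUM x:E i. \<Omega> y x * z x) = 0" for z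
  using schur_injective[OF irreducible[OF i] \<Omega> _ that nz1(1,2)] nz1(3) by blast
 \<comment> \<open>One inequality by injectivity of \<open>\<Omega>\<close>, the other one by surjectivity of \<open>\<Lambda>\<close>.\<close>
 have card: "card (E i) = card (E t)"
  using card_le_if_injective_matrix[OF finite_E[OF t] finite_E[OF i], of \<Omega>] inj\<Omega>
   card_le_if_injective_matrix[OF finite_E[OF i] finite_E[OF t], of "\<lambda>u y. \<Lambda> y u"] inj\<Lambda> by (meson antisym)
 obtain M where M: "\<And>u u'. u \<in> E i \<Longrightarrow> u' \<in> E i \<Longrightarrow> (SUM y:E t. \<Lambda> y u * M y u') = (if u = u' then 1 else 0)"
  "\<And>y y'. y \<in> E t \<Longrightarrow> y' \<in> E t \<Longrightarrow> (SUM u:E i. M y u * \<Lambda> y' u) = (if y = y' then 1 else 0)"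
  by (rule square_injective_inverse[OF finite_E[OF i] finite_E[OF t] card, of "\<lambda>u y. \<Lambda> y u"], rule inj\<Lambda>) (assumption, rule that)
 obtain \<kappa>1 \<mu>1 where 1: "dual_pair (E i) (A i) (E t) (A t) \<kappa>1 \<mu>1"
 proof (rule dual_pair_iso[OF U comatrix_E[OF t] \<Lambda>, of "\<lambda>u y. M y u"])
  show "(SUM r:E i. \<Lambda> y r * M y' r) = (if y = y' then 1 else 0)" if "y \<in> E t" "y' \<in> E t" for y y'
   using M(2)[OF that(2,1)] by (simp add: mult.commute)
  show "(SUM y:E t. M y r * \<Lambda> y r') = (if r = r' then 1 else 0)" if "r \<in> E i" "r' \<in> E i" for r r'
   using M(1)[OF that(2,1)] by (simp add: mult.commute)
 qed (rule that)
 obtain O' where O': "\<And>y y'. y \<in> E t \<Longrightarrow> y' \<in> E t \<Longrightarrow> (SUM x:E i. \<Omega> y x * O' x y') = (if y = y' then 1 else 0)"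
  "\<And>x x'. x \<in> E i \<Longrightarrow> x' \<in> E i \<Longrightarrow> (SUM y:E t. O' x y * \<Omega> y x') = (if x = x' then 1 else 0)"
  by (rule square_injective_inverse[OF finite_E[OF t] finite_E[OF i] card[symmetric], of \<Omega>], rule inj\<Omega>) (assumption, rule that)
 obtain \<kappa>2 \<mu>2 where 2: "dual_pair (E t) (A t) (E i) (A i) \<kappa>2 \<mu>2"
  by (rule dual_pair_iso[OF W comatrix_E[OF i] inverse_hom[OF finite_E[OF i] finite_E[OF t] \<Omega> O'] O'(2) O'(1)])
   (assumption | erule that)+
 show ?thesis by (rule that[OF t 1 2])
qed

end

section \<open>Counting extensions\<close>

context coalgebra
begin

text \<open>The pullback of an extension along a homomorphism \<open>\<Lambda>\<close> to the
 quotient.\<close>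
definition comp_hom :: "'t set \<Rightarrow> ('t \<Rightarrow> 'u \<Rightarrow> 'a) \<Rightarrow> ('r \<Rightarrow> 't \<Rightarrow> 'b) \<Rightarrow> 'r \<Rightarrow> 'u \<Rightarrow> 'b" where
 "comp_hom T \<Lambda> Y = (\<lambda>p q. SUM t:T. \<Lambda> t q *s Y p t)"

lemma lin_comp_hom: "lin (mscale scale) (mscale scale) (comp_hom T \<Lambda>)"
 by (rule linI[OF vs_matrices vs_matrices])
  (auto simp: comp_hom_def pointwise_scale_def fun_eq_iff scale_right_distrib sum.distrib scale_sum_right mult.commute)

lemma comp_hom_cocycle:
 assumes fin: "finite T" and \<Lambda>: "comatrix_hom U G T D \<Lambda>" and Y: "Y \<in> ext_cocycles R C T D"
 shows "comp_hom T \<Lambda> Y \<in> ext_cocycles R C U G"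
proof (rule ext_cocycleI)
 fix p q f g assume pq: "p \<in> R" "q \<in> U" and f: "lin scale (*) f" and g: "lin scale (*) g"
 have "conv f g (comp_hom T \<Lambda> Y p q) = (SUM t:T. \<Lambda> t q * conv f g (Y p t))"
  by (simp add: comp_hom_def lin_sum[OF lin_conv] lin_scale[OF lin_conv])
 also have "\<dots> = (SUM t:T. \<Lambda> t q * ((SUM k:R. f (C p k) * g (Y k t)) + (SUM l:T. f (Y p l) * g (D l t))))"
  by (intro sum.cong refl) (simp add: conv_ext_cocycle[OF Y pq(1) _ f g])
 also have "\<dots> = (SUM k:R. f (C p k) * (SUM t:T. \<Lambda> t q * g (Y k t))) + (SUM l:T. f (Y p l) * (SUM t:T. g (D l t) * \<Lambda> t q))"
  unfolding distrib_left sum.distrib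
  unfolding sum_distrib_left sum.cartesian_product
  by (intro arg_cong2[where f="(+)"] sum.reindex_bij_witness[of _ "\<lambda>(a, b). (b, a)" "\<lambda>(a, b). (b, a)"]) (auto simp: ac_simps)
 also have "(SUM l:T. f (Y p l) * (SUM t:T. g (D l t) * \<Lambda> t q)) = (SUM l:T. f (Y p l) * (SUM r:U. \<Lambda> l r * g (G r q)))"
  by (intro sum.cong refl) (simp add: comatrix_hom_functional[OF \<Lambda> g _ pq(2)])
 also have "\<dots> = (SUM r:U. f (comp_hom T \<Lambda> Y p r) * g (G r q))"
  unfolding comp_hom_def lin_sum[OF f] lin_scale[OF f] unfolding sum_distrib_left sum_distrib_right sum.cartesian_product
  by (rule sum.reindex_bij_witness[of _ "\<lambda>(a, b). (b, a)" "\<lambda>(a, b). (b, a)"]) (auto simp: ac_simps)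
 finally show "conv f g (comp_hom T \<Lambda> Y p q) = (SUM k:R. f (C p k) * g (comp_hom T \<Lambda> Y k q)) + \<dots>"
  by (simp add: comp_hom_def lin_sum[OF g] lin_scale[OF g])
qed

lemma comp_hom_coboundary:
 assumes \<Lambda>: "comatrix_hom U G T D \<Lambda>" and Y: "Y \<in> ext_coboundaries R C T D"
 shows "comp_hom T \<Lambda> Y \<in> ext_coboundaries R C U G"
proof -
 obtain M where M: "\<And>p q. p \<in> R \<Longrightarrow> q \<in> T \<Longrightarrow> Y p q = (SUM k:R. M k q *s C p k) - (SUM l:T. M p l *s D l q)"
  using Y unfolding ext_coboundaries_def by blast
 have "comp_hom T \<Lambda> Y p q = (SUM k:R. (SUM t:T. \<Lambda> t q * M k t) *s C p k) - (SUM r:U. (SUM t:T. \<Lambda> t r * M p t) *s G r q)"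
  if pq: "p \<in> R" "q \<in> U" for p q
 proof (rule functionals_separate[OF vs])
  fix f assume f: "lin scale (*) f"
  have "f (comp_hom T \<Lambda> Y p q) = (SUM t:T. \<Lambda> t q * ((SUM k:R. M k t * f (C p k)) - (SUM l:T. M p l * f (D l t))))"
   by (simp add: comp_hom_def lin_sum[OF f] lin_scale[OF f] M[OF pq(1)] lin_diff[OF f])
  also have "\<dots> = (SUM k:R. (SUM t:T. \<Lambda> t q * M k t) * f (C p k)) - (SUM l:T. M p l * (SUM t:T. f (D l t) * \<Lambda> t q))"
   unfolding right_diff_distrib sum_subtractf
   unfolding sum_distrib_left sum_distrib_right sum.cartesian_product
   by (intro arg_cong2[where f="(-)"] sum.reindex_bij_witness[of _ "\<lambda>(a, b). (b, a)" "\<lambda>(a, b). (b, a)"]) (auto simp: ac_simps)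
  also have "(SUM l:T. M p l * (SUM t:T. f (D l t) * \<Lambda> t q)) = (SUM l:T. M p l * (SUM r:U. \<Lambda> l r * f (G r q)))"
   by (intro sum.cong refl) (simp add: comatrix_hom_functional[OF \<Lambda> f _ pq(2)])
  also have "\<dots> = (SUM r:U. (SUM t:T. \<Lambda> t r * M p t) * f (G r q))"
   unfolding sum_distrib_left sum_distrib_right sum.cartesian_product
   by (rule sum.reindex_bij_witness[of _ "\<lambda>(a, b). (b, a)" "\<lambda>(a, b). (b, a)"]) (auto simp: ac_simps)
  finally show "f (comp_hom T \<Lambda> Y p q) =
    f ((SUM k:R. (SUM t:T. \<Lambda> t q * M k t) *s C p k) - (SUM r:U. (SUM t:T. \<Lambda> t r * M p t) *s G r q))"
   by (simp add: lin_sum[OF f] lin_scale[OF f] lin_diff[OF f])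
 qed
 then show ?thesis unfolding ext_coboundaries_def by (intro CollectI exI[of _ "\<lambda>k q. SUM t:T. \<Lambda> t q * M k t"]) auto
qed

text \<open>Only the entries with indices in \<open>R \<times> T\<close> matter.\<close>
lemma zero_coboundary:
 "(\<And>p q. p \<in> R \<Longrightarrow> q \<in> T \<Longrightarrow> Y p q = 0) \<Longrightarrow> Y \<in> ext_coboundaries R C T D"
 unfolding ext_coboundaries_def by (intro CollectI exI[of _ "\<lambda>_ _. 0"]) simp

text \<open>Pulling extensions back along the injections and projections of a direct sum shows that
 \<open>Ext\<close> is additive in the quotient.\<close>
lemma ext_decomposition:
 assumes C: "comatrix R C" and G: "comatrix X G" and dec: "decomposition X G P E A \<iota> \<pi>"
  and A: "\<And>p. p \<in> P \<Longrightarrow> comatrix (E (fst p)) (A (fst p))"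
  and \<beta>: "vector_space.basis_mod (mscale scale) (ext_cocycles R C X G) (ext_coboundaries R C X G) \<beta>"
  and \<gamma>: "\<And>p. p \<in> P \<Longrightarrow> vector_space.basis_mod (mscale scale) (ext_cocycles R C (E (fst p)) (A (fst p)))
   (ext_coboundaries R C (E (fst p)) (A (fst p))) (\<gamma> (fst p))"
 shows "\<beta> \<approx> (SIGMA p:P. \<gamma> (fst p))"
proof -
 note D = decompositionD[OF dec]
 note fin = comatrixD(1)[OF A] comatrixD(1)[OF G]
 have swap: "(SUM x:S. a x *s (SUM y:T. b y x *s z y)) = (SUM y:T. (SUM x:S. b y x * a x) *s z y)" for S T a b z
  unfolding scale_sum_right scale_sum_left scale_scale
  by (subst sum.swap) (simp add: mult.commute)
 show ?thesis
 proof (rule basis_mod_direct_sum[OF vs_matrices vs_matrices D(1) subspace_ext_cocycles subspace_ext_coboundaries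
    ext_coboundaries_subset[OF C G] subspace_ext_coboundaries lin_comp_hom[of "E (fst _)" "\<pi> _"] lin_comp_hom[of X "\<iota> _"]
    comp_hom_cocycle[OF fin(1) D(3)] comp_hom_coboundary[OF D(3)] comp_hom_cocycle[OF fin(2) D(2)] comp_hom_coboundary[OF D(2)] _ _ \<beta> \<gamma>],
   assumption+)
  fix p q y assume pq: "p \<in> P" "q \<in> P"
  show "comp_hom X (\<iota> p) (comp_hom (E (fst q)) (\<pi> q) y) - (if p = q then y else 0) \<in> ext_coboundaries R C (E (fst p)) (A (fst p))"
  proof (rule zero_coboundary)
   fix r c assume r: "r \<in> R" "c \<in> E (fst p)"
   have "comp_hom X (\<iota> p) (comp_hom (E (fst q)) (\<pi> q) y) r c = (SUM c':E (fst q). (SUM x:X. \<pi> q c' x * \<iota> p x c) *s y r c')"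
    unfolding comp_hom_def by (rule swap)
   also have "\<dots> = (SUM c':E (fst q). if c' = c then if q = p then y r c else 0 else 0)"
    by (intro sum.cong refl) (simp add: D(4)[OF pq(2,1) _ r(2)])
   also have "\<dots> = (if q = p then y r c else 0)" using fin(1)[OF pq(2)] r by auto
   finally show "(comp_hom X (\<iota> p) (comp_hom (E (fst q)) (\<pi> q) y) - (if p = q then y else 0)) r c = 0" by auto
  qed
 next
  fix Y
  show "(SUM p:P. comp_hom (E (fst p)) (\<pi> p) (comp_hom X (\<iota> p) Y)) - Y \<in> ext_coboundaries R C X G"
  proof (rule zero_coboundary)
   fix r x assume r: "r \<in> R" "x \<in> X"
   have "(SUM p:P. comp_hom (E (fst p)) (\<pi> p) (comp_hom X (\<iota> p) Y)) r x =
    (SUM p:P. SUM x':X. (SUM c:E (fst p). \<iota> p x' c * \<pi> p c x) *s Y r x')"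
    unfolding sum_apply comp_hom_def by (intro sum.cong refl swap)
   also have "\<dots> = (SUM x':X. (SUM p:P. SUM c:E (fst p). \<iota> p x' c * \<pi> p c x) *s Y r x')"
    by (subst sum.swap) (simp add: scale_sum_left)
   also have "\<dots> = (SUM x':X. if x' = x then Y r x else 0)"
    by (intro sum.cong refl) (simp add: D(5)[OF _ r(2)])
   also have "\<dots> = Y r x" using fin(2) r by simp
   finally show "((SUM p:P. comp_hom (E (fst p)) (\<pi> p) (comp_hom X (\<iota> p) Y)) - Y) r x = 0" by simp
  qed
 qed
qed

end

text \<open>The maps \<open>pull\<close> and \<open>push\<close> are inverse to each other on
 extension classes.\<close>
lemma (in coquasi_bialgebra_inverse) ext_dual:
 assumes dual: "dual_pair R V T U \<kappa> \<mu>" and X: "comatrix W X"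
  and \<beta>: "vector_space.basis_mod (mscale scale) (ext_cocycles R V W X) (ext_coboundaries R V W X) \<beta>"
  and \<delta>: "vector_space.basis_mod (mscale scale) (ext_cocycles {()} (\<lambda>_ _. \<one>) (T \<times> W) (prod_comatrix U X))
   (ext_coboundaries {()} (\<lambda>_ _. \<one>) (T \<times> W) (prod_comatrix U X)) \<delta>"
 shows "\<beta> \<approx> \<delta>"
proof -
 have "\<beta> \<approx> (SIGMA p:{()}. \<delta>)"
 proof (rule basis_mod_direct_sum[OF vs_matrices vs_matrices _ subspace_ext_cocycles subspace_ext_coboundaries
    ext_coboundaries_subset[OF dual_pairD(1)[OF dual] X] subspace_ext_coboundaries lin_pull[OF dual X] lin_push[OF dual X]
    pull_cocycle[OF dual X] pull_coboundary[OF dual X] push_cocycle[OF dual X] push_coboundary[OF dual X] _ _ \<beta> \<delta>],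
   simp, assumption+)
  fix p q :: unit and y assume "y \<in> ext_cocycles {()} (\<lambda>_ _. \<one>) (T \<times> W) (prod_comatrix U X)"
  then show "push R T U \<mu> (pull R V T U \<kappa> W X y) - (if p = q then y else 0) \<in> ext_coboundaries {()} (\<lambda>_ _. \<one>) (T \<times> W) (prod_comatrix U X)"
   using push_pull[OF dual X] by simp
 next
  fix x assume "x \<in> ext_cocycles R V W X"
  then show "(SUM p:{()}. pull R V T U \<kappa> W X (push R T U \<mu> x)) - x \<in> ext_coboundaries R V W X"
   using pull_push[OF dual X] by simp
 qed
 also have "(SIGMA p:{()}. \<delta>) \<approx> \<delta>"
  unfolding eqpoll_def by (intro exI[of _ snd] bij_betw_byWitness[where f'="Pair ()"]) auto
 finally show ?thesis .
qed

context fusion_family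
begin

text \<open>By adjunction, \<open>Hom(U \<otimes> X, B)\<close> embeds into \<open>Hom(X, V \<otimes> B)\<close>; for simple \<open>X\<close>, \<open>B\<close> and \<open>V = A i\<close>,
 \<open>U = A i'\<close> the dimensions are multiplicities, by Schur's lemma.\<close>
lemma multiplicity_le:
 assumes dual: "dual_pair (E i) (A i) (E i') (A i') \<kappa> \<mu>" and I: "i \<in> I" "i' \<in> I" "j \<in> I" "k \<in> I"
 shows "N i' j k \<le> N i k j"
proof (rule ccontr)
 assume "\<not> ?thesis"
 then have less: "N i k j < N i' j k" by simp
 obtain \<iota> \<pi> where dec: "decomposition (E i' \<times> E j) (prod_comatrix (A i') (A j)) (SIGMA t:I. {..<N i' j t}) E A \<iota> \<pi>"
  using fusion[OF I(2,3)] by blast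
 obtain \<iota>' \<pi>' where dec': "decomposition (E i \<times> E k) (prod_comatrix (A i) (A k)) (SIGMA t:I. {..<N i k t}) E A \<iota>' \<pi>'"
  using fusion[OF I(1,4)] by blast
 note D = decompositionD[OF dec] and D' = decompositionD[OF dec']
 obtain F where F: "\<And>g B. comatrix_hom (E i' \<times> E j) (prod_comatrix (A i') (A j)) (E k) B g \<Longrightarrow>
   comatrix_hom (E j) (A j) (E i \<times> E k) (prod_comatrix (A i) B) (F g)"
  "\<And>g B. comatrix_hom (E i' \<times> E j) (prod_comatrix (A i') (A j)) (E k) B g \<Longrightarrow>
   (\<And>y x. y \<in> E i \<times> E k \<Longrightarrow> x \<in> E j \<Longrightarrow> F g y x = 0) \<Longrightarrow> (\<forall>y\<in>E k. \<forall>z\<in>E i' \<times> E j. g y z = 0)"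
  "\<And>(J :: nat set) c g. F (\<lambda>y z. SUM j:J. c j * g j y z) = (\<lambda>y x. SUM j:J. c j * F (g j) y x)"
 proof (rule hom_adjunction[OF dual comatrix_E[OF I(3)] finite_E[OF I(4)]], goal_cases)
  case (1 F)
  show ?case by (rule 1(1)[of F]) (fact 1)+
 qed
 have \<pi>: "comatrix_hom (E i' \<times> E j) (prod_comatrix (A i') (A j)) (E k) (A k) (\<pi> (k, n))" if "n < N i' j k" for n
  using D(3)[of "(k, n)"] that I by simp
 have \<pi>': "comatrix_hom (E i \<times> E k) (prod_comatrix (A i) (A k)) (E (fst p)) (A (fst p)) (\<pi>' p)" if "p \<in> (SIGMA t:I. {..<N i k t})" for p
  using D'(3)[OF that] .
 let ?h = "\<lambda>n p c x. SUM y:E i \<times> E k. \<pi>' p c y * F (\<pi> (k, n)) y x"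
 have hom: "comatrix_hom (E j) (A j) (E (fst p)) (A (fst p)) (?h n p)" if "n < N i' j k" "p \<in> (SIGMA t:I. {..<N i k t})" for n p
  by (rule comatrix_hom_compose[OF F(1)[OF \<pi>[OF that(1)]] \<pi>'[OF that(2)]])
 have "\<exists>s. \<forall>c\<in>E j. \<forall>x\<in>E j. ?h n (j, m) c x = (if c = x then s else 0)" if "n < N i' j k" "m < N i k j" for n m
 proof -
  have "comatrix_hom (E j) (A j) (E j) (A j) (?h n (j, m))" using hom[OF that(1), of "(j, m)"] that(2) I by simp
  from schur_scalar[OF irreducible[OF I(3)] this] obtain s where "\<And>r r'. r \<in> E j \<Longrightarrow> r' \<in> E j \<Longrightarrow> ?h n (j, m) r r' = (if r = r' then s else 0)" by blast
  then show ?thesis by (intro exI[of _ s] ballI)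
 qed
 note ex = this
 define s where "s m n = (SOME s. \<forall>c\<in>E j. \<forall>x\<in>E j. ?h n (j, m) c x = (if c = x then s else 0))" for m n
 have s: "?h n (j, m) c x = (if c = x then s m n else 0)"
  if "n < N i' j k" "m < N i k j" "c \<in> E j" "x \<in> E j" for n m c x
  using someI_ex[OF ex[OF that(1,2)]] that(3,4) unfolding s_def by blast
 \<comment> \<open>If there were more projections than multiplicities, some nontrivial combination of their adjoints would have no component in any copy of \<open>A j\<close>, and hence be zero.\<close>
 obtain c where c: "\<exists>n\<in>{..<N i' j k}. c n \<noteq> 0" "\<And>m. m < N i k j \<Longrightarrow> (\<Sum>n<N i' j k. s m n * c n) = 0"
  using homogeneous_system[of "{..<N i k j}" "{..<N i' j k}" s] less by auto
 define g where "g y z = (\<Sum>n<N i' j k. c n * \<pi> (k, n) y z)" for y z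
 have g: "comatrix_hom (E i' \<times> E j) (prod_comatrix (A i') (A j)) (E k) (A k) g"
 proof (rule comatrix_homI)
  fix f t r assume f: "lin scale (*) f" and t: "t \<in> E k" and r: "r \<in> E i' \<times> E j"
  have "(SUM r':E i' \<times> E j. g t r' * f (prod_comatrix (A i') (A j) r' r)) =
   (\<Sum>n<N i' j k. c n * (SUM r':E i' \<times> E j. \<pi> (k, n) t r' * f (prod_comatrix (A i') (A j) r' r)))"
   unfolding g_def sum_distrib_left sum_distrib_right by (subst sum.swap) (simp add: mult.assoc)
  also have "\<dots> = (\<Sum>n<N i' j k. c n * (SUM t':E k. f (A k t t') * \<pi> (k, n) t' r))"
   by (intro sum.cong refl) (simp add: comatrix_hom_functional[OF \<pi> f t r])
  also have "\<dots> = (SUM t':E k. f (A k t t') * g t' r)"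
   unfolding g_def sum_distrib_left by (subst sum.swap) (simp add: ac_simps)
  finally show "(SUM r':E i' \<times> E j. g t r' * f (prod_comatrix (A i') (A j) r' r)) = (SUM t':E k. f (A k t t') * g t' r)" .
 qed
 have Fg: "F g y x = (\<Sum>n<N i' j k. c n * F (\<pi> (k, n)) y x)" for y x
  unfolding g_def by (subst F(3)) (rule refl)
 have proj0: "(SUM y:E i \<times> E k. \<pi>' p b y * F g y x) = 0"
  if p: "p \<in> (SIGMA t:I. {..<N i k t})" and b: "b \<in> E (fst p)" and x: "x \<in> E j" for p b x
 proof -
  have eq: "(SUM y:E i \<times> E k. \<pi>' p b y * F g y x) = (\<Sum>n<N i' j k. c n * ?h n p b x)"
   unfolding Fg sum_distrib_left by (subst sum.swap) (simp add: ac_simps)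
  show ?thesis
  proof (cases "fst p = j")
   case True
   then obtain m where m: "p = (j, m)" "m < N i k j" using p by auto
   have "(\<Sum>n<N i' j k. c n * ?h n p b x) = (\<Sum>n<N i' j k. c n * (if b = x then s m n else 0))"
    using s[OF _ m(2) _ x, of _ b] b m(1) by (intro sum.cong refl) auto
   also have "\<dots> = 0" using c(2)[OF m(2)] by (cases "b = x") (simp_all add: mult.commute)
   finally show ?thesis unfolding eq .
  next
   case False
   have "?h n p b x = 0" if "n < N i' j k" for n
    by (rule hom0[OF I(3) _ _ hom[OF that p] b x]) (use p False in auto)
   then show ?thesis unfolding eq by simp
  qed
 qed
 have "F g y x = 0" if y: "y \<in> E i \<times> E k" and x: "x \<in> E j" for y x
 proof -
  have "F g y x = (SUM y':E i \<times> E k. (SUM p:(SIGMA t:I. {..<N i k t}). SUM b:E (fst p). \<iota>' p y b * \<pi>' p b y') * F g y' x)"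
   by (simp add: D'(5)[OF y] sum_delta_mult[OF _ y] finite_E I cong: sum.cong)
  also have "\<dots> = (SUM p:(SIGMA t:I. {..<N i k t}). SUM b:E (fst p). \<iota>' p y b * (SUM y':E i \<times> E k. \<pi>' p b y' * F g y' x))"
   unfolding sum_distrib_left sum_distrib_right
   by (subst sum.swap, rule sum.cong[OF refl], subst sum.swap) (simp add: mult.assoc)
  also have "\<dots> = 0" by (intro sum.neutral ballI) (simp add: proj0[OF _ _ x])
  finally show ?thesis .
 qed
 from F(2)[OF g this] have g0: "g y z = 0" if "y \<in> E k" "z \<in> E i' \<times> E j" for y z using that by blast
 obtain n where n: "n < N i' j k" "c n \<noteq> 0" using c(1) by auto
 obtain y where y: "y \<in> E k" using irreducibleD(3)[OF irreducible[OF I(4)]] by auto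
 have "0 = (SUM z:E i' \<times> E j. g y z * \<iota> (k, n) z y)" using g0[OF y] by simp
 also have "\<dots> = (\<Sum>m<N i' j k. c m * (SUM z:E i' \<times> E j. \<pi> (k, m) y z * \<iota> (k, n) z y))"
  unfolding g_def sum_distrib_left sum_distrib_right by (subst sum.swap) (simp add: mult.assoc)
 also have "\<dots> = (\<Sum>m<N i' j k. c m * (if m = n then 1 else 0))"
  using D(4)[of "(k, _)" "(k, n)" y y] I y n by (intro sum.cong refl) auto
 also have "\<dots> = c n" using n by (simp add: sum_delta_mult)
 finally show False using n by simp
qed

text \<open>\<open>Ext(A j, A i) = Ext(A i' \<otimes> A j, 1)\<close> is the direct sum of the \<open>Ext(A k, 1)\<close> with multiplicities
 \<open>dim Hom(A k, A i' \<otimes> A j) = dim Hom(A i \<otimes> A k, A j)\<close>.\<close>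
theorem ext_count:
 assumes dual: "dual_pair (E i) (A i) (E i') (A i') \<kappa> \<mu>" "dual_pair (E i') (A i') (E i) (A i) \<kappa>' \<mu>'"
  and I: "i \<in> I" "i' \<in> I" "j \<in> I"
  and \<beta>: "vector_space.basis_mod (mscale scale) (ext_cocycles (E i) (A i) (E j) (A j)) (ext_coboundaries (E i) (A i) (E j) (A j)) \<beta>"
  and \<gamma>: "\<And>k. k \<in> I \<Longrightarrow> vector_space.basis_mod (mscale scale) (ext_cocycles {()} (\<lambda>_ _. \<one>) (E k) (A k))
   (ext_coboundaries {()} (\<lambda>_ _. \<one>) (E k) (A k)) (\<gamma> k)"
 shows "\<beta> \<approx> (SIGMA k:I. \<gamma> k \<times> {..<N i k j})"
proof -
 interpret M: vector_space "mscale scale :: _ \<Rightarrow> (unit \<Rightarrow> 'e \<times> 'e \<Rightarrow> 'h) \<Rightarrow> _" by (rule vs_matrices)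
 have N: "N i' j k = N i k j" if "k \<in> I" for k
  using multiplicity_le[OF dual(1) I that] multiplicity_le[OF dual(2) I(2,1) that I(3)] by simp
 note prod = comatrix_prod[OF comatrix_E[OF I(2)] comatrix_E[OF I(3)]]
 obtain \<delta> where \<delta>: "M.basis_mod (ext_cocycles {()} (\<lambda>_ _. \<one>) (E i' \<times> E j) (prod_comatrix (A i') (A j)))
   (ext_coboundaries {()} (\<lambda>_ _. \<one>) (E i' \<times> E j) (prod_comatrix (A i') (A j))) \<delta>"
  by (rule M.basis_mod_exists[OF subspace_ext_cocycles subspace_ext_coboundaries ext_coboundaries_subset[OF comatrix_one prod]]) (rule that)
 obtain \<iota> \<pi> where dec: "decomposition (E i' \<times> E j) (prod_comatrix (A i') (A j)) (SIGMA t:I. {..<N i' j t}) E A \<iota> \<pi>"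
  using fusion[OF I(2,3)] by blast
 have "\<beta> \<approx> \<delta>" by (rule ext_dual[OF dual(1) comatrix_E[OF I(3)] \<beta> \<delta>])
 also have "\<delta> \<approx> (SIGMA p:(SIGMA t:I. {..<N i' j t}). \<gamma> (fst p))"
  by (rule ext_decomposition[OF comatrix_one prod dec _ \<delta> \<gamma>]) (auto simp: comatrix_E)
 also have "\<dots> \<approx> (SIGMA k:I. \<gamma> k \<times> {..<N i k j})"
  unfolding eqpoll_def
  by (intro exI[of _ "\<lambda>((k, n), c). (k, c, n)"] bij_betw_byWitness[where f'="\<lambda>(k, c, n). ((k, n), c)"]) (auto simp: N)
 finally show ?thesis .
qed

end

section \<open>Comodules, fusion coefficients and arrows in coordinates\<close>

text \<open>An infinite set absorbs the finite factor.\<close>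
lemma times_lessThan_eqpoll_cancel:
 assumes "A \<times> {..<n} \<approx> B \<times> {..<n}" "n > (0::nat)"
 shows "A \<approx> B"
proof -
 have ne: "{..<n} \<noteq> {}" using assms(2) by auto
 have self: "X \<times> {..<n} \<approx> X" if "infinite X" for X :: "'x set"
  using card_of_Times_infinite_simps(1)[OF that ne] finite_lepoll_infinite[OF that, of "{..<n}"]
  by (simp add: eqpoll_iff_card_of_ordIso lepoll_def card_of_ordLeq)
 have fin: "finite A \<longleftrightarrow> finite B"
  using eqpoll_finite_iff[OF assms(1)] ne by (auto simp: finite_cartesian_product_iff)
 show ?thesis
 proof (cases "finite A")
  case True
  then have "card (A \<times> {..<n}) = card (B \<times> {..<n})" using eqpoll_iff_card[of "A \<times> {..<n}" "B \<times> {..<n}"] fin assms(1) by auto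
  then show ?thesis using True fin assms(2) by (simp add: card_cartesian_product eqpoll_iff_card)
 next
  case False
  then show ?thesis using self[of A] self[of B] fin assms(1) by (meson eqpoll_sym eqpoll_trans)
 qed
qed

context coalgebra
begin

text \<open>By linearity in the vector the matrix coefficients are spanned by those of basis vectors;
 for a form dual to the basis such a coefficient is an entry of \<open>A\<close>.\<close>
lemma coefficient_coalgebra_entries:
 assumes \<rho>: "right_comodule sV V \<rho>" and E: "finite E" "\<not> module.dependent sV E" "V = module.span sV E"
  and A: "\<And>b. b \<in> E \<Longrightarrow> \<rho> b = (SUM a:E. tensor sV scale a (A a b))"
 shows "coefficient_coalgebra sV V \<rho> = entries E A"
proof -
 note V = comoduleD[OF \<rho>]
 interpret V: vector_space sV by fact
 have EV: "E \<subseteq> V" unfolding E(3) by (rule V.span_superset)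
 obtain d where d: "\<And>a. lin sV (*) (d a)" "\<And>a b. a \<in> E \<Longrightarrow> b \<in> E \<Longrightarrow> d a b = (if a = b then 1 else 0)"
  "\<And>v. v \<in> V \<Longrightarrow> v = (SUM a:E. sV (d a v) a)"
  by (rule finite_basis_dual[OF V(1) E]) (rule that)
 let ?c = "\<lambda>f v. SUM (v0, h)<-coact sV V \<rho> v. f v0 *s h"
 have bil: "bilinear_on sV scale scale V UNIV (\<lambda>v h. f v *s h)" if "lin sV (*) f" for f
  using that by (auto simp: bilinear_on_def linear_on_def lin_add lin_scale scale_left_distrib scale_right_distrib ac_simps)
 have basis: "?c f b = (SUM a:E. f a *s A a b)" if "lin sV (*) f" "b \<in> E" for f b
  by (rule coact_eq[OF \<rho> _ vs bil[OF that(1)] _ A[OF that(2)]]) (use that EV in auto)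
 have mem: "?c f v \<in> entries E A" if f: "lin sV (*) f" and v: "v \<in> V" for f v
 proof -
  note L = coact_linear_on[OF \<rho> vs bil[OF f]]
  have "v \<in> V \<and> ?c f v \<in> entries E A" using v unfolding E(3)
  proof (induction rule: V.span_induct_alt)
   case base
   have "?c f 0 = ?c f (sV 0 0)" by simp
   also have "\<dots> = 0 *s ?c f 0" using L V.subspace_0[OF V(2)] unfolding linear_on_def by blast
   finally show ?case unfolding E(3)[symmetric] using subspace_0[OF subspace_entries, of E A] V.subspace_0[OF V(2)] by simp
  next
   case (step c x y)
   have xy: "x \<in> V" "y \<in> V" "sV c x \<in> V" using step EV V.subspace_scale[OF V(2)] unfolding E(3)[symmetric] by auto
   have "?c f (sV c x + y) = c *s ?c f x + ?c f y" using L xy unfolding linear_on_def by auto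
   moreover have "?c f x \<in> entries E A" unfolding basis[OF f step.hyps]
    by (intro subspace_sum[OF subspace_entries] subspace_scale[OF subspace_entries] in_entries) (use step.hyps in auto)
   ultimately show ?case unfolding E(3)[symmetric] using step.IH[folded E(3)] V.subspace_add[OF V(2) xy(3,2)]
    by (simp add: subspace_add[OF subspace_entries] subspace_scale[OF subspace_entries])
  qed
  then show ?thesis by blast
 qed
 have "A a b \<in> coefficient_coalgebra sV V \<rho>" if "a \<in> E" "b \<in> E" for a b
 proof -
  have "?c (d a) b = (SUM c:E. if c = a then A c b else 0)"
   unfolding basis[OF d(1) that(2)] by (rule sum.cong) (use d(2)[OF that(1)] in auto)
  then have "?c (d a) b = A a b" using E(1) that by simp
  then show ?thesis unfolding coefficient_coalgebra_def using d(1) that EV by (intro span_base CollectI) (metis subsetD)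
 qed
 then show ?thesis using mem unfolding coefficient_coalgebra_def entries_def
  by (intro subset_antisym span_minimal subspace_span) auto
qed

text \<open>\<open>A\<close> and \<open>B\<close> are conjugate if \<open>\<Lambda>\<close> is invertible.\<close>
lemma entries_subset_if_iso:
 assumes \<Lambda>: "comatrix_hom R A T B \<Lambda>"
  and inv: "\<And>t t'. t \<in> T \<Longrightarrow> t' \<in> T \<Longrightarrow> (SUM r:R. \<Lambda> t r * M r t') = (if t = t' then 1 else 0)" and T: "finite T"
 shows "entries T B \<subseteq> entries R A"
proof -
 have "B t t' \<in> entries R A" if t: "t \<in> T" "t' \<in> T" for t t'
 proof -
  have "(SUM r:R. M r t' *s (SUM r':R. \<Lambda> t r' *s A r' r)) = (SUM r:R. M r t' *s (SUM t'':T. \<Lambda> t'' r *s B t t''))"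
   using comatrix_homD[OF \<Lambda> t(1)] by simp
  also have "\<dots> = (SUM t'':T. (SUM r:R. \<Lambda> t'' r * M r t') *s B t t'')"
   unfolding scale_sum_right scale_sum_left scale_scale by (subst sum.swap) (simp add: mult.commute)
  also have "\<dots> = (SUM t'':T. if t'' = t' then B t t' else 0)" by (intro sum.cong refl) (simp add: inv t)
  also have "\<dots> = B t t'" using t T by simp
  finally have eq: "(SUM r:R. M r t' *s (SUM r':R. \<Lambda> t r' *s A r' r)) = B t t'" .
  show ?thesis unfolding eq[symmetric]
   by (intro subspace_sum[OF subspace_entries] subspace_scale[OF subspace_entries] in_entries)
 qed
 then show ?thesis unfolding entries_def[of T B] by (intro span_minimal subspace_entries) auto
qed

text \<open>The injections are homomorphisms because they are inverse to the projections.\<close>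
lemma decompositionI:
 assumes P: "finite P" and X: "finite X" and E: "\<And>p. p \<in> P \<Longrightarrow> finite (E (fst p))"
  and \<pi>: "\<And>p. p \<in> P \<Longrightarrow> comatrix_hom X G (E (fst p)) (A (fst p)) (\<pi> p)"
  and \<pi>\<iota>: "\<And>p q c c'. p \<in> P \<Longrightarrow> q \<in> P \<Longrightarrow> c \<in> E (fst p) \<Longrightarrow> c' \<in> E (fst q) \<Longrightarrow>
   (SUM x:X. \<pi> p c x * \<iota> q x c') = (if p = q \<and> c = c' then 1 else 0)"
  and \<iota>\<pi>: "\<And>x x'. x \<in> X \<Longrightarrow> x' \<in> X \<Longrightarrow> (SUM p:P. SUM c:E (fst p). \<iota> p x c * \<pi> p c x') = (if x = x' then 1 else 0)"
 shows "decomposition X G P E A \<iota> \<pi>"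
proof -
 let ?S = "SIGMA p:P. E (fst p)"
 have S: "(SUM p:P. SUM c:E (fst p). g p c) = (SUM y:?S. g (fst y) (snd y))" for g :: "_ \<Rightarrow> _ \<Rightarrow> 'a"
  by (subst sum.Sigma) (use P E in \<open>auto simp: split_def\<close>)
 have "comatrix_hom (E (fst q)) (A (fst q)) X G (\<iota> q)" if q: "q \<in> P" for q
 proof (rule comatrix_homI)
  fix f x0 c1 assume f: "lin scale (*) f" and x0: "x0 \<in> X" and c1: "c1 \<in> E (fst q)"
  have "(SUM x:X. f (G x0 x) * \<iota> q x c1) = (SUM x:X. SUM x':X. (if x0 = x' then 1 else 0) * (f (G x' x) * \<iota> q x c1))"
   by (intro sum.cong refl) (simp only: sum_delta_mult(2)[OF X x0])
  also have "\<dots> = (SUM x:X. SUM x':X. (SUM p:P. SUM c:E (fst p). \<iota> p x0 c * \<pi> p c x') * (f (G x' x) * \<iota> q x c1))"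
   by (intro sum.cong refl) (simp add: \<iota>\<pi>[OF x0])
  also have "\<dots> = (SUM p:P. SUM c:E (fst p). \<iota> p x0 c * (SUM x:X. (SUM x':X. \<pi> p c x' * f (G x' x)) * \<iota> q x c1))"
   unfolding S unfolding sum_distrib_left sum_distrib_right sum.cartesian_product
   by (rule sum.reindex_bij_witness[of _ "\<lambda>(a, b, c). (b, c, a)" "\<lambda>(b, c, a). (a, b, c)"]) (auto simp: ac_simps)
  also have "\<dots> = (SUM p:P. SUM c:E (fst p). \<iota> p x0 c * (SUM x:X. (SUM c':E (fst p). f (A (fst p) c c') * \<pi> p c' x) * \<iota> q x c1))"
   by (intro sum.cong refl) (simp add: comatrix_hom_functional[OF \<pi> f])
  also have "\<dots> = (SUM p:P. SUM c:E (fst p). \<iota> p x0 c * (SUM c':E (fst p). f (A (fst p) c c') * (SUM x:X. \<pi> p c' x * \<iota> q x c1)))"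
   unfolding sum_distrib_left sum_distrib_right
   by (intro sum.cong refl, subst sum.swap) (simp add: ac_simps)
  also have "\<dots> = (SUM p:P. if p = q then SUM c:E (fst p). \<iota> p x0 c * (SUM c':E (fst p). f (A (fst p) c c') * (if c' = c1 then 1 else 0)) else 0)"
   by (intro sum.cong refl) (auto simp: \<pi>\<iota> q c1 cong: sum.cong)
  also have "\<dots> = (SUM c:E (fst q). \<iota> q x0 c * f (A (fst q) c c1))"
   using P q by (simp add: sum_delta_mult[OF E[OF q] c1])
  finally show "(SUM c:E (fst q). \<iota> q x0 c * f (A (fst q) c c1)) = (SUM x:X. f (G x0 x) * \<iota> q x c1)" ..
 qed
 then show ?thesis unfolding decomposition_def using assms by blast
qed

end

context coalgebra_alg_closed
begin

text \<open>The case of a single comatrix: the \<open>(card R)\<^sup>2\<close> entries form a basis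
 of the coefficient coalgebra.\<close>
lemma irreducible_entries_dual:
 assumes A: "irreducible_comatrix R A"
 obtains cs where "\<And>a b. lin scale (*) (cs a b)"
  "\<And>a b a' b'. a \<in> R \<Longrightarrow> b \<in> R \<Longrightarrow> a' \<in> R \<Longrightarrow> b' \<in> R \<Longrightarrow> cs a b (A a' b') = (if a = a' \<and> b = b' then 1 else 0)"
  "dim (entries R A) = (card R)\<^sup>2"
proof -
 note fin = irreducibleD(2)[OF A]
 let ?z = "\<lambda>(a, b). A a b"
 have ind: "\<forall>p\<in>R \<times> R. x p = 0" if "(SUM p:R \<times> R. x p *s ?z p) = 0" for x
 proof -
  have "(SUM (t, a):Sigma {()} (\<lambda>_. R). SUM b:R. x (a, b) *s A a b) = (SUM a:R. SUM b:R. x (a, b) *s A a b)"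
   using fin by (subst sum.Sigma[symmetric]) auto
  also have "\<dots> = 0" using that by (simp add: sum.cartesian_product split_def)
  finally show ?thesis
   using irreducible_entries_independent[where F="{()}" and E="\<lambda>_. R" and A="\<lambda>_. A" and x="\<lambda>_ a b. x (a, b)"] A by auto
 qed
 obtain d where d: "\<And>p. lin scale (*) (d p)" "\<And>p q. p \<in> R \<times> R \<Longrightarrow> q \<in> R \<times> R \<Longrightarrow> d p (?z q) = (if p = q then 1 else 0)"
  by (rule independent_family_dual[OF vs _ ind]) (use fin in simp, assumption, rule that)
 have inj: "inj_on ?z (R \<times> R)"
  by (rule inj_onI) (metis d(2) zero_neq_one)
 have "independent (?z ` (R \<times> R))"
 proof (rule independent_if_scalars_zero)
  fix f y assume f: "(SUM y:?z ` (R \<times> R). f y *s y) = 0" and y: "y \<in> ?z ` (R \<times> R)"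
  then have "(SUM p:R \<times> R. f (?z p) *s ?z p) = 0" by (simp add: sum.reindex[OF inj])
  from ind[OF this] y show "f y = 0" by auto
 qed (use fin in simp)
 then have "dim (span (?z ` (R \<times> R))) = card (?z ` (R \<times> R))" by (rule dim_span_eq_card_independent)
 moreover have "entries R A = span (?z ` (R \<times> R))" unfolding entries_def by (rule arg_cong[where f=span]) auto
 ultimately have "dim (entries R A) = card (?z ` (R \<times> R))" by (simp only:)
 also have "\<dots> = (card R)\<^sup>2" by (simp add: card_image[OF inj] card_cartesian_product power2_eq_square)
 finally show ?thesis using d by (intro that[of "\<lambda>a b. d (a, b)"]) auto
qed

end

lemma linear_on_sum:
 assumes f: "linear_on sV sW V f" and V: "vector_space sV" "module.subspace sV V" and W: "vector_space sW"
  and x: "\<And>i. i \<in> I \<Longrightarrow> x i \<in> V"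
 shows "f (SUM i:I. sV (c i) (x i)) = (SUM i:I. sW (c i) (f (x i)))"
proof -
 interpret V: vector_space sV by fact
 interpret W: vector_space sW by fact
 have "f (sV 0 0) = sW 0 (f 0)" using f V.subspace_0[OF V(2)] unfolding linear_on_def by blast
 then have f0: "f 0 = 0" by simp
 show ?thesis using x
 proof (induction I rule: infinite_finite_induct)
  case (insert i I)
  have "sV (c i) (x i) \<in> V" "(SUM i:I. sV (c i) (x i)) \<in> V"
   using insert.prems by (auto intro!: V.subspace_scale[OF V(2)] V.subspace_sum[OF V(2)])
  then have "f (sV (c i) (x i) + (SUM i:I. sV (c i) (x i))) = f (sV (c i) (x i)) + f (SUM i:I. sV (c i) (x i))"
   using f unfolding linear_on_def by blast
  also have "f (sV (c i) (x i)) = sW (c i) (f (x i))" using f insert.prems unfolding linear_on_def by blast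
  finally show ?case using insert by simp
 qed (simp_all add: f0)
qed

lemma linear_on_sum_list:
 assumes "\<And>y. y \<in> set ys \<Longrightarrow> linear_on sV sW V (\<lambda>x. f y x)" and W: "vector_space sW"
 shows "linear_on sV sW V (\<lambda>x. SUM y<-ys. f y x)"
proof -
 interpret W: vector_space sW by fact
 show ?thesis using assms(1)
  by (induction ys) (auto simp: linear_on_def W.scale_right_distrib)
qed

context coquasi_bialgebra_inverse
begin

text \<open>The sums over chosen representatives in \<open>tensor_coaction\<close> are bilinear, so
 they may be evaluated at the representatives given by the bases.\<close>
lemma tensor_coaction_basis:
 assumes V: "right_comodule sV V \<rho>" and E: "finite E" "E \<subseteq> V"
  and A: "\<And>b. b \<in> E \<Longrightarrow> \<rho> b = (SUM a:E. tensor sV scale a (A a b))"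
  and W: "right_comodule sV W \<sigma>" and F: "finite F" "F \<subseteq> W"
  and B: "\<And>b. b \<in> F \<Longrightarrow> \<sigma> b = (SUM a:F. tensor sV scale a (B a b))"
  and ab: "a \<in> E" "b \<in> F"
 shows "tensor_coaction sV V \<rho> sV W \<sigma> (tensor sV sV a b) =
  (SUM x:E \<times> F. tensor tscale scale (tensor sV sV (fst x) (snd x)) (prod_comatrix A B x (a, b)))"
proof -
 note DV = comoduleD[OF V] and DW = comoduleD[OF W]
 let ?T = "\<lambda>v0 g w0 h. tensor tscale scale (tensor sV sV v0 w0) (g \<cdot> h)"
 have T: "linear_on sV tscale X (\<lambda>v0. ?T v0 g w0 h)" "linear_on scale tscale Y (\<lambda>g. ?T v0 g w0 h)"
  "linear_on sV tscale X (\<lambda>w0. ?T v0 g w0 h)" "linear_on scale tscale Y (\<lambda>h. ?T v0 g w0 h)" for X Y v0 g w0 h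
 proof -
  have L: "linear_on s s' Z p" if "lin s s' p" for s s' Z p
   using that by (auto simp: linear_on_def Vector_Spaces.linear_iff)
  note t = tensor_bilinear[OF vector_space_tscale vs] and t' = tensor_bilinear[OF DV(1) DV(1)]
  show "linear_on sV tscale X (\<lambda>v0. ?T v0 g w0 h)" by (rule L, rule lin_comp[OF bilinear_left[OF t'] bilinear_left[OF t]])
  show "linear_on scale tscale Y (\<lambda>g. ?T v0 g w0 h)"
   by (rule L, rule lin_comp[OF bilinear_left[OF mult_bilinear] bilinear_right[OF t]])
  show "linear_on sV tscale X (\<lambda>w0. ?T v0 g w0 h)" by (rule L, rule lin_comp[OF bilinear_right[OF t'] bilinear_left[OF t]])
  show "linear_on scale tscale Y (\<lambda>h. ?T v0 g w0 h)"
   by (rule L, rule lin_comp[OF bilinear_right[OF mult_bilinear] bilinear_right[OF t]])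
 qed
 let ?S = "\<lambda>v w. SUM (v0, g)<-coact sV V \<rho> v. SUM (w0, h)<-coact sV W \<sigma> w. ?T v0 g w0 h"
 have S': "bilinear_on sV scale tscale V UNIV (\<lambda>v0 g. SUM (w0, h)<-coact sV W \<sigma> w. ?T v0 g w0 h)" for w
  unfolding bilinear_on_def split_def by (intro conjI ballI linear_on_sum_list vector_space_tscale T)
 have S: "bilinear_on sV sV tscale V W ?S"
  unfolding bilinear_on_def
 proof (intro conjI ballI)
  show "linear_on sV tscale W (?S v)" for v
   unfolding split_def
   by (intro linear_on_sum_list vector_space_tscale coact_linear_on[OF W vector_space_tscale, unfolded split_def])
    (intro bilinear_on_def[THEN iffD2] conjI ballI T)
  show "linear_on sV tscale V (\<lambda>v. ?S v w)" for w
   by (rule coact_linear_on[OF V vector_space_tscale S'])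
 qed
 have "tensor_coaction sV V \<rho> sV W \<sigma> (tensor sV sV a b) = (SUM i:{()}. ?S a b)"
  unfolding tensor_coaction_def
  by (rule tensor_rep_sum[OF DV(1,2) DW(1,2) vector_space_tscale S]) (use ab E F in auto)
 also have "\<dots> = (SUM v0:E. SUM (w0, h)<-coact sV W \<sigma> b. ?T v0 (A v0 a) w0 h)"
  using coact_eq[OF V _ vector_space_tscale S' _ A[OF ab(1)]] E ab by auto
 also have "\<dots> = (SUM v0:E. SUM w0:F. ?T v0 (A v0 a) w0 (B w0 b))"
  by (intro sum.cong refl coact_eq[OF W _ vector_space_tscale _ _ B[OF ab(2)]] bilinear_on_def[THEN iffD2] conjI ballI T)
   (use F ab in auto)
 finally show ?thesis by (simp add: sum_Times)
qed

text \<open>The projections are the coordinates of the images of the basis tensors under the given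
 isomorphism, the injections are the coordinates of the preimages of the basis vectors of the
 summands. Only finitely many summands occur, since the images of the finitely many basis tensors
 have finite support.\<close>
lemma fusion_decomposition:
 assumes V: "\<And>t. t \<in> I \<Longrightarrow> right_comodule sV (V t) (\<rho> t)"
  and E: "\<And>t. t \<in> I \<Longrightarrow> finite (E t)" "\<And>t. t \<in> I \<Longrightarrow> \<not> module.dependent sV (E t)"
   "\<And>t. t \<in> I \<Longrightarrow> V t = module.span sV (E t)" "\<And>t. t \<in> I \<Longrightarrow> E t \<noteq> {}"
  and A: "\<And>t b. t \<in> I \<Longrightarrow> b \<in> E t \<Longrightarrow> \<rho> t b = (SUM a:E t. tensor sV scale a (A t a b))"
  and iso: "comodule_isomorphic tscale (tensor_space sV sV (V s) (V t)) (tensor_coaction sV (V s) (\<rho> s) sV (V t) (\<rho> t))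
    (pointwise_scale sV) (direct_sum P (V \<circ> fst)) (direct_sum_coaction sV (V \<circ> fst) (\<rho> \<circ> fst))"
  and st: "s \<in> I" "t \<in> I" and P: "fst ` P \<subseteq> I"
 obtains \<iota> \<pi> where "decomposition (E s \<times> E t) (prod_comatrix (A s) (A t)) P E A \<iota> \<pi>"
proof -
 note DV = comoduleD[OF V]
 have sV: "vector_space sV" by (rule DV(1)[OF st(1)])
 interpret V: vector_space sV by fact
 note vpw = vector_space_pointwise[OF sV]
 have PI: "fst p \<in> I" if "p \<in> P" for p using that P by auto
 have EV: "E t \<subseteq> V t" if "t \<in> I" for t unfolding E(3)[OF that] by (rule V.span_superset)
 let ?D = "\<lambda>t d. (\<forall>a. lin sV (*) (d a)) \<and> (\<forall>a\<in>E t. \<forall>b\<in>E t. d a b = (if a = b then 1 else 0)) \<and>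
  (\<forall>v\<in>V t. v = (SUM a:E t. sV (d a v) a))"
 define d where "d t = (SOME d. ?D t d)" for t
 have "\<exists>d. ?D t d" if "t \<in> I" for t
  by (rule finite_basis_dual[OF sV E(1-3)[OF that]]) (intro exI conjI ballI allI)
 note D = someI_ex[OF this, folded d_def]
 have d: "lin sV (*) (d t a)" if "t \<in> I" for t a using D[OF that] by blast
 have dE: "d t a b = (if a = b then 1 else 0)" if "t \<in> I" "a \<in> E t" "b \<in> E t" for t a b using D[OF that(1)] that by blast
 have dV: "(SUM a:E t. sV (d t a v) a) = v" if "t \<in> I" "v \<in> V t" for t v using D[OF that(1)] that by metis
 let ?X = "E s \<times> E t" and ?G = "prod_comatrix (A s) (A t)"
 let ?TV = "tensor_space sV sV (V s) (V t)" and ?\<tau> = "tensor_coaction sV (V s) (\<rho> s) sV (V t) (\<rho> t)"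
 let ?DS = "direct_sum P (V \<circ> fst)" and ?\<sigma> = "direct_sum_coaction sV (V \<circ> fst) (\<rho> \<circ> fst)"
 obtain f where f: "linear_on tscale (pointwise_scale sV) ?TV f" "bij_betw f ?TV ?DS"
  and hom: "\<And>v. v \<in> ?TV \<Longrightarrow> ?\<sigma> (f v) = (SUM (v0, h)<-coact tscale ?TV ?\<tau> v. tensor (pointwise_scale sV) scale (f v0) h)"
  using iso unfolding comodule_isomorphic_def by blast
 have fin: "finite ?X" using E(1) st by simp
 define e where "e x = tensor sV sV (fst x) (snd x)" for x
 have e: "e x \<in> ?TV" if "x \<in> ?X" for x using that EV[OF st(1)] EV[OF st(2)] unfolding e_def by (intro tensor_in_space) auto
 \<comment> \<open>Evaluating a tensor at \<open>form x\<close> gives its coordinate with respect to \<open>e x\<close>.\<close>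
 define form where "form x = (\<lambda>v w. d s (fst x) v * d t (snd x) w)" for x
 have form: "bilinear_map sV sV (*) (form x)" for x unfolding form_def by (rule bilinear_form_functionals[OF d[OF st(1)] d[OF st(2)]])
 have eform: "e x (form y) = (if x = y then 1 else 0)" if "x \<in> ?X" "y \<in> ?X" for x y
  using that dE st unfolding e_def tensor_apply[OF form] unfolding form_def by (auto simp: prod_eq_iff)
 interpret T: vector_space "tscale :: 'k \<Rightarrow> ('b, 'b, 'k) tensor \<Rightarrow> _" by (rule vector_space_tscale)
 have expand: "u = (SUM x:?X. tscale (u (form x)) (e x))" if u: "u \<in> ?TV" for u
 proof -
  interpret TT: vector_space_pair "tscale :: 'k \<Rightarrow> ('b, 'b, 'k) tensor \<Rightarrow> _" "tscale :: 'k \<Rightarrow> ('b, 'b, 'k) tensor \<Rightarrow> _" ..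
  have ev: "lin tscale (*) (\<lambda>u :: ('b, 'b, 'k) tensor. u b)" for b
   by (rule linI[OF vector_space_tscale vector_space_mult]) (auto simp: pointwise_scale_def)
  note tb = tensor_bilinear[OF sV sV]
  show ?thesis
  proof (rule TT.linear_eq_on[OF lin_id[OF vector_space_tscale] _ u[unfolded tensor_space_def]])
   show "lin tscale tscale (\<lambda>u. SUM x:?X. tscale (u (form x)) (e x))"
    by (intro lin_sum_fun vector_space_tscale lin_scale_fun ev)
   fix z assume "z \<in> {tensor sV sV v w | v w. v \<in> V s \<and> w \<in> V t}"
   then obtain v w where vw: "z = tensor sV sV v w" "v \<in> V s" "w \<in> V t" by auto
   have "z = tensor sV sV (SUM a:E s. sV (d s a v) a) (SUM b:E t. sV (d t b w) b)"
    using dV st vw by simp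
   also have "\<dots> = (SUM a:E s. SUM b:E t. tscale (d s a v * d t b w) (tensor sV sV a b))"
    by (simp add: lin_sum[OF bilinear_left[OF tb]] lin_sum[OF bilinear_right[OF tb]] lin_scale[OF bilinear_left[OF tb]]
      lin_scale[OF bilinear_right[OF tb]] T.scale_sum_right mult.commute sum.swap[of _ "E t"])
   finally show "z = (SUM x:?X. tscale (z (form x)) (e x))"
    unfolding vw(1) tensor_apply[OF form] by (simp add: sum_Times form_def e_def)
  qed
 qed
 have f_sum: "f (SUM i:K. tscale (c i) (x i)) = (SUM i:K. pointwise_scale sV (c i) (f (x i)))" if "\<And>i. i \<in> K \<Longrightarrow> x i \<in> ?TV" for K :: "'z set" and c x
  by (rule linear_on_sum[OF f(1) vector_space_tscale subspace_tensor_space vpw that])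
 have fDS: "f u \<in> ?DS" if "u \<in> ?TV" for u using f(2) that by (auto simp: bij_betw_def)
 define \<pi> where "\<pi> p c x = d (fst p) c (f (e x) p)" for p c x
 define z where "z p c = (0(p := c))" for p :: "'a \<times> 'c" and c :: 'b
 have z: "z p c \<in> ?DS" if "p \<in> P" "c \<in> E (fst p)" for p c
  using that EV[OF PI[OF that(1)]] by (auto simp: z_def direct_sum_def V.subspace_0[OF DV(2)[OF PI]])
 define u where "u p c = inv_into ?TV f (z p c)" for p c
 have u: "u p c \<in> ?TV" "f (u p c) = z p c" if "p \<in> P" "c \<in> E (fst p)" for p c
  using z[OF that] bij_betw_imp_surj_on[OF f(2)] unfolding u_def by (metis inv_into_into, metis f_inv_into_f)
 define \<iota> where "\<iota> p x c = u p c (form x)" for p x c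
 have z_expand: "z p c = (SUM x:?X. pointwise_scale sV (\<iota> p x c) (f (e x)))" if "p \<in> P" "c \<in> E (fst p)" for p c
  using f_sum[of ?X e "\<lambda>x. \<iota> p x c"] e u[OF that] expand[OF u(1)[OF that]] unfolding \<iota>_def by simp
 have finP: "finite P"
 proof (rule finite_subset)
  show "P \<subseteq> (\<Union>x\<in>?X. {p. f (e x) p \<noteq> 0})"
  proof
   fix p assume p: "p \<in> P"
   obtain c where c: "c \<in> E (fst p)" using E(4)[OF PI[OF p]] by auto
   have "c \<noteq> 0" using dE[OF PI[OF p] c c] lin_zero[OF d[OF PI[OF p]]] by auto
   moreover have "c = (SUM x:?X. sV (\<iota> p x c) (f (e x) p))"
    using fun_cong[OF z_expand[OF p c], of p] by (simp add: z_def sum_apply pointwise_scale_def)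
   ultimately show "p \<in> (\<Union>x\<in>?X. {p. f (e x) p \<noteq> 0})" by (auto intro: ccontr simp: sum.neutral)
  qed
  show "finite (\<Union>x\<in>?X. {p. f (e x) p \<noteq> 0})"
   using fin fDS[OF e] by (auto simp: direct_sum_def)
 qed
 have "decomposition ?X ?G P E A \<iota> \<pi>"
 proof (rule decompositionI[OF finP fin])
  show "finite (E (fst p))" if "p \<in> P" for p using E(1)[OF PI[OF that]] .
  show "comatrix_hom ?X ?G (E (fst p)) (A (fst p)) (\<pi> p)" if p: "p \<in> P" for p
  proof (rule comatrix_homI)
   fix g c x assume g: "lin scale (*) g" and c: "c \<in> E (fst p)" and x: "x \<in> ?X"
   note pI = PI[OF p]
   define b where "b y h = d (fst p) c (y p) * g h" for y h
   have ev: "lin (pointwise_scale sV) sV (\<lambda>y. y p)"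
    by (rule linI[OF vpw sV]) (auto simp: pointwise_scale_def)
   have b: "bilinear_map (pointwise_scale sV) scale (*) b"
    unfolding b_def by (rule bilinear_form_functionals[OF lin_comp[OF ev d[OF pI]] g])
   have bp: "bilinear_map sV scale (*) (\<lambda>v h. d (fst p) c v * g h)" by (rule bilinear_form_functionals[OF d[OF pI] g])
   have val: "\<rho> (fst p) v (\<lambda>v h. d (fst p) c v * g h) = (SUM c':E (fst p). d (fst p) c' v * g (A (fst p) c c'))"
    if v: "v \<in> V (fst p)" for v
   proof -
    have "\<rho> (fst p) v = \<rho> (fst p) (SUM a:E (fst p). sV (d (fst p) a v) a)" using dV[OF pI v] by simp
    also have "\<dots> = (SUM c':E (fst p). tscale (d (fst p) c' v) (\<rho> (fst p) c'))"
     by (rule linear_on_sum[OF DV(3)[OF pI] sV DV(2)[OF pI] vector_space_tscale]) (use EV[OF pI] in auto)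
    finally have \<rho>v: "\<rho> (fst p) v = \<dots>" .
    show ?thesis
     unfolding \<rho>v sum_apply pointwise_scale_def
     by (intro sum.cong refl arg_cong[where f="(*) _"])
      (simp add: A[OF pI] sum_apply tensor_apply[OF bp] dE[OF pI c] sum_delta_mult[OF E(1)[OF pI] c] cong: sum.cong)
   qed
   have y: "f (e x) \<in> ?DS" by (rule fDS[OF e[OF x]])
   have yp: "f (e x) p \<in> V (fst p)" using y p by (auto simp: direct_sum_def)
   have "?\<sigma> (f (e x)) b = (\<Sum>q | f (e x) q \<noteq> 0. SUM (v0, h)<-coact sV (V (fst q)) (\<rho> (fst q)) (f (e x) q). b (0(q := v0)) h)"
    by (simp add: direct_sum_coaction_def sum_apply sum_list_apply split_def tensor_apply[OF b])
   also have "\<dots> = (\<Sum>q | f (e x) q \<noteq> 0. if q = p then \<rho> (fst p) (f (e x) p) (\<lambda>v h. d (fst p) c v * g h) else 0)"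
   proof (rule sum.cong[OF refl])
    fix q
    show "(SUM (v0, h)<-coact sV (V (fst q)) (\<rho> (fst q)) (f (e x) q). b (0(q := v0)) h) =
     (if q = p then \<rho> (fst p) (f (e x) p) (\<lambda>v h. d (fst p) c v * g h) else 0)"
     using coact_form[OF V[OF pI] yp bp] by (simp add: b_def lin_zero[OF d[OF pI]] split_def)
   qed
   also have "\<dots> = (SUM c':E (fst p). g (A (fst p) c c') * \<pi> p c' x)"
    using y val[OF yp] by (auto simp: direct_sum_def \<pi>_def lin_zero[OF d[OF pI]] mult.commute)
   finally have 1: "?\<sigma> (f (e x)) b = \<dots>" .
   have "?\<tau> (e x) = (SUM x':?X. tensor tscale scale (e x') (?G x' x))"
    using tensor_coaction_basis[OF V[OF st(1)] E(1)[OF st(1)] EV[OF st(1)] A[OF st(1)] V[OF st(2)] E(1)[OF st(2)] EV[OF st(2)] A[OF st(2)], of "fst x" "snd x"] x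
    by (auto simp: e_def)
   then have "?\<sigma> (f (e x)) = (SUM x':?X. tensor (pointwise_scale sV) scale (f (e x')) (?G x' x))"
    unfolding hom[OF e[OF x]] coact_def
   proof (rule tensor_rep_sum[OF vector_space_tscale subspace_tensor_space vs subspace_UNIV vector_space_tscale, rotated 3])
    note t = tensor_bilinear[OF vpw vs]
    show "bilinear_on tscale scale tscale ?TV UNIV (\<lambda>v0 h. tensor (pointwise_scale sV) scale (f v0) h)"
     unfolding bilinear_on_def
    proof (intro conjI ballI)
     show "linear_on scale tscale UNIV (tensor (pointwise_scale sV) scale (f v))" for v
      using bilinear_right[OF t] by (auto simp: linear_on_def Vector_Spaces.linear_iff)
     show "linear_on tscale tscale ?TV (\<lambda>v. tensor (pointwise_scale sV) scale (f v) w)" for w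
      using f(1) by (simp add: linear_on_def lin_add[OF bilinear_left[OF t]] lin_scale[OF bilinear_left[OF t]])
    qed
   qed (use e in auto)
   then have "?\<sigma> (f (e x)) b = (SUM x':?X. \<pi> p c x' * g (?G x' x))"
    by (simp add: sum_apply tensor_apply[OF b]) (simp add: b_def \<pi>_def)
   with 1 show "(SUM x':?X. \<pi> p c x' * g (?G x' x)) = (SUM c':E (fst p). g (A (fst p) c c') * \<pi> p c' x)" by simp
  qed
 next
  fix p q c c' assume *: "p \<in> P" "q \<in> P" "c \<in> E (fst p)" "c' \<in> E (fst q)"
  note pI = PI[OF *(1)]
  have "(SUM x:?X. \<pi> p c x * \<iota> q x c') = d (fst p) c (SUM x:?X. sV (\<iota> q x c') (f (e x) p))"
   unfolding \<pi>_def lin_sum[OF d[OF pI]] lin_scale[OF d[OF pI]] by (simp only: mult.commute)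
  also have "(SUM x:?X. sV (\<iota> q x c') (f (e x) p)) = z q c' p"
   using fun_cong[OF z_expand[OF *(2,4)], of p] by (simp add: sum_apply pointwise_scale_def)
  finally show "(SUM x:?X. \<pi> p c x * \<iota> q x c') = (if p = q \<and> c = c' then 1 else 0)"
   using *(3,4) dE[OF pI] lin_zero[OF d[OF pI]] by (auto simp: z_def)
 next
  fix x x' assume x: "x \<in> ?X" "x' \<in> ?X"
  let ?S = "SIGMA p:P. E (fst p)"
  have S: "(SUM p:P. SUM c:E (fst p). g p c) = (SUM y:?S. g (fst y) (snd y))" for g :: "_ \<Rightarrow> _ \<Rightarrow> 'a \<times> 'c \<Rightarrow> 'b"
   by (subst sum.Sigma) (use finP E(1)[OF PI] in \<open>auto simp: split_def\<close>)
  have S': "(SUM p:P. SUM c:E (fst p). g p c) = (SUM y:?S. g (fst y) (snd y))" for g :: "_ \<Rightarrow> _ \<Rightarrow> 'k"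
   by (subst sum.Sigma) (use finP E(1)[OF PI] in \<open>auto simp: split_def\<close>)
  have DSx: "f (e x') \<in> ?DS" by (rule fDS[OF e[OF x(2)]])
  have "f (e x') q = (SUM p:P. SUM c:E (fst p). pointwise_scale sV (\<pi> p c x') (z p c)) q" for q
  proof -
   have "(SUM p:P. SUM c:E (fst p). pointwise_scale sV (\<pi> p c x') (z p c)) q =
    (SUM p:P. if p = q then SUM c:E (fst p). sV (d (fst p) c (f (e x') p)) c else 0)"
    unfolding sum_apply by (intro sum.cong refl) (auto simp: pointwise_scale_def z_def \<pi>_def)
   also have "\<dots> = (SUM p:P. if p = q then f (e x') p else 0)"
    by (intro sum.cong refl) (use DSx dV[OF PI] in \<open>auto simp: direct_sum_def\<close>)
   also have "\<dots> = f (e x') q" using finP DSx by (cases q) (auto simp: direct_sum_def)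
   finally show ?thesis ..
  qed
  then have "f (e x') = (SUM p:P. SUM c:E (fst p). pointwise_scale sV (\<pi> p c x') (z p c))" by (rule ext)
  also have "\<dots> = (SUM p:P. SUM c:E (fst p). pointwise_scale sV (\<pi> p c x') (f (u p c)))"
   by (intro sum.cong refl) (simp add: u(2))
  also have "\<dots> = (SUM y:?S. pointwise_scale sV (\<pi> (fst y) (snd y) x') (f (u (fst y) (snd y))))" by (rule S)
  also have "\<dots> = f (SUM y:?S. tscale (\<pi> (fst y) (snd y) x') (u (fst y) (snd y)))"
   by (rule f_sum[symmetric]) (auto intro: u)
  finally have "e x' = (SUM y:?S. tscale (\<pi> (fst y) (snd y) x') (u (fst y) (snd y)))"
   using f(2) e[OF x(2)] unfolding bij_betw_def
   by (elim conjE inj_onD) (auto intro!: T.subspace_sum[OF subspace_tensor_space] T.subspace_scale[OF subspace_tensor_space] u)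
  from fun_cong[OF this, of "form x"] have "e x' (form x) = (SUM y:?S. \<pi> (fst y) (snd y) x' * \<iota> (fst y) x (snd y))"
   by (simp add: sum_apply pointwise_scale_def \<iota>_def)
  then show "(SUM p:P. SUM c:E (fst p). \<iota> p x c * \<pi> p c x') = (if x = x' then 1 else 0)"
   unfolding S' using eform[OF x(2,1)] by (cases "x = x'") (simp_all add: mult.commute)
 qed
 then show ?thesis by (rule that)
qed

end

lemma (in coquasi_bialgebra) one_nonzero: "\<one> \<noteq> 0"
 using \<epsilon>_one lin_zero[OF \<epsilon>_linear] by auto

lemma (in coquasi_bialgebra) simple_span_one: "span {\<one>} \<in> simple_subcoalgebras"
proof -
 interpret T: vector_space "tscale :: 'k \<Rightarrow> ('h, 'h, 'k) tensor \<Rightarrow> _" by (rule vector_space_tscale)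
 have mem: "c *s \<one> \<in> span {\<one>}" for c by (intro span_scale span_base) simp
 have "\<Delta> x \<in> tensor_space scale scale (span {\<one>}) (span {\<one>})" if "x \<in> span {\<one>}" for x
 proof -
  obtain c where x: "x = c *s \<one>" using \<open>x \<in> span {\<one>}\<close> by (auto simp: span_singleton)
  have "\<Delta> x = tscale c (\<one> \<otimes> \<one>)" unfolding x lin_scale[OF \<Delta>_linear] \<Delta>_one ..
  then show ?thesis
   using mem[of 1] by (simp add: T.subspace_scale[OF subspace_tensor_space] tensor_in_space)
 qed
 then have "subcoalgebra (span {\<one>})" unfolding subcoalgebra_def by simp
 moreover have "D = {0} \<or> D = span {\<one>}" if D: "subcoalgebra D" "D \<subseteq> span {\<one>}" for D
 proof (rule disjCI)
  assume "D \<noteq> span {\<one>}"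
  have sub: "subspace D" using D unfolding subcoalgebra_def by blast
  have "c = 0" if "c *s \<one> \<in> D" for c
  proof (rule ccontr)
   assume "c \<noteq> 0"
   then have "\<one> \<in> D" using subspace_scale[OF sub that, of "inverse c"] by simp
   then have "span {\<one>} \<subseteq> D" using sub by (intro span_minimal) auto
   with D \<open>D \<noteq> span {\<one>}\<close> show False by blast
  qed
  then show "D = {0}" using D(2) subspace_0[OF sub] by (auto simp: span_singleton)
 qed
 moreover have "span {\<one>} \<noteq> {0}" using mem[of 1] one_nonzero by auto
 ultimately show ?thesis unfolding simple_subcoalgebras_def simple_subcoalgebra_def by blast
qed

context coquasi_bialgebra_inverse
begin

lemma irreducible_one: "irreducible_comatrix {()} (\<lambda>_ _. \<one>)"
 unfolding irreducible_comatrix_def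
proof (intro conjI allI impI comatrix_one)
 fix x y :: "unit \<Rightarrow> 'k" assume x: "\<exists>j\<in>{()}. x j \<noteq> 0"
 have "lin scale (*) (\<lambda>h. y () / x () * \<epsilon> h)" by (rule lin_mult_left[OF \<epsilon>_linear])
 then show "\<exists>f. lin scale (*) f \<and> (\<forall>i\<in>{()}. y i = (SUM j:{()}. f \<one> * x j))"
  using x by (intro exI[of _ "\<lambda>h. y () / x () * \<epsilon> h"]) (simp add: \<epsilon>_one)
qed simp

lemma entries_one: "entries {()} (\<lambda>_ _. \<one>) = span {\<one>}"
 unfolding entries_def by (rule arg_cong[where f=span]) auto

lemma wedge_basis_irreducible:
 assumes R: "irreducible_comatrix R C" and T: "irreducible_comatrix T D"
  and B: "basis_mod (entries R C \<and>\<^sub>c entries T D) (entries R C + entries T D) B"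
  and \<beta>: "vector_space.basis_mod (mscale scale) (ext_cocycles R C T D) (ext_coboundaries R C T D) \<beta>"
 shows "B \<approx> (R \<times> T) \<times> \<beta>"
proof -
 obtain cs where cs: "\<And>a b. lin scale (*) (cs a b)"
  "\<And>a b a' b'. a \<in> R \<Longrightarrow> b \<in> R \<Longrightarrow> a' \<in> R \<Longrightarrow> b' \<in> R \<Longrightarrow> cs a b (C a' b') = (if a = a' \<and> b = b' then 1 else 0)"
  by (rule irreducible_entries_dual[OF R]) (rule that)
 obtain ds where ds: "\<And>a b. lin scale (*) (ds a b)"
  "\<And>a b a' b'. a \<in> T \<Longrightarrow> b \<in> T \<Longrightarrow> a' \<in> T \<Longrightarrow> b' \<in> T \<Longrightarrow> ds a b (D a' b') = (if a = a' \<and> b = b' then 1 else 0)"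
  by (rule irreducible_entries_dual[OF T]) (rule that)
 show ?thesis
  by (rule wedge_basis[OF irreducibleD(1)[OF R] irreducibleD(1)[OF T], of cs ds]) (fact cs ds B \<beta>)+
qed

text \<open>The common factor \<open>rs\<close> in the two counts of the dimension of the wedge is
 cancelled.\<close>
lemma arrows_eqpoll:
 assumes Q: "link_quiver Q" and R: "irreducible_comatrix R C" and T: "irreducible_comatrix T D"
  and S: "entries R C \<in> simple_subcoalgebras" "entries T D \<in> simple_subcoalgebras"
  and \<beta>: "vector_space.basis_mod (mscale scale) (ext_cocycles R C T D) (ext_coboundaries R C T D) \<beta>"
 shows "arrows Q (entries T D) (entries R C) \<approx> \<beta>"
proof -
 note fin = irreducibleD(2)[OF R] irreducibleD(2)[OF T]
 have "dim (entries R C) = (card R)\<^sup>2" by (rule irreducible_entries_dual[OF R])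
 moreover have "dim (entries T D) = (card T)\<^sup>2" by (rule irreducible_entries_dual[OF T])
 ultimately obtain B where B: "basis_mod (entries R C \<and>\<^sub>c entries T D) (entries R C + entries T D) B"
  "arrows Q (entries T D) (entries R C) \<times> {..<card R * card T} \<approx> B"
  using Q S unfolding link_quiver_def by blast
 note B(2)
 also have "B \<approx> (R \<times> T) \<times> \<beta>" by (rule wedge_basis_irreducible[OF R T B(1) \<beta>])
 also have "\<dots> \<approx> \<beta> \<times> (R \<times> T)" by (rule times_commute_eqpoll)
 also have "\<dots> \<approx> \<beta> \<times> {..<card R * card T}"
  by (rule times_eqpoll_cong[OF eqpoll_refl]) (simp add: eqpoll_iff_finite_card fin card_cartesian_product)
 finally show ?thesis
  by (rule times_lessThan_eqpoll_cancel) (use fin irreducibleD(3)[OF R] irreducibleD(3)[OF T] in \<open>simp add: card_gt_0_iff\<close>)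
qed

text \<open>If the wedge equals the sum, then the empty set is a basis of the quotient.\<close>
lemma no_extensions_if_not_linked:
 assumes T: "irreducible_comatrix T D" and W: "span {\<one>} + entries T D = span {\<one>} \<and>\<^sub>c entries T D"
  and \<beta>: "vector_space.basis_mod (mscale scale) (ext_cocycles {()} (\<lambda>_ _. \<one>) T D) (ext_coboundaries {()} (\<lambda>_ _. \<one>) T D) \<beta>"
 shows "\<beta> = {}"
proof -
 have "subspace (span {\<one>} + entries T D)" by (intro subspace_plus subspace_span subspace_entries)
 then have "basis_mod (span {\<one>} \<and>\<^sub>c entries T D) (span {\<one>} + entries T D) {}"
  unfolding basis_mod_def W[symmetric] by (simp add: span_eq_iff)
 then have "({} :: 'h set) \<approx> ({()} \<times> T) \<times> \<beta>"
  by (rule wedge_basis_irreducible[OF irreducible_one T _ \<beta>, unfolded entries_one])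
 then have "({()} \<times> T) \<times> \<beta> \<approx> ({} :: 'h set)" by (rule eqpoll_sym)
 then have "({()} \<times> T) \<times> \<beta> = {}" by (simp only: eqpoll_empty_iff_empty)
 then show ?thesis using irreducibleD(3)[OF T] by auto
qed

end

text \<open>The pairs of basis vectors are swapped, which turns the multiplicities in
 \<open>V\<^sub>s \<otimes> V\<^sub>t\<close> into those in \<open>V\<^sub>t \<otimes>
 V\<^sub>s\<close>.\<close>
lemma (in fusion_family) fusion_family_opposite:
 "fusion_family scale \<Delta> \<epsilon> (\<lambda>a b. b \<cdot> a) \<one> (\<lambda>a b c. \<Psi> c b a) (\<lambda>a b c. \<Phi> c b a) I E A (\<lambda>s t. N t s) i0 e0"
proof -
 interpret op: coquasi_bialgebra_inverse scale \<Delta> \<epsilon> "\<lambda>a b. b \<cdot> a" \<one> "\<lambda>a b c. \<Psi> c b a" "\<lambda>a b c. \<Phi> c b a"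
  by (rule opposite)
 have swap: "(SUM x:Y \<times> X. f (prod.swap x)) = (SUM x:X \<times> Y. f x)" for f :: "_ \<Rightarrow> 'z::comm_monoid_add" and X Y
  by (rule sum.reindex_bij_witness[of _ prod.swap prod.swap]) auto
 have G: "op.prod_comatrix (A s) (A t) x y = prod_comatrix (A t) (A s) (prod.swap x) (prod.swap y)" for s t x y
  by (cases x; cases y) simp
 show ?thesis
 proof (unfold_locales)
  fix s t assume st: "s \<in> I" "t \<in> I"
  obtain \<iota> \<pi> where dec: "decomposition (E t \<times> E s) (prod_comatrix (A t) (A s)) (SIGMA k:I. {..<N t s k}) E A \<iota> \<pi>"
   using fusion[OF st(2,1)] by blast
  note D = decompositionD[OF dec]
  have "decomposition (E s \<times> E t) (op.prod_comatrix (A s) (A t)) (SIGMA k:I. {..<N t s k}) E A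
    (\<lambda>p x c. \<iota> p (prod.swap x) c) (\<lambda>p c x. \<pi> p c (prod.swap x))"
  proof (rule decompositionI[OF D(1)])
   show "finite (E s \<times> E t)" using finite_E st by simp
   show "finite (E (fst p))" if "p \<in> (SIGMA k:I. {..<N t s k})" for p using that finite_E by auto
   show "comatrix_hom (E s \<times> E t) (op.prod_comatrix (A s) (A t)) (E (fst p)) (A (fst p)) (\<lambda>c x. \<pi> p c (prod.swap x))"
    if "p \<in> (SIGMA k:I. {..<N t s k})" for p
   proof (rule comatrix_homI)
    fix f c x assume f: "lin scale (*) f" and c: "c \<in> E (fst p)" and x: "x \<in> E s \<times> E t"
    have "(SUM x':E s \<times> E t. \<pi> p c (prod.swap x') * f (op.prod_comatrix (A s) (A t) x' x)) =
     (SUM x':E t \<times> E s. \<pi> p c x' * f (prod_comatrix (A t) (A s) x' (prod.swap x)))"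
     unfolding G by (rule swap)
    also have "\<dots> = (SUM c':E (fst p). f (A (fst p) c c') * \<pi> p c' (prod.swap x))"
     by (rule comatrix_hom_functional[OF D(3)[OF that] f c]) (use x in auto)
    finally show "(SUM x':E s \<times> E t. \<pi> p c (prod.swap x') * f (op.prod_comatrix (A s) (A t) x' x)) =
     (SUM c':E (fst p). f (A (fst p) c c') * \<pi> p c' (prod.swap x))" .
   qed
   show "(SUM x:E s \<times> E t. \<pi> p c (prod.swap x) * \<iota> q (prod.swap x) c') = (if p = q \<and> c = c' then 1 else 0)"
    if "p \<in> (SIGMA k:I. {..<N t s k})" "q \<in> (SIGMA k:I. {..<N t s k})" "c \<in> E (fst p)" "c' \<in> E (fst q)" for p q c c'
    using D(4)[OF that] swap[of "\<lambda>x. \<pi> p c x * \<iota> q x c'" "E s" "E t"] by simp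
   show "(SUM p:(SIGMA k:I. {..<N t s k}). SUM c:E (fst p). \<iota> p (prod.swap x) c * \<pi> p c (prod.swap x')) = (if x = x' then 1 else 0)"
    if "x \<in> E s \<times> E t" "x' \<in> E s \<times> E t" for x x'
    using D(5)[of "prod.swap x" "prod.swap x'"] that by (auto simp: mem_Times_iff prod_eq_iff)
  qed
  then show "\<exists>\<iota> \<pi>. decomposition (E s \<times> E t) (op.prod_comatrix (A s) (A t)) (SIGMA k:I. {..<N t s k}) E A \<iota> \<pi>"
   by blast
 qed (use irreducible hom0 unit in blast)+
qed
theorem proposition3p15:
 fixes scale :: "'k::alg_closed_field \<Rightarrow> 'h::ab_group_add \<Rightarrow> 'h"
  and \<Delta> :: "'h \<Rightarrow> ('h, 'h, 'k) tensor"
  and \<epsilon> :: "'h \<Rightarrow> 'k"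
  and mult :: "'h \<Rightarrow> 'h \<Rightarrow> 'h"
  and one :: 'h
  and \<Phi> :: "'h \<Rightarrow> 'h \<Rightarrow> 'h \<Rightarrow> 'k"
  and S :: "'h \<Rightarrow> 'h"
  and \<alpha> \<beta> :: "'h \<Rightarrow> 'k"
  and I J :: "'i set"
  and C :: "'i \<Rightarrow> 'h set"
  and Q :: "('h set, 'e) pre_digraph"
  and sV :: "'k \<Rightarrow> 'v::ab_group_add \<Rightarrow> 'v"
  and V :: "'i \<Rightarrow> 'v set"
  and \<rho> :: "'i \<Rightarrow> 'v \<Rightarrow> ('v, 'h, 'k) tensor"
  and N :: "'i \<Rightarrow> 'i \<Rightarrow> 'i \<Rightarrow> nat"
 assumes "coquasi_hopf_algebra scale \<Delta> \<epsilon> mult one \<Phi> S \<alpha> \<beta>"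
  and "\<not> precoalgebra.cosemisimple scale \<Delta>"
  and "coquasi_hopf_algebra.dual_Chevalley scale \<Delta> mult one S"
  and "bij_betw C I (precoalgebra.simple_subcoalgebras scale \<Delta>)"
  and "precoalgebra.link_quiver scale \<Delta> Q"
  and "\<And>i. i \<in> I \<Longrightarrow> precoalgebra.simple_right_comodule scale \<Delta> \<epsilon> sV (V i) (\<rho> i)"
  and "\<And>i. i \<in> I \<Longrightarrow> precoalgebra.coefficient_coalgebra scale sV (V i) (\<rho> i) = C i"
  and "coquasi_bialgebra.fusion_coefficients scale mult sV I V \<rho> N"
  and "J \<subseteq> I"
  and "coquasi_bialgebra.linked_to_one scale \<Delta> one = C ` J"
  and "i \<in> I"
  and "j \<in> I"
 shows "arrows Q (C j) (C i) \<approx>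
      (SIGMA k:J. arrows Q (C k) (module.span scale {one}) \<times> {..<N i k j})
     \<and> arrows Q (C j) (C i) \<approx>
      (SIGMA k:J. arrows Q (C k) (module.span scale {one}) \<times> {..<N k i j})"
proof -
 interpret H: coquasi_hopf_algebra scale \<Delta> \<epsilon> mult one \<Phi> S \<alpha> \<beta> by fact
 obtain \<Psi> where \<Psi>: "H.is_convolution_inverse3 \<Phi> \<Psi>" using H.\<Phi>_invertible by blast
 interpret B: coquasi_bialgebra_inverse scale \<Delta> \<epsilon> mult one \<Phi> \<Psi> by unfold_locales (fact \<Psi>)
 note sim = assms(6) and coef = assms(7)
 have \<rho>: "H.right_comodule sV (V t) (\<rho> t)" if "t \<in> I" for t
  using sim[OF that] unfolding H.simple_right_comodule_def by blast
 let ?P = "\<lambda>t (E, A). V t = module.span sV E \<and> \<not> module.dependent sV E \<and> H.irreducible_comatrix E A \<and>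
  (\<forall>b\<in>E. \<rho> t b = (SUM a:E. tensor sV scale a (A a b)))"
 have "\<exists>q. ?P t q" if "t \<in> I" for t
 proof (rule H.simple_comodule_comatrix[OF sim[OF that]])
  fix E A assume "V t = module.span sV E" "\<not> module.dependent sV E" "H.irreducible_comatrix E A"
   "\<And>b. b \<in> E \<Longrightarrow> \<rho> t b = (SUM a:E. tensor sV scale a (A a b))"
  then show "\<exists>q. ?P t q" by (intro exI[of _ "(E, A)"]) simp
 qed
 note ex = this
 define q where "q t = (SOME q. ?P t q)" for t
 define E where "E t = fst (q t)" for t
 define A where "A t = snd (q t)" for t
 have "?P t (q t)" if "t \<in> I" for t unfolding q_def by (rule someI_ex[OF ex[OF that]])
 then have E: "V t = module.span sV (E t)" "\<not> module.dependent sV (E t)" "H.irreducible_comatrix (E t) (A t)"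
  and A: "b \<in> E t \<Longrightarrow> \<rho> t b = (SUM a:E t. tensor sV scale a (A t a b))" if "t \<in> I" for t b
  using that unfolding E_def A_def by (auto simp: split_def)
 note irr = E(3)
 note fin = H.irreducibleD(2)[OF irr] and com = H.irreducibleD(1)[OF irr] and ne = H.irreducibleD(3)[OF irr]
 have CE: "C t = H.entries (E t) (A t)" if "t \<in> I" for t
  using H.coefficient_coalgebra_entries[OF \<rho>[OF that] fin[OF that] E(2,1)[OF that] A[OF that]] coef[OF that] by simp
 have CS: "C t \<in> H.simple_subcoalgebras" if "t \<in> I" for t using assms(4) that by (auto simp: bij_betw_def)
 have hom0: "\<Lambda> a b = 0"
  if st: "s \<in> I" "t \<in> I" "s \<noteq> t" and \<Lambda>: "H.comatrix_hom (E s) (A s) (E t) (A t) \<Lambda>" and ab: "a \<in> E t" "b \<in> E s" for s t \<Lambda> a b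
 proof (rule ccontr)
  assume "\<Lambda> a b \<noteq> 0"
  then obtain M where M: "H.comatrix_hom (E t) (A t) (E s) (A s) M"
   "\<And>t1 t'. t1 \<in> E t \<Longrightarrow> t' \<in> E t \<Longrightarrow> (SUM r:E s. \<Lambda> t1 r * M r t') = (if t1 = t' then 1 else 0)"
   "\<And>r r'. r \<in> E s \<Longrightarrow> r' \<in> E s \<Longrightarrow> (SUM t1:E t. M r t1 * \<Lambda> t1 r') = (if r = r' then 1 else 0)"
   by (rule H.schur_iso[OF irr[OF st(1)] irr[OF st(2)] \<Lambda> ab]) (rule that)
  have "C t \<subseteq> C s" "C s \<subseteq> C t"
   unfolding CE[OF st(1)] CE[OF st(2)]
   by (rule H.entries_subset_if_iso[OF \<Lambda> M(2) fin[OF st(2)]]; assumption)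
    (rule H.entries_subset_if_iso[OF M(1,3) fin[OF st(1)]]; assumption)
  then have "C s = C t" by (intro subset_antisym)
  from inj_onD[OF bij_betw_imp_inj_on[OF assms(4)] this st(1,2)] st(3) show False by contradiction
 qed
 have "H.span {one} \<in> C ` I" unfolding bij_betw_imp_surj_on[OF assms(4)] by (rule H.simple_span_one)
 then obtain i0 where i0: "H.span {one} = C i0" "i0 \<in> I" by (rule imageE)
 note i0 = i0(2) i0(1)[symmetric]
 have "H.dim (H.entries (E i0) (A i0)) = (card (E i0))\<^sup>2" by (rule B.irreducible_entries_dual[OF irr[OF i0(1)]])
 then have "(card (E i0))\<^sup>2 = H.dim (H.span {one})" by (simp only: i0(2) CE[OF i0(1), symmetric])
 also have "\<dots> = 1" using H.dim_span_eq_card_independent[of "{one}"] H.one_nonzero by simp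
 finally have "card (E i0) = 1" by (simp add: power2_eq_square)
 then obtain e0 where e0: "E i0 = {e0}" by (rule card_1_singletonE)
 have A0: "A i0 e0 e0 = one"
 proof -
  have "A i0 e0 e0 \<in> H.span {one}" using H.in_entries[of e0 "E i0" e0 "A i0"] CE[OF i0(1)] i0(2) e0 by simp
  then obtain c where c: "A i0 e0 e0 = scale c one" by (auto simp: H.span_singleton)
  have "1 = \<epsilon> (scale c one)" using H.comatrixD(3)[OF com[OF i0(1)], of e0 e0] e0 c by simp
  then have "c = 1" by (simp add: lin_scale[OF H.\<epsilon>_linear] H.\<epsilon>_one)
  then show ?thesis using c by simp
 qed
 interpret F: fusion_family scale \<Delta> \<epsilon> mult one \<Phi> \<Psi> I E A N i0 e0
 proof
  show "\<exists>\<iota> \<pi>. H.decomposition (E s \<times> E t) (B.prod_comatrix (A s) (A t)) (SIGMA k:I. {..<N s t k}) E A \<iota> \<pi>"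
   if st: "s \<in> I" "t \<in> I" for s t
  proof -
   have iso: "H.comodule_isomorphic tscale (tensor_space sV sV (V s) (V t)) (H.tensor_coaction sV (V s) (\<rho> s) sV (V t) (\<rho> t))
    (pointwise_scale sV) (H.direct_sum (SIGMA k:I. {..<N s t k}) (V \<circ> fst)) (H.direct_sum_coaction sV (V \<circ> fst) (\<rho> \<circ> fst))"
    using assms(8) st unfolding H.fusion_coefficients_def by blast
   show ?thesis
    by (rule B.fusion_decomposition[OF \<rho> fin E(2,1) ne A iso st]) (assumption+, force, intro exI)
  qed
 qed (use irr hom0 i0 e0 A0 in auto)
 have S: "S (A t a b) \<in> H.span (\<Union>t\<in>I. {A t a b | a b. a \<in> E t \<and> b \<in> E t})" if t: "t \<in> I" "a \<in> E t" "b \<in> E t" for t a b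
 proof -
  have "A t a b \<in> C t" unfolding CE[OF t(1)] by (rule H.in_entries[OF t(2,3)])
  then have "A t a b \<in> H.coradical" unfolding H.coradical_def using CS[OF t(1)] by (intro H.span_base) blast
  then have "S (A t a b) \<in> H.coradical"
   using assms(3) unfolding H.dual_Chevalley_def H.coquasi_hopf_subalgebra_def by blast
  moreover have "H.coradical \<subseteq> H.span (\<Union>t\<in>I. {A t a b | a b. a \<in> E t \<and> b \<in> E t})"
   unfolding H.coradical_def
  proof (rule H.span_minimal[OF _ H.subspace_span], rule Union_least)
   fix X assume "X \<in> H.simple_subcoalgebras"
   then have "X \<in> C ` I" unfolding bij_betw_imp_surj_on[OF assms(4)] .
   then obtain t where "X = C t" "t \<in> I" by (rule imageE)
   then show "X \<subseteq> H.span (\<Union>t\<in>I. {A t a b | a b. a \<in> E t \<and> b \<in> E t})"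
    unfolding \<open>X = C t\<close> CE[OF \<open>t \<in> I\<close>] H.entries_def by (intro H.span_mono) blast
  qed
  ultimately show ?thesis by blast
 qed
 obtain i' \<kappa> \<mu> \<kappa>' \<mu>' where i': "i' \<in> I" and dual: "B.dual_pair (E i) (A i) (E i') (A i') \<kappa> \<mu>" "B.dual_pair (E i') (A i') (E i) (A i) \<kappa>' \<mu>'"
 proof (rule F.simple_duals[OF _ assms(11)])
  fix t assume t: "t \<in> I"
  show "\<exists>U \<kappa> \<mu>. B.dual_pair (E t) (A t) (E t) U \<kappa> \<mu> \<and>
    (\<forall>u\<in>E t. \<forall>u'\<in>E t. U u u' \<in> H.span (\<Union>t\<in>I. {A t a b | a b. a \<in> E t \<and> b \<in> E t}))"
   using B.antipode_dual[OF assms(1) com[OF t]] S[OF t] by (intro exI conjI ballI) auto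
 qed (erule (2) that)
 interpret M: vector_space "mscale scale :: _ \<Rightarrow> ('v \<Rightarrow> 'v \<Rightarrow> 'h) \<Rightarrow> _" by (rule H.vs_matrices)
 interpret M': vector_space "mscale scale :: _ \<Rightarrow> (unit \<Rightarrow> 'v \<Rightarrow> 'h) \<Rightarrow> _" by (rule H.vs_matrices)
 obtain \<beta>' where \<beta>': "M.basis_mod (H.ext_cocycles (E i) (A i) (E j) (A j)) (H.ext_coboundaries (E i) (A i) (E j) (A j)) \<beta>'"
  by (rule M.basis_mod_exists[OF H.subspace_ext_cocycles H.subspace_ext_coboundaries
     H.ext_coboundaries_subset[OF com[OF assms(11)] com[OF assms(12)]]]) (rule that)
 let ?G = "\<lambda>k g. M'.basis_mod (H.ext_cocycles {()} (\<lambda>_ _. one) (E k) (A k)) (H.ext_coboundaries {()} (\<lambda>_ _. one) (E k) (A k)) g"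
 define \<gamma> where "\<gamma> k = (SOME g. ?G k g)" for k
 have "\<exists>g. ?G k g" if "k \<in> I" for k
  by (rule M'.basis_mod_exists[OF H.subspace_ext_cocycles H.subspace_ext_coboundaries
     H.ext_coboundaries_subset[OF B.comatrix_one com[OF that]]]) (rule exI)
 note \<gamma> = someI_ex[OF this, folded \<gamma>_def]
 have arrows_\<beta>: "arrows Q (C j) (C i) \<approx> \<beta>'"
  using B.arrows_eqpoll[OF assms(5) irr irr _ _ \<beta>'] assms(11,12) CE CS by simp
 have arrows_\<gamma>: "arrows Q (C k) (H.span {one}) \<approx> \<gamma> k" if "k \<in> I" for k
  using B.arrows_eqpoll[OF assms(5) B.irreducible_one irr[OF that] _ _ \<gamma>[OF that]] CE[OF that] CS[OF that] H.simple_span_one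
  by (simp add: B.entries_one)
 have \<gamma>0: "\<gamma> k = {}" if k: "k \<in> I" "k \<notin> J" for k
 proof -
  have "C k \<notin> C ` J" using inj_on_image_mem_iff[OF bij_betw_imp_inj_on[OF assms(4)] k(1) assms(9)] k(2) by simp
  then have "H.span {one} + C k = H.wedge (H.span {one}) (C k)"
   using assms(10) CS[OF k(1)] unfolding H.linked_to_one_def by blast
  then show ?thesis using B.no_extensions_if_not_linked[OF irr[OF k(1)] _ \<gamma>[OF k(1)]] CE[OF k(1)] by simp
 qed
 have transfer: "arrows Q (C j) (C i) \<approx> (SIGMA k:J. arrows Q (C k) (H.span {one}) \<times> {..<n k})"
  if "\<beta>' \<approx> (SIGMA k:I. \<gamma> k \<times> {..<n k})" for n :: "'i \<Rightarrow> nat"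
 proof -
  note arrows_\<beta>
  also note that
  also have "(SIGMA k:I. \<gamma> k \<times> {..<n k}) = (SIGMA k:J. \<gamma> k \<times> {..<n k})" using \<gamma>0 assms(9) by blast
  also have "\<dots> \<approx> (SIGMA k:J. arrows Q (C k) (H.span {one}) \<times> {..<n k})"
   using assms(9) by (intro Sigma_eqpoll_cong[OF bij_betw_id] times_eqpoll_cong eqpoll_refl) (auto intro: eqpoll_sym[OF arrows_\<gamma>])
  finally show ?thesis .
 qed
 interpret op: fusion_family scale \<Delta> \<epsilon> "\<lambda>a b. mult b a" one "\<lambda>a b c. \<Psi> c b a" "\<lambda>a b c. \<Phi> c b a" I E A "\<lambda>s t. N t s" i0 e0
  by (rule F.fusion_family_opposite)
 show ?thesis
  using transfer[OF F.ext_count[OF dual assms(11) i' assms(12) \<beta>' \<gamma>]]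
   transfer[OF op.ext_count[OF B.dual_pair_opposite[OF dual(2)] B.dual_pair_opposite[OF dual(1)] assms(11) i' assms(12) \<beta>' \<gamma>]]
  by blast
qed

end
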